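(* Let $G$ be a profinite group. There is an equivalence of categories between the category of Weyl-$G$-sheaves of $\mathbb{Q}$-modules over $\mathcal{S}G$ and the full subcategory of the category of $G_\bullet$-sheaves of $\mathbb{Q}$-modules over $\mathcal{S}G_\bullet$ on those $D_\bullet$ such that every $D_N$ is a Weyl-$G/N$-sheaf over $\mathcal{S}(G/N)$ and whose adjoint structure maps $$\bar\alpha_{M,N}\colon D_N\longrightarrow(\bar\phi_{M,N})_*D_M$$ are isomorphisms for all open normal subgroups $M\leqslant N$ of $G$. The equivalence is given by the functor $D_\bullet\mapsto\operatorname{colim}_{N}\bar p_N^*D_N$ (colimit over the open normal subgroups $N$ of $G$) and the functor $\bar p_\bullet\colon E\mapsto\{(\bar p_N)_*E\}_N$.
   Context: For a profinite group $G$, $\mathcal{S}G$ is the set of closed subgroups of $G$ with the topology having as basis the sets $O(N,NK)=\{L\in\mathcal{S}G\mid NL=NK\}$ for $N$ an open normal subgroup and $K$ a closed subgroup; it is a profinite $G$-space under conjugation. When $G$ is finite, $\mathcal{S}G$ is the finite discrete set of subgroups. For a topological group $\Gamma$ and a $\Gamma$-space $X$, a $\Gamma$-sheaf of $\mathbb{Q}$-modules over $X$ is a $\Gamma$-equivariant local homeomorphism $p\colon E\to X$, with $E$ a space with continuous $\Gamma$-action, such that each stalk $E_x=p^{-1}(x)$ is a $\mathbb{Q}$-module, the fibrewise subtraction $E\times_XE\to E$ and scalar multiplications are continuous, and each map $g\colon E_x\to E_{gx}$ is $\mathbb{Q}$-linear. Morphisms are continuous $\Gamma$-equivariant maps over $X$,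 linear on stalks. $E(U)$ denotes all continuous sections over $U$, and $g$ acts by $g\ast s=g\circ s\circ g^{-1}\colon gU\to E$. A Weyl-$\Gamma$-sheaf ($\Gamma$ profinite) is a $\Gamma$-sheaf $E$ over $\mathcal{S}\Gamma$ such that $K$ acts trivially on the stalk $E_K$ for every closed subgroup $K$ of $\Gamma$; these form a full subcategory. Change of space and group: let $\pi\colon\Gamma\to\Gamma'$ be a surjective homomorphism of profinite groups with open kernel $N$, and $q\colon X\to Y$ a continuous surjection from a $\Gamma$-space to a $\Gamma'$-space with $q(gx)=\pi(g)q(x)$. For a $\Gamma'$-sheaf $D$ over $Y$, $\bar q^*D$ is the pull back $X\times_YD\to X$ with $g(x,d)=(gx,\pi(g)d)$. For a $\Gamma$-sheaf $E$ over $X$, $\bar q_*E$ is the $\Gamma'$-sheaf over $Y$ with sections $V\mapsto E(q^{-1}V)^N$. The functor $\bar q^*$ is left adjoint to $\bar q_*$. This is applied to $p_N\colon\mathcal{S}G\to\mathcal{S}(G/N)$, $K\mapsto KN/N$ (with $G\to G/N$) and, for open normal subgroups $M\leqslant N$, to the induced map $\phi_{M,N}\colon\mathcal{S}(G/M)\to\mathcal{S}(G/N)$ (with $G/M\to G/N$). A $G_\bullet$-sheaf of $\mathbb{Q}$-modules over $\mathcal{S}G_\bullet$, $D_\bullet$, consists of a $G/N$-sheaf of $\mathbb{Q}$-modules $D_N$ over $\mathcal{S}(G/N)$ for each open normal subgroup $N$ of $G$ and maps of $G/M$-sheaves $\alpha_{M,N}\colon(\bar\phi_{M,N})^*D_N\to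 D_M$ for $M\leqslant N$, compatible with identities and composition. Morphisms are families of maps of $G/N$-sheaves $D_N\to D'_N$ commuting with the $\alpha_{M,N}$. $\bar\alpha_{M,N}$ is the adjoint of $\alpha_{M,N}$. The colimit is taken in $G$-sheaves of $\mathbb{Q}$-modules over $\mathcal{S}G$ along the maps $\bar p_N^*D_N=\bar p_M^*(\bar\phi_{M,N})^*D_N\to\bar p_M^*D_M$. The structure maps of $\bar p_\bullet E$ are the adjoints of the equalities $(\bar p_N)_*E=(\bar\phi_{M,N})_*(\bar p_M)_*E$. *)

theory Defs
  imports "HOL-Analysis.Analysis" "HOL-Algebra.Coset" "HOL-Algebra.Module"
begin

section \<open>Categories, functors, equivalences\<close>

text \<open>Hom-sets are indexed by their source and target and need not be disjoint; identities,
  composition and the arrow part of a functor therefore take the objects as arguments.\<close>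

record ('o, 'm) category =
  Obj :: "'o set"
  Hom :: "'o \<Rightarrow> 'o \<Rightarrow> 'm set"
  Idn :: "'o \<Rightarrow> 'm"
  Cmp :: "'o \<Rightarrow> 'o \<Rightarrow> 'o \<Rightarrow> 'm \<Rightarrow> 'm \<Rightarrow> 'm"

definition is_category :: "('o, 'm) category \<Rightarrow> bool" where
  "is_category C \<longleftrightarrow>
     (\<forall>X\<in>Obj C. Idn C X \<in> Hom C X X) \<and>
     (\<forall>X\<in>Obj C. \<forall>Y\<in>Obj C. \<forall>Z\<in>Obj C. \<forall>f\<in>Hom C X Y. \<forall>g\<in>Hom C Y Z.
        Cmp C X Y Z g f \<in> Hom C X Z) \<and>
     (\<forall>X\<in>Obj C. \<forall>Y\<in>Obj C. \<forall>f\<in>Hom C X Y.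
        Cmp C X X Y f (Idn C X) = f \<and> Cmp C X Y Y (Idn C Y) f = f) \<and>
     (\<forall>W\<in>Obj C. \<forall>X\<in>Obj C. \<forall>Y\<in>Obj C. \<forall>Z\<in>Obj C.
        \<forall>f\<in>Hom C W X. \<forall>g\<in>Hom C X Y. \<forall>h\<in>Hom C Y Z.
          Cmp C W X Z (Cmp C X Y Z h g) f = Cmp C W Y Z h (Cmp C W X Y g f))"

definition full_subcategory :: "('o, 'm) category \<Rightarrow> ('o \<Rightarrow> bool) \<Rightarrow> ('o, 'm) category" where
  "full_subcategory C P = C\<lparr>Obj := {X \<in> Obj C. P X}\<rparr>"

record ('o, 'm, 'p, 'n) cfunctor =
  fobj :: "'o \<Rightarrow> 'p"
  farr :: "'o \<Rightarrow> 'o \<Rightarrow> 'm \<Rightarrow> 'n"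

definition is_functor ::
  "('o, 'm) category \<Rightarrow> ('p, 'n) category \<Rightarrow> ('o, 'm, 'p, 'n) cfunctor \<Rightarrow> bool" where
  "is_functor C D F \<longleftrightarrow>
     (\<forall>X\<in>Obj C. fobj F X \<in> Obj D) \<and>
     (\<forall>X\<in>Obj C. \<forall>Y\<in>Obj C. \<forall>f\<in>Hom C X Y. farr F X Y f \<in> Hom D (fobj F X) (fobj F Y)) \<and>
     (\<forall>X\<in>Obj C. farr F X X (Idn C X) = Idn D (fobj F X)) \<and>
     (\<forall>X\<in>Obj C. \<forall>Y\<in>Obj C. \<forall>Z\<in>Obj C. \<forall>f\<in>Hom C X Y. \<forall>g\<in>Hom C Y Z.
        farr F X Z (Cmp C X Y Z g f) =
        Cmp D (fobj F X) (fobj F Y) (fobj F Z) (farr F Y Z g) (farr F X Y f))"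

definition id_functor :: "('o, 'm, 'o, 'm) cfunctor" where
  "id_functor = \<lparr>fobj = (\<lambda>X. X), farr = (\<lambda>X Y f. f)\<rparr>"

definition comp_functor ::
  "('p, 'n, 'q, 'k) cfunctor \<Rightarrow> ('o, 'm, 'p, 'n) cfunctor \<Rightarrow> ('o, 'm, 'q, 'k) cfunctor" where
  "comp_functor F' F =
     \<lparr>fobj = (\<lambda>X. fobj F' (fobj F X)),
      farr = (\<lambda>X Y f. farr F' (fobj F X) (fobj F Y) (farr F X Y f))\<rparr>"

definition is_isomorphism :: "('o, 'm) category \<Rightarrow> 'o \<Rightarrow> 'o \<Rightarrow> 'm \<Rightarrow> bool" where
  "is_isomorphism C X Y f \<longleftrightarrow> f \<in> Hom C X Y \<and>
     (\<exists>g\<in>Hom C Y X. Cmp C X Y X g f = Idn C X \<and> Cmp C Y X Y f g = Idn C Y)"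

definition natural_isomorphism ::
  "('o, 'm) category \<Rightarrow> ('p, 'n) category \<Rightarrow> ('o, 'm, 'p, 'n) cfunctor \<Rightarrow>
   ('o, 'm, 'p, 'n) cfunctor \<Rightarrow> ('o \<Rightarrow> 'n) \<Rightarrow> bool" where
  "natural_isomorphism C D F F' \<eta> \<longleftrightarrow>
     (\<forall>X\<in>Obj C. is_isomorphism D (fobj F X) (fobj F' X) (\<eta> X)) \<and>
     (\<forall>X\<in>Obj C. \<forall>Y\<in>Obj C. \<forall>f\<in>Hom C X Y.
        Cmp D (fobj F X) (fobj F Y) (fobj F' Y) (\<eta> Y) (farr F X Y f) =
        Cmp D (fobj F X) (fobj F' X) (fobj F' Y) (farr F' X Y f) (\<eta> X))"

definition equivalence_of_categories ::
  "('o, 'm) category \<Rightarrow> ('p, 'n) category \<Rightarrow> ('o, 'm, 'p, 'n) cfunctor \<Rightarrow>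
   ('p, 'n, 'o, 'm) cfunctor \<Rightarrow> bool" where
  "equivalence_of_categories C D F F' \<longleftrightarrow>
     is_category C \<and> is_category D \<and> is_functor C D F \<and> is_functor D C F' \<and>
     (\<exists>\<eta>. natural_isomorphism C C id_functor (comp_functor F' F) \<eta>) \<and>
     (\<exists>\<epsilon>. natural_isomorphism D D (comp_functor F F') id_functor \<epsilon>)"


section \<open>Profinite groups and spaces of closed subgroups\<close>

definition topological_group_on :: "'g monoid \<Rightarrow> 'g topology \<Rightarrow> bool" where
  "topological_group_on G T \<longleftrightarrow> group G \<and> topspace T = carrier G \<and>
     continuous_map (prod_topology T T) T (\<lambda>(g, h). g \<otimes>\<^bsub>G\<^esub> h) \<and>
     continuous_map T T (\<lambda>g. inv\<^bsub>G\<^esub> g)"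

definition profinite_group :: "'g monoid \<Rightarrow> 'g topology \<Rightarrow> bool" where
  "profinite_group G T \<longleftrightarrow> topological_group_on G T \<and> compact_space T \<and> Hausdorff_space T \<and>
     (\<forall>x\<in>topspace T. connected_component_of_set T x = {x})"

definition open_normal :: "'g monoid \<Rightarrow> 'g topology \<Rightarrow> 'g set set" where
  "open_normal G T = {N. N \<lhd> G \<and> openin T N}"

definition closed_subgroups :: "'g monoid \<Rightarrow> 'g topology \<Rightarrow> 'g set set" where
  "closed_subgroups G T = {K. subgroup K G \<and> closedin T K}"

definition subgroup_topology :: "'g monoid \<Rightarrow> 'g topology \<Rightarrow> 'g set topology" where
  "subgroup_topology G T = topology_generated_by
     {{L \<in> closed_subgroups G T. N <#>\<^bsub>G\<^esub> L = N <#>\<^bsub>G\<^esub> K} | N K.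
        N \<in> open_normal G T \<and> K \<in> closed_subgroups G T}"

text \<open>The quotient topology on \<open>G Mod N\<close>, whose points are cosets.\<close>

definition quotient_group_topology :: "'g monoid \<Rightarrow> 'g topology \<Rightarrow> 'g set \<Rightarrow> 'g set topology" where
  "quotient_group_topology G T N =
     topology (\<lambda>U. U \<subseteq> carrier (G Mod N) \<and> openin T (\<Union>U))"

text \<open>A space with an action of a topological group, as bare data.\<close>

record ('g, 'x) gspace =
  grp :: "'g monoid"
  grp_top :: "'g topology"
  space_top :: "'x topology"
  space_act :: "'g \<Rightarrow> 'x \<Rightarrow> 'x"

definition continuous_action ::
  "'g monoid \<Rightarrow> 'g topology \<Rightarrow> 'x topology \<Rightarrow> ('g \<Rightarrow> 'x \<Rightarrow> 'x) \<Rightarrow> bool" where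
  "continuous_action G T X a \<longleftrightarrow>
     continuous_map (prod_topology T X) X (\<lambda>(g, x). a g x) \<and>
     (\<forall>x\<in>topspace X. a \<one>\<^bsub>G\<^esub> x = x) \<and>
     (\<forall>g\<in>carrier G. \<forall>h\<in>carrier G. \<forall>x\<in>topspace X. a (g \<otimes>\<^bsub>G\<^esub> h) x = a g (a h x))"

definition subgroup_space :: "'g monoid \<Rightarrow> 'g topology \<Rightarrow> ('g, 'g set) gspace" where
  "subgroup_space G T =
     \<lparr>grp = G, grp_top = T, space_top = subgroup_topology G T,
      space_act = (\<lambda>g K. (\<lambda>k. g \<otimes>\<^bsub>G\<^esub> k \<otimes>\<^bsub>G\<^esub> inv\<^bsub>G\<^esub> g) ` K)\<rparr>"

definition quotient_subgroup_space ::
  "'g monoid \<Rightarrow> 'g topology \<Rightarrow> 'g set \<Rightarrow> ('g set, 'g set set) gspace" where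
  "quotient_subgroup_space G T N = subgroup_space (G Mod N) (quotient_group_topology G T N)"


section \<open>Equivariant sheaves of \<open>\<rat>\<close>-modules\<close>

definition rat_ring :: "rat ring" where
  "rat_ring = \<lparr>carrier = UNIV, mult = (*), one = 1, zero = 0, add = (+)\<rparr>"

text \<open>A sheaf is given by its total space. The module operations are functions on the whole
  point type; only their values on points of a common stalk are meaningful.\<close>

record ('g, 'x, 'e) gsheaf =
  tot :: "'e topology"
  sproj :: "'e \<Rightarrow> 'x"
  sact :: "'g \<Rightarrow> 'e \<Rightarrow> 'e"
  szero :: "'x \<Rightarrow> 'e"
  sadd :: "'e \<Rightarrow> 'e \<Rightarrow> 'e"
  sscale :: "rat \<Rightarrow> 'e \<Rightarrow> 'e"

abbreviation pts :: "('g, 'x, 'e) gsheaf \<Rightarrow> 'e set" where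
  "pts E \<equiv> topspace (tot E)"

text \<open>The multiplicative fields belong to the record type of modules but not to its axioms.\<close>

definition stalk :: "('g, 'x, 'e) gsheaf \<Rightarrow> 'x \<Rightarrow> (rat, 'e) module" where
  "stalk E x = \<lparr>carrier = {e \<in> pts E. sproj E e = x}, mult = undefined, one = undefined,
     zero = szero E x, add = sadd E, smult = sscale E\<rparr>"

definition module_linear :: "(rat, 'e) module \<Rightarrow> (rat, 'f) module \<Rightarrow> ('e \<Rightarrow> 'f) \<Rightarrow> bool" where
  "module_linear M M' f \<longleftrightarrow> f \<in> carrier M \<rightarrow> carrier M' \<and>
     (\<forall>a\<in>carrier M. \<forall>b\<in>carrier M. f (a \<oplus>\<^bsub>M\<^esub> b) = f a \<oplus>\<^bsub>M'\<^esub> f b) \<and>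
     (\<forall>r. \<forall>a\<in>carrier M. f (r \<odot>\<^bsub>M\<^esub> a) = r \<odot>\<^bsub>M'\<^esub> f a)"

definition local_homeomorphism :: "'e topology \<Rightarrow> 'x topology \<Rightarrow> ('e \<Rightarrow> 'x) \<Rightarrow> bool" where
  "local_homeomorphism E X p \<longleftrightarrow> continuous_map E X p \<and>
     (\<forall>e\<in>topspace E. \<exists>U. openin E U \<and> e \<in> U \<and> openin X (p ` U) \<and>
        homeomorphic_map (subtopology E U) (subtopology X (p ` U)) p)"

definition is_gsheaf :: "('g, 'x) gspace \<Rightarrow> ('g, 'x, 'e) gsheaf \<Rightarrow> bool" where
  "is_gsheaf B E \<longleftrightarrow>
     continuous_action (grp B) (grp_top B) (tot E) (sact E) \<and>
     local_homeomorphism (tot E) (space_top B) (sproj E) \<and>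
     (\<forall>g\<in>carrier (grp B). \<forall>e\<in>pts E. sproj E (sact E g e) = space_act B g (sproj E e)) \<and>
     (\<forall>x\<in>topspace (space_top B). Module.module rat_ring (stalk E x)) \<and>
     continuous_map
       (subtopology (prod_topology (tot E) (tot E)) {(d, e). sproj E d = sproj E e}) (tot E)
       (\<lambda>(d, e). d \<ominus>\<^bsub>stalk E (sproj E d)\<^esub> e) \<and>
     (\<forall>r. continuous_map (tot E) (tot E) (sscale E r)) \<and>
     (\<forall>g\<in>carrier (grp B). \<forall>x\<in>topspace (space_top B).
        module_linear (stalk E x) (stalk E (space_act B g x)) (sact E g))"

text \<open>Maps of sheaves are taken to be extensional, so that equality of functions is equality
  of morphisms. The two total spaces may have different point types.\<close>

definition sheaf_hom ::
  "('g, 'x) gspace \<Rightarrow> ('g, 'x, 'e) gsheaf \<Rightarrow> ('g, 'x, 'f) gsheaf \<Rightarrow> ('e \<Rightarrow> 'f) set" where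
  "sheaf_hom B E F = {f \<in> extensional (pts E).
     continuous_map (tot E) (tot F) f \<and>
     (\<forall>e\<in>pts E. sproj F (f e) = sproj E e) \<and>
     (\<forall>g\<in>carrier (grp B). \<forall>e\<in>pts E. f (sact E g e) = sact F g (f e)) \<and>
     (\<forall>x\<in>topspace (space_top B). module_linear (stalk E x) (stalk F x) f)}"

definition sheaf_iso ::
  "('g, 'x) gspace \<Rightarrow> ('g, 'x, 'e) gsheaf \<Rightarrow> ('g, 'x, 'f) gsheaf \<Rightarrow> ('e \<Rightarrow> 'f) \<Rightarrow> bool" where
  "sheaf_iso B E F f \<longleftrightarrow> f \<in> sheaf_hom B E F \<and>
     (\<exists>g\<in>sheaf_hom B F E. (\<forall>e\<in>pts E. g (f e) = e) \<and> (\<forall>e\<in>pts F. f (g e) = e))"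

definition sheaf_category ::
  "('g, 'x) gspace \<Rightarrow> (('g, 'x, 'e) gsheaf, 'e \<Rightarrow> 'e) category" where
  "sheaf_category B =
     \<lparr>Obj = {E. is_gsheaf B E}, Hom = sheaf_hom B,
      Idn = (\<lambda>E. \<lambda>e\<in>pts E. e), Cmp = (\<lambda>X Y Z g f. compose (pts X) g f)\<rparr>"

definition is_weyl_sheaf :: "'g monoid \<Rightarrow> 'g topology \<Rightarrow> ('g, 'g set, 'e) gsheaf \<Rightarrow> bool" where
  "is_weyl_sheaf G T E \<longleftrightarrow> is_gsheaf (subgroup_space G T) E \<and>
     (\<forall>K\<in>closed_subgroups G T. \<forall>k\<in>K. \<forall>e\<in>carrier (stalk E K). sact E k e = e)"

definition weyl_category ::
  "'g monoid \<Rightarrow> 'g topology \<Rightarrow> (('g, 'g set, 'e) gsheaf, 'e \<Rightarrow> 'e) category" where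
  "weyl_category G T = full_subcategory (sheaf_category (subgroup_space G T)) (is_weyl_sheaf G T)"

definition sections ::
  "('g, 'x) gspace \<Rightarrow> ('g, 'x, 'e) gsheaf \<Rightarrow> 'x set \<Rightarrow> ('x \<Rightarrow> 'e) set" where
  "sections B E U = {s \<in> extensional U.
     continuous_map (subtopology (space_top B) U) (tot E) s \<and> (\<forall>x\<in>U. sproj E (s x) = x)}"

text \<open>The section \<open>g * s\<close> over \<open>g U\<close> of a section \<open>s\<close> over \<open>U\<close>.\<close>

definition section_act ::
  "('g, 'x) gspace \<Rightarrow> ('g, 'x, 'e) gsheaf \<Rightarrow> 'g \<Rightarrow> 'x set \<Rightarrow> ('x \<Rightarrow> 'e) \<Rightarrow> 'x \<Rightarrow> 'e" where
  "section_act B E g U s =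
     (\<lambda>x\<in>space_act B g ` U. sact E g (s (space_act B (inv\<^bsub>grp B\<^esub> g) x)))"


section \<open>Change of space and group\<close>

record ('g, 'x, 'h, 'y) change =
  src :: "('g, 'x) gspace"
  tgt :: "('h, 'y) gspace"
  ghom :: "'g \<Rightarrow> 'h"
  smap :: "'x \<Rightarrow> 'y"

definition preim :: "('g, 'x, 'h, 'y) change \<Rightarrow> 'y set \<Rightarrow> 'x set" where
  "preim c V = {x \<in> topspace (space_top (src c)). smap c x \<in> V}"

subsection \<open>Pull back\<close>

definition pull :: "('g, 'x, 'h, 'y) change \<Rightarrow> ('h, 'y, 'e) gsheaf \<Rightarrow> ('g, 'x, 'x \<times> 'e) gsheaf" where
  "pull c D =
     \<lparr>tot = subtopology (prod_topology (space_top (src c)) (tot D)) {(x, d). smap c x = sproj D d},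
      sproj = fst,
      sact = (\<lambda>g (x, d). (space_act (src c) g x, sact D (ghom c g) d)),
      szero = (\<lambda>x. (x, szero D (smap c x))),
      sadd = (\<lambda>(x, d) (x', d'). (x, sadd D d d')),
      sscale = (\<lambda>r (x, d). (x, sscale D r d))\<rparr>"

definition pull_map ::
  "('g, 'x, 'h, 'y) change \<Rightarrow> ('h, 'y, 'e) gsheaf \<Rightarrow> ('e \<Rightarrow> 'f) \<Rightarrow> 'x \<times> 'e \<Rightarrow> 'x \<times> 'f" where
  "pull_map c D f = (\<lambda>(x, d)\<in>pts (pull c D). (x, f d))"

subsection \<open>Push forward\<close>

definition invariant_sections ::
  "('g, 'x, 'h, 'y) change \<Rightarrow> ('g, 'x, 'e) gsheaf \<Rightarrow> 'y set \<Rightarrow> ('x \<Rightarrow> 'e) set" where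
  "invariant_sections c E V = {s \<in> sections (src c) E (preim c V).
     \<forall>n\<in>kernel (grp (src c)) (grp (tgt c)) (ghom c). section_act (src c) E n (preim c V) s = s}"

text \<open>The total space of the push forward is the space of germs of the sheaf of invariant
  sections; the germ at \<open>y\<close> of a section \<open>s\<close> over \<open>V\<close> is recorded as \<open>y\<close> together with the
  class of all pairs \<open>(V', s')\<close> that agree with \<open>(V, s)\<close> near \<open>y\<close>.\<close>

type_synonym ('x, 'y, 'e) germ = "'y \<times> ('y set \<times> ('x \<Rightarrow> 'e)) set"

definition germ ::
  "('g, 'x, 'h, 'y) change \<Rightarrow> ('g, 'x, 'e) gsheaf \<Rightarrow> 'y \<Rightarrow> 'y set \<Rightarrow> ('x \<Rightarrow> 'e) \<Rightarrow> ('x, 'y, 'e) germ" where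
  "germ c E y V s = (y, {(V', s').
     openin (space_top (tgt c)) V' \<and> y \<in> V' \<and> s' \<in> invariant_sections c E V' \<and>
     (\<exists>W. openin (space_top (tgt c)) W \<and> y \<in> W \<and> W \<subseteq> V \<inter> V' \<and>
        (\<forall>x\<in>preim c W. s' x = s x))})"

definition germ_dom :: "('x, 'y, 'e) germ \<Rightarrow> 'y set" where
  "germ_dom z = fst (SOME r. r \<in> snd z)"

definition germ_sec :: "('x, 'y, 'e) germ \<Rightarrow> 'x \<Rightarrow> 'e" where
  "germ_sec z = snd (SOME r. r \<in> snd z)"

definition push ::
  "('g, 'x, 'h, 'y) change \<Rightarrow> ('g, 'x, 'e) gsheaf \<Rightarrow> ('h, 'y, ('x, 'y, 'e) germ) gsheaf" where
  "push c E =
     \<lparr>tot = topology_generated_by {(\<lambda>y. germ c E y V s) ` V | V s.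
        openin (space_top (tgt c)) V \<and> s \<in> invariant_sections c E V},
      sproj = fst,
      sact = (\<lambda>h z. let g = (SOME g. g \<in> carrier (grp (src c)) \<and> ghom c g = h) in
        germ c E (space_act (tgt c) h (fst z)) (space_act (tgt c) h ` germ_dom z)
          (section_act (src c) E g (preim c (germ_dom z)) (germ_sec z))),
      szero = (\<lambda>y. germ c E y (topspace (space_top (tgt c)))
        (\<lambda>x\<in>preim c (topspace (space_top (tgt c))). szero E x)),
      sadd = (\<lambda>z z'. germ c E (fst z) (germ_dom z \<inter> germ_dom z')
        (\<lambda>x\<in>preim c (germ_dom z \<inter> germ_dom z'). sadd E (germ_sec z x) (germ_sec z' x))),
      sscale = (\<lambda>r z. germ c E (fst z) (germ_dom z)
        (\<lambda>x\<in>preim c (germ_dom z). sscale E r (germ_sec z x)))\<rparr>"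

definition push_map ::
  "('g, 'x, 'h, 'y) change \<Rightarrow> ('g, 'x, 'e) gsheaf \<Rightarrow> ('g, 'x, 'f) gsheaf \<Rightarrow> ('e \<Rightarrow> 'f) \<Rightarrow>
   ('x, 'y, 'e) germ \<Rightarrow> ('x, 'y, 'f) germ" where
  "push_map c E F f = (\<lambda>z\<in>pts (push c E).
     germ c F (fst z) (germ_dom z) (\<lambda>x\<in>preim c (germ_dom z). f (germ_sec z x)))"

subsection \<open>The adjunction\<close>

text \<open>The unit at \<open>D\<close> sends \<open>d\<close> to the germ of the pulled back section \<open>x \<mapsto> (x, t (q x))\<close>,
  where \<open>t\<close> is any local section of \<open>D\<close> through \<open>d\<close>; the counit at \<open>E\<close> sends \<open>x\<close> and the germ
  at \<open>q x\<close> of a section \<open>s\<close> to \<open>s x\<close>.\<close>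

definition adj_unit ::
  "('g, 'x, 'h, 'y) change \<Rightarrow> ('h, 'y, 'e) gsheaf \<Rightarrow> 'e \<Rightarrow> ('x, 'y, 'x \<times> 'e) germ" where
  "adj_unit c D = (\<lambda>d\<in>pts D.
     let (V, t) = (SOME (V, t). openin (space_top (tgt c)) V \<and> sproj D d \<in> V \<and>
                                t \<in> sections (tgt c) D V \<and> t (sproj D d) = d)
     in germ c (pull c D) (sproj D d) V (\<lambda>x\<in>preim c V. (x, t (smap c x))))"

definition adj_counit ::
  "('g, 'x, 'h, 'y) change \<Rightarrow> ('g, 'x, 'e) gsheaf \<Rightarrow> 'x \<times> ('x, 'y, 'e) germ \<Rightarrow> 'e" where
  "adj_counit c E = (\<lambda>(x, z)\<in>pts (pull c (push c E)). germ_sec z x)"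

text \<open>The adjoint \<open>D \<rightarrow> q\<^sub>* E\<close> of a map \<open>q\<^sup>* D \<rightarrow> E\<close>, and the reverse passage.\<close>

definition adjoint_to_push ::
  "('g, 'x, 'h, 'y) change \<Rightarrow> ('h, 'y, 'e) gsheaf \<Rightarrow> ('g, 'x, 'f) gsheaf \<Rightarrow> ('x \<times> 'e \<Rightarrow> 'f) \<Rightarrow>
   'e \<Rightarrow> ('x, 'y, 'f) germ" where
  "adjoint_to_push c D E f = compose (pts D) (push_map c (pull c D) E f) (adj_unit c D)"

definition adjoint_from_pull ::
  "('g, 'x, 'h, 'y) change \<Rightarrow> ('h, 'y, 'e) gsheaf \<Rightarrow> ('g, 'x, 'f) gsheaf \<Rightarrow>
   ('e \<Rightarrow> ('x, 'y, 'f) germ) \<Rightarrow> 'x \<times> 'e \<Rightarrow> 'f" where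
  "adjoint_from_pull c D E h = compose (pts (pull c D)) (adj_counit c E) (pull_map c D h)"

text \<open>The identification \<open>q\<^sub>* E = q''\<^sub>* (q'\<^sub>* E)\<close> for \<open>q = q'' \<circ> q'\<close>: both sides have the sections
  \<open>V \<mapsto> E(q\<^sup>-\<^sup>1 V)\<^sup>N\<close>, and \<open>s\<close> over \<open>V\<close> corresponds to the section of \<open>q'\<^sub>* E\<close> over \<open>q''\<^sup>-\<^sup>1 V\<close>
  formed by the germs of \<open>s\<close>. The three arguments are \<open>q\<close>, \<open>q''\<close> and \<open>q'\<close>.\<close>

definition push_comp ::
  "('g, 'x, 'k, 'z) change \<Rightarrow> ('h, 'y, 'k, 'z) change \<Rightarrow> ('g, 'x, 'h, 'y) change \<Rightarrow>
   ('g, 'x, 'e) gsheaf \<Rightarrow> ('x, 'z, 'e) germ \<Rightarrow> ('y, 'z, ('x, 'y, 'e) germ) germ" where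
  "push_comp c c2 c1 E = (\<lambda>z\<in>pts (push c E).
     germ c2 (push c1 E) (fst z) (germ_dom z)
       (\<lambda>y\<in>preim c2 (germ_dom z). germ c1 E y (preim c2 (germ_dom z)) (germ_sec z)))"

subsection \<open>The maps \<open>p\<^sub>N\<close> and \<open>\<phi>\<^bsub>M,N\<^esub>\<close>\<close>

definition pN :: "'g monoid \<Rightarrow> 'g topology \<Rightarrow> 'g set \<Rightarrow> ('g, 'g set, 'g set, 'g set set) change" where
  "pN G T N =
     \<lparr>src = subgroup_space G T, tgt = quotient_subgroup_space G T N,
      ghom = (\<lambda>g. N #>\<^bsub>G\<^esub> g), smap = (\<lambda>K. (\<lambda>k. N #>\<^bsub>G\<^esub> k) ` K)\<rparr>"

text \<open>For \<open>M \<subseteq> N\<close> the projection \<open>G Mod M \<rightarrow> G Mod N\<close> sends a coset \<open>C\<close> to \<open>N C\<close>.\<close>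

definition phiMN ::
  "'g monoid \<Rightarrow> 'g topology \<Rightarrow> 'g set \<Rightarrow> 'g set \<Rightarrow> ('g set, 'g set set, 'g set, 'g set set) change" where
  "phiMN G T M N =
     \<lparr>src = quotient_subgroup_space G T M, tgt = quotient_subgroup_space G T N,
      ghom = (\<lambda>C. N <#>\<^bsub>G\<^esub> C), smap = (\<lambda>K. (\<lambda>C. N <#>\<^bsub>G\<^esub> C) ` K)\<rparr>"


section \<open>\<open>G\<^sub>\<bullet>\<close>-sheaves\<close>

text \<open>\<open>stage D N\<close> is \<open>D\<^sub>N\<close> and \<open>struct D M N\<close> is \<open>\<alpha>\<^bsub>M,N\<^esub>\<close>. Points of the pull back of \<open>D\<^sub>N\<close>
  along \<open>\<phi>\<^bsub>M,N\<^esub>\<close> are pairs \<open>(K, d)\<close>; in these terms the identification of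
  \<open>\<phi>\<^bsub>L,N\<^esub>\<^sup>* D\<^sub>N\<close> with \<open>\<phi>\<^bsub>L,M\<^esub>\<^sup>* \<phi>\<^bsub>M,N\<^esub>\<^sup>* D\<^sub>N\<close> is \<open>(K, d) \<mapsto> (K, (\<phi>\<^bsub>L,M\<^esub> K, d))\<close>.\<close>

record ('g, 'e) bullet_sheaf =
  stage :: "'g set \<Rightarrow> ('g set, 'g set set, 'e) gsheaf"
  struct :: "'g set \<Rightarrow> 'g set \<Rightarrow> 'g set set \<times> 'e \<Rightarrow> 'e"

definition is_bullet_sheaf :: "'g monoid \<Rightarrow> 'g topology \<Rightarrow> ('g, 'e) bullet_sheaf \<Rightarrow> bool" where
  "is_bullet_sheaf G T D \<longleftrightarrow>
     (\<forall>N\<in>open_normal G T. is_gsheaf (quotient_subgroup_space G T N) (stage D N)) \<and>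
     (\<forall>M\<in>open_normal G T. \<forall>N\<in>open_normal G T. M \<subseteq> N \<longrightarrow>
        struct D M N \<in> sheaf_hom (quotient_subgroup_space G T M)
          (pull (phiMN G T M N) (stage D N)) (stage D M)) \<and>
     (\<forall>N\<in>open_normal G T. \<forall>(K, d)\<in>pts (pull (phiMN G T N N) (stage D N)).
        struct D N N (K, d) = d) \<and>
     (\<forall>L\<in>open_normal G T. \<forall>M\<in>open_normal G T. \<forall>N\<in>open_normal G T. L \<subseteq> M \<longrightarrow> M \<subseteq> N \<longrightarrow>
        (\<forall>(K, d)\<in>pts (pull (phiMN G T L N) (stage D N)).
           struct D L N (K, d) =
           struct D L M (K, struct D M N (smap (phiMN G T L M) K, d))))"

definition bullet_hom ::
  "'g monoid \<Rightarrow> 'g topology \<Rightarrow> ('g, 'e) bullet_sheaf \<Rightarrow> ('g, 'e) bullet_sheaf \<Rightarrow>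
   ('g set \<Rightarrow> 'e \<Rightarrow> 'e) set" where
  "bullet_hom G T D D' = {f \<in> extensional (open_normal G T).
     (\<forall>N\<in>open_normal G T.
        f N \<in> sheaf_hom (quotient_subgroup_space G T N) (stage D N) (stage D' N)) \<and>
     (\<forall>M\<in>open_normal G T. \<forall>N\<in>open_normal G T. M \<subseteq> N \<longrightarrow>
        (\<forall>z\<in>pts (pull (phiMN G T M N) (stage D N)).
           f M (struct D M N z) =
           struct D' M N (pull_map (phiMN G T M N) (stage D N) (f N) z)))}"

definition bullet_category ::
  "'g monoid \<Rightarrow> 'g topology \<Rightarrow> (('g, 'e) bullet_sheaf, 'g set \<Rightarrow> 'e \<Rightarrow> 'e) category" where
  "bullet_category G T =
     \<lparr>Obj = {D. is_bullet_sheaf G T D}, Hom = bullet_hom G T,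
      Idn = (\<lambda>D. \<lambda>N\<in>open_normal G T. \<lambda>e\<in>pts (stage D N). e),
      Cmp = (\<lambda>X Y Z g f. \<lambda>N\<in>open_normal G T. compose (pts (stage X N)) (g N) (f N))\<rparr>"

definition adjoint_struct ::
  "'g monoid \<Rightarrow> 'g topology \<Rightarrow> ('g, 'e) bullet_sheaf \<Rightarrow> 'g set \<Rightarrow> 'g set \<Rightarrow>
   'e \<Rightarrow> ('g set set, 'g set set, 'e) germ" where
  "adjoint_struct G T D M N =
     adjoint_to_push (phiMN G T M N) (stage D N) (stage D M) (struct D M N)"

definition weyl_bullet_category ::
  "'g monoid \<Rightarrow> 'g topology \<Rightarrow> (('g, 'e) bullet_sheaf, 'g set \<Rightarrow> 'e \<Rightarrow> 'e) category" where
  "weyl_bullet_category G T = full_subcategory (bullet_category G T) (\<lambda>D.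
     (\<forall>N\<in>open_normal G T. is_weyl_sheaf (G Mod N) (quotient_group_topology G T N) (stage D N)) \<and>
     (\<forall>M\<in>open_normal G T. \<forall>N\<in>open_normal G T. M \<subseteq> N \<longrightarrow>
        sheaf_iso (quotient_subgroup_space G T N)
          (stage D N) (push (phiMN G T M N) (stage D M)) (adjoint_struct G T D M N)))"


section \<open>The two functors\<close>

text \<open>Let \<open>'u\<close> be the type of points of the sheaves under consideration. The points of a
  push forward are germs, hence of another type. The functor \<open>p\<^sub>\<bullet>\<close> therefore uses a
  chosen isomorphic copy with points in \<open>'u\<close>, together with the isomorphism.\<close>

definition copy ::
  "('g, 'x) gspace \<Rightarrow> ('g, 'x, 'e) gsheaf \<Rightarrow> ('g, 'x, 'u) gsheaf \<times> ('e \<Rightarrow> 'u)" where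
  "copy B E = (SOME (F, r). is_gsheaf B F \<and> sheaf_iso B E F r)"

definition push_pN ::
  "'g monoid \<Rightarrow> 'g topology \<Rightarrow> ('g, 'g set, 'u) gsheaf \<Rightarrow> 'g set \<Rightarrow> ('g set, 'g set set, 'u) gsheaf" where
  "push_pN G T E N = fst (copy (quotient_subgroup_space G T N) (push (pN G T N) E))"

definition to_copy ::
  "'g monoid \<Rightarrow> 'g topology \<Rightarrow> ('g, 'g set, 'u) gsheaf \<Rightarrow> 'g set \<Rightarrow>
   ('g set, 'g set set, 'u) germ \<Rightarrow> 'u" where
  "to_copy G T E N = snd (copy (quotient_subgroup_space G T N) (push (pN G T N) E))"

definition from_copy ::
  "'g monoid \<Rightarrow> 'g topology \<Rightarrow> ('g, 'g set, 'u) gsheaf \<Rightarrow> 'g set \<Rightarrow>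
   'u \<Rightarrow> ('g set, 'g set set, 'u) germ" where
  "from_copy G T E N = inv_into (pts (push (pN G T N) E)) (to_copy G T E N)"

definition p_bullet ::
  "'g monoid \<Rightarrow> 'g topology \<Rightarrow>
   (('g, 'g set, 'u) gsheaf, 'u \<Rightarrow> 'u, ('g, 'u) bullet_sheaf, 'g set \<Rightarrow> 'u \<Rightarrow> 'u) cfunctor" where
  "p_bullet G T =
     \<lparr>fobj = (\<lambda>E. \<lparr>stage = push_pN G T E,
        struct = (\<lambda>M N. compose (pts (pull (phiMN G T M N) (push_pN G T E N)))
          (to_copy G T E M)
          (adjoint_from_pull (phiMN G T M N) (push_pN G T E N) (push (pN G T M) E)
            (compose (pts (push_pN G T E N))
              (push_comp (pN G T N) (phiMN G T M N) (pN G T M) E)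
              (from_copy G T E N))))\<rparr>),
      farr = (\<lambda>E E' f. \<lambda>N\<in>open_normal G T. \<lambda>u\<in>pts (push_pN G T E N).
        to_copy G T E' N (push_map (pN G T N) E E' f (from_copy G T E N u)))\<rparr>"

text \<open>The colimit of the \<open>p\<^sub>N\<^sup>* D\<^sub>N\<close> in the category of \<open>G\<close>-sheaves, by its universal property.
  The transition map from stage \<open>N\<close> to stage \<open>M \<subseteq> N\<close> is \<open>(K, d) \<mapsto> (K, \<alpha>\<^bsub>M,N\<^esub> (p\<^sub>M K, d))\<close>.\<close>

definition is_cocone ::
  "'g monoid \<Rightarrow> 'g topology \<Rightarrow> ('g, 'u) bullet_sheaf \<Rightarrow> ('g, 'g set, 'u) gsheaf \<Rightarrow>
   ('g set \<Rightarrow> 'g set \<times> 'u \<Rightarrow> 'u) \<Rightarrow> bool" where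
  "is_cocone G T D E \<kappa> \<longleftrightarrow> is_gsheaf (subgroup_space G T) E \<and>
     (\<forall>N\<in>open_normal G T.
        \<kappa> N \<in> sheaf_hom (subgroup_space G T) (pull (pN G T N) (stage D N)) E) \<and>
     (\<forall>M\<in>open_normal G T. \<forall>N\<in>open_normal G T. M \<subseteq> N \<longrightarrow>
        (\<forall>(K, d)\<in>pts (pull (pN G T N) (stage D N)).
           \<kappa> M (K, struct D M N (smap (pN G T M) K, d)) = \<kappa> N (K, d)))"

definition is_colimit ::
  "'g monoid \<Rightarrow> 'g topology \<Rightarrow> ('g, 'u) bullet_sheaf \<Rightarrow> ('g, 'g set, 'u) gsheaf \<Rightarrow>
   ('g set \<Rightarrow> 'g set \<times> 'u \<Rightarrow> 'u) \<Rightarrow> bool" where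
  "is_colimit G T D E \<kappa> \<longleftrightarrow> is_cocone G T D E \<kappa> \<and>
     (\<forall>E' \<kappa>'. is_cocone G T D E' \<kappa>' \<longrightarrow>
        (\<exists>!h. h \<in> sheaf_hom (subgroup_space G T) E E' \<and>
           (\<forall>N\<in>open_normal G T. \<forall>z\<in>pts (pull (pN G T N) (stage D N)). h (\<kappa> N z) = \<kappa>' N z)))"

definition colim ::
  "'g monoid \<Rightarrow> 'g topology \<Rightarrow> ('g, 'u) bullet_sheaf \<Rightarrow>
   ('g, 'g set, 'u) gsheaf \<times> ('g set \<Rightarrow> 'g set \<times> 'u \<Rightarrow> 'u)" where
  "colim G T D = (SOME (E, \<kappa>). is_colimit G T D E \<kappa>)"

definition colim_functor ::
  "'g monoid \<Rightarrow> 'g topology \<Rightarrow>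
   (('g, 'u) bullet_sheaf, 'g set \<Rightarrow> 'u \<Rightarrow> 'u, ('g, 'g set, 'u) gsheaf, 'u \<Rightarrow> 'u) cfunctor" where
  "colim_functor G T =
     \<lparr>fobj = (\<lambda>D. fst (colim G T D)),
      farr = (\<lambda>D D' f. THE h.
        h \<in> sheaf_hom (subgroup_space G T) (fst (colim G T D)) (fst (colim G T D')) \<and>
        (\<forall>N\<in>open_normal G T. \<forall>z\<in>pts (pull (pN G T N) (stage D N)).
           h (snd (colim G T D) N z) =
           snd (colim G T D') N (pull_map (pN G T N) (stage D N) (f N) z)))\<rparr>"


section \<open>Universes\<close>

text \<open>A category of sheaves needs a set of admissible points. Here this is an
  infinite type \<open>'u\<close> such that families of points indexed by sets of elements of \<open>G\<close> can
  be coded by points; then the push forwards and colimits above exist in \<open>'u\<close>.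
  The lemma shows that there are such types into which any given type \<open>'v\<close> embeds.\<close>

definition universe :: "'g itself \<Rightarrow> 'u itself \<Rightarrow> bool" where
  "universe _ _ \<longleftrightarrow> infinite (UNIV :: 'u set) \<and> (\<exists>code :: ('g set \<Rightarrow> 'u) \<Rightarrow> 'u. inj code)"

lemma universe_exists:
  "universe TYPE('g) TYPE('g set \<times> nat \<Rightarrow> 'v option)"
  "\<exists>i :: 'v \<Rightarrow> ('g set \<times> nat \<Rightarrow> 'v option). inj i"
proof -
  let ?A = "UNIV :: ('g set \<times> nat) set"
  have infA: "infinite ?A"
    by (simp add: finite_prod)
  obtain j0 :: "_ \<Rightarrow> 'g set \<times> nat" where j0: "inj_on j0 (?A \<times> ?A)"
    using card_of_ordLeq [THEN iffD2,
        OF ordIso_imp_ordLeq [OF card_of_Times_same_infinite [OF infA]]] by blast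
  define j where "j = (\<lambda>(S :: 'g set, q :: 'g set \<times> nat). j0 ((S, 0 :: nat), q))"
  have j: "inj j"
    using j0 by (auto simp: inj_on_def j_def)
  define code :: "('g set \<Rightarrow> ('g set \<times> nat \<Rightarrow> 'v option)) \<Rightarrow> ('g set \<times> nat \<Rightarrow> 'v option)"
    where "code = (\<lambda>f p. f (fst (inv_into UNIV j p)) (snd (inv_into UNIV j p)))"
  have "inj code"
  proof (rule injI, intro ext)
    fix f f' :: "'g set \<Rightarrow> ('g set \<times> nat \<Rightarrow> 'v option)" and S and q
    assume "code f = code f'"
    then have "code f (j (S, q)) = code f' (j (S, q))"
      by simp
    then show "f S q = f' S q"
      by (simp add: code_def inv_f_f [OF j])
  qed
  moreover have "infinite (UNIV :: ('g set \<times> nat \<Rightarrow> 'v option) set)"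
  proof -
    define k :: "'g set \<times> nat \<Rightarrow> ('g set \<times> nat \<Rightarrow> 'v option)"
      where "k = (\<lambda>p q. if p = q then None else Some undefined)"
    have "inj k"
    proof (rule injI)
      fix p p' assume "k p = k p'"
      then have "k p p = k p' p" by simp
      then show "p = p'" by (simp add: k_def split: if_splits)
    qed
    then have "infinite (range k)"
      using infA finite_imageD by blast
    then show ?thesis
      using finite_subset [OF subset_UNIV] by blast
  qed
  ultimately show "universe TYPE('g) TYPE('g set \<times> nat \<Rightarrow> 'v option)"
    unfolding universe_def by blast
  show "\<exists>i :: 'v \<Rightarrow> ('g set \<times> nat \<Rightarrow> 'v option). inj i"
    by (rule exI [of _ "\<lambda>v p. Some v"]) (auto simp: inj_def fun_eq_iff)
qed

end

theory Submission
  imports Defs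
begin

text \<open>The groups \<open>G/N\<close> and the spaces \<open>\<S>(G/N)\<close> are finite and discrete, and the fibres of the maps
  \<open>p\<^sub>N\<close> form a basis of \<open>\<S>G\<close>. A point of \<open>(p\<^sub>N)\<^sub>* E\<close> over \<open>S\<close> is therefore an \<open>N\<close>-invariant section of
  \<open>E\<close> over the fibre of \<open>S\<close>. Every germ of \<open>E\<close> is the germ of such a section for some small \<open>N\<close>, so
  \<open>E\<close> is the colimit of the \<open>p\<^sub>N\<^sup>* (p\<^sub>N)\<^sub>* E\<close>. Conversely let \<open>E\<close> be the colimit of the
  \<open>p\<^sub>N\<^sup>* D\<^sub>N\<close>. Locally a section of \<open>E\<close> comes from some \<open>D\<^sub>M\<close>; by compactness of \<open>\<S>G\<close> one \<open>M\<close> serves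
  the whole fibre of \<open>S\<close>, and since \<open>G/M\<close> is finite, an \<open>N\<close>-invariant section becomes an
  \<open>N\<close>-invariant family of points of \<open>D\<^sub>L\<close> at some \<open>L \<subseteq> M\<close>. The adjoint structure maps being
  bijective, this family comes from a unique point of \<open>D\<^sub>N\<close>.\<close>

section \<open>Sheaves and their sections\<close>

subsection \<open>Stalks\<close>

text \<open>Two obstacles shape the proof. The colimit is given by a universal property and an
  arbitrary choice, so nothing can be read off its points. One colimit is therefore built by hand,
  from the directed colimits of the stalks with the final topology, and the description of its
  points (\<open>good_cocone\<close>: each comes from a stage, and two that become equal do so at a
  stage) is carried to the chosen colimit along the comparison isomorphism. \<open>E\<close> has the
  same description over its own push forwards, so the unit is an isomorphism by uniqueness of
  colimits. Secondly, equality in the colimit is equality at a stage that depends on the point,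
  while the adjoint structure maps speak of all points of a fibre at one stage.
  \<open>compact_stage\<close> passes from pointwise to uniform: a condition on the points of the
  finite sets \<open>Y N\<close> that is inherited by finer stages and holds eventually along each
  closed subgroup holds throughout one stage. It applies because transition maps depend on
  \<open>K\<close> only through \<open>p M K\<close>. The counit is defined as the inverse of the
  maps \<open>theta\<close>, which are the ones with a direct formula.\<close>

definition fib :: "('g, 'x, 'e) gsheaf \<Rightarrow> 'x \<Rightarrow> 'e set" where
  "fib E x = {e \<in> pts E. sproj E e = x}"

lemma in_fib_iff [simp]: "e \<in> fib E x \<longleftrightarrow> e \<in> pts E \<and> sproj E e = x"
  by (simp add: fib_def)

text \<open>The module axioms in terms of the operations of the sheaf. The law for scaling by 0
  stands in for additive inverses: it makes \<open>sscale E (- 1) a\<close> a negative of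
  \<open>a\<close>.\<close>

definition rat_stalk :: "('g, 'x, 'e) gsheaf \<Rightarrow> 'x \<Rightarrow> bool" where
  "rat_stalk E x \<longleftrightarrow> szero E x \<in> fib E x \<and>
     (\<forall>a\<in>fib E x. \<forall>b\<in>fib E x. sadd E a b \<in> fib E x) \<and>
     (\<forall>r. \<forall>a\<in>fib E x. sscale E r a \<in> fib E x) \<and>
     (\<forall>a\<in>fib E x. \<forall>b\<in>fib E x. \<forall>c\<in>fib E x. sadd E (sadd E a b) c = sadd E a (sadd E b c)) \<and>
     (\<forall>a\<in>fib E x. \<forall>b\<in>fib E x. sadd E a b = sadd E b a) \<and>
     (\<forall>a\<in>fib E x. sadd E (szero E x) a = a) \<and>
     (\<forall>a\<in>fib E x. sscale E 1 a = a) \<and>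
     (\<forall>a\<in>fib E x. sscale E 0 a = szero E x) \<and>
     (\<forall>r s. \<forall>a\<in>fib E x. sscale E (r + s) a = sadd E (sscale E r a) (sscale E s a)) \<and>
     (\<forall>r s. \<forall>a\<in>fib E x. sscale E (r * s) a = sscale E r (sscale E s a)) \<and>
     (\<forall>r. \<forall>a\<in>fib E x. \<forall>b\<in>fib E x. sscale E r (sadd E a b) = sadd E (sscale E r a) (sscale E r b))"

lemma rat_stalkD:
  assumes "rat_stalk E x"
  shows "szero E x \<in> pts E" "sproj E (szero E x) = x"
    "\<And>a b. a \<in> fib E x \<Longrightarrow> b \<in> fib E x \<Longrightarrow> sadd E a b \<in> fib E x"
    "\<And>r a. a \<in> fib E x \<Longrightarrow> sscale E r a \<in> fib E x"
    "\<And>a b c. a \<in> fib E x \<Longrightarrow> b \<in> fib E x \<Longrightarrow> c \<in> fib E x \<Longrightarrow> sadd E (sadd E a b) c = sadd E a (sadd E b c)"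
    "\<And>a b. a \<in> fib E x \<Longrightarrow> b \<in> fib E x \<Longrightarrow> sadd E a b = sadd E b a"
    "\<And>a. a \<in> fib E x \<Longrightarrow> sadd E (szero E x) a = a"
    "\<And>a. a \<in> fib E x \<Longrightarrow> sscale E 1 a = a"
    "\<And>a. a \<in> fib E x \<Longrightarrow> sscale E 0 a = szero E x"
    "\<And>r s a. a \<in> fib E x \<Longrightarrow> sscale E (r + s) a = sadd E (sscale E r a) (sscale E s a)"
    "\<And>r s a. a \<in> fib E x \<Longrightarrow> sscale E (r * s) a = sscale E r (sscale E s a)"
    "\<And>r a b. a \<in> fib E x \<Longrightarrow> b \<in> fib E x \<Longrightarrow> sscale E r (sadd E a b) = sadd E (sscale E r a) (sscale E r b)"
proof -
  note D = assms [unfolded rat_stalk_def]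
  show "szero E x \<in> pts E" "sproj E (szero E x) = x"
    using D [THEN conjunct1] by auto
  show "\<And>a b. a \<in> fib E x \<Longrightarrow> b \<in> fib E x \<Longrightarrow> sadd E a b \<in> fib E x"
    by (rule D [THEN conjunct2, THEN conjunct1, rule_format])
  show "\<And>r a. a \<in> fib E x \<Longrightarrow> sscale E r a \<in> fib E x"
    by (rule D [THEN conjunct2, THEN conjunct2, THEN conjunct1, rule_format])
  show "\<And>a b c. a \<in> fib E x \<Longrightarrow> b \<in> fib E x \<Longrightarrow> c \<in> fib E x \<Longrightarrow> sadd E (sadd E a b) c = sadd E a (sadd E b c)"
    by (rule D [THEN conjunct2, THEN conjunct2, THEN conjunct2, THEN conjunct1, rule_format])
  show "\<And>a b. a \<in> fib E x \<Longrightarrow> b \<in> fib E x \<Longrightarrow> sadd E a b = sadd E b a"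
    by (rule D [THEN conjunct2, THEN conjunct2, THEN conjunct2, THEN conjunct2, THEN conjunct1, rule_format])
  show "\<And>a. a \<in> fib E x \<Longrightarrow> sadd E (szero E x) a = a"
    by (rule D [THEN conjunct2, THEN conjunct2, THEN conjunct2, THEN conjunct2, THEN conjunct2, THEN conjunct1, rule_format])
  show "\<And>a. a \<in> fib E x \<Longrightarrow> sscale E 1 a = a"
    by (rule D [THEN conjunct2, THEN conjunct2, THEN conjunct2, THEN conjunct2, THEN conjunct2, THEN conjunct2, THEN conjunct1, rule_format])
  show "\<And>a. a \<in> fib E x \<Longrightarrow> sscale E 0 a = szero E x"
    by (rule D [THEN conjunct2, THEN conjunct2, THEN conjunct2, THEN conjunct2, THEN conjunct2, THEN conjunct2, THEN conjunct2, THEN conjunct1, rule_format])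
  show "\<And>r s a. a \<in> fib E x \<Longrightarrow> sscale E (r + s) a = sadd E (sscale E r a) (sscale E s a)"
    by (rule D [THEN conjunct2, THEN conjunct2, THEN conjunct2, THEN conjunct2, THEN conjunct2, THEN conjunct2, THEN conjunct2, THEN conjunct2, THEN conjunct1, rule_format])
  show "\<And>r s a. a \<in> fib E x \<Longrightarrow> sscale E (r * s) a = sscale E r (sscale E s a)"
    by (rule D [THEN conjunct2, THEN conjunct2, THEN conjunct2, THEN conjunct2, THEN conjunct2, THEN conjunct2, THEN conjunct2, THEN conjunct2, THEN conjunct2, THEN conjunct1, rule_format])
  show "\<And>r a b. a \<in> fib E x \<Longrightarrow> b \<in> fib E x \<Longrightarrow> sscale E r (sadd E a b) = sadd E (sscale E r a) (sscale E r b)"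
    by (rule D [THEN conjunct2, THEN conjunct2, THEN conjunct2, THEN conjunct2, THEN conjunct2, THEN conjunct2, THEN conjunct2, THEN conjunct2, THEN conjunct2, THEN conjunct2, rule_format])
qed

lemma rat_stalk_zero: "rat_stalk E x \<Longrightarrow> szero E x \<in> fib E x"
  by (simp add: rat_stalkD)

lemma carrier_stalk: "carrier (stalk E x) = fib E x"
  by (simp add: stalk_def fib_def)

lemma stalk_simps [simp]:
  "add (stalk E x) = sadd E" "zero (stalk E x) = szero E x" "smult (stalk E x) = sscale E"
  by (simp_all add: stalk_def)

lemma cring_rat_ring: "cring rat_ring"
proof (rule cringI)
  show "abelian_group rat_ring"
  proof (rule abelian_groupI)
    fix x assume "x \<in> carrier rat_ring"
    show "\<exists>y\<in>carrier rat_ring. y \<oplus>\<^bsub>rat_ring\<^esub> x = \<zero>\<^bsub>rat_ring\<^esub>"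
      by (rule bexI [of _ "- x"]) (auto simp: rat_ring_def)
  qed (auto simp: rat_ring_def)
  show "Group.comm_monoid rat_ring"
    by (rule comm_monoidI) (auto simp: rat_ring_def)
qed (auto simp: rat_ring_def algebra_simps)

lemma rat_ring_simps:
  "carrier rat_ring = UNIV" "add rat_ring = (+)" "mult rat_ring = (*)"
  "one rat_ring = 1" "zero rat_ring = 0"
  by (auto simp: rat_ring_def)

lemma rat_stalkI:
  assumes "Module.module rat_ring (stalk E x)"
  shows "rat_stalk E x"
proof -
  interpret M: Module.module rat_ring "stalk E x" by (rule assms)
  note [simp] = rat_ring_simps
  note c = carrier_stalk [of E x]
  have z: "sscale E 0 a = szero E x" if "a \<in> fib E x" for a
    using M.smult_l_null [of a] that by (simp add: c del: in_fib_iff)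
  show ?thesis
    unfolding rat_stalk_def
    using M.zero_closed M.a_closed M.smult_closed M.a_assoc M.a_comm M.l_zero M.smult_one
      M.smult_l_distr M.smult_assoc1 M.smult_r_distr z
    by (simp add: c del: in_fib_iff)
qed

lemma stalk_moduleI:
  assumes "rat_stalk E x"
  shows "Module.module rat_ring (stalk E x)"
proof (rule moduleI)
  show "abelian_group (stalk E x)"
  proof (rule abelian_groupI)
    fix a assume a: "a \<in> carrier (stalk E x)"
    have "sadd E (sscale E (- 1) a) (sscale E 1 a) = sscale E (- 1 + 1) a"
      using rat_stalkD(10) [OF assms, of a "- 1" 1] a by (simp only: carrier_stalk)
    then have "sadd E (sscale E (- 1) a) a = szero E x"
      using a by (simp add: carrier_stalk rat_stalkD(8,9) [OF assms])
    then show "\<exists>y\<in>carrier (stalk E x). y \<oplus>\<^bsub>stalk E x\<^esub> a = \<zero>\<^bsub>stalk E x\<^esub>"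
      using a rat_stalkD(4) [OF assms] by (intro bexI [of _ "sscale E (- 1) a"]) (simp_all add: carrier_stalk del: in_fib_iff)
  qed (unfold carrier_stalk stalk_simps, (rule rat_stalkD [OF assms] rat_stalk_zero [OF assms]; assumption)+)
qed (unfold rat_ring_simps carrier_stalk stalk_simps, (rule cring_rat_ring rat_stalkD [OF assms]; assumption)+)

lemma stalk_module_iff: "Module.module rat_ring (stalk E x) \<longleftrightarrow> rat_stalk E x"
  by (rule iffI [OF rat_stalkI stalk_moduleI])

text \<open>Negation is scaling by -1, so the subtraction in the definition of a sheaf becomes an
  expression in \<open>sadd\<close> and \<open>sscale\<close>, with no reference to the stalk as a
  record.\<close>

lemma stalk_minus:
  assumes "rat_stalk E x" "d \<in> fib E x" "e \<in> fib E x"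
  shows "d \<ominus>\<^bsub>stalk E x\<^esub> e = sadd E d (sscale E (- 1) e)"
proof -
  interpret M: Module.module rat_ring "stalk E x" using assms by (simp add: stalk_module_iff)
  have "sadd E (sscale E (- 1) e) (sscale E 1 e) = sscale E (- 1 + 1) e"
    using rat_stalkD(10) [OF assms(1,3), of "- 1" 1] by simp
  then have "sadd E (sscale E (- 1) e) e = szero E x"
    using assms(3) by (simp add: rat_stalkD(8,9) [OF assms(1)])
  then have "\<ominus>\<^bsub>stalk E x\<^esub> e = sscale E (- 1) e"
    using M.minus_equality [of "sscale E (- 1) e" e, unfolded carrier_stalk stalk_simps]
      rat_stalkD(4) [OF assms(1,3)] assms(3) by blast
  then show ?thesis
    by (simp add: a_minus_def)
qed

lemma module_linear_iff:
  "module_linear (stalk E x) (stalk F y) f \<longleftrightarrow>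
     (\<forall>a\<in>fib E x. f a \<in> fib F y) \<and>
     (\<forall>a\<in>fib E x. \<forall>b\<in>fib E x. f (sadd E a b) = sadd F (f a) (f b)) \<and>
     (\<forall>r. \<forall>a\<in>fib E x. f (sscale E r a) = sscale F r (f a))"
  unfolding module_linear_def carrier_stalk stalk_simps by blast

lemma linear_zero:
  assumes "module_linear (stalk E x) (stalk F y) f" "rat_stalk E x" "rat_stalk F y"
  shows "f (szero E x) = szero F y"
proof -
  have z: "szero E x \<in> fib E x" "f (szero E x) \<in> fib F y"
    using assms rat_stalkD(1,2) [of E x] by (auto simp: module_linear_iff)
  then have "f (sscale E 0 (szero E x)) = sscale F 0 (f (szero E x))"
    using assms by (auto simp: module_linear_iff)
  with z show ?thesis
    using rat_stalkD(9) [OF assms(2)] rat_stalkD(9) [OF assms(3)] by simp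
qed

text \<open>The two forms of subtraction agree on the fibre product, because every point of the
  total space lies over a point of the base, where the module axioms hold.\<close>

lemma is_gsheaf_iff:
  "is_gsheaf B E \<longleftrightarrow>
     continuous_action (grp B) (grp_top B) (tot E) (sact E) \<and>
     local_homeomorphism (tot E) (space_top B) (sproj E) \<and>
     (\<forall>g\<in>carrier (grp B). \<forall>e\<in>pts E. sproj E (sact E g e) = space_act B g (sproj E e)) \<and>
     (\<forall>x\<in>topspace (space_top B). rat_stalk E x) \<and>
     continuous_map
       (subtopology (prod_topology (tot E) (tot E)) {(d, e). sproj E d = sproj E e}) (tot E)
       (\<lambda>(d, e). sadd E d (sscale E (- 1) e)) \<and>
     (\<forall>r. continuous_map (tot E) (tot E) (sscale E r)) \<and>
     (\<forall>g\<in>carrier (grp B). \<forall>x\<in>topspace (space_top B).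
        module_linear (stalk E x) (stalk E (space_act B g x)) (sact E g))"
proof -
  have "continuous_map
       (subtopology (prod_topology (tot E) (tot E)) {(d, e). sproj E d = sproj E e}) (tot E)
       (\<lambda>(d, e). d \<ominus>\<^bsub>stalk E (sproj E d)\<^esub> e) \<longleftrightarrow> continuous_map
       (subtopology (prod_topology (tot E) (tot E)) {(d, e). sproj E d = sproj E e}) (tot E)
       (\<lambda>(d, e). sadd E d (sscale E (- 1) e))"
    if lh: "local_homeomorphism (tot E) (space_top B) (sproj E)"
      and rs: "\<forall>x\<in>topspace (space_top B). rat_stalk E x"
  proof (rule iffI; erule continuous_map_eq)
    have "sproj E d \<in> topspace (space_top B)" if "d \<in> pts E" for d
      using lh that by (auto simp: local_homeomorphism_def continuous_map_def Pi_iff)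
    then have *: "d \<ominus>\<^bsub>stalk E (sproj E d)\<^esub> e = sadd E d (sscale E (- 1) e)"
      if "d \<in> pts E" "e \<in> pts E" "sproj E d = sproj E e" for d e
      using that rs by (intro stalk_minus) auto
    show "(case x of (d, e) \<Rightarrow> d \<ominus>\<^bsub>stalk E (sproj E d)\<^esub> e) = (case x of (d, e) \<Rightarrow> sadd E d (sscale E (- 1) e))"
      if "x \<in> topspace (subtopology (prod_topology (tot E) (tot E)) {(d, e). sproj E d = sproj E e})" for x
      using that * by auto
    show "(case x of (d, e) \<Rightarrow> sadd E d (sscale E (- 1) e)) = (case x of (d, e) \<Rightarrow> d \<ominus>\<^bsub>stalk E (sproj E d)\<^esub> e)"
      if "x \<in> topspace (subtopology (prod_topology (tot E) (tot E)) {(d, e). sproj E d = sproj E e})" for x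
      using that * by auto
  qed
  then show ?thesis
    unfolding is_gsheaf_def stalk_module_iff by blast
qed

subsection \<open>Local homeomorphisms\<close>

text \<open>Near \<open>s x\<close> there is a sheet on which \<open>p\<close> is injective. Over
  the open set where \<open>s\<close> takes values in it, the image of \<open>s\<close> is the part
  of the sheet lying over that set.\<close>

lemma section_image_open:
  assumes lh: "local_homeomorphism E X p" and U: "openin X U"
    and s: "continuous_map (subtopology X U) E s" "\<forall>x\<in>U. p (s x) = x"
  shows "openin E (s ` U)"
proof (subst openin_subopen, intro ballI)
  fix e assume "e \<in> s ` U"
  then obtain x where x: "x \<in> U" "e = s x" by auto
  have UX: "U \<subseteq> topspace X" using U by (rule openin_subset)
  have "s x \<in> topspace E"
    using s(1) x UX by (auto simp: continuous_map_def Pi_iff)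
  then obtain W where W: "openin E W" "s x \<in> W"
      "homeomorphic_map (subtopology E W) (subtopology X (p ` W)) p"
    using lh unfolding local_homeomorphism_def by blast
  have WE: "W \<subseteq> topspace E" using W openin_subset by blast
  have inj: "inj_on p W"
    using W(3) WE by (simp add: homeomorphic_eq_everything_map Int_absorb1)
  let ?V = "{x \<in> U. s x \<in> W}"
  have V: "openin X ?V"
  proof -
    have "openin (subtopology X U) {x \<in> topspace (subtopology X U). s x \<in> W}"
      using s(1) W(1) by (rule openin_continuous_map_preimage)
    then show ?thesis
      using U UX by (simp add: openin_open_subtopology Int_absorb1)
  qed
  have contp: "continuous_map E X p" using lh by (simp add: local_homeomorphism_def)
  \<comment> \<open>A point of the sheet \<open>W\<close> over \<open>?V\<close> has the same
    projection as the value of \<open>s\<close> there, so injectivity of \<open>p\<close> on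
    \<open>W\<close> identifies them.\<close>
  have "s ` ?V = W \<inter> {e \<in> topspace E. p e \<in> ?V}"
  proof
    show "s ` ?V \<subseteq> W \<inter> {e \<in> topspace E. p e \<in> ?V}"
      using s(2) WE by auto
    show "W \<inter> {e \<in> topspace E. p e \<in> ?V} \<subseteq> s ` ?V"
    proof
      fix w assume "w \<in> W \<inter> {e \<in> topspace E. p e \<in> ?V}"
      then have "s (p w) = w"
        using s(2) inj by (auto simp: inj_on_def)
      then show "w \<in> s ` ?V"
        using \<open>w \<in> _\<close> by (metis (mono_tags, lifting) IntD2 imageI mem_Collect_eq)
    qed
  qed
  moreover have "openin E {e \<in> topspace E. p e \<in> ?V}"
    using contp V by (rule openin_continuous_map_preimage)
  ultimately have "openin E (s ` ?V)"
    using W(1) by (simp add: openin_Int)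
  then show "\<exists>T. openin E T \<and> e \<in> T \<and> T \<subseteq> s ` U"
    using x W(2) by (intro exI [of _ "s ` ?V"]) auto
qed

lemma local_section_exists:
  assumes lh: "local_homeomorphism E X p" and e: "e \<in> topspace E"
  obtains U s where "openin X U" "p e \<in> U" "continuous_map (subtopology X U) E s"
    "\<forall>x\<in>U. p (s x) = x" "s (p e) = e"
proof -
  obtain W where W: "openin E W" "e \<in> W" "openin X (p ` W)"
      "homeomorphic_map (subtopology E W) (subtopology X (p ` W)) p"
    using lh e unfolding local_homeomorphism_def by blast
  obtain s where s: "homeomorphic_maps (subtopology E W) (subtopology X (p ` W)) p s"
    using W(4) by (auto simp: homeomorphic_map_maps)
  have WE: "W \<subseteq> topspace E" "p ` W \<subseteq> topspace X" using W openin_subset by blast+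
  show ?thesis
  proof
    show "continuous_map (subtopology X (p ` W)) E s"
      using s by (auto simp: homeomorphic_maps_def continuous_map_in_subtopology)
    show "\<forall>x\<in>p ` W. p (s x) = x" "s (p e) = e"
      using s W(2) WE by (auto simp: homeomorphic_maps_def)
  qed (use W in auto)
qed

text \<open>The image of \<open>t\<close> is open, and \<open>s x\<close> lies in it only if
  \<open>s x = t x\<close>, since both are sections; the set in question is a preimage of that image
  under \<open>s\<close>.\<close>

lemma sections_agree_open:
  assumes lh: "local_homeomorphism E X p"
    and s: "openin X U" "continuous_map (subtopology X U) E s" "\<forall>x\<in>U. p (s x) = x"
    and t: "openin X V" "continuous_map (subtopology X V) E t" "\<forall>x\<in>V. p (t x) = x"
  shows "openin X {x \<in> U \<inter> V. s x = t x}"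
proof -
  have "openin E (t ` V)"
    using lh t by (rule section_image_open)
  then have *: "openin (subtopology X U) {x \<in> topspace (subtopology X U). s x \<in> t ` V}"
    using s(2) openin_continuous_map_preimage by blast
  have "topspace (subtopology X U) = U"
    using openin_subset [OF s(1)] by auto
  with * have "openin (subtopology X U) {x \<in> U. s x \<in> t ` V}"
    by (simp only:)
  moreover have "{x \<in> U. s x \<in> t ` V} = {x \<in> U \<inter> V. s x = t x}"
    using s(3) t(3) by (auto simp: image_iff)
  ultimately show ?thesis
    using s(1) by (simp add: openin_open_subtopology)
qed

lemma continuous_map_locally:
  assumes "\<And>x. x \<in> topspace X \<Longrightarrow> \<exists>U. openin X U \<and> x \<in> U \<and> continuous_map (subtopology X U) Y f"
  shows "continuous_map X Y f"
proof -
  obtain U where U: "\<And>x. x \<in> topspace X \<Longrightarrow> openin X (U x) \<and> x \<in> U x \<and> continuous_map (subtopology X (U x)) Y f"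
    using assms by metis
  show ?thesis
    by (rule pasting_lemma [where I = "topspace X" and T = U and f = "\<lambda>_. f"]) (use U in auto)
qed

text \<open>Images of local sections are open and cover the total space; on such an image
  \<open>f\<close> is the composite of \<open>p\<close> with the map obtained by restricting
  \<open>f\<close> along the section.\<close>

lemma continuous_map_over:
  assumes lh: "local_homeomorphism E X p"
    and *: "\<And>e. e \<in> topspace E \<Longrightarrow> \<exists>U s. openin X U \<and> p e \<in> U \<and>
       continuous_map (subtopology X U) E s \<and> (\<forall>x\<in>U. p (s x) = x) \<and> s (p e) = e \<and>
       continuous_map (subtopology X U) Z (\<lambda>x. f (s x))"
  shows "continuous_map E Z f"
proof (rule continuous_map_locally)
  fix e assume e: "e \<in> topspace E"
  then obtain U s where s: "openin X U" "p e \<in> U" "continuous_map (subtopology X U) E s"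
      "\<forall>x\<in>U. p (s x) = x" "s (p e) = e" "continuous_map (subtopology X U) Z (\<lambda>x. f (s x))"
    using * by blast
  have o: "openin E (s ` U)"
    by (rule section_image_open [OF lh s(1,3,4)])
  have "continuous_map (subtopology E (s ` U)) (subtopology X U) p"
    using lh s(4) by (auto simp: local_homeomorphism_def continuous_map_in_subtopology
        intro: continuous_map_from_subtopology)
  then have "continuous_map (subtopology E (s ` U)) Z ((\<lambda>x. f (s x)) \<circ> p)"
    using s(6) continuous_map_compose by blast
  then have "continuous_map (subtopology E (s ` U)) Z f"
    by (rule continuous_map_eq) (use s(4) in auto)
  then show "\<exists>U. openin E U \<and> e \<in> U \<and> continuous_map (subtopology E U) Z f"
    using o s(2,5) by (intro exI [of _ "s ` U"]) (auto simp: image_iff intro!: bexI [of _ "p e"])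
qed

section \<open>Profinite groups\<close>

text \<open>The finite intersection property for downward directed families: a finite subfamily has
  a member below all of it, so nonempty members already give nonempty finite intersections.\<close>

lemma compact_directed:
  assumes X: "compact_space X" and I: "I \<noteq> {}"
    and C: "\<And>i. i \<in> I \<Longrightarrow> closedin X (C i)" "\<And>i. i \<in> I \<Longrightarrow> C i \<noteq> {}"
    and dir: "\<And>i j. i \<in> I \<Longrightarrow> j \<in> I \<Longrightarrow> \<exists>k\<in>I. C k \<subseteq> C i \<inter> C j"
  shows "\<exists>x\<in>topspace X. \<forall>i\<in>I. x \<in> C i"
proof (rule ccontr)
    assume *: "\<not> ?thesis"
    have "compactin X (topspace X)" using X by (simp add: compact_space_def)
    moreover have "topspace X \<subseteq> \<Union> ((\<lambda>i. topspace X - C i) ` I)"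
      using * by auto
    moreover have "\<forall>U\<in>(\<lambda>i. topspace X - C i) ` I. openin X U"
      using C(1) by (auto simp: openin_diff)
    ultimately obtain \<F> where F: "finite \<F>" "\<F> \<subseteq> (\<lambda>i. topspace X - C i) ` I" "topspace X \<subseteq> \<Union>\<F>"
      unfolding compactin_def by meson
    then obtain J where J: "finite J" "J \<subseteq> I" "\<F> = (\<lambda>i. topspace X - C i) ` J"
      by (meson finite_subset_image)
    have "\<exists>k\<in>I. \<forall>i\<in>J. C k \<subseteq> C i"
      using J(1,2)
    proof (induction J rule: finite_induct)
      case empty then show ?case using I by auto
    next
      case (insert j J)
      then obtain k where k: "k \<in> I" "\<forall>i\<in>J. C k \<subseteq> C i" by auto
      obtain l where "l \<in> I" "C l \<subseteq> C k \<inter> C j" using dir [of k j] k insert by auto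
      with k show ?case by (intro bexI [of _ l]) auto
    qed
    then obtain k where k: "k \<in> I" "\<forall>i\<in>J. C k \<subseteq> C i" by auto
    obtain x where "x \<in> C k" using C(2) k(1) by blast
    moreover have "x \<in> topspace X" using C(1) [OF k(1)] closedin_subset calculation by blast
    ultimately show False using F(3) J(3) k(2) by auto
qed

lemma (in group) carrier_is_normal: "carrier G \<lhd> G"
  by (simp add: normal_inv_iff subgroup_self)

locale profin =
  fixes G :: "'g monoid" (structure) and T :: "'g topology"
  assumes profinite: "profinite_group G T"
begin

abbreviation "ON \<equiv> open_normal G T"
abbreviation "SS \<equiv> subgroup_space G T"
abbreviation "X \<equiv> closed_subgroups G T"
abbreviation "SG \<equiv> subgroup_topology G T"
abbreviation "QS \<equiv> quotient_subgroup_space G T"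
abbreviation "Y N \<equiv> closed_subgroups (G Mod N) (quotient_group_topology G T N)"
abbreviation "p N \<equiv> smap (pN G T N)"
abbreviation "ph M N \<equiv> smap (phiMN G T M N)"
abbreviation "act \<equiv> space_act (subgroup_space G T)"
abbreviation "qact N \<equiv> space_act (quotient_subgroup_space G T N)"

lemma is_group: "group G" and topspace_T [simp]: "topspace T = carrier G"
  and compact_T: "compact_space T"
  and Hausdorff_T: "Hausdorff_space T"
  using profinite by (auto simp: profinite_group_def topological_group_on_def)

lemma carrier_clopen [simp]: "openin T (carrier G)" "closedin T (carrier G)"
  using openin_topspace [of T] closedin_topspace [of T] by simp_all

end

sublocale profin \<subseteq> group G
  by (rule is_group)

context profin
begin

lemma inv_cancel [simp]:
  "a \<in> carrier G \<Longrightarrow> b \<in> carrier G \<Longrightarrow> a \<otimes> (inv a \<otimes> b) = b"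
  "a \<in> carrier G \<Longrightarrow> b \<in> carrier G \<Longrightarrow> inv a \<otimes> (a \<otimes> b) = b"
  by (simp_all flip: m_assoc)

lemma continuous_mult:
  assumes "continuous_map Z T f" "continuous_map Z T g"
  shows "continuous_map Z T (\<lambda>z. f z \<otimes> g z)"
proof -
  have "continuous_map (prod_topology T T) T (\<lambda>(g, h). g \<otimes> h)"
    using profinite by (auto simp: profinite_group_def topological_group_on_def)
  moreover have "continuous_map Z (prod_topology T T) (\<lambda>z. (f z, g z))"
    using assms by (simp add: continuous_map_paired)
  ultimately have "continuous_map Z T ((\<lambda>(g, h). g \<otimes> h) \<circ> (\<lambda>z. (f z, g z)))"
    by (rule continuous_map_compose [rotated])
  then show ?thesis by (simp add: o_def)
qed

lemma continuous_rtrans: "a \<in> carrier G \<Longrightarrow> continuous_map T T (\<lambda>x. x \<otimes> a)"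
  by (rule continuous_mult) auto

text \<open>The translate of \<open>V\<close> by \<open>h\<close> is an open neighbourhood of
  \<open>h\<close> inside \<open>H\<close>.\<close>

lemma subgroup_openI:
  assumes "subgroup H G" "openin T V" "\<one> \<in> V" "V \<subseteq> H"
  shows "openin T H"
proof (subst openin_subopen, intro ballI)
  interpret H: subgroup H G by fact
  fix h assume h: "h \<in> H"
  let ?U = "{x \<in> topspace T. x \<otimes> inv h \<in> V}"
  have "openin T ?U"
    using h by (intro openin_continuous_map_preimage [OF continuous_rtrans assms(2)]) auto
  moreover have "h \<in> ?U" using h assms(3) by auto
  moreover have "?U \<subseteq> H"
  proof
    fix x assume "x \<in> ?U"
    then have x: "x \<in> carrier G" "x \<otimes> inv h \<in> H" using assms(4) by auto
    then have "(x \<otimes> inv h) \<otimes> h \<in> H" using h by blast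
    then show "x \<in> H" using x h by (simp add: m_assoc)
  qed
  ultimately show "\<exists>T'. openin T T' \<and> h \<in> T' \<and> T' \<subseteq> H" by blast
qed

text \<open>In a compact Hausdorff space components are quasi-components, so total disconnectedness
  yields a clopen \<open>C\<close> between the identity and \<open>U\<close>. Compactness is used
  again to find an open normal subgroup inside \<open>C\<close>.\<close>

theorem open_normal_base:
  assumes U: "openin T U" "\<one> \<in> U"
  obtains N where "N \<in> ON" "N \<subseteq> U"
proof -
  have q: "quasi_component_of T \<one> x \<Longrightarrow> x = \<one>" for x
  proof -
    assume "quasi_component_of T \<one> x"
    moreover have "quasi_component_of T \<one> = connected_component_of T \<one>"
      by (rule quasi_eq_connected_component_of) (simp add: compact_T Hausdorff_T)
    moreover have "connected_component_of_set T \<one> = {\<one>}"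
      using profinite by (auto simp: profinite_group_def)
    ultimately show ?thesis by auto
  qed
  have "\<exists>C. openin T C \<and> closedin T C \<and> \<one> \<in> C \<and> C \<subseteq> U"
  proof (rule ccontr)
    assume *: "\<not> ?thesis"
    let ?I = "{C. openin T C \<and> closedin T C \<and> \<one> \<in> C}"
    \<comment> \<open>Clopen neighbourhoods of the identity are closed under intersection. If none
      lay in \<open>U\<close>, a point outside \<open>U\<close> would lie in all of them, that is,
      in the quasi-component of the identity.\<close>
    have "\<exists>x\<in>topspace T. \<forall>C\<in>?I. x \<in> C - U"
    proof (rule compact_directed [OF compact_T, of ?I "\<lambda>C. C - U"])
      have "topspace T \<in> ?I" by auto
      then show "?I \<noteq> {}" by blast
      show "\<exists>k\<in>?I. k - U \<subseteq> (i - U) \<inter> (j - U)" if "i \<in> ?I" "j \<in> ?I" for i j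
        using that by (intro bexI [of _ "i \<inter> j"]) auto
    qed (use * U in \<open>auto simp: closedin_diff\<close>)
    then obtain x where x: "x \<in> topspace T" "\<And>C. C \<in> ?I \<Longrightarrow> x \<in> C - U" by blast
    then have "quasi_component_of T \<one> x"
      by (auto simp: quasi_component_of)
    then show False
      using q x(2) [of "topspace T"] U by auto
  qed
  then obtain C where C: "openin T C" "closedin T C" "\<one> \<in> C" "C \<subseteq> U" by blast
  \<comment> \<open>The elements that may be inserted into any product without affecting membership
    in \<open>C\<close>. This is the largest normal subgroup of which \<open>C\<close> is a union of
    cosets; having factors on both sides makes it normal at once.\<close>
  define N where "N = {h \<in> carrier G. \<forall>a\<in>carrier G. \<forall>b\<in>carrier G. a \<otimes> b \<in> C \<longleftrightarrow> a \<otimes> h \<otimes> b \<in> C}"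
  have sub: "subgroup N G"
  proof (rule subgroupI)
    show "N \<noteq> {}" using one_closed unfolding N_def by force
    show "inv h \<in> N" if h: "h \<in> N" for h
    proof -
      have hG: "h \<in> carrier G" using h by (simp add: N_def)
      have "a \<otimes> b \<in> C \<longleftrightarrow> a \<otimes> inv h \<otimes> b \<in> C" if ab: "a \<in> carrier G" "b \<in> carrier G" for a b
      proof -
        have "a \<otimes> inv h \<otimes> b \<in> C \<longleftrightarrow> a \<otimes> inv h \<otimes> h \<otimes> b \<in> C"
          using h ab hG unfolding N_def by blast
        then show ?thesis using ab hG by (simp add: m_assoc)
      qed
      then show ?thesis using hG by (simp add: N_def)
    qed
    show "h \<otimes> k \<in> N" if h: "h \<in> N" and k: "k \<in> N" for h k
    proof -
      have hG: "h \<in> carrier G" "k \<in> carrier G" using h k by (simp_all add: N_def)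
      have "a \<otimes> b \<in> C \<longleftrightarrow> a \<otimes> (h \<otimes> k) \<otimes> b \<in> C" if ab: "a \<in> carrier G" "b \<in> carrier G" for a b
      proof -
        have "a \<otimes> h \<otimes> b \<in> C \<longleftrightarrow> a \<otimes> h \<otimes> k \<otimes> b \<in> C"
          using k ab hG unfolding N_def by blast
        moreover have "a \<otimes> b \<in> C \<longleftrightarrow> a \<otimes> h \<otimes> b \<in> C"
          using h ab hG unfolding N_def by blast
        ultimately show ?thesis using ab hG by (simp add: m_assoc)
      qed
      then show ?thesis using hG by (simp add: N_def)
    qed
  qed (auto simp: N_def)
  have normal: "N \<lhd> G"
  proof (subst normal_inv_iff, intro conjI ballI sub)
    fix g h assume g: "g \<in> carrier G" and h: "h \<in> N"
    have hG: "h \<in> carrier G" using h by (simp add: N_def)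
    have "a \<otimes> b \<in> C \<longleftrightarrow> a \<otimes> (g \<otimes> h \<otimes> inv g) \<otimes> b \<in> C" if ab: "a \<in> carrier G" "b \<in> carrier G" for a b
    proof -
      have "(a \<otimes> g) \<otimes> (inv g \<otimes> b) \<in> C \<longleftrightarrow> (a \<otimes> g) \<otimes> h \<otimes> (inv g \<otimes> b) \<in> C"
        using h ab g unfolding N_def by blast
      moreover have "(a \<otimes> g) \<otimes> (inv g \<otimes> b) = a \<otimes> b"
        using ab g by (simp add: m_assoc)
      moreover have "(a \<otimes> g) \<otimes> h \<otimes> (inv g \<otimes> b) = a \<otimes> (g \<otimes> h \<otimes> inv g) \<otimes> b"
        using ab g hG by (simp add: m_assoc)
      ultimately show ?thesis by simp
    qed
    then show "g \<otimes> h \<otimes> inv g \<in> N" using g hG by (simp add: N_def)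
  qed
  let ?P = "prod_topology (prod_topology T T) T"
  let ?f = "\<lambda>z. fst (fst z) \<otimes> snd (fst z)" and ?h = "\<lambda>z. fst (fst z) \<otimes> snd z \<otimes> snd (fst z)"
  have c1: "continuous_map ?P T (\<lambda>z. fst (fst z))" "continuous_map ?P T (\<lambda>z. snd (fst z))"
      "continuous_map ?P T snd"
    using continuous_map_compose [OF continuous_map_fst continuous_map_fst]
      continuous_map_compose [OF continuous_map_fst continuous_map_snd]
    by (auto simp: o_def intro: continuous_map_snd)
  have f: "continuous_map ?P T ?f" and h: "continuous_map ?P T ?h"
    using c1 by (intro continuous_mult; simp)+
  \<comment> \<open>The triples for which inserting the third element does not change membership in
    \<open>C\<close>. Both alternatives are open because \<open>C\<close> is clopen.\<close>
  define W where "W = ({z \<in> topspace ?P. ?f z \<in> C} \<inter> {z \<in> topspace ?P. ?h z \<in> C}) \<union>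
     ({z \<in> topspace ?P. ?f z \<in> topspace T - C} \<inter> {z \<in> topspace ?P. ?h z \<in> topspace T - C})"
  have "openin ?P W"
    unfolding W_def using C by (intro openin_Un openin_Int openin_continuous_map_preimage [OF f]
      openin_continuous_map_preimage [OF h]) auto
  \<comment> \<open>Tube lemma: \<open>W\<close> contains the compact set of all pairs times the
    identity, hence all pairs times a neighbourhood of the identity.\<close>
  moreover have "compactin (prod_topology T T) (carrier G \<times> carrier G)"
    using compact_T compact_space_prod_topology [of T T] by (auto simp: compact_space_def)
  moreover have "(carrier G \<times> carrier G) \<times> {\<one>} \<subseteq> W"
    by (auto simp: W_def)
  ultimately obtain A V where V: "openin T V" "\<one> \<in> V" "(carrier G \<times> carrier G) \<subseteq> A" "A \<times> V \<subseteq> W"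
    using tube_lemma_left [of "prod_topology T T" T W "carrier G \<times> carrier G" \<one>] by auto
  have "V \<subseteq> N"
  proof
    fix v assume v: "v \<in> V"
    then have "v \<in> carrier G" using V(1) openin_subset by fastforce
    moreover have "a \<otimes> b \<in> C \<longleftrightarrow> a \<otimes> v \<otimes> b \<in> C" if ab: "a \<in> carrier G" "b \<in> carrier G" for a b
    proof -
      have "((a, b), v) \<in> W" using V v ab by blast
      then show ?thesis by (auto simp: W_def)
    qed
    ultimately show "v \<in> N" by (simp add: N_def)
  qed
  then have "openin T N"
    using subgroup_openI sub V by blast
  moreover have "N \<subseteq> C"
  proof
    fix h assume "h \<in> N"
    then have "h \<in> carrier G" "\<one> \<otimes> \<one> \<in> C \<longleftrightarrow> \<one> \<otimes> h \<otimes> \<one> \<in> C" unfolding N_def by blast+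
    then show "h \<in> C" using C(3) by simp
  qed
  ultimately show ?thesis
    using that [of N] normal C(4) by (auto simp: open_normal_def)
qed

end

subsection \<open>Finite quotients\<close>

context profin
begin

lemma grp_simps [simp]:
  "grp SS = G" "grp_top SS = T" "space_top SS = SG"
  "grp (QS N) = G Mod N" "grp_top (QS N) = quotient_group_topology G T N"
  "src (pN G T N) = SS" "tgt (pN G T N) = QS N" "ghom (pN G T N) = (\<lambda>g. N #> g)"
  "src (phiMN G T M N) = QS M" "tgt (phiMN G T M N) = QS N" "ghom (phiMN G T M N) = (\<lambda>C. N <#> C)"
  by (simp_all add: subgroup_space_def quotient_subgroup_space_def pN_def phiMN_def)

lemma act_def': "act g K = (\<lambda>k. g \<otimes> k \<otimes> inv g) ` K"
  and qact_def': "qact N C S = (\<lambda>D. C <#> D <#> inv\<^bsub>G Mod N\<^esub> C) ` S"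
  and p_def': "p N K = (\<lambda>k. N #> k) ` K"
  and ph_def': "ph M N S = (\<lambda>C. N <#> C) ` S"
  by (simp_all add: subgroup_space_def quotient_subgroup_space_def pN_def phiMN_def)

lemma ON_normal: "N \<in> ON \<Longrightarrow> N \<lhd> G"
  and ON_open: "N \<in> ON \<Longrightarrow> openin T N"
  and ON_subgroup: "N \<in> ON \<Longrightarrow> subgroup N G"
  and ON_group_Mod: "N \<in> ON \<Longrightarrow> group (G Mod N)"
  by (auto simp: open_normal_def normal_imp_subgroup normal.factorgroup_is_group)

lemma ON_sub: "N \<in> ON \<Longrightarrow> N \<subseteq> carrier G"
  using ON_subgroup subgroup.subset by blast

lemma ON_one: "N \<in> ON \<Longrightarrow> \<one> \<in> N"
  using ON_subgroup subgroup.one_closed by blast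

lemma ON_Int: "M \<in> ON \<Longrightarrow> N \<in> ON \<Longrightarrow> M \<inter> N \<in> ON"
  by (auto simp: open_normal_def normal_subgroup_intersect)

lemma ON_carrier: "carrier G \<in> ON"
  by (simp add: open_normal_def carrier_is_normal)

lemma coset_in: "N \<in> ON \<Longrightarrow> g \<in> carrier G \<Longrightarrow> N #> g \<in> carrier (G Mod N)"
  by (simp add: carrier_FactGroup)

lemma coset_ex:
  assumes "C \<in> carrier (G Mod N)" obtains g where "g \<in> carrier G" "C = N #> g"
  using assms by (auto simp: carrier_FactGroup)

lemma coset_mult: "N \<in> ON \<Longrightarrow> g \<in> carrier G \<Longrightarrow> h \<in> carrier G \<Longrightarrow> (N #> g) <#> (N #> h) = N #> (g \<otimes> h)"
  by (rule normal.rcos_sum [OF ON_normal])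

lemma coset_hom: "N \<in> ON \<Longrightarrow> group_hom G (G Mod N) (\<lambda>g. N #> g)"
  by (simp add: group_hom_def group_hom_axioms_def is_group ON_group_Mod normal.r_coset_hom_Mod ON_normal)

lemma coset_inv: "N \<in> ON \<Longrightarrow> g \<in> carrier G \<Longrightarrow> inv\<^bsub>G Mod N\<^esub> (N #> g) = N #> inv g"
  using group_hom.hom_inv [OF coset_hom] by simp

lemma coset_self: "N \<in> ON \<Longrightarrow> g \<in> carrier G \<Longrightarrow> g \<in> N #> g"
  by (rule rcos_self [OF _ ON_subgroup])

lemma coset_eqI: "N \<in> ON \<Longrightarrow> g \<in> carrier G \<Longrightarrow> h \<in> N #> g \<Longrightarrow> N #> h = N #> g"
  by (rule repr_independence [OF _ _ ON_subgroup, symmetric])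

lemma coset_one: "N \<in> ON \<Longrightarrow> N #> \<one> = N"
  by (simp add: ON_sub)

lemma coset_eq_one: "N \<in> ON \<Longrightarrow> g \<in> carrier G \<Longrightarrow> N #> g = N \<longleftrightarrow> g \<in> N"
  using coset_join1 [OF _ _ ON_subgroup] coset_join2 [OF _ ON_subgroup] by blast

lemma coset_merge:
  assumes "M \<in> ON" "N \<in> ON" "M \<subseteq> N" "g \<in> carrier G"
  shows "N <#> (M #> g) = N #> g"
proof -
  interpret N: subgroup N G by (rule ON_subgroup) fact
  have "n \<otimes> (m \<otimes> g) \<in> N #> g" if "n \<in> N" "m \<in> M" for n m
  proof -
    have "n \<otimes> (m \<otimes> g) = (n \<otimes> m) \<otimes> g" "n \<otimes> m \<in> N"
      using that assms N.subset ON_sub by (auto simp: m_assoc subset_iff)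
    then show ?thesis by (auto simp: r_coset_def)
  qed
  then have "N <#> (M #> g) \<subseteq> N #> g"
    by (auto simp: set_mult_def r_coset_def [of G M])
  moreover have "N #> g \<subseteq> N <#> (M #> g)"
    using coset_self [OF assms(1,4)] by (auto simp: set_mult_def r_coset_def [of G N])
  ultimately show ?thesis
    by (rule subset_antisym)
qed

lemma coset_open:
  assumes "N \<in> ON" "g \<in> carrier G"
  shows "openin T (N #> g)"
proof -
  have "N #> g = {x \<in> topspace T. x \<otimes> inv g \<in> N}"
    using assms ON_sub [OF assms(1)]
    by (auto simp: r_coset_def m_assoc subset_iff intro!: bexI [of _ "_ \<otimes> inv g"])
  then show ?thesis
    using assms openin_continuous_map_preimage [OF continuous_rtrans ON_open] by simp
qed

text \<open>Cosets of an open subgroup are open, so openness of the union is automatic and the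
  predicate reduces to inclusion in the set of cosets.\<close>

lemma openin_quotient: "openin (quotient_group_topology G T N) U \<longleftrightarrow> U \<subseteq> carrier (G Mod N)"
  if N: "N \<in> ON"
proof -
  have op: "openin T (\<Union>U)" if "U \<subseteq> carrier (G Mod N)" for U
    using that coset_open [OF N] by (intro openin_Union) (auto simp: carrier_FactGroup)
  have eq: "(\<lambda>U. U \<subseteq> carrier (G Mod N) \<and> openin T (\<Union>U)) = (\<lambda>U. U \<subseteq> carrier (G Mod N))"
    using op by auto
  have "istopology (\<lambda>U. U \<subseteq> carrier (G Mod N))"
    by (auto simp: istopology_def)
  then show ?thesis
    unfolding quotient_group_topology_def eq by (simp add: topology_inverse')
qed

lemma quotient_discrete: "N \<in> ON \<Longrightarrow> quotient_group_topology G T N = discrete_topology (carrier (G Mod N))"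
  by (simp add: topology_eq openin_quotient)

section \<open>Subgroups of the finite quotients and the maps between them\<close>

lemma Y_iff: "N \<in> ON \<Longrightarrow> S \<in> Y N \<longleftrightarrow> subgroup S (G Mod N)"
  by (auto simp: closed_subgroups_def quotient_discrete dest: subgroup.mem_carrier)

text \<open>The cosets form an open cover of a compact space by disjoint nonempty sets, so a finite
  subcover contains all of them.\<close>

lemma finite_quotient:
  assumes N: "N \<in> ON" shows "finite (carrier (G Mod N))"
proof -
  have "compactin T (topspace T)" using compact_T by (simp add: compact_space_def)
  moreover have "topspace T \<subseteq> \<Union> (carrier (G Mod N))"
    using coset_self [OF N] by (auto simp: carrier_FactGroup)
  moreover have "\<forall>U\<in>carrier (G Mod N). openin T U"
    using coset_open [OF N] by (auto simp: carrier_FactGroup)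
  ultimately obtain \<F> where F: "finite \<F>" "\<F> \<subseteq> carrier (G Mod N)" "topspace T \<subseteq> \<Union>\<F>"
    unfolding compactin_def by meson
  have "carrier (G Mod N) \<subseteq> \<F>"
  proof
    fix C assume "C \<in> carrier (G Mod N)"
    then obtain g where g: "g \<in> carrier G" "C = N #> g" by (rule coset_ex)
    then obtain D where D: "D \<in> \<F>" "g \<in> D" using F(3) by auto
    then obtain h where h: "h \<in> carrier G" "D = N #> h" using F(2) D(1) by (auto simp: carrier_FactGroup)
    then have "N #> g = N #> h" using coset_eqI [OF N h(1), of g] D(2) by simp
    then show "C \<in> \<F>" using D(1) g h by simp
  qed
  then show ?thesis using F(1) finite_subset by blast
qed

lemma finite_Y: "N \<in> ON \<Longrightarrow> finite (Y N)"
  by (rule finite_subset [of _ "Pow (carrier (G Mod N))"])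
     (auto simp: Y_iff finite_quotient dest: subgroup.mem_carrier)

lemma X_sub: "K \<in> X \<Longrightarrow> K \<subseteq> carrier G"
  by (auto simp: closed_subgroups_def dest: subgroup.subset)

lemma X_subgroup: "K \<in> X \<Longrightarrow> subgroup K G"
  by (auto simp: closed_subgroups_def)

lemma p_in:
  assumes "N \<in> ON" "K \<in> X" shows "p N K \<in> Y N"
  using assms group_hom.subgroup_img_is_subgroup [OF coset_hom X_subgroup, of N K]
  by (simp add: Y_iff p_def')

text \<open>The full preimage of \<open>S\<close> in \<open>G\<close> is closed because its
  complement is a union of open cosets. It is exposed in the conclusion since the construction of a
  subgroup from a compatible family needs this particular lift.\<close>

lemma p_surj:
  assumes N: "N \<in> ON" and S: "S \<in> Y N"
  obtains K where "K \<in> X" "p N K = S" "K = {g \<in> carrier G. N #> g \<in> S}"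
proof -
  interpret S: subgroup S "G Mod N" using S N by (simp add: Y_iff)
  define K where "K = {g \<in> carrier G. N #> g \<in> S}"
  have "subgroup K G"
  proof (rule subgroupI)
    show "K \<noteq> {}"
      using S.one_closed coset_one [OF N] one_closed unfolding K_def by force
    show "inv a \<in> K" if "a \<in> K" for a
      using that S.m_inv_closed [of "N #> a"] coset_inv [OF N, of a] by (auto simp: K_def)
    show "a \<otimes> b \<in> K" if "a \<in> K" "b \<in> K" for a b
      using that S.m_closed [of "N #> a" "N #> b"] coset_mult [OF N, of a b] by (auto simp: K_def)
  qed (auto simp: K_def)
  moreover have "closedin T K"
  proof -
    have "topspace T - K = \<Union> (carrier (G Mod N) - S)"
    proof
      show "topspace T - K \<subseteq> \<Union> (carrier (G Mod N) - S)"
        using coset_self [OF N] coset_in [OF N] by (auto simp: K_def)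
      show "\<Union> (carrier (G Mod N) - S) \<subseteq> topspace T - K"
      proof
        fix x assume "x \<in> \<Union> (carrier (G Mod N) - S)"
        then obtain g where g: "g \<in> carrier G" "x \<in> N #> g" "N #> g \<notin> S"
          by (auto simp: carrier_FactGroup)
        then show "x \<in> topspace T - K"
          using coset_eqI [OF N g(1,2)] r_coset_subset_G [OF ON_sub [OF N] g(1)] by (auto simp: K_def)
      qed
    qed
    moreover have "openin T (\<Union> (carrier (G Mod N) - S))"
      using coset_open [OF N] by (intro openin_Union) (auto simp: carrier_FactGroup)
    ultimately show ?thesis
      by (simp add: closedin_def K_def)
  qed
  moreover have "p N K = S"
    using S.subset by (auto simp: p_def' K_def carrier_FactGroup)
  ultimately show ?thesis
    using that [of K] K_def by (simp add: closed_subgroups_def)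
qed

lemma p_ex: "N \<in> ON \<Longrightarrow> S \<in> Y N \<Longrightarrow> \<exists>K\<in>X. S = p N K"
  by (erule (1) p_surj) blast

text \<open>Together with surjectivity of \<open>p M\<close> this reduces the facts on
  \<open>ph\<close> to facts on \<open>p\<close>: the composition laws need no computation with
  cosets of cosets.\<close>

lemma ph_p: "M \<in> ON \<Longrightarrow> N \<in> ON \<Longrightarrow> M \<subseteq> N \<Longrightarrow> K \<in> X \<Longrightarrow> ph M N (p M K) = p N K"
  unfolding p_def' ph_def' image_image using X_sub [of K]
  by (intro image_cong refl coset_merge) auto

lemma ph_in: "M \<in> ON \<Longrightarrow> N \<in> ON \<Longrightarrow> M \<subseteq> N \<Longrightarrow> S \<in> Y M \<Longrightarrow> ph M N S \<in> Y N"
  by (frule p_ex [of M], assumption) (auto simp: ph_p p_in)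

lemma ph_id: "N \<in> ON \<Longrightarrow> S \<in> Y N \<Longrightarrow> ph N N S = S"
  by (frule p_ex, assumption) (auto simp: ph_p)

lemma ph_ph: "L \<in> ON \<Longrightarrow> M \<in> ON \<Longrightarrow> N \<in> ON \<Longrightarrow> L \<subseteq> M \<Longrightarrow> M \<subseteq> N \<Longrightarrow> S \<in> Y L
   \<Longrightarrow> ph M N (ph L M S) = ph L N S"
  by (frule p_ex [of L], assumption) (auto simp: ph_p)

lemma p_refine: "M \<in> ON \<Longrightarrow> N \<in> ON \<Longrightarrow> M \<subseteq> N \<Longrightarrow> K \<in> X \<Longrightarrow> L \<in> X \<Longrightarrow> p M L = p M K \<Longrightarrow> p N L = p N K"
  by (simp flip: ph_p [of M N])

lemma Union_p: "\<Union> (p N L) = N <#> L"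
  by (auto simp: p_def' r_coset_def set_mult_def)

text \<open>The union of the cosets in \<open>p N L\<close> is the product \<open>N <#> L\<close>,
  and conversely this product determines the cosets. Hence the fibres of \<open>p N\<close> are
  exactly the basic sets in the definition of the topology.\<close>

lemma p_eq_iff:
  assumes "N \<in> ON" "K \<in> X" "L \<in> X"
  shows "p N L = p N K \<longleftrightarrow> N <#> L = N <#> K"
proof
  have *: "p N L \<subseteq> p N K" if "N <#> L = N <#> K" "K \<in> X" "L \<in> X" for K L
  proof
    fix C assume "C \<in> p N L"
    then obtain l where l: "l \<in> L" "C = N #> l" by (auto simp: p_def')
    then have lG: "l \<in> carrier G" using X_sub that by auto
    have "l \<in> N <#> L"
      using l ON_one [OF assms(1)] lG by (force simp: set_mult_def)
    then have "l \<in> N <#> K" using that by simp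
    then obtain n k where nk: "n \<in> N" "k \<in> K" "l = n \<otimes> k" by (auto simp: set_mult_def)
    then have "N #> l = N #> k"
      using coset_eqI [OF assms(1), of k l] X_sub that by (auto simp: r_coset_def)
    then show "C \<in> p N K" using l nk by (auto simp: p_def')
  qed
  show "p N L = p N K" if "N <#> L = N <#> K"
    using * [of L K] * [of K L] that assms by auto
qed (simp flip: Union_p)

subsection \<open>The space of closed subgroups\<close>

lemma p_fibre_open:
  assumes "N \<in> ON" shows "openin SG {K \<in> X. p N K = S}"
proof (cases "\<exists>K\<in>X. p N K = S")
  case True
  then obtain K where K: "K \<in> X" "p N K = S" by blast
  then have "{L \<in> X. p N L = S} = {L \<in> X. N <#> L = N <#> K}"
    using p_eq_iff [OF assms] by blast
  then show ?thesis
    unfolding subgroup_topology_def using assms K by (auto intro!: topology_generated_by_Basis)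
next
  case False
  then have "{K \<in> X. p N K = S} = {}" by auto
  then show ?thesis by (simp only: openin_empty)
qed

lemma topspace_SG [simp]: "topspace SG = X"
  unfolding subgroup_topology_def topology_generated_by_topspace
  using ON_carrier by blast

text \<open>The generating sets are fibres of the maps \<open>p N\<close>, and the fibres for
  \<open>M \<inter> N\<close> refine those for \<open>M\<close> and for \<open>N\<close>; finite
  intersections of generators thus contain a fibre around each of their points.\<close>

lemma SG_base:
  assumes "openin SG U" "K \<in> U"
  shows "\<exists>N\<in>ON. \<forall>L\<in>X. p N L = p N K \<longrightarrow> L \<in> U"
proof -
  have "generate_topology_on {{L \<in> X. N <#> L = N <#> K} | N K. N \<in> ON \<and> K \<in> X} U"
    using assms(1) unfolding subgroup_topology_def by (rule openin_topology_generated_by)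
  moreover have KX: "K \<in> X" using assms openin_subset by fastforce
  ultimately have "K \<in> U \<longrightarrow> (\<exists>N\<in>ON. \<forall>L\<in>X. p N L = p N K \<longrightarrow> L \<in> U)"
  proof (induction rule: generate_topology_on.induct)
    case (Int a b)
    show ?case
    proof
      assume K: "K \<in> a \<inter> b"
      then obtain M N where MN: "M \<in> ON" "N \<in> ON" "\<forall>L\<in>X. p M L = p M K \<longrightarrow> L \<in> a" "\<forall>L\<in>X. p N L = p N K \<longrightarrow> L \<in> b"
        using Int by blast
      then have "\<forall>L\<in>X. p (M \<inter> N) L = p (M \<inter> N) K \<longrightarrow> L \<in> a \<inter> b"
        using p_refine [OF ON_Int [OF MN(1,2)]] Int.prems by blast
      then show "\<exists>N\<in>ON. \<forall>L\<in>X. p N L = p N K \<longrightarrow> L \<in> a \<inter> b"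
        using ON_Int MN by blast
    qed
  next
    case (UN \<K>)
    then show ?case by blast
  next
    case (Basis s)
    then show ?case using p_eq_iff by blast
  qed auto
  then show ?thesis using assms(2) by (rule mp)
qed

text \<open>The topology is the one induced by the maps \<open>p N\<close> to discrete sets, so
  continuity means that each \<open>p N (f z)\<close> is locally constant in
  \<open>z\<close>.\<close>

lemma continuous_into_SG:
  assumes "\<And>z. z \<in> topspace Z \<Longrightarrow> f z \<in> X"
    and "\<And>z N. z \<in> topspace Z \<Longrightarrow> N \<in> ON \<Longrightarrow> \<exists>U. openin Z U \<and> z \<in> U \<and> (\<forall>w\<in>U. p N (f w) = p N (f z))"
  shows "continuous_map Z SG f"
  unfolding continuous_map_def
proof (intro conjI allI impI)
  fix U assume U: "openin SG U"
  show "openin Z {z \<in> topspace Z. f z \<in> U}"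
  proof (subst openin_subopen, intro ballI)
    fix z assume z: "z \<in> {z \<in> topspace Z. f z \<in> U}"
    then have z': "z \<in> topspace Z" "f z \<in> U" by auto
    obtain N where N: "N \<in> ON" "\<forall>L\<in>X. p N L = p N (f z) \<longrightarrow> L \<in> U"
      using SG_base [OF U z'(2)] ..
    obtain V where V: "openin Z V \<and> z \<in> V \<and> (\<forall>w\<in>V. p N (f w) = p N (f z))"
      using assms(2) [OF z'(1) N(1)] ..
    have "V \<subseteq> {z \<in> topspace Z. f z \<in> U}"
    proof
      fix w assume w: "w \<in> V"
      have wZ: "w \<in> topspace Z" using openin_subset [OF conjunct1 [OF V]] w by (rule subsetD)
      moreover have "p N (f w) = p N (f z)" using V [THEN conjunct2, THEN conjunct2] w by (rule bspec)
      ultimately show "w \<in> {z \<in> topspace Z. f z \<in> U}"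
        using N(2) [rule_format, OF assms(1) [OF wZ]] by simp
    qed
    then show "\<exists>V. openin Z V \<and> z \<in> V \<and> V \<subseteq> {z \<in> topspace Z. f z \<in> U}"
      using V [THEN conjunct1] V [THEN conjunct2, THEN conjunct1] by (intro exI [of _ V] conjI)
  qed
qed (use assms in auto)

section \<open>Conjugation of closed subgroups and of subgroups of the quotients\<close>

lemma act_in:
  assumes g: "g \<in> carrier G" and K: "K \<in> X"
  shows "act g K \<in> X"
proof -
  interpret K: subgroup K G using K by (rule X_subgroup)
  have eq: "act g K = {x \<in> carrier G. inv g \<otimes> x \<otimes> g \<in> K}"
  proof
    show "act g K \<subseteq> {x \<in> carrier G. inv g \<otimes> x \<otimes> g \<in> K}"
      using g by (auto simp: act_def' m_assoc)
    show "{x \<in> carrier G. inv g \<otimes> x \<otimes> g \<in> K} \<subseteq> act g K"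
    proof
      fix x assume x: "x \<in> {x \<in> carrier G. inv g \<otimes> x \<otimes> g \<in> K}"
      then have "x = g \<otimes> (inv g \<otimes> x \<otimes> g) \<otimes> inv g"
        using g by (simp add: m_assoc)
      then show "x \<in> act g K" using x by (auto simp: act_def')
    qed
  qed
  have "subgroup (act g K) G"
  proof (rule subgroupI)
    show "act g K \<noteq> {}" by (auto simp: act_def' intro: K.one_closed)
    show "act g K \<subseteq> carrier G" using eq by auto
    show "inv a \<in> act g K" if a: "a \<in> act g K" for a
    proof -
      obtain k where k: "k \<in> K" "a = g \<otimes> k \<otimes> inv g" using a by (auto simp: act_def')
      then have "inv a = g \<otimes> inv k \<otimes> inv g" using g by (simp add: inv_mult_group m_assoc)
      then show ?thesis using k by (auto simp: act_def')
    qed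
    show "a \<otimes> b \<in> act g K" if a: "a \<in> act g K" and b: "b \<in> act g K" for a b
    proof -
      obtain k where k: "k \<in> K" "a = g \<otimes> k \<otimes> inv g" using a by (auto simp: act_def')
      obtain l where l: "l \<in> K" "b = g \<otimes> l \<otimes> inv g" using b by (auto simp: act_def')
      have "a \<otimes> b = g \<otimes> (k \<otimes> l) \<otimes> inv g"
        using k l g by (simp add: m_assoc)
      then show ?thesis using k l by (auto simp: act_def')
    qed
  qed
  moreover have "closedin T (act g K)"
  proof -
    have "continuous_map T T (\<lambda>x. inv g \<otimes> x \<otimes> g)"
      using g by (intro continuous_mult) auto
    then have "closedin T {x \<in> topspace T. inv g \<otimes> x \<otimes> g \<in> K}"
      using K by (intro closedin_continuous_map_preimage) (auto simp: closed_subgroups_def)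
    then show ?thesis by (simp add: eq)
  qed
  ultimately show ?thesis by (simp add: closed_subgroups_def)
qed

lemma act_one: "K \<in> X \<Longrightarrow> act \<one> K = K"
  using X_sub [of K] by (force simp: act_def' subset_iff)

lemma act_mult: "g \<in> carrier G \<Longrightarrow> h \<in> carrier G \<Longrightarrow> K \<in> X \<Longrightarrow> act (g \<otimes> h) K = act g (act h K)"
  using X_sub [of K] unfolding act_def' image_image
  by (intro image_cong refl) (simp add: m_assoc inv_mult_group subset_iff)

lemma act_inv: "g \<in> carrier G \<Longrightarrow> K \<in> X \<Longrightarrow> act (inv g) (act g K) = K"
  "g \<in> carrier G \<Longrightarrow> K \<in> X \<Longrightarrow> act g (act (inv g) K) = K"
  using act_mult [of "inv g" g K] act_mult [of g "inv g" K] act_one by simp_all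

lemma act_self:
  assumes "K \<in> X" "k \<in> K" shows "act k K = K"
proof -
  interpret K: subgroup K G using assms by (simp add: X_subgroup)
  have *: "act k K \<subseteq> K" if "k \<in> K" for k
    using that by (auto simp: act_def')
  have "act k (act (inv k) K) \<subseteq> act k K"
    using * [of "inv k"] assms by (auto simp: act_def')
  then show ?thesis
    using * [OF assms(2)] act_inv(2) [of k K] assms by auto
qed

lemma p_act:
  assumes "N \<in> ON" "g \<in> carrier G" "K \<in> X"
  shows "p N (act g K) = qact N (N #> g) (p N K)"
  unfolding act_def' qact_def' p_def' image_image coset_inv [OF assms(1,2)]
  using assms X_sub [of K] by (intro image_cong refl) (auto simp: coset_mult subset_iff)

text \<open>Every subgroup of the quotient lifts to a closed subgroup of \<open>G\<close>, so this
  and the action laws after it are conjugation in \<open>G\<close> seen through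
  \<open>p_act\<close>.\<close>

lemma qact_in: "N \<in> ON \<Longrightarrow> C \<in> carrier (G Mod N) \<Longrightarrow> S \<in> Y N \<Longrightarrow> qact N C S \<in> Y N"
  by (frule p_ex, assumption) (auto simp: carrier_FactGroup act_in p_in simp flip: p_act)

lemma qact_one: "N \<in> ON \<Longrightarrow> S \<in> Y N \<Longrightarrow> qact N N S = S"
  using p_ex [of N S] p_act [of N \<one>] by (auto simp: act_one coset_one)

lemma qact_mult: "N \<in> ON \<Longrightarrow> C \<in> carrier (G Mod N) \<Longrightarrow> D \<in> carrier (G Mod N) \<Longrightarrow> S \<in> Y N
   \<Longrightarrow> qact N (C <#> D) S = qact N C (qact N D S)"
  by (frule p_ex, assumption) (auto simp: carrier_FactGroup coset_mult act_in act_mult simp flip: p_act)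

lemma ph_qact: "M \<in> ON \<Longrightarrow> N \<in> ON \<Longrightarrow> M \<subseteq> N \<Longrightarrow> C \<in> carrier (G Mod M) \<Longrightarrow> S \<in> Y M
   \<Longrightarrow> ph M N (qact M C S) = qact N (N <#> C) (ph M N S)"
  by (frule p_ex [of M], assumption) (auto simp: carrier_FactGroup coset_merge ph_p act_in simp flip: p_act)

text \<open>\<open>p N (act g K)\<close> depends only on the coset of \<open>g\<close> and on
  \<open>p N K\<close>, hence is constant on the product of the open coset with the open
  fibre.\<close>

lemma continuous_action_SG: "continuous_action G T SG act"
  unfolding continuous_action_def
proof (intro conjI ballI)
  show "continuous_map (prod_topology T SG) SG (\<lambda>(g, x). act g x)"
  proof (rule continuous_into_SG)
    show "(case z of (g, x) \<Rightarrow> act g x) \<in> X" if "z \<in> topspace (prod_topology T SG)" for z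
      using that act_in by auto
    show "\<exists>U. openin (prod_topology T SG) U \<and> z \<in> U \<and>
        (\<forall>w\<in>U. p N (case w of (g, x) \<Rightarrow> act g x) = p N (case z of (g, x) \<Rightarrow> act g x))"
      if z: "z \<in> topspace (prod_topology T SG)" and N: "N \<in> ON" for z N
    proof -
      obtain g K where gK: "z = (g, K)" "g \<in> carrier G" "K \<in> X" using z by auto
      let ?U = "(N #> g) \<times> {L \<in> X. p N L = p N K}"
      have "N #> h = N #> g" "h \<in> carrier G" if "h \<in> N #> g" for h
        using coset_eqI [OF N gK(2) that] that r_coset_subset_G [OF ON_sub [OF N] gK(2)] by auto
      then have "\<forall>w\<in>?U. p N (case w of (g, x) \<Rightarrow> act g x) = p N (case z of (g, x) \<Rightarrow> act g x)"
        using N gK by (auto simp: p_act)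
      moreover have "openin (prod_topology T SG) ?U"
        using N gK by (simp add: openin_prod_Times_iff coset_open p_fibre_open)
      moreover have "z \<in> ?U" using gK coset_self [OF N] by auto
      ultimately show ?thesis by blast
    qed
  qed
qed (auto simp: act_one act_mult)

lemma topspace_QS [simp]:
  assumes "N \<in> ON"
  shows "topspace (space_top (QS N)) = Y N"
proof -
  interpret Q: group "G Mod N" using assms by (rule ON_group_Mod)
  have "carrier (G Mod N) \<in> open_normal (G Mod N) (quotient_group_topology G T N)"
    using assms by (simp add: open_normal_def Q.carrier_is_normal quotient_discrete)
  then show ?thesis
    unfolding quotient_subgroup_space_def subgroup_space_def subgroup_topology_def
      gspace.simps topology_generated_by_topspace
    by blast
qed

text \<open>In a discrete group the trivial subgroup is open and normal, and multiplying by it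
  changes nothing, so its basic sets are singletons.\<close>

lemma space_QS:
  assumes "N \<in> ON"
  shows "space_top (QS N) = discrete_topology (Y N)"
proof -
  interpret Q: group "G Mod N" using assms by (rule ON_group_Mod)
  have one: "{\<one>\<^bsub>G Mod N\<^esub>} \<in> open_normal (G Mod N) (quotient_group_topology G T N)"
    using assms Q.one_closed by (simp add: open_normal_def Q.one_is_normal quotient_discrete del: one_FactGroup)
  have mult1: "{\<one>\<^bsub>G Mod N\<^esub>} <#>\<^bsub>G Mod N\<^esub> L = L" if "L \<in> Y N" for L
  proof -
    have "L \<subseteq> carrier (G Mod N)" using that assms by (simp add: Y_iff subgroup.subset)
    then show ?thesis
      using Q.l_one by (force simp: set_mult_def [of "G Mod N"] simp del: one_FactGroup mult_FactGroup)
  qed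
  have "openin (space_top (QS N)) {S}" if "S \<in> Y N" for S
  proof -
    have "{S} = {L \<in> Y N. {\<one>\<^bsub>G Mod N\<^esub>} <#>\<^bsub>G Mod N\<^esub> L = {\<one>\<^bsub>G Mod N\<^esub>} <#>\<^bsub>G Mod N\<^esub> S}"
      using mult1 that by auto
    then show ?thesis
      unfolding quotient_subgroup_space_def subgroup_space_def subgroup_topology_def
        gspace.simps
      using one that by (intro topology_generated_by_Basis) blast
  qed
  then show ?thesis
    using topspace_QS [OF assms] discrete_topology_unique [of "Y N" "space_top (QS N)"] by auto
qed

subsection \<open>Compactness\<close>

text \<open>The space of closed subgroups is the inverse limit of the finite sets
  \<open>Y N\<close>. The subgroup sought is the intersection of the full preimages
  \<open>H N\<close>; that it still maps onto each \<open>f N\<close> is where compactness of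
  \<open>G\<close> enters.\<close>

lemma inverse_limit:
  assumes f: "\<And>N. N \<in> ON \<Longrightarrow> f N \<in> Y N"
    and comp: "\<And>M N. M \<in> ON \<Longrightarrow> N \<in> ON \<Longrightarrow> M \<subseteq> N \<Longrightarrow> f N = ph M N (f M)"
  shows "\<exists>K\<in>X. \<forall>N\<in>ON. p N K = f N"
proof -
  define H where "H N = {g \<in> carrier G. N #> g \<in> f N}" for N
  have H: "H N \<in> X" "p N (H N) = f N" if "N \<in> ON" for N
    by (rule p_surj [OF that f [OF that]], simp add: H_def)+
  have Hmono: "H M \<subseteq> H N" if MN: "M \<in> ON" "N \<in> ON" "M \<subseteq> N" for M N
  proof
    fix g assume g: "g \<in> H M"
    then have "N <#> (M #> g) \<in> ph M N (f M)" by (auto simp: H_def ph_def')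
    then show "g \<in> H N" using comp [OF MN] g by (auto simp: H_def coset_merge [OF MN])
  qed
  define K where "K = (\<Inter>N\<in>ON. H N)"
  have ne: "ON \<noteq> {}" using ON_carrier by auto
  have "K \<in> X"
    unfolding closed_subgroups_def K_def
    using H(1) ne by (auto simp: closed_subgroups_def intro!: subgroups_Inter)
  moreover have "p N K = f N" if N: "N \<in> ON" for N
  proof
    show "p N K \<subseteq> f N"
      using N by (auto simp: p_def' K_def H_def)
    show "f N \<subseteq> p N K"
    proof
      fix C assume C: "C \<in> f N"
      \<comment> \<open>For \<open>M\<close> below \<open>N\<close> the subgroup \<open>H M\<close>
        still maps onto \<open>f N\<close>, so it meets the coset \<open>C\<close>. A point common
        to all these intersections is an element of \<open>K\<close> in \<open>C\<close>.\<close>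
      let ?I = "{M \<in> ON. M \<subseteq> N}" and ?D = "\<lambda>M. H M \<inter> C"
      have "C \<in> carrier (G Mod N)" using C f [OF N] N by (auto simp: Y_iff dest: subgroup.subset)
      then obtain c where c: "c \<in> carrier G" "C = N #> c" by (rule coset_ex)
      \<comment> \<open>\<open>N\<close> is the full preimage of the trivial subgroup of the
        quotient, hence closed by \<open>p_surj\<close>, and \<open>C\<close> is a translate of
        it.\<close>
      have clC: "closedin T C"
      proof -
        have "{N} \<in> Y N"
          using group.triv_subgroup [OF ON_group_Mod [OF N]] by (simp add: Y_iff N)
        then obtain K0 where K0: "K0 \<in> X" "K0 = {g \<in> carrier G. N #> g \<in> {N}}"
          using p_surj [OF N, of "{N}"] by blast
        then have "K0 = N" using ON_sub [OF N] coset_eq_one [OF N] by auto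
        then have "closedin T N" using K0(1) by (auto simp: closed_subgroups_def)
        moreover have "C = {x \<in> topspace T. x \<otimes> inv c \<in> N}"
          using c ON_sub [OF N]
          by (auto simp: r_coset_def m_assoc subset_iff intro!: bexI [of _ "_ \<otimes> inv c"])
        ultimately show ?thesis
          using c closedin_continuous_map_preimage [OF continuous_rtrans, of "inv c" N] by simp
      qed
      have "\<exists>x\<in>topspace T. \<forall>M\<in>?I. x \<in> ?D M"
      proof (rule compact_directed [OF compact_T, of ?I ?D])
        show "?I \<noteq> {}" using N by auto
        show "closedin T (?D M)" if "M \<in> ?I" for M
          using that H(1) clC by (auto simp: closed_subgroups_def)
        show "?D M \<noteq> {}" if M: "M \<in> ?I" for M
        proof -
          have "p N (H M) = f N"
            using ph_p [of M N "H M"] M N H [of M] comp [of M N] by auto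
          then obtain k where "k \<in> H M" "C = N #> k" using C by (auto simp: p_def')
          then show ?thesis using coset_self [OF N, of k] by (auto simp: H_def)
        qed
        show "\<exists>k\<in>?I. ?D k \<subseteq> ?D i \<inter> ?D j" if "i \<in> ?I" "j \<in> ?I" for i j
          using that Hmono [of "i \<inter> j" i] Hmono [of "i \<inter> j" j] ON_Int
          by (intro bexI [of _ "i \<inter> j"]) auto
      qed
      then obtain x where x: "x \<in> topspace T" "\<And>M. M \<in> ?I \<Longrightarrow> x \<in> ?D M" by blast
      have "x \<in> H M" if "M \<in> ON" for M
        using x(2) [of "M \<inter> N"] Hmono [of "M \<inter> N" M] ON_Int that N by auto
      then have "x \<in> K" by (simp add: K_def)
      moreover have "C = N #> x" using x(2) [of N] N coset_eqI [OF N c(1)] c(2) by auto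
      ultimately show "C \<in> p N K" by (auto simp: p_def')
    qed
  qed
  ultimately show ?thesis by blast
qed

text \<open>If every stage had a counterexample, the families in the product of the finite sets
  \<open>Y N\<close> that extend one would form a directed system of nonempty closed sets. A common
  family is compatible, so it comes from a closed subgroup along which the condition never
  holds.\<close>

theorem compact_stage:
  assumes ex: "\<And>K. K \<in> X \<Longrightarrow> \<exists>N\<in>ON. R N (p N K)"
    and down: "\<And>M N S. M \<in> ON \<Longrightarrow> N \<in> ON \<Longrightarrow> M \<subseteq> N \<Longrightarrow> S \<in> Y M \<Longrightarrow> R N (ph M N S) \<Longrightarrow> R M S"
  shows "\<exists>N\<in>ON. \<forall>S\<in>Y N. R N S"
proof (rule ccontr)
    assume neg: "\<not> ?thesis"
    let ?Z = "product_topology (\<lambda>N. discrete_topology (Y N)) ON"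
    let ?E = "\<lambda>M N. {f \<in> topspace ?Z. f N = ph M N (f M)}"
    \<comment> \<open>Families whose value at \<open>M\<close> is a counterexample and whose values
      at the larger subgroups are the images of it; the remaining coordinates are free, which keeps
      the set closed.\<close>
    define C where "C = (\<lambda>M. {f \<in> topspace ?Z. f M \<in> {S \<in> Y M. \<not> R M S}} \<inter> (\<Inter>N\<in>{N \<in> ON. M \<subseteq> N}. ?E M N))"
    have C_iff: "f \<in> C M \<longleftrightarrow> f \<in> topspace ?Z \<and> f M \<in> Y M \<and> \<not> R M (f M) \<and>
        (\<forall>N\<in>ON. M \<subseteq> N \<longrightarrow> f N = ph M N (f M))" if "M \<in> ON" for f M
      using that by (auto simp: C_def simp del: topspace_product_topology)
    have C_D: "f M \<in> Y M" "\<not> R M (f M)" if "M \<in> ON" "f \<in> C M" for f M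
      using that(2) unfolding C_iff [OF that(1)] by simp_all
    have C_D3: "f N = ph M N (f M)" if "M \<in> ON" "f \<in> C M" "N \<in> ON" "M \<subseteq> N" for f M N
      by (rule that(2) [unfolded C_iff [OF that(1)], THEN conjunct2, THEN conjunct2, THEN conjunct2, rule_format, OF that(3,4)])
    have Z: "compact_space ?Z"
      by (simp add: compact_space_product_topology finite_Y compact_space_discrete_topology)
    have "\<exists>f\<in>topspace ?Z. \<forall>M\<in>ON. f \<in> C M"
    proof (rule compact_directed [OF Z, of ON C])
      show "ON \<noteq> {}" using ON_carrier by auto
      show "closedin ?Z (C M)" if M: "M \<in> ON" for M
        unfolding C_def
      proof (intro closedin_Int closedin_Inter)
        show "closedin ?Z {f \<in> topspace ?Z. f M \<in> {S \<in> Y M. \<not> R M S}}"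
          using M by (intro closedin_continuous_map_preimage [OF continuous_map_product_projection]) auto
        show "closedin ?Z S" if S: "S \<in> ?E M ` {N \<in> ON. M \<subseteq> N}" for S
        proof -
          obtain N where N: "N \<in> ON" "M \<subseteq> N" "S = ?E M N" using S by blast
          have c1: "continuous_map ?Z (discrete_topology (Y N)) (\<lambda>f. f N)"
            using N by (intro continuous_map_product_projection)
          have "continuous_map ?Z (discrete_topology (Y M)) (\<lambda>f. f M)"
            using M by (intro continuous_map_product_projection)
          moreover have "continuous_map (discrete_topology (Y M)) (discrete_topology (Y N)) (ph M N)"
            using ph_in M N by auto
          ultimately have "continuous_map ?Z (discrete_topology (Y N)) (ph M N \<circ> (\<lambda>f. f M))"
            by (rule continuous_map_compose)
          then show ?thesis
            unfolding N(3) using c1 by (intro closedin_continuous_maps_eq) (simp_all add: o_def Hausdorff_space_discrete_topology)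
        qed
      qed (use M in auto)
      show "C M \<noteq> {}" if M: "M \<in> ON" for M
      proof -
        have "\<exists>S\<in>Y M. \<not> R M S" using neg M by simp
        then obtain S where S: "S \<in> Y M" "\<not> R M S" ..
        obtain K where K: "K \<in> X" "S = p M K" using p_ex [OF M S(1)] ..
        \<comment> \<open>A closed subgroup lying over the counterexample supplies all coordinates
          at once.\<close>
        have "(\<lambda>N\<in>ON. p N K) \<in> C M"
          using S M by (simp add: C_iff K(2) ph_p [OF M _ _ K(1)] p_in [OF _ K(1)])
        then show ?thesis by (rule_tac ex_in_conv [THEN iffD1, OF exI])
      qed
      show "\<exists>k\<in>ON. C k \<subseteq> C i \<inter> C j" if ij: "i \<in> ON" "j \<in> ON" for i j
      proof (intro bexI)
        \<comment> \<open>Contrapositively, \<open>down\<close> says that the image of a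
          counterexample at a larger subgroup is again one.\<close>
        have *: "C L \<subseteq> C M" if LM: "L \<in> ON" "M \<in> ON" "L \<subseteq> M" for L M
        proof
          fix f assume f: "f \<in> C L"
          have fL: "f L \<in> Y L" "\<not> R L (f L)" "f M = ph L M (f L)"
            by (rule C_D [OF LM(1) f] C_D3 [OF LM(1) f LM(2,3)])+
          have "f \<in> topspace ?Z" using f unfolding C_iff [OF LM(1)] by (rule conjunct1)
          moreover have "f M \<in> Y M"
            unfolding fL(3) by (rule ph_in [OF LM fL(1)])
          moreover have "\<not> R M (f M)"
            unfolding fL(3) by (rule notI, rule notE [OF fL(2)], rule down [OF LM fL(1)])
          moreover have "f N = ph M N (f M)" if "N \<in> ON" "M \<subseteq> N" for N
          proof -
            have "f N = ph L N (f L)" by (rule C_D3 [OF LM(1) f that(1)]) (use that LM in auto)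
            then show ?thesis unfolding fL(3) using ph_ph [OF LM(1,2) that(1) LM(3) that(2) fL(1)] by simp
          qed
          ultimately show "f \<in> C M" unfolding C_iff [OF LM(2)] by (intro conjI ballI impI)
        qed
        show "C (i \<inter> j) \<subseteq> C i \<inter> C j"
          using * [OF ON_Int [OF ij] ij(1)] * [OF ON_Int [OF ij] ij(2)] by simp
      qed (use ij ON_Int in auto)
    qed
    then obtain f where f: "f \<in> topspace ?Z" and f2: "\<forall>M\<in>ON. f \<in> C M" ..
    have "\<exists>K\<in>X. \<forall>N\<in>ON. p N K = f N"
    proof (rule inverse_limit)
      show "f N \<in> Y N" if "N \<in> ON" for N by (rule C_D [OF that f2 [rule_format, OF that]])
      show "f N = ph M N (f M)" if "M \<in> ON" "N \<in> ON" "M \<subseteq> N" for M N by (rule C_D3 [OF that(1) f2 [rule_format, OF that(1)] that(2,3)])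
    qed
    then obtain K where K: "K \<in> X" "\<And>N. N \<in> ON \<Longrightarrow> p N K = f N" by blast
    from ex [OF K(1)] obtain N where "N \<in> ON" "R N (p N K)" by blast
    then show False using C_D(2) [OF _ f2 [rule_format]] K by simp
qed

end

section \<open>Morphisms of sheaves\<close>

lemma sheaf_homI:
  assumes "f \<in> extensional (pts E)" "continuous_map (tot E) (tot F) f"
    and "\<And>e. e \<in> pts E \<Longrightarrow> f e \<in> pts F"
    and "\<And>e. e \<in> pts E \<Longrightarrow> sproj F (f e) = sproj E e"
    and "\<And>g e. g \<in> carrier (grp B) \<Longrightarrow> e \<in> pts E \<Longrightarrow> f (sact E g e) = sact F g (f e)"
    and "\<And>x a b. x \<in> topspace (space_top B) \<Longrightarrow> a \<in> fib E x \<Longrightarrow> b \<in> fib E x \<Longrightarrow> f (sadd E a b) = sadd F (f a) (f b)"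
    and "\<And>x r a. x \<in> topspace (space_top B) \<Longrightarrow> a \<in> fib E x \<Longrightarrow> f (sscale E r a) = sscale F r (f a)"
  shows "f \<in> sheaf_hom B E F"
  unfolding sheaf_hom_def module_linear_iff using assms by simp

lemma sheaf_homD:
  assumes "f \<in> sheaf_hom B E F"
  shows "f \<in> extensional (pts E)" "continuous_map (tot E) (tot F) f"
    "\<And>e. e \<in> pts E \<Longrightarrow> f e \<in> pts F"
    "\<And>e. e \<in> pts E \<Longrightarrow> sproj F (f e) = sproj E e"
    "\<And>g e. g \<in> carrier (grp B) \<Longrightarrow> e \<in> pts E \<Longrightarrow> f (sact E g e) = sact F g (f e)"
    "\<And>x a b. x \<in> topspace (space_top B) \<Longrightarrow> a \<in> fib E x \<Longrightarrow> b \<in> fib E x \<Longrightarrow> f (sadd E a b) = sadd F (f a) (f b)"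
    "\<And>x r a. x \<in> topspace (space_top B) \<Longrightarrow> a \<in> fib E x \<Longrightarrow> f (sscale E r a) = sscale F r (f a)"
  using assms unfolding sheaf_hom_def module_linear_iff
  by (auto simp: continuous_map_def Pi_iff)

lemma gsheafD:
  assumes "is_gsheaf B E"
  shows "local_homeomorphism (tot E) (space_top B) (sproj E)"
    "continuous_map (tot E) (space_top B) (sproj E)"
    "\<And>e. e \<in> pts E \<Longrightarrow> sproj E e \<in> topspace (space_top B)"
    "\<And>g e. g \<in> carrier (grp B) \<Longrightarrow> e \<in> pts E \<Longrightarrow> sproj E (sact E g e) = space_act B g (sproj E e)"
    "\<And>x. x \<in> topspace (space_top B) \<Longrightarrow> rat_stalk E x"
    "\<And>r. continuous_map (tot E) (tot E) (sscale E r)"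
    "\<And>e. e \<in> pts E \<Longrightarrow> sact E \<one>\<^bsub>grp B\<^esub> e = e"
    "\<And>g h e. g \<in> carrier (grp B) \<Longrightarrow> h \<in> carrier (grp B) \<Longrightarrow> e \<in> pts E \<Longrightarrow>
       sact E (g \<otimes>\<^bsub>grp B\<^esub> h) e = sact E g (sact E h e)"
    "\<And>g x. g \<in> carrier (grp B) \<Longrightarrow> x \<in> topspace (space_top B) \<Longrightarrow>
       module_linear (stalk E x) (stalk E (space_act B g x)) (sact E g)"
    "continuous_map (prod_topology (grp_top B) (tot E)) (tot E) (\<lambda>(g, e). sact E g e)"
    "\<And>g e. g \<in> carrier (grp B) \<Longrightarrow> e \<in> pts E \<Longrightarrow> sact E g e \<in> pts E"
    "\<And>g x a b. g \<in> carrier (grp B) \<Longrightarrow> x \<in> topspace (space_top B) \<Longrightarrow> a \<in> fib E x \<Longrightarrow> b \<in> fib E x \<Longrightarrow>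
       sact E g (sadd E a b) = sadd E (sact E g a) (sact E g b)"
    "\<And>g x r a. g \<in> carrier (grp B) \<Longrightarrow> x \<in> topspace (space_top B) \<Longrightarrow> a \<in> fib E x \<Longrightarrow>
       sact E g (sscale E r a) = sscale E r (sact E g a)"
proof -
  note D = assms [unfolded is_gsheaf_iff continuous_action_def]
  show lh: "local_homeomorphism (tot E) (space_top B) (sproj E)" using D by simp
  then show c: "continuous_map (tot E) (space_top B) (sproj E)" by (simp add: local_homeomorphism_def)
  then show p: "sproj E e \<in> topspace (space_top B)" if "e \<in> pts E" for e
    using that by (auto simp: continuous_map_def Pi_iff)
  show "\<And>g e. g \<in> carrier (grp B) \<Longrightarrow> e \<in> pts E \<Longrightarrow> sproj E (sact E g e) = space_act B g (sproj E e)"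
    "\<And>x. x \<in> topspace (space_top B) \<Longrightarrow> rat_stalk E x"
    "\<And>r. continuous_map (tot E) (tot E) (sscale E r)"
    "\<And>e. e \<in> pts E \<Longrightarrow> sact E \<one>\<^bsub>grp B\<^esub> e = e"
    "\<And>g h e. g \<in> carrier (grp B) \<Longrightarrow> h \<in> carrier (grp B) \<Longrightarrow> e \<in> pts E \<Longrightarrow>
       sact E (g \<otimes>\<^bsub>grp B\<^esub> h) e = sact E g (sact E h e)"
    "continuous_map (prod_topology (grp_top B) (tot E)) (tot E) (\<lambda>(g, e). sact E g e)"
    using D by simp_all
  show lin: "module_linear (stalk E x) (stalk E (space_act B g x)) (sact E g)"
    if "g \<in> carrier (grp B)" "x \<in> topspace (space_top B)" for g x
    using D that by simp
  show "sact E g e \<in> pts E" if "g \<in> carrier (grp B)" "e \<in> pts E" for g e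
    using lin [OF that(1) p [OF that(2)]] that by (simp add: module_linear_iff)
  show "sact E g (sadd E a b) = sadd E (sact E g a) (sact E g b)"
    if "g \<in> carrier (grp B)" "x \<in> topspace (space_top B)" "a \<in> fib E x" "b \<in> fib E x" for g x a b
    using lin [OF that(1,2)] that(3,4) by (simp add: module_linear_iff)
  show "sact E g (sscale E r a) = sscale E r (sact E g a)"
    if "g \<in> carrier (grp B)" "x \<in> topspace (space_top B)" "a \<in> fib E x" for g x r a
    using lin [OF that(1,2)] that(3) by (simp add: module_linear_iff)
qed

text \<open>The definition of a sheaf grants continuity of subtraction and of scaling; the sum of
  \<open>s\<close> and \<open>t\<close> is the difference of \<open>s\<close> and the negative of
  \<open>t\<close>.\<close>

lemma continuous_sadd:
  assumes E: "is_gsheaf B E"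
    and s: "continuous_map Z (tot E) s" and t: "continuous_map Z (tot E) t"
    and eq: "\<And>z. z \<in> topspace Z \<Longrightarrow> sproj E (s z) = sproj E (t z)"
  shows "continuous_map Z (tot E) (\<lambda>z. sadd E (s z) (t z))"
proof -
  let ?S = "subtopology (prod_topology (tot E) (tot E)) {(d, e). sproj E d = sproj E e}"
  have sp: "s z \<in> pts E" "t z \<in> pts E" if "z \<in> topspace Z" for z
    using s t that by (auto simp: continuous_map_def Pi_iff)
  have st: "rat_stalk E (sproj E (t z))" if "z \<in> topspace Z" for z
    using gsheafD(3,5) [OF E] sp [OF that] by simp
  have m: "sscale E (- 1) (t z) \<in> fib E (sproj E (t z))" if "z \<in> topspace Z" for z
    using rat_stalkD(4) [OF st [OF that], of "t z" "-1"] sp [OF that] by simp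
  have tc: "continuous_map Z (tot E) (\<lambda>z. sscale E (- 1) (t z))"
    using continuous_map_compose [OF t gsheafD(6) [OF E, of "- 1"]] by (simp add: o_def)
  have "continuous_map Z ?S (\<lambda>z. (s z, sscale E (- 1) (t z)))"
    unfolding continuous_map_in_subtopology
    using s tc eq m by (auto simp: continuous_map_paired)
  moreover have "continuous_map ?S (tot E) (\<lambda>(d, e). sadd E d (sscale E (- 1) e))"
    using E by (simp add: is_gsheaf_iff)
  ultimately have "continuous_map Z (tot E) ((\<lambda>(d, e). sadd E d (sscale E (- 1) e)) \<circ> (\<lambda>z. (s z, sscale E (- 1) (t z))))"
    by (rule continuous_map_compose)
  then show ?thesis
  proof (rule continuous_map_eq)
    fix z assume z: "z \<in> topspace Z"
    have "sscale E (- 1 * - 1) (t z) = sscale E (- 1) (sscale E (- 1) (t z))"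
      by (rule rat_stalkD(11) [OF st [OF z]]) (use sp [OF z] in simp)
    then have "sscale E (- 1) (sscale E (- 1) (t z)) = t z"
      using rat_stalkD(8) [OF st [OF z]] sp [OF z] by simp
    then show "((\<lambda>(d, e). sadd E d (sscale E (- 1) e)) \<circ> (\<lambda>z. (s z, sscale E (- 1) (t z)))) z = sadd E (s z) (t z)"
      by simp
  qed
qed

text \<open>Near any point there is some continuous section, and scaling it by 0 gives the zero
  section.\<close>

lemma continuous_szero:
  assumes E: "is_gsheaf B E"
  shows "continuous_map (space_top B) (tot E) (szero E)"
proof (rule continuous_map_locally)
  fix x assume x: "x \<in> topspace (space_top B)"
  have z: "szero E x \<in> pts E" "sproj E (szero E x) = x"
    using rat_stalkD(1,2) [OF gsheafD(5) [OF E x]] .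
  obtain U s where U: "openin (space_top B) U" "sproj E (szero E x) \<in> U"
      "continuous_map (subtopology (space_top B) U) (tot E) s" "\<forall>x\<in>U. sproj E (s x) = x"
    using local_section_exists [OF gsheafD(1) [OF E] z(1)] by metis
  have "continuous_map (subtopology (space_top B) U) (tot E) (sscale E 0 \<circ> s)"
    using U(3) gsheafD(6) [OF E] by (rule continuous_map_compose)
  then have "continuous_map (subtopology (space_top B) U) (tot E) (szero E)"
  proof (rule continuous_map_eq)
    fix w assume "w \<in> topspace (subtopology (space_top B) U)"
    then have w: "w \<in> topspace (space_top B)" "w \<in> U" by auto
    then have "s w \<in> pts E" using U(3) by (auto simp: continuous_map_def Pi_iff)
    then show "(sscale E 0 \<circ> s) w = szero E w"
      using rat_stalkD(9) [OF gsheafD(5) [OF E w(1)], of "s w"] U(4) w by simp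
  qed
  then show "\<exists>U. openin (space_top B) U \<and> x \<in> U \<and> continuous_map (subtopology (space_top B) U) (tot E) (szero E)"
    using U z by auto
qed

lemma continuous_sact:
  assumes "is_gsheaf B E" "g \<in> topspace (grp_top B)"
  shows "continuous_map (tot E) (tot E) (sact E g)"
proof -
  have "continuous_map (tot E) (prod_topology (grp_top B) (tot E)) (\<lambda>e. (g, e))"
    using assms by (simp add: continuous_map_paired)
  from continuous_map_compose [OF this gsheafD(10) [OF assms(1)]] show ?thesis
    by (simp add: o_def)
qed

lemma sheaf_hom_id: "is_gsheaf B E \<Longrightarrow> (\<lambda>e\<in>pts E. e) \<in> sheaf_hom B E E"
proof (rule sheaf_homI)
  assume E: "is_gsheaf B E"
  show "continuous_map (tot E) (tot E) (\<lambda>e\<in>pts E. e)"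
    by (rule continuous_map_eq [of _ _ "\<lambda>e. e"]) auto
  show "(\<lambda>e\<in>pts E. e) (sact E g e) = sact E g ((\<lambda>e\<in>pts E. e) e)" if "g \<in> carrier (grp B)" "e \<in> pts E" for g e
    using that gsheafD(11) [OF E] by simp
  show "(\<lambda>e\<in>pts E. e) (sadd E a b) = sadd E ((\<lambda>e\<in>pts E. e) a) ((\<lambda>e\<in>pts E. e) b)"
    if "x \<in> topspace (space_top B)" "a \<in> fib E x" "b \<in> fib E x" for x a b
    using that rat_stalkD(3) [OF gsheafD(5) [OF E that(1)] that(2,3)] by simp
  show "(\<lambda>e\<in>pts E. e) (sscale E r a) = sscale E r ((\<lambda>e\<in>pts E. e) a)"
    if "x \<in> topspace (space_top B)" "a \<in> fib E x" for x r a
    using that rat_stalkD(4) [OF gsheafD(5) [OF E that(1)] that(2), of r] by simp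
qed auto

lemma sheaf_hom_compose:
  assumes E: "is_gsheaf B E" and f: "f \<in> sheaf_hom B E F" and g: "g \<in> sheaf_hom B F H"
  shows "compose (pts E) g f \<in> sheaf_hom B E H"
proof (rule sheaf_homI)
  note F = sheaf_homD [OF f] and G = sheaf_homD [OF g]
  show "compose (pts E) g f \<in> extensional (pts E)" by simp
  show "continuous_map (tot E) (tot H) (compose (pts E) g f)"
    by (rule continuous_map_eq [OF continuous_map_compose [OF F(2) G(2)]]) (simp add: compose_def)
  show "compose (pts E) g f e \<in> pts H" "sproj H (compose (pts E) g f e) = sproj E e" if "e \<in> pts E" for e
    using that F(3,4) G(3,4) by (simp_all add: compose_def)
  show "compose (pts E) g f (sact E h e) = sact H h (compose (pts E) g f e)"
    if "h \<in> carrier (grp B)" "e \<in> pts E" for h e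
    using that F(3,5) G(5) gsheafD(11) [OF E] by (simp add: compose_def)
  show "compose (pts E) g f (sadd E a b) = sadd H (compose (pts E) g f a) (compose (pts E) g f b)"
    if x: "x \<in> topspace (space_top B)" "a \<in> fib E x" "b \<in> fib E x" for x a b
    using x F(3,4) F(6) [OF x] G(6) [OF x(1), of "f a" "f b"] rat_stalkD(3) [OF gsheafD(5) [OF E x(1)] x(2,3)]
    by (simp add: compose_def)
  show "compose (pts E) g f (sscale E r a) = sscale H r (compose (pts E) g f a)"
    if x: "x \<in> topspace (space_top B)" "a \<in> fib E x" for x r a
    using x F(3,4) F(7) [OF x] G(7) [OF x(1), of "f a"] rat_stalkD(4) [OF gsheafD(5) [OF E x(1)] x(2), of r]
    by (simp add: compose_def)
qed

section \<open>Sheaves over discrete spaces\<close>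

definition discrete_gspace :: "('g, 'x) gspace \<Rightarrow> bool" where
  "discrete_gspace B \<longleftrightarrow> space_top B = discrete_topology (topspace (space_top B)) \<and>
     grp_top B = discrete_topology (carrier (grp B))"

text \<open>A point is the image of a local section restricted to a singleton, which is open in the
  base.\<close>

lemma discrete_gsheaf_tot:
  assumes B: "discrete_gspace B" and E: "is_gsheaf B E"
  shows "tot E = discrete_topology (pts E)"
proof -
  have "openin (tot E) {e}" if e: "e \<in> pts E" for e
  proof -
    obtain U s where U: "openin (space_top B) U" "sproj E e \<in> U"
      "continuous_map (subtopology (space_top B) U) (tot E) s" "\<forall>x\<in>U. sproj E (s x) = x" "s (sproj E e) = e"
      using local_section_exists [OF gsheafD(1) [OF E] e] by metis
    have x: "sproj E e \<in> topspace (space_top B)" using gsheafD(3) [OF E e] .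
    then have "openin (space_top B) {sproj E e}"
      using B unfolding discrete_gspace_def by (metis openin_discrete_topology empty_subsetI insert_subset)
    moreover have "continuous_map (subtopology (space_top B) {sproj E e}) (tot E) s"
      using U(2,3) by (meson continuous_map_from_subtopology_mono empty_subsetI insert_subset)
    ultimately have "openin (tot E) (s ` {sproj E e})"
      using U(2,4) by (intro section_image_open [OF gsheafD(1) [OF E]]) auto
    then show ?thesis using U(5) by simp
  qed
  then show ?thesis
    by (metis discrete_topology_unique)
qed

text \<open>Singletons serve as sheets, and all continuity conditions concern maps out of discrete
  spaces, so only the algebra has to be supplied.\<close>

lemma discrete_gsheafI:
  assumes B: "discrete_gspace B" and tot: "tot E = discrete_topology (pts E)"
    and p: "\<And>e. e \<in> pts E \<Longrightarrow> sproj E e \<in> topspace (space_top B)"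
    and a: "\<And>g e. g \<in> carrier (grp B) \<Longrightarrow> e \<in> pts E \<Longrightarrow> sact E g e \<in> pts E"
    and pa: "\<And>g e. g \<in> carrier (grp B) \<Longrightarrow> e \<in> pts E \<Longrightarrow> sproj E (sact E g e) = space_act B g (sproj E e)"
    and a1: "\<And>e. e \<in> pts E \<Longrightarrow> sact E \<one>\<^bsub>grp B\<^esub> e = e"
    and am: "\<And>g h e. g \<in> carrier (grp B) \<Longrightarrow> h \<in> carrier (grp B) \<Longrightarrow> e \<in> pts E \<Longrightarrow>
       sact E (g \<otimes>\<^bsub>grp B\<^esub> h) e = sact E g (sact E h e)"
    and st: "\<And>x. x \<in> topspace (space_top B) \<Longrightarrow> rat_stalk E x"
    and aadd: "\<And>g x a b. g \<in> carrier (grp B) \<Longrightarrow> x \<in> topspace (space_top B) \<Longrightarrow> a \<in> fib E x \<Longrightarrow> b \<in> fib E x \<Longrightarrow>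
       sact E g (sadd E a b) = sadd E (sact E g a) (sact E g b)"
    and asc: "\<And>g x r a. g \<in> carrier (grp B) \<Longrightarrow> x \<in> topspace (space_top B) \<Longrightarrow> a \<in> fib E x \<Longrightarrow>
       sact E g (sscale E r a) = sscale E r (sact E g a)"
  shows "is_gsheaf B E"
  unfolding is_gsheaf_iff continuous_action_def
proof (intro conjI allI ballI)
  let ?S = "topspace (space_top B)"
  have sp: "space_top B = discrete_topology ?S" and gr: "grp_top B = discrete_topology (carrier (grp B))"
    using B by (simp_all add: discrete_gspace_def)
  show "continuous_map (prod_topology (grp_top B) (tot E)) (tot E) (\<lambda>(g, e). sact E g e)"
    by (subst gr, subst tot) (use a in \<open>auto simp flip: prod_topology_discrete_topology\<close>)
  show "local_homeomorphism (tot E) (space_top B) (sproj E)"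
    unfolding local_homeomorphism_def
  proof (intro conjI ballI)
    show "continuous_map (tot E) (space_top B) (sproj E)"
      by (subst tot) (use p in \<open>auto\<close>)
    fix e assume e: "e \<in> pts E"
    have "homeomorphic_maps (subtopology (tot E) {e}) (subtopology (space_top B) (sproj E ` {e})) (sproj E) (\<lambda>_. e)"
      unfolding homeomorphic_maps_def continuous_map_in_subtopology
      using e p by (subst (1) tot) (auto simp: subtopology_discrete_topology)
    moreover have "openin (tot E) {e}"
      using e by (subst tot) simp
    moreover have "openin (space_top B) (sproj E ` {e})"
      using p [OF e] by (subst sp) simp
    ultimately show "\<exists>U. openin (tot E) U \<and> e \<in> U \<and> openin (space_top B) (sproj E ` U) \<and>
        homeomorphic_map (subtopology (tot E) U) (subtopology (space_top B) (sproj E ` U)) (sproj E)"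
      by (intro exI [of _ "{e}"]) (auto simp: homeomorphic_map_maps)
  qed
  have m: "sadd E d (sscale E (- 1) e) \<in> pts E" if "d \<in> pts E" "e \<in> pts E" "sproj E d = sproj E e" for d e
    using rat_stalkD(4) [OF st, of "sproj E e" e "- 1"] rat_stalkD(3) [OF st, of "sproj E e" d "sscale E (- 1) e"] that p
    by simp
  show "continuous_map (subtopology (prod_topology (tot E) (tot E)) {(d, e). sproj E d = sproj E e}) (tot E)
     (\<lambda>(d, e). sadd E d (sscale E (- 1) e))"
    by (subst (1 2) tot) (use m in \<open>auto simp: subtopology_discrete_topology simp flip: prod_topology_discrete_topology\<close>)
  show "continuous_map (tot E) (tot E) (sscale E r)" for r
    using rat_stalkD(4) [OF st] p by (subst (1) tot) auto
  show "module_linear (stalk E x) (stalk E (space_act B g x)) (sact E g)"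
    if "g \<in> carrier (grp B)" "x \<in> ?S" for g x
    unfolding module_linear_iff using that a pa aadd [OF that] asc [OF that] by auto
qed (use a1 am pa st in auto)

lemma discrete_homI:
  assumes "tot E = discrete_topology (pts E)" "f \<in> extensional (pts E)"
    and "\<And>e. e \<in> pts E \<Longrightarrow> f e \<in> pts F"
    and "\<And>e. e \<in> pts E \<Longrightarrow> sproj F (f e) = sproj E e"
    and "\<And>g e. g \<in> carrier (grp B) \<Longrightarrow> e \<in> pts E \<Longrightarrow> f (sact E g e) = sact F g (f e)"
    and "\<And>x a b. x \<in> topspace (space_top B) \<Longrightarrow> a \<in> fib E x \<Longrightarrow> b \<in> fib E x \<Longrightarrow> f (sadd E a b) = sadd F (f a) (f b)"
    and "\<And>x r a. x \<in> topspace (space_top B) \<Longrightarrow> a \<in> fib E x \<Longrightarrow> f (sscale E r a) = sscale F r (f a)"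
  shows "f \<in> sheaf_hom B E F"
proof (rule sheaf_homI)
  show "continuous_map (tot E) (tot F) f"
    by (subst assms(1)) (use assms(3) in \<open>auto\<close>)
qed (use assms in auto)

lemma sheaf_iso_bij:
  assumes "sheaf_iso B E F f"
  shows "f \<in> sheaf_hom B E F" "bij_betw f (pts E) (pts F)"
proof -
  obtain g where g: "f \<in> sheaf_hom B E F" "g \<in> sheaf_hom B F E" "\<forall>e\<in>pts E. g (f e) = e" "\<forall>e\<in>pts F. f (g e) = e"
    using assms by (auto simp: sheaf_iso_def)
  then show "f \<in> sheaf_hom B E F" by simp
  show "bij_betw f (pts E) (pts F)"
    using g sheaf_homD(3) [OF g(1)] sheaf_homD(3) [OF g(2)] by (intro bij_betw_byWitness [where f' = g]) auto
qed

text \<open>The inverse bijection is continuous because its source is discrete, and it inherits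
  linearity and equivariance from \<open>f\<close>.\<close>

lemma discrete_sheaf_iso:
  assumes B: "discrete_gspace B" and E: "is_gsheaf B E" and F: "is_gsheaf B F"
    and f: "f \<in> sheaf_hom B E F" and bij: "bij_betw f (pts E) (pts F)"
  shows "sheaf_iso B E F f"
proof -
  define g where "g = (\<lambda>e\<in>pts F. inv_into (pts E) f e)"
  have gf: "g (f e) = e" if "e \<in> pts E" for e
    using that bij sheaf_homD(3) [OF f that] by (simp add: g_def bij_betw_inv_into_left)
  have fg: "f (g e) = e" "g e \<in> pts E" if "e \<in> pts F" for e
    using that bij by (simp_all add: g_def bij_betw_inv_into_right) (metis bij_betw_def inv_into_into)
  have gp: "sproj E (g e) = sproj F e" if "e \<in> pts F" for e
    using sheaf_homD(4) [OF f fg(2) [OF that]] fg(1) [OF that] by simp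
  have "g \<in> sheaf_hom B F E"
  proof (rule discrete_homI)
    show "tot F = discrete_topology (pts F)" by (rule discrete_gsheaf_tot [OF B F])
    show "g (sact F h e) = sact E h (g e)" if "h \<in> carrier (grp B)" "e \<in> pts F" for h e
      using gf [of "sact E h (g e)"] sheaf_homD(5) [OF f that(1), of "g e"] gsheafD(11) [OF E that(1)] fg [OF that(2)] by simp
    show "g (sadd F a b) = sadd E (g a) (g b)" if "x \<in> topspace (space_top B)" "a \<in> fib F x" "b \<in> fib F x" for x a b
    proof -
      have "g a \<in> fib E x" "g b \<in> fib E x" using that fg(2) gp by auto
      then show ?thesis
        using gf [of "sadd E (g a) (g b)"] sheaf_homD(6) [OF f that(1), of "g a" "g b"]
          rat_stalkD(3) [OF gsheafD(5) [OF E that(1)], of "g a" "g b"] fg(1) that by simp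
    qed
    show "g (sscale F r a) = sscale E r (g a)" if "x \<in> topspace (space_top B)" "a \<in> fib F x" for x r a
    proof -
      have "g a \<in> fib E x" using that fg(2) gp by auto
      then show ?thesis
        using gf [of "sscale E r (g a)"] sheaf_homD(7) [OF f that(1), of "g a" r]
          rat_stalkD(4) [OF gsheafD(5) [OF E that(1)], of "g a" r] fg(1) that by simp
    qed
  qed (use fg gp in \<open>auto simp: g_def\<close>)
  then show ?thesis
    using f gf fg by (auto simp: sheaf_iso_def)
qed

text \<open>Transport of structure: the copy lives on the image of \<open>r\<close> with the
  discrete topology, and each operation is conjugated by \<open>r\<close>.\<close>

lemma discrete_copy_exists:
  fixes E :: "('g, 'x, 'e) gsheaf" and r :: "'e \<Rightarrow> 'u"
  assumes B: "discrete_gspace B" and E: "is_gsheaf B E" and r: "inj_on r (pts E)"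
  shows "\<exists>(F :: ('g, 'x, 'u) gsheaf) r'. is_gsheaf B F \<and> sheaf_iso B E F r'"
proof -
  define i where "i = inv_into (pts E) r"
  have i: "i (r e) = e" if "e \<in> pts E" for e using that r by (simp add: i_def)
  define F :: "('g, 'x, 'u) gsheaf" where "F =
     \<lparr>tot = discrete_topology (r ` pts E), sproj = (\<lambda>u. sproj E (i u)), sact = (\<lambda>g u. r (sact E g (i u))),
      szero = (\<lambda>x. r (szero E x)), sadd = (\<lambda>u v. r (sadd E (i u) (i v))), sscale = (\<lambda>q u. r (sscale E q (i u)))\<rparr>"
  have F: "pts F = r ` pts E" "\<And>e. e \<in> pts E \<Longrightarrow> sproj F (r e) = sproj E e"
    "\<And>g e. e \<in> pts E \<Longrightarrow> sact F g (r e) = r (sact E g e)" "\<And>x. szero F x = r (szero E x)"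
    "\<And>a b. a \<in> pts E \<Longrightarrow> b \<in> pts E \<Longrightarrow> sadd F (r a) (r b) = r (sadd E a b)"
    "\<And>q a. a \<in> pts E \<Longrightarrow> sscale F q (r a) = r (sscale E q a)"
    by (auto simp: F_def i)
  have fibF: "fib F x = r ` fib E x" for x
    using F(1,2) by (auto simp: fib_def)
  have st: "rat_stalk F x" if x: "x \<in> topspace (space_top B)" for x
  proof -
    note D = rat_stalkD [OF gsheafD(5) [OF E x]]
    note D' = D(3,4) [unfolded in_fib_iff]
    show ?thesis
      unfolding rat_stalk_def fibF ball_simps
      using D D' by (simp add: F del: in_fib_iff add: in_fib_iff [of _ E])
  qed
  have "is_gsheaf B F"
  proof (rule discrete_gsheafI [OF B])
    show "tot F = discrete_topology (pts F)" by (simp add: F_def)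
    show "rat_stalk F x" if x: "x \<in> topspace (space_top B)" for x using st [OF x] .
    show "sact F g (sadd F a b) = sadd F (sact F g a) (sact F g b)"
      if g: "g \<in> carrier (grp B)" and x: "x \<in> topspace (space_top B)" and ab: "a \<in> fib F x" "b \<in> fib F x" for g x a b
    proof -
      obtain a' b' where *: "a' \<in> fib E x" "b' \<in> fib E x" "a = r a'" "b = r b'" using ab unfolding fibF by auto
      then show ?thesis
        using gsheafD(12) [OF E g x *(1,2)] rat_stalkD(3) [OF gsheafD(5) [OF E x] *(1,2)] gsheafD(11) [OF E g]
        by (simp add: F)
    qed
    show "sact F g (sscale F q a) = sscale F q (sact F g a)"
      if g: "g \<in> carrier (grp B)" and x: "x \<in> topspace (space_top B)" and ab: "a \<in> fib F x" for g x q a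
    proof -
      obtain a' where *: "a' \<in> fib E x" "a = r a'" using ab unfolding fibF by auto
      then show ?thesis
        using gsheafD(13) [OF E g x *(1)] rat_stalkD(4) [OF gsheafD(5) [OF E x] *(1)] gsheafD(11) [OF E g]
        by (simp add: F)
    qed
  qed (use gsheafD(3,4,7,8,11) [OF E] in \<open>auto simp: F\<close>)
  moreover have "restrict r (pts E) \<in> sheaf_hom B E F"
  proof (rule discrete_homI)
    show "tot E = discrete_topology (pts E)" by (rule discrete_gsheaf_tot [OF B E])
    show "restrict r (pts E) (sadd E a b) = sadd F (restrict r (pts E) a) (restrict r (pts E) b)"
      if "x \<in> topspace (space_top B)" "a \<in> fib E x" "b \<in> fib E x" for x a b
      using rat_stalkD(3) [OF gsheafD(5) [OF E that(1)] that(2,3)] that by (simp add: F)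
    show "restrict r (pts E) (sscale E q a) = sscale F q (restrict r (pts E) a)"
      if "x \<in> topspace (space_top B)" "a \<in> fib E x" for x q a
      using rat_stalkD(4) [OF gsheafD(5) [OF E that(1)] that(2)] that by (simp add: F)
  qed (use gsheafD(11) [OF E] in \<open>auto simp: F\<close>)
  moreover have "bij_betw (restrict r (pts E)) (pts E) (pts F)"
    using r by (simp add: bij_betw_def F inj_on_restrict_eq)
  ultimately show ?thesis
    using discrete_sheaf_iso [OF B E] by blast
qed

section \<open>Push forward to a discrete space\<close>

text \<open>A common frame for \<open>pN\<close> and \<open>phiMN\<close>. Discreteness is asked of
  the target only, since the source of \<open>pN\<close> is the space of all closed
  subgroups.\<close>

locale discrete_change =
  fixes c :: "('g, 'x, 'h, 'y) change"
  assumes src_group: "group (grp (src c))" and tgt_group: "group (grp (tgt c))"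
    and ghom: "ghom c \<in> hom (grp (src c)) (grp (tgt c))"
    and ghom_surj: "ghom c ` carrier (grp (src c)) = carrier (grp (tgt c))"
    and discrete: "discrete_gspace (tgt c)"
    and src_action: "continuous_action (grp (src c)) (grp_top (src c)) (space_top (src c)) (space_act (src c))"
    and src_top: "topspace (grp_top (src c)) = carrier (grp (src c))"
    and tgt_act: "\<And>h y. h \<in> carrier (grp (tgt c)) \<Longrightarrow> y \<in> topspace (space_top (tgt c)) \<Longrightarrow>
        space_act (tgt c) h y \<in> topspace (space_top (tgt c))"
    and tgt_one: "\<And>y. y \<in> topspace (space_top (tgt c)) \<Longrightarrow> space_act (tgt c) \<one>\<^bsub>grp (tgt c)\<^esub> y = y"
    and tgt_mult: "\<And>h k y. h \<in> carrier (grp (tgt c)) \<Longrightarrow> k \<in> carrier (grp (tgt c)) \<Longrightarrow> y \<in> topspace (space_top (tgt c)) \<Longrightarrow>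
        space_act (tgt c) (h \<otimes>\<^bsub>grp (tgt c)\<^esub> k) y = space_act (tgt c) h (space_act (tgt c) k y)"
    and smap_cont: "continuous_map (space_top (src c)) (space_top (tgt c)) (smap c)"
    and smap_act: "\<And>g x. g \<in> carrier (grp (src c)) \<Longrightarrow> x \<in> topspace (space_top (src c)) \<Longrightarrow>
        smap c (space_act (src c) g x) = space_act (tgt c) (ghom c g) (smap c x)"
begin

abbreviation "A \<equiv> grp (src c)"
abbreviation "B \<equiv> grp (tgt c)"
abbreviation "XT \<equiv> space_top (src c)"
abbreviation "YY \<equiv> topspace (space_top (tgt c))"
abbreviation "ax \<equiv> space_act (src c)"
abbreviation "ay \<equiv> space_act (tgt c)"
abbreviation "ker \<equiv> kernel A B (ghom c)"
abbreviation "IS \<equiv> invariant_sections c"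

sublocale A: group A by (rule src_group)
sublocale B: group B by (rule tgt_group)
sublocale AB: group_hom A B "ghom c"
  by (simp add: group_hom_def group_hom_axioms_def src_group tgt_group ghom)

lemma tgt_space: "space_top (tgt c) = discrete_topology YY" "grp_top (tgt c) = discrete_topology (carrier B)"
  using discrete by (simp_all add: discrete_gspace_def)

lemma tgt_open: "openin (space_top (tgt c)) V \<longleftrightarrow> V \<subseteq> YY"
  by (subst tgt_space) simp

lemma lift_ex: "h \<in> carrier B \<Longrightarrow> \<exists>g. g \<in> carrier A \<and> ghom c g = h"
  unfolding ghom_surj [symmetric] by auto

lemma ax_cont: "g \<in> carrier A \<Longrightarrow> continuous_map XT XT (ax g)"
proof -
  assume g: "g \<in> carrier A"
  have "continuous_map XT (prod_topology (grp_top (src c)) XT) (\<lambda>x. (g, x))"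
    using g src_top by (simp add: continuous_map_paired)
  moreover have "continuous_map (prod_topology (grp_top (src c)) XT) XT (\<lambda>(g, x). ax g x)"
    using src_action by (simp add: continuous_action_def)
  ultimately have "continuous_map XT XT ((\<lambda>(g, x). ax g x) \<circ> (\<lambda>x. (g, x)))"
    by (rule continuous_map_compose)
  then show ?thesis by (simp add: o_def)
qed

lemma ax_in: "g \<in> carrier A \<Longrightarrow> x \<in> topspace XT \<Longrightarrow> ax g x \<in> topspace XT"
  using ax_cont by (auto simp: continuous_map_def Pi_iff)

lemma ax_one: "x \<in> topspace XT \<Longrightarrow> ax \<one>\<^bsub>A\<^esub> x = x"
  and ax_mult: "g \<in> carrier A \<Longrightarrow> h \<in> carrier A \<Longrightarrow> x \<in> topspace XT \<Longrightarrow> ax (g \<otimes>\<^bsub>A\<^esub> h) x = ax g (ax h x)"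
  using src_action by (simp_all add: continuous_action_def)

lemma ax_inv: "g \<in> carrier A \<Longrightarrow> x \<in> topspace XT \<Longrightarrow> ax (inv\<^bsub>A\<^esub> g) (ax g x) = x"
  "g \<in> carrier A \<Longrightarrow> x \<in> topspace XT \<Longrightarrow> ax g (ax (inv\<^bsub>A\<^esub> g) x) = x"
  using ax_mult [of "inv\<^bsub>A\<^esub> g" g x] ax_mult [of g "inv\<^bsub>A\<^esub> g" x] ax_one [of x] by simp_all

lemma smap_in: "x \<in> topspace XT \<Longrightarrow> smap c x \<in> YY"
  using smap_cont by (auto simp: continuous_map_def Pi_iff)

lemma ay_inv: "h \<in> carrier B \<Longrightarrow> y \<in> YY \<Longrightarrow> ay (inv\<^bsub>B\<^esub> h) (ay h y) = y"
  "h \<in> carrier B \<Longrightarrow> y \<in> YY \<Longrightarrow> ay h (ay (inv\<^bsub>B\<^esub> h) y) = y"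
  using tgt_mult [of "inv\<^bsub>B\<^esub> h" h y] tgt_mult [of h "inv\<^bsub>B\<^esub> h" y] tgt_one [of y] by simp_all

section \<open>Kernel invariance and germs over a discrete space\<close>

lemma in_preim: "x \<in> preim c V \<longleftrightarrow> x \<in> topspace XT \<and> smap c x \<in> V"
  by (simp add: preim_def)

lemma in_ker: "n \<in> ker \<longleftrightarrow> n \<in> carrier A \<and> ghom c n = \<one>\<^bsub>B\<^esub>"
  by (simp add: kernel_def)

lemma ker_inv: "n \<in> ker \<Longrightarrow> inv\<^bsub>A\<^esub> n \<in> ker"
  by (simp add: in_ker)

lemma smap_ker: "n \<in> ker \<Longrightarrow> x \<in> topspace XT \<Longrightarrow> smap c (ax n x) = smap c x"
  using smap_act [of n x] tgt_one [OF smap_in] by (simp add: in_ker)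

lemma preim_ker: "n \<in> ker \<Longrightarrow> x \<in> preim c V \<Longrightarrow> ax n x \<in> preim c V"
  by (simp add: in_preim smap_ker) (simp add: in_ker ax_in)

lemma ker_preim_image: "n \<in> ker \<Longrightarrow> ax n ` preim c V = preim c V"
proof
  assume n: "n \<in> ker"
  show "ax n ` preim c V \<subseteq> preim c V" using preim_ker [OF n] by auto
  show "preim c V \<subseteq> ax n ` preim c V"
  proof
    fix x assume x: "x \<in> preim c V"
    then have "x = ax n (ax (inv\<^bsub>A\<^esub> n) x)" using ax_inv(2) [of n x] n by (simp add: in_ker in_preim)
    then show "x \<in> ax n ` preim c V" using preim_ker [OF ker_inv [OF n] x] by blast
  qed
qed

text \<open>The kernel moves points within the fibres of \<open>smap c\<close>, so it maps each
  preimage onto itself and invariance of a section becomes equivariance under the kernel, point by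
  point.\<close>

lemma IS_iff:
  "s \<in> IS E V \<longleftrightarrow> s \<in> extensional (preim c V) \<and> continuous_map (subtopology XT (preim c V)) (tot E) s \<and>
     (\<forall>x\<in>preim c V. sproj E (s x) = x) \<and> (\<forall>n\<in>ker. \<forall>x\<in>preim c V. s (ax n x) = sact E n (s x))"
proof -
  have "section_act (src c) E n (preim c V) s = s \<longleftrightarrow> (\<forall>x\<in>preim c V. s (ax n x) = sact E n (s x))"
    if n: "n \<in> ker" and s: "s \<in> extensional (preim c V)" for n
  proof
    have nA: "n \<in> carrier A" using n by (simp add: in_ker)
    assume eq: "section_act (src c) E n (preim c V) s = s"
    show "\<forall>x\<in>preim c V. s (ax n x) = sact E n (s x)"
    proof
      fix x assume x: "x \<in> preim c V"
      have "section_act (src c) E n (preim c V) s (ax n x) = sact E n (s x)"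
        using x preim_ker [OF n x] nA by (simp add: section_act_def ker_preim_image [OF n] ax_inv in_preim)
      then show "s (ax n x) = sact E n (s x)" using eq by simp
    qed
  next
    have nA: "n \<in> carrier A" using n by (simp add: in_ker)
    assume eq: "\<forall>x\<in>preim c V. s (ax n x) = sact E n (s x)"
    show "section_act (src c) E n (preim c V) s = s"
    proof
      fix x
      show "section_act (src c) E n (preim c V) s x = s x"
      proof (cases "x \<in> preim c V")
        case True
        have "s (ax n (ax (inv\<^bsub>A\<^esub> n) x)) = sact E n (s (ax (inv\<^bsub>A\<^esub> n) x))"
          using eq preim_ker [OF ker_inv [OF n] True] by blast
        then show ?thesis
          using True nA ax_inv(2) [OF nA, of x] by (simp add: section_act_def ker_preim_image [OF n] in_preim)
      next
        case False
        then show ?thesis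
          using s by (simp add: section_act_def ker_preim_image [OF n] extensional_def)
      qed
    qed
  qed
  then show ?thesis
    unfolding invariant_sections_def sections_def by auto
qed

lemma IS_D:
  assumes "s \<in> IS E V"
  shows "s \<in> extensional (preim c V)" "continuous_map (subtopology XT (preim c V)) (tot E) s"
    "\<And>x. x \<in> preim c V \<Longrightarrow> sproj E (s x) = x"
    "\<And>n x. n \<in> ker \<Longrightarrow> x \<in> preim c V \<Longrightarrow> s (ax n x) = sact E n (s x)"
    "\<And>x. x \<in> preim c V \<Longrightarrow> s x \<in> pts E"
    "\<And>x. x \<in> preim c V \<Longrightarrow> s x \<in> fib E x"
proof -
  show c: "continuous_map (subtopology XT (preim c V)) (tot E) s" and p: "\<And>x. x \<in> preim c V \<Longrightarrow> sproj E (s x) = x"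
    using assms by (simp_all add: IS_iff)
  show pt: "s x \<in> pts E" if "x \<in> preim c V" for x
    using c that by (auto simp: continuous_map_def Pi_iff in_preim)
  show "s x \<in> fib E x" if "x \<in> preim c V" for x
    using pt p that by simp
qed (use assms in \<open>simp_all add: IS_iff\<close>)

lemma IS_restrict:
  assumes s: "s \<in> IS E V" and W: "W \<subseteq> V"
  shows "restrict s (preim c W) \<in> IS E W"
proof -
  have sub: "preim c W \<subseteq> preim c V" using W by (auto simp: in_preim)
  have "continuous_map (subtopology XT (preim c W)) (tot E) s"
    using IS_D(2) [OF s] sub by (rule continuous_map_from_subtopology_mono)
  then have "continuous_map (subtopology XT (preim c W)) (tot E) (restrict s (preim c W))"
    by (rule continuous_map_eq) simp
  then show ?thesis
    unfolding IS_iff using IS_D(3,4) [OF s] sub preim_ker by auto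
qed

text \<open>Points of the target are open, so the neighbourhood on which two representatives have to
  agree may be taken to be \<open>{y}\<close>.\<close>

lemma germ_unfold:
  assumes "y \<in> V" "V \<subseteq> YY"
  shows "germ c E y V s = (y, {(V', s'). V' \<subseteq> YY \<and> y \<in> V' \<and> s' \<in> IS E V' \<and> (\<forall>x\<in>preim c {y}. s' x = s x)})"
  unfolding germ_def tgt_open using assms by (auto simp: in_preim intro!: exI [of _ "{y}"])

lemma fst_germ [simp]: "fst (germ c E y V s) = y"
  by (simp add: germ_def)

lemma germ_cong:
  assumes "y \<in> V" "V \<subseteq> YY" "y \<in> V'" "V' \<subseteq> YY" "\<And>x. x \<in> preim c {y} \<Longrightarrow> s x = s' x"
  shows "germ c E y V s = germ c E y V' s'"
  unfolding germ_unfold [OF assms(1,2)] germ_unfold [OF assms(3,4)] using assms(5) by simp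

text \<open>\<open>germ_dom\<close> and \<open>germ_sec\<close> return an arbitrary member of the
  class. The class contains \<open>(V, s)\<close>, so the choice succeeds, and any member agrees
  with \<open>s\<close> over the fibre of \<open>y\<close>.\<close>

lemma germ_rep:
  assumes "s \<in> IS E V" "y \<in> V" "V \<subseteq> YY" and z: "z = germ c E y V s"
  shows "germ_dom z \<subseteq> YY" "y \<in> germ_dom z" "germ_sec z \<in> IS E (germ_dom z)"
    "\<And>x. x \<in> preim c {y} \<Longrightarrow> germ_sec z x = s x"
proof -
  have "(V, s) \<in> snd z"
    unfolding z germ_unfold [OF assms(2,3)] using assms by simp
  then have "(SOME r. r \<in> snd z) \<in> snd z"
    by (rule someI)
  then have "(germ_dom z, germ_sec z) \<in> snd z"
    unfolding germ_dom_def germ_sec_def by simp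
  then have "germ_dom z \<subseteq> YY \<and> y \<in> germ_dom z \<and> germ_sec z \<in> IS E (germ_dom z) \<and> (\<forall>x\<in>preim c {y}. germ_sec z x = s x)"
    unfolding z germ_unfold [OF assms(2,3)] by simp
  then show "germ_dom z \<subseteq> YY" "y \<in> germ_dom z" "germ_sec z \<in> IS E (germ_dom z)"
    "\<And>x. x \<in> preim c {y} \<Longrightarrow> germ_sec z x = s x" by auto
qed

end

text \<open>Over a discrete space a germ at \<open>y\<close> is determined by its values over the fibre of \<open>y\<close>.\<close>

definition gval :: "('g, 'x, 'h, 'y) change \<Rightarrow> ('x, 'y, 'e) germ \<Rightarrow> 'x \<Rightarrow> 'e" where
  "gval c z = restrict (germ_sec z) (preim c {fst z})"

context discrete_change
begin

lemma gval_germ: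
  assumes "s \<in> IS E V" "y \<in> V" "V \<subseteq> YY"
  shows "gval c (germ c E y V s) = restrict s (preim c {y})"
  unfolding gval_def using germ_rep(4) [OF assms refl] by (auto simp: restrict_def fun_eq_iff)

lemma gval_simp: "x \<in> topspace XT \<Longrightarrow> smap c x = fst z \<Longrightarrow> gval c z x = germ_sec z x"
  by (simp add: gval_def in_preim)

lemma pts_push: "pts (push c E) = {germ c E y {y} s | y s. y \<in> YY \<and> s \<in> IS E {y}}"
proof -
  have "germ c E y V s \<in> {germ c E y {y} s | y s. y \<in> YY \<and> s \<in> IS E {y}}"
    if "y \<in> V" "V \<subseteq> YY" "s \<in> IS E V" for y V s
  proof -
    have "germ c E y V s = germ c E y {y} (restrict s (preim c {y}))"
      using that by (intro germ_cong) auto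
    moreover have "restrict s (preim c {y}) \<in> IS E {y}"
      using IS_restrict [OF that(3), of "{y}"] that(1) by simp
    ultimately show ?thesis using that by blast
  qed
  then show ?thesis
    unfolding push_def gsheaf.simps topology_generated_by_topspace tgt_open
    by auto (metis image_eqI singletonI empty_subsetI insert_subset)
qed

lemma germ_in_push:
  assumes "s \<in> IS E V" "y \<in> V" "V \<subseteq> YY"
  shows "germ c E y V s \<in> pts (push c E)"
proof -
  have "germ c E y V s = germ c E y {y} (restrict s (preim c {y}))"
    using assms by (intro germ_cong) auto
  moreover have "restrict s (preim c {y}) \<in> IS E {y}"
    using IS_restrict [OF assms(1), of "{y}"] assms(2) by simp
  ultimately show ?thesis using assms unfolding pts_push by blast
qed

lemma pushD:
  assumes "z \<in> pts (push c E)"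
  shows "fst z \<in> YY" "gval c z \<in> IS E {fst z}" "germ c E (fst z) {fst z} (gval c z) = z"
    "germ_dom z \<subseteq> YY" "fst z \<in> germ_dom z" "germ_sec z \<in> IS E (germ_dom z)"
proof -
  obtain y s where ys: "y \<in> YY" "s \<in> IS E {y}" "z = germ c E y {y} s"
    using assms unfolding pts_push by blast
  have "gval c z = s"
    using gval_germ [OF ys(2)] ys IS_D(1) [OF ys(2)] by (simp add: extensional_restrict)
  then show "fst z \<in> YY" "gval c z \<in> IS E {fst z}" "germ c E (fst z) {fst z} (gval c z) = z"
    using ys by simp_all
  show "germ_dom z \<subseteq> YY" "fst z \<in> germ_dom z" "germ_sec z \<in> IS E (germ_dom z)"
    using germ_rep [OF ys(2) _ _ ys(3)] ys by auto
qed

text \<open>Later equations between germs are proved through this lemma: on values over a fibre the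
  operations of the push forward are those of \<open>E\<close>, independently of the chosen
  representatives.\<close>

lemma gval_inj:
  assumes "z \<in> pts (push c E)" "z' \<in> pts (push c E)" "fst z = fst z'"
    "\<And>x. x \<in> preim c {fst z} \<Longrightarrow> gval c z x = gval c z' x"
  shows "z = z'"
proof -
  have "gval c z = gval c z'"
  proof (rule extensionalityI)
    show "gval c z \<in> extensional (preim c {fst z})"
      by (rule IS_D(1) [OF pushD(2) [OF assms(1)]])
    show "gval c z' \<in> extensional (preim c {fst z})"
      unfolding assms(3) by (rule IS_D(1) [OF pushD(2) [OF assms(2)]])
  qed (rule assms(4))
  then have "germ c E (fst z) {fst z} (gval c z) = germ c E (fst z') {fst z'} (gval c z')"
    by (simp only: assms(3))
  then show ?thesis
    unfolding pushD(3) [OF assms(1)] pushD(3) [OF assms(2)] .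
qed

text \<open>A germ at \<open>y\<close> is the whole image of a section over the open set
  \<open>{y}\<close>, which is one of the generating sets.\<close>

lemma push_tot: "tot (push c E) = discrete_topology (pts (push c E))"
proof -
  have "openin (tot (push c E)) {z}" if z: "z \<in> pts (push c E)" for z
  proof -
    obtain y s where ys: "y \<in> YY" "s \<in> IS E {y}" "z = germ c E y {y} s"
      using z unfolding pts_push by blast
    have "openin (tot (push c E)) ((\<lambda>y. germ c E y {y} s) ` {y})"
      unfolding push_def gsheaf.simps by (intro topology_generated_by_Basis) (use ys tgt_open in blast)
    then show ?thesis using ys by simp
  qed
  then show ?thesis by (metis discrete_topology_unique)
qed

lemma push_map_props:
  assumes f: "f \<in> sheaf_hom (src c) E E'" and z: "z \<in> pts (push c E)"
  shows "push_map c E E' f z \<in> pts (push c E')" "fst (push_map c E E' f z) = fst z"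
    "gval c (push_map c E E' f z) = (\<lambda>x\<in>preim c {fst z}. f (gval c z x))"
proof -
  let ?V = "germ_dom z" and ?s = "\<lambda>x\<in>preim c (germ_dom z). f (germ_sec z x)"
  note P = pushD [OF z] and F = sheaf_homD [OF f] and S = IS_D [OF pushD(6) [OF z]]
  have "continuous_map (subtopology XT (preim c ?V)) (tot E') (f \<circ> germ_sec z)"
    using S(2) F(2) by (rule continuous_map_compose)
  then have "continuous_map (subtopology XT (preim c ?V)) (tot E') ?s"
    by (rule continuous_map_eq) simp
  then have s: "?s \<in> IS E' ?V"
    unfolding IS_iff using S(3,4,5) F(4,5) preim_ker by (auto simp: in_ker)
  have eq: "push_map c E E' f z = germ c E' (fst z) ?V ?s"
    using z by (simp add: push_map_def)
  show "push_map c E E' f z \<in> pts (push c E')" "fst (push_map c E E' f z) = fst z"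
    unfolding eq using germ_in_push [OF s P(5,4)] by simp_all
  have "preim c {fst z} \<subseteq> preim c ?V" using P(5) by (auto simp: in_preim)
  then show "gval c (push_map c E E' f z) = (\<lambda>x\<in>preim c {fst z}. f (gval c z x))"
    unfolding eq gval_germ [OF s P(5,4)] by (auto simp: gval_def restrict_def fun_eq_iff)
qed

lemma sproj_push [simp]: "sproj (push c E) = fst"
  by (simp add: push_def)

section \<open>Module operations and group action on germs\<close>

context
  fixes E :: "('g, 'x, 'e) gsheaf"
  assumes E: "is_gsheaf (src c) E"
begin

lemma IS_add:
  assumes s: "s \<in> IS E V" and t: "t \<in> IS E V"
  shows "(\<lambda>x\<in>preim c V. sadd E (s x) (t x)) \<in> IS E V"
proof -
  have "continuous_map (subtopology XT (preim c V)) (tot E) (\<lambda>x. sadd E (s x) (t x))"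
    by (rule continuous_sadd [OF E IS_D(2) [OF s] IS_D(2) [OF t]]) (simp add: IS_D(3) [OF s] IS_D(3) [OF t])
  then have 1: "continuous_map (subtopology XT (preim c V)) (tot E) (\<lambda>x\<in>preim c V. sadd E (s x) (t x))"
    by (rule continuous_map_eq) simp
  have 2: "sadd E (s x) (t x) \<in> fib E x" if "x \<in> preim c V" for x
    using rat_stalkD(3) [OF gsheafD(5) [OF E] IS_D(6) [OF s that] IS_D(6) [OF t that]] that by (simp add: in_preim)
  have 3: "sadd E (s (ax n x)) (t (ax n x)) = sact E n (sadd E (s x) (t x))" if "n \<in> ker" "x \<in> preim c V" for n x
    using gsheafD(12) [OF E _ _ IS_D(6) [OF s that(2)] IS_D(6) [OF t that(2)], of n] that IS_D(4) [OF s that] IS_D(4) [OF t that]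
    by (simp add: in_ker in_preim)
  show ?thesis
    unfolding IS_iff using 1 2 3 preim_ker by simp
qed

lemma IS_scale:
  assumes s: "s \<in> IS E V"
  shows "(\<lambda>x\<in>preim c V. sscale E r (s x)) \<in> IS E V"
proof -
  have "continuous_map (subtopology XT (preim c V)) (tot E) (sscale E r \<circ> s)"
    by (rule continuous_map_compose [OF IS_D(2) [OF s] gsheafD(6) [OF E]])
  then have 1: "continuous_map (subtopology XT (preim c V)) (tot E) (\<lambda>x\<in>preim c V. sscale E r (s x))"
    by (rule continuous_map_eq) simp
  have 2: "sscale E r (s x) \<in> fib E x" if "x \<in> preim c V" for x
    using rat_stalkD(4) [OF gsheafD(5) [OF E] IS_D(6) [OF s that]] that by (simp add: in_preim)
  have 3: "sscale E r (s (ax n x)) = sact E n (sscale E r (s x))" if "n \<in> ker" "x \<in> preim c V" for n x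
    using gsheafD(13) [OF E _ _ IS_D(6) [OF s that(2)], of n] that IS_D(4) [OF s that]
    by (simp add: in_ker in_preim)
  show ?thesis
    unfolding IS_iff using 1 2 3 preim_ker by simp
qed

lemma IS_zero: "(\<lambda>x\<in>preim c V. szero E x) \<in> IS E V"
proof -
  have "continuous_map (subtopology XT (preim c V)) (tot E) (szero E)"
    by (rule continuous_map_from_subtopology [OF continuous_szero [OF E]])
  then have 1: "continuous_map (subtopology XT (preim c V)) (tot E) (\<lambda>x\<in>preim c V. szero E x)"
    by (rule continuous_map_eq) simp
  have 3: "szero E (ax n x) = sact E n (szero E x)" if "n \<in> ker" "x \<in> preim c V" for n x
    using linear_zero [OF gsheafD(9) [OF E, of n x] gsheafD(5) [OF E] gsheafD(5) [OF E]] that ax_in [of n x]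
    by (simp add: in_ker in_preim)
  show ?thesis
    unfolding IS_iff using 1 3 preim_ker rat_stalkD(2) [OF gsheafD(5) [OF E]] by (auto simp: in_preim)
qed

lemma preim_act:
  assumes g: "g \<in> carrier A" and V: "V \<subseteq> YY"
  shows "ax g ` preim c V = preim c (ay (ghom c g) ` V)"
proof
  show "ax g ` preim c V \<subseteq> preim c (ay (ghom c g) ` V)"
    using g smap_act ax_in by (auto simp: in_preim)
  show "preim c (ay (ghom c g) ` V) \<subseteq> ax g ` preim c V"
  proof
    fix x assume "x \<in> preim c (ay (ghom c g) ` V)"
    then obtain y where y: "x \<in> topspace XT" "y \<in> V" "smap c x = ay (ghom c g) y" by (auto simp: in_preim)
    have "smap c (ax (inv\<^bsub>A\<^esub> g) x) = y"
      using smap_act [of "inv\<^bsub>A\<^esub> g" x] y g V ay_inv(1) [of "ghom c g" y] by (auto simp: subset_iff)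
    then have "ax (inv\<^bsub>A\<^esub> g) x \<in> preim c V" using y g ax_in by (simp add: in_preim)
    then show "x \<in> ax g ` preim c V" using ax_inv(2) [OF g y(1)] by (metis image_eqI)
  qed
qed

lemma IS_act:
  assumes g: "g \<in> carrier A" and s: "s \<in> IS E V" and V: "V \<subseteq> YY"
  shows "section_act (src c) E g (preim c V) s \<in> IS E (ay (ghom c g) ` V)"
proof -
  let ?W = "ay (ghom c g) ` V"
  have eq: "section_act (src c) E g (preim c V) s = (\<lambda>x\<in>preim c ?W. sact E g (s (ax (inv\<^bsub>A\<^esub> g) x)))"
    unfolding section_act_def preim_act [OF g V] ..
  have bk: "ax (inv\<^bsub>A\<^esub> g) x \<in> preim c V" if x: "x \<in> preim c ?W" for x
  proof -
    obtain x' where "x' \<in> preim c V" "x = ax g x'" using x unfolding preim_act [OF g V, symmetric] by auto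
    then show ?thesis using ax_inv(1) [OF g, of x'] by (simp add: in_preim)
  qed
  have "continuous_map (subtopology XT (preim c ?W)) (subtopology XT (preim c V)) (ax (inv\<^bsub>A\<^esub> g))"
    unfolding continuous_map_in_subtopology using bk ax_cont [of "inv\<^bsub>A\<^esub> g"] g
    by (auto intro: continuous_map_from_subtopology)
  from continuous_map_compose [OF continuous_map_compose [OF this IS_D(2) [OF s]] continuous_sact [OF E, of g]]
  have "continuous_map (subtopology XT (preim c ?W)) (tot E) (sact E g \<circ> (s \<circ> ax (inv\<^bsub>A\<^esub> g)))"
    using g src_top by simp
  then have 1: "continuous_map (subtopology XT (preim c ?W)) (tot E) (\<lambda>x\<in>preim c ?W. sact E g (s (ax (inv\<^bsub>A\<^esub> g) x)))"
    by (rule continuous_map_eq) simp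
  have 2: "sproj E (sact E g (s (ax (inv\<^bsub>A\<^esub> g) x))) = x" if "x \<in> preim c ?W" for x
    using gsheafD(4) [OF E g IS_D(5) [OF s bk [OF that]]] IS_D(3) [OF s bk [OF that]] ax_inv(2) [OF g, of x] that
    by (simp add: in_preim)
  have 3: "sact E g (s (ax (inv\<^bsub>A\<^esub> g) (ax n x))) = sact E n (sact E g (s (ax (inv\<^bsub>A\<^esub> g) x)))"
    if n: "n \<in> ker" and x: "x \<in> preim c ?W" for n x
  proof -
    \<comment> \<open>The kernel is normal: moving \<open>n\<close> past \<open>g\<close> turns it
      into a conjugate that again lies in the kernel, under which \<open>s\<close> is
      invariant.\<close>
    let ?m = "inv\<^bsub>A\<^esub> g \<otimes>\<^bsub>A\<^esub> n \<otimes>\<^bsub>A\<^esub> g"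
    have nA: "n \<in> carrier A" and xX: "x \<in> topspace XT" using n x by (simp_all add: in_ker in_preim)
    have m: "?m \<in> ker" using n g by (simp add: in_ker)
    have mA: "?m \<in> carrier A" using nA g by simp
    have gm: "g \<otimes>\<^bsub>A\<^esub> ?m = n \<otimes>\<^bsub>A\<^esub> g"
      using nA g by (simp add: A.m_assoc [symmetric])
    have "ax (inv\<^bsub>A\<^esub> g) (ax n x) = ax (?m \<otimes>\<^bsub>A\<^esub> inv\<^bsub>A\<^esub> g) x"
      using nA g xX by (simp add: A.m_assoc ax_mult)
    also have "\<dots> = ax ?m (ax (inv\<^bsub>A\<^esub> g) x)"
      using mA g xX by (simp add: ax_mult)
    finally have "s (ax (inv\<^bsub>A\<^esub> g) (ax n x)) = sact E ?m (s (ax (inv\<^bsub>A\<^esub> g) x))"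
      using IS_D(4) [OF s m bk [OF x]] by simp
    then have "sact E g (s (ax (inv\<^bsub>A\<^esub> g) (ax n x))) = sact E (g \<otimes>\<^bsub>A\<^esub> ?m) (s (ax (inv\<^bsub>A\<^esub> g) x))"
      using gsheafD(8) [OF E g mA IS_D(5) [OF s bk [OF x]]] by simp
    then show ?thesis
      unfolding gm using gsheafD(8) [OF E nA g IS_D(5) [OF s bk [OF x]]] by simp
  qed
  show ?thesis
    unfolding eq IS_iff using 1 2 3 preim_ker by simp
qed

lemma push_add:
  assumes z: "z \<in> pts (push c E)" "z' \<in> pts (push c E)" "fst z' = fst z"
  shows "sadd (push c E) z z' \<in> pts (push c E)" "fst (sadd (push c E) z z') = fst z"
    "\<And>x. x \<in> preim c {fst z} \<Longrightarrow> gval c (sadd (push c E) z z') x = sadd E (gval c z x) (gval c z' x)"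
proof -
  let ?V = "germ_dom z \<inter> germ_dom z'"
  have V: "fst z \<in> ?V" "?V \<subseteq> YY" using pushD(4,5) [OF z(1)] pushD(4,5) [OF z(2)] z(3) by auto
  let ?s = "\<lambda>x\<in>preim c ?V. sadd E (germ_sec z x) (germ_sec z' x)"
  have "(\<lambda>x\<in>preim c ?V. sadd E (restrict (germ_sec z) (preim c ?V) x) (restrict (germ_sec z') (preim c ?V) x)) \<in> IS E ?V"
    by (intro IS_add IS_restrict [OF pushD(6)] z) auto
  then have s: "?s \<in> IS E ?V"
    by (simp cong: restrict_cong)
  have eq: "sadd (push c E) z z' = germ c E (fst z) ?V ?s" by (simp add: push_def)
  show "sadd (push c E) z z' \<in> pts (push c E)" "fst (sadd (push c E) z z') = fst z"
    unfolding eq using germ_in_push [OF s V] by simp_all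
  show "gval c (sadd (push c E) z z') x = sadd E (gval c z x) (gval c z' x)" if "x \<in> preim c {fst z}" for x
    using that V(1) z(3) unfolding eq gval_germ [OF s V] by (auto simp: gval_def in_preim)
qed

lemma push_scale:
  assumes z: "z \<in> pts (push c E)"
  shows "sscale (push c E) r z \<in> pts (push c E)" "fst (sscale (push c E) r z) = fst z"
    "\<And>x. x \<in> preim c {fst z} \<Longrightarrow> gval c (sscale (push c E) r z) x = sscale E r (gval c z x)"
proof -
  let ?V = "germ_dom z" and ?s = "\<lambda>x\<in>preim c (germ_dom z). sscale E r (germ_sec z x)"
  note V = pushD(5,4) [OF z]
  have s: "?s \<in> IS E ?V" by (rule IS_scale [OF pushD(6) [OF z]])
  have eq: "sscale (push c E) r z = germ c E (fst z) ?V ?s" by (simp add: push_def)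
  show "sscale (push c E) r z \<in> pts (push c E)" "fst (sscale (push c E) r z) = fst z"
    unfolding eq using germ_in_push [OF s V] by simp_all
  show "gval c (sscale (push c E) r z) x = sscale E r (gval c z x)" if "x \<in> preim c {fst z}" for x
    using that V(1) unfolding eq gval_germ [OF s V] by (auto simp: gval_def in_preim)
qed

lemma push_zero:
  assumes y: "y \<in> YY"
  shows "szero (push c E) y \<in> pts (push c E)" "fst (szero (push c E) y) = y"
    "\<And>x. x \<in> preim c {y} \<Longrightarrow> gval c (szero (push c E) y) x = szero E x"
proof -
  let ?s = "\<lambda>x\<in>preim c YY. szero E x"
  have s: "?s \<in> IS E YY" by (rule IS_zero)
  have eq: "szero (push c E) y = germ c E y YY ?s" by (simp add: push_def)
  show "szero (push c E) y \<in> pts (push c E)" "fst (szero (push c E) y) = y"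
    unfolding eq using germ_in_push [OF s y] by simp_all
  show "gval c (szero (push c E) y) x = szero E x" if "x \<in> preim c {y}" for x
    using that y unfolding eq gval_germ [OF s y order_refl] by (auto simp: in_preim)
qed

text \<open>The action on germs is defined with one chosen lift of \<open>h\<close>. The value
  formula is stated for every lift, so that later arguments may use whichever lift is at
  hand.\<close>

lemma push_act:
  assumes z: "z \<in> pts (push c E)" and h: "h \<in> carrier B"
  shows "sact (push c E) h z \<in> pts (push c E)" "fst (sact (push c E) h z) = ay h (fst z)"
    "\<And>g x. g \<in> carrier A \<Longrightarrow> ghom c g = h \<Longrightarrow> x \<in> preim c {ay h (fst z)} \<Longrightarrow>
      gval c (sact (push c E) h z) x = sact E g (gval c z (ax (inv\<^bsub>A\<^esub> g) x))"
proof -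
  define g0 where "g0 = (SOME g. g \<in> carrier A \<and> ghom c g = h)"
  have g0: "g0 \<in> carrier A" "ghom c g0 = h"
    unfolding g0_def using someI_ex [OF lift_ex [OF h]] by simp_all
  let ?V = "germ_dom z" and ?s = "section_act (src c) E g0 (preim c (germ_dom z)) (germ_sec z)"
  note V = pushD(5,4) [OF z]
  have s: "?s \<in> IS E (ay h ` ?V)" using IS_act [OF g0(1) pushD(6) [OF z] V(2)] g0(2) by simp
  have V': "ay h (fst z) \<in> ay h ` ?V" "ay h ` ?V \<subseteq> YY" using V h tgt_act by auto
  have eq: "sact (push c E) h z = germ c E (ay h (fst z)) (ay h ` ?V) ?s"
    by (simp add: push_def g0_def Let_def)
  show "sact (push c E) h z \<in> pts (push c E)" "fst (sact (push c E) h z) = ay h (fst z)"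
    unfolding eq using germ_in_push [OF s V'] by simp_all
  fix g x assume g: "g \<in> carrier A" "ghom c g = h" and x: "x \<in> preim c {ay h (fst z)}"
  have xX: "x \<in> topspace XT" and qx: "smap c x = ay h (fst z)" using x by (simp_all add: in_preim)
  have fib: "ax (inv\<^bsub>A\<^esub> g) x \<in> preim c {fst z}" if "g \<in> carrier A" "ghom c g = h" for g
    using that xX qx ax_in [of "inv\<^bsub>A\<^esub> g" x] smap_act [of "inv\<^bsub>A\<^esub> g" x] ay_inv(1) [OF h pushD(1) [OF z]]
    by (simp add: in_preim)
  have "x \<in> preim c (ay h ` ?V)" using x V' by (auto simp: in_preim)
  then have "?s x = sact E g0 (germ_sec z (ax (inv\<^bsub>A\<^esub> g0) x))"
    unfolding section_act_def preim_act [OF g0(1) V(2)] g0(2) by simp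
  then have 1: "gval c (sact (push c E) h z) x = sact E g0 (gval c z (ax (inv\<^bsub>A\<^esub> g0) x))"
    unfolding eq gval_germ [OF s V'] using x fib [OF g0] by (simp add: gval_def)
  \<comment> \<open>Two lifts of \<open>h\<close> differ by this element of the kernel, and the
    section is equivariant under the kernel.\<close>
  let ?n = "inv\<^bsub>A\<^esub> g0 \<otimes>\<^bsub>A\<^esub> g"
  have n: "?n \<in> ker" "?n \<in> carrier A" using g g0 h by (simp_all add: in_ker)
  have "ax ?n (ax (inv\<^bsub>A\<^esub> g) x) = ax (inv\<^bsub>A\<^esub> g0) x"
    using ax_mult [of ?n "inv\<^bsub>A\<^esub> g" x] g(1) g0(1) xX by (simp add: A.m_assoc)
  then have "gval c z (ax (inv\<^bsub>A\<^esub> g0) x) = sact E ?n (gval c z (ax (inv\<^bsub>A\<^esub> g) x))"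
    using IS_D(4) [OF pushD(2) [OF z] n(1) fib [OF g]] by simp
  moreover have "g0 \<otimes>\<^bsub>A\<^esub> ?n = g" using g(1) g0(1) by (simp add: A.m_assoc [symmetric])
  ultimately show "gval c (sact (push c E) h z) x = sact E g (gval c z (ax (inv\<^bsub>A\<^esub> g) x))"
    unfolding 1 using gsheafD(8) [OF E g0(1) n(2) IS_D(5) [OF pushD(2) [OF z] fib [OF g]]] by simp
qed

lemma gval_fib: "z \<in> pts (push c E) \<Longrightarrow> x \<in> preim c {fst z} \<Longrightarrow> gval c z x \<in> fib E x"
  by (rule IS_D(6) [OF pushD(2)])

text \<open>Each axiom is inherited from \<open>E\<close> at every point of the fibre;
  \<open>gval_inj\<close> turns an identity of germs into these pointwise identities.\<close>

lemma push_stalk: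
  assumes y: "y \<in> YY"
  shows "rat_stalk (push c E) y"
  unfolding rat_stalk_def in_fib_iff sproj_push
proof (intro conjI ballI allI)
  let ?P = "push c E"
  have R: "rat_stalk E x" if "x \<in> preim c V" for x V
    using gsheafD(5) [OF E] that by (simp add: in_preim)
  show "szero ?P y \<in> pts ?P" "fst (szero ?P y) = y" using push_zero [OF y] by simp_all
  fix a b d assume "a \<in> fib ?P y" "b \<in> fib ?P y" "d \<in> fib ?P y"
  then have a: "a \<in> pts ?P" "fst a = y" and b: "b \<in> pts ?P" "fst b = y" and d: "d \<in> pts ?P" "fst d = y" by simp_all
  note V = gval_fib [OF a(1), unfolded a(2)] gval_fib [OF b(1), unfolded b(2)] gval_fib [OF d(1), unfolded d(2)]
  fix r s
  note ab = push_add [OF a(1) b(1), unfolded a(2) b(2), OF refl]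
    and ba = push_add [OF b(1) a(1), unfolded a(2) b(2), OF refl]
    and bd = push_add [OF b(1) d(1), unfolded d(2) b(2), OF refl]
    and ra = push_scale [OF a(1), where r = r, unfolded a(2)] and sa = push_scale [OF a(1), where r = s, unfolded a(2)]
    and rb = push_scale [OF b(1), where r = r, unfolded b(2)] and z = push_zero [OF y]
  note rsa = push_scale [OF a(1), where r = "r + s", unfolded a(2)] push_scale [OF a(1), where r = "r * s", unfolded a(2)]
  show "sadd ?P a b \<in> pts ?P" "fst (sadd ?P a b) = y" "sscale ?P r a \<in> pts ?P" "fst (sscale ?P r a) = y"
    using ab ra by simp_all
  note ab_d = push_add [OF ab(1) d(1), unfolded ab(2) d(2), OF refl]
    and a_bd = push_add [OF a(1) bd(1), unfolded bd(2) a(2), OF refl]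
  show "sadd ?P (sadd ?P a b) d = sadd ?P a (sadd ?P b d)"
    by (rule gval_inj [where E = E]) (simp_all add: ab_d a_bd, simp add: ab bd rat_stalkD(5) [OF R V] del: in_fib_iff)
  show "sadd ?P a b = sadd ?P b a"
    by (rule gval_inj [where E = E]) (simp_all add: ab ba, simp add: rat_stalkD(6) [OF R V(1,2)] del: in_fib_iff)
  note za = push_add [OF z(1) a(1), unfolded z(2) a(2), OF refl]
  show "sadd ?P (szero ?P y) a = a"
    by (rule gval_inj [where E = E]) (simp_all add: za a, simp add: z rat_stalkD(7) [OF R V(1)] del: in_fib_iff)
  note oa = push_scale [OF a(1), where r = 1, unfolded a(2)] push_scale [OF a(1), where r = 0, unfolded a(2)]
  show "sscale ?P 1 a = a"
    by (rule gval_inj [where E = E]) (simp_all add: oa a, simp add: rat_stalkD(8) [OF R V(1)] del: in_fib_iff)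
  show "sscale ?P 0 a = szero ?P y"
    by (rule gval_inj [where E = E]) (simp_all add: oa z, simp add: rat_stalkD(9) [OF R V(1)] del: in_fib_iff)
  note ra_sa = push_add [OF ra(1) sa(1), unfolded ra(2) sa(2), OF refl]
  show "sscale ?P (r + s) a = sadd ?P (sscale ?P r a) (sscale ?P s a)"
    by (rule gval_inj [where E = E]) (simp_all add: rsa ra_sa, simp add: ra sa rat_stalkD(10) [OF R V(1)] del: in_fib_iff)
  note r_sa = push_scale [OF sa(1), where r = r, unfolded sa(2)]
  show "sscale ?P (r * s) a = sscale ?P r (sscale ?P s a)"
    by (rule gval_inj [where E = E]) (simp_all add: rsa r_sa, simp add: sa rat_stalkD(11) [OF R V(1)] del: in_fib_iff)
  note r_ab = push_scale [OF ab(1), where r = r, unfolded ab(2)]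
    and ra_rb = push_add [OF ra(1) rb(1), unfolded ra(2) rb(2), OF refl]
  show "sscale ?P r (sadd ?P a b) = sadd ?P (sscale ?P r a) (sscale ?P r b)"
    by (rule gval_inj [where E = E]) (simp_all add: r_ab ra_rb, simp add: ab ra rb rat_stalkD(12) [OF R V(1,2)] del: in_fib_iff)
qed

theorem push_gsheaf: "is_gsheaf (tgt c) (push c E)"
proof (rule discrete_gsheafI [OF discrete])
  let ?P = "push c E"
  show "tot ?P = discrete_topology (pts ?P)" by (rule push_tot)
  show "sproj ?P z \<in> YY" if "z \<in> pts ?P" for z using pushD(1) [OF that] by simp
  show "sact ?P h z \<in> pts ?P" "sproj ?P (sact ?P h z) = ay h (sproj ?P z)" if "h \<in> carrier B" "z \<in> pts ?P" for h z
    using push_act [OF that(2,1)] by simp_all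
  have fibre: "ax (inv\<^bsub>A\<^esub> g) x \<in> preim c {y}" if "g \<in> carrier A" "x \<in> preim c {ay (ghom c g) y}" "y \<in> YY" for g x y
    using that ax_in [of "inv\<^bsub>A\<^esub> g" x] smap_act [of "inv\<^bsub>A\<^esub> g" x] ay_inv(1) [of "ghom c g" y]
    by (simp add: in_preim)
  show "sact ?P \<one>\<^bsub>B\<^esub> z = z" if z: "z \<in> pts ?P" for z
  proof (rule gval_inj)
    note P = push_act [OF z B.one_closed]
    show "sact ?P \<one>\<^bsub>B\<^esub> z \<in> pts ?P" "fst (sact ?P \<one>\<^bsub>B\<^esub> z) = fst z"
      using P(1,2) tgt_one [OF pushD(1) [OF z]] by simp_all
    then show "gval c (sact ?P \<one>\<^bsub>B\<^esub> z) x = gval c z x" if "x \<in> preim c {fst (sact ?P \<one>\<^bsub>B\<^esub> z)}" for x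
      using P(3) [of "\<one>\<^bsub>A\<^esub>" x] that gsheafD(7) [OF E] gval_fib [OF z, of x] P(2) tgt_one [OF pushD(1) [OF z]] ax_one
      by (simp add: in_preim)
  qed (rule z)
  show "sact ?P (h \<otimes>\<^bsub>B\<^esub> k) z = sact ?P h (sact ?P k z)" if h: "h \<in> carrier B" "k \<in> carrier B" and z: "z \<in> pts ?P" for h k z
  proof (rule gval_inj)
    note P = push_act [OF z B.m_closed [OF h]] and Q = push_act [OF z h(2)]
    note R = push_act [OF Q(1) h(1), unfolded Q(2)]
    note y = pushD(1) [OF z]
    show "sact ?P (h \<otimes>\<^bsub>B\<^esub> k) z \<in> pts ?P" "sact ?P h (sact ?P k z) \<in> pts ?P"
      "fst (sact ?P (h \<otimes>\<^bsub>B\<^esub> k) z) = fst (sact ?P h (sact ?P k z))"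
      using P(1,2) R(1,2) tgt_mult [OF h y] by simp_all
    fix x assume x: "x \<in> preim c {fst (sact ?P (h \<otimes>\<^bsub>B\<^esub> k) z)}"
    obtain g l where gl: "g \<in> carrier A" "ghom c g = h" "l \<in> carrier A" "ghom c l = k"
      using lift_ex [OF h(1)] lift_ex [OF h(2)] by auto
    have x1: "x \<in> preim c {ay (h \<otimes>\<^bsub>B\<^esub> k) (fst z)}" and x2: "x \<in> preim c {ay h (ay k (fst z))}"
      using x P(2) tgt_mult [OF h y] by simp_all
    have x3: "ax (inv\<^bsub>A\<^esub> g) x \<in> preim c {ay k (fst z)}"
      using fibre [of g x "ay k (fst z)"] gl x2 tgt_act [OF h(2) y] by simp
    have x4: "ax (inv\<^bsub>A\<^esub> l) (ax (inv\<^bsub>A\<^esub> g) x) \<in> preim c {fst z}"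
      using fibre [of l "ax (inv\<^bsub>A\<^esub> g) x" "fst z"] gl x3 y by simp
    have "ax (inv\<^bsub>A\<^esub> (g \<otimes>\<^bsub>A\<^esub> l)) x = ax (inv\<^bsub>A\<^esub> l) (ax (inv\<^bsub>A\<^esub> g) x)"
      using gl x by (simp add: A.inv_mult_group ax_mult in_preim)
    then show "gval c (sact ?P (h \<otimes>\<^bsub>B\<^esub> k) z) x = gval c (sact ?P h (sact ?P k z)) x"
      using P(3) [of "g \<otimes>\<^bsub>A\<^esub> l" x] R(3) [OF gl(1,2) x2] Q(3) [OF gl(3,4) x3] gl x1
        gsheafD(8) [OF E gl(1,3)] gval_fib [OF z x4] by simp
  qed
  show "rat_stalk ?P y" if "y \<in> YY" for y by (rule push_stalk [OF that])
  show "sact ?P h (sadd ?P a b) = sadd ?P (sact ?P h a) (sact ?P h b)"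
    if h: "h \<in> carrier B" and y: "y \<in> YY" and ab: "a \<in> fib ?P y" "b \<in> fib ?P y" for h y a b
  proof -
    have a: "a \<in> pts ?P" "fst a = y" and b: "b \<in> pts ?P" "fst b = y" using ab by simp_all
    obtain g where g: "g \<in> carrier A" "ghom c g = h" using lift_ex [OF h] by auto
    note s = push_add [OF a(1) b(1), unfolded a(2) b(2), OF refl]
    note hs = push_act [OF s(1) h, unfolded s(2)] and ha = push_act [OF a(1) h, unfolded a(2)] and hb = push_act [OF b(1) h, unfolded b(2)]
    note t = push_add [OF ha(1) hb(1), unfolded ha(2) hb(2), OF refl]
    show ?thesis
    proof (rule gval_inj [OF hs(1) t(1)])
      fix x assume "x \<in> preim c {fst (sact ?P h (sadd ?P a b))}"
      then have x: "x \<in> preim c {ay h y}" unfolding hs(2) .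
      then have x': "ax (inv\<^bsub>A\<^esub> g) x \<in> preim c {y}" using fibre [of g x y] g y by simp
      then have "ax (inv\<^bsub>A\<^esub> g) x \<in> topspace XT" by (simp add: in_preim)
      then show "gval c (sact ?P h (sadd ?P a b)) x = gval c (sadd ?P (sact ?P h a) (sact ?P h b)) x"
        using hs(3) [OF g x] t(3) [OF x] ha(3) [OF g x] hb(3) [OF g x] s(3) [OF x']
          gsheafD(12) [OF E g(1) _ gval_fib [OF a(1), unfolded a(2), OF x'] gval_fib [OF b(1), unfolded b(2), OF x']]
        by simp
    qed (simp add: hs(2) t(2))
  qed
  show "sact ?P h (sscale ?P r a) = sscale ?P r (sact ?P h a)"
    if h: "h \<in> carrier B" and y: "y \<in> YY" and ab: "a \<in> fib ?P y" for h y r a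
  proof -
    have a: "a \<in> pts ?P" "fst a = y" using ab by simp_all
    obtain g where g: "g \<in> carrier A" "ghom c g = h" using lift_ex [OF h] by auto
    note s = push_scale [OF a(1), where r = r, unfolded a(2)]
    note hs = push_act [OF s(1) h, unfolded s(2)] and ha = push_act [OF a(1) h, unfolded a(2)]
    note t = push_scale [OF ha(1), where r = r, unfolded ha(2)]
    show ?thesis
    proof (rule gval_inj [OF hs(1) t(1)])
      fix x assume "x \<in> preim c {fst (sact ?P h (sscale ?P r a))}"
      then have x: "x \<in> preim c {ay h y}" unfolding hs(2) .
      then have x': "ax (inv\<^bsub>A\<^esub> g) x \<in> preim c {y}" using fibre [of g x y] g y by simp
      then have "ax (inv\<^bsub>A\<^esub> g) x \<in> topspace XT" by (simp add: in_preim)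
      then show "gval c (sact ?P h (sscale ?P r a)) x = gval c (sscale ?P r (sact ?P h a)) x"
        using hs(3) [OF g x] t(3) [OF x] ha(3) [OF g x] s(3) [OF x']
          gsheafD(13) [OF E g(1) _ gval_fib [OF a(1), unfolded a(2), OF x']]
        by simp
    qed (simp add: hs(2) t(2))
  qed
qed

end

subsection \<open>Adjoints\<close>

lemma pts_pull: "(x, d) \<in> pts (pull c D) \<longleftrightarrow> x \<in> topspace XT \<and> d \<in> pts D \<and> smap c x = sproj D d"
  by (auto simp: pull_def)

text \<open>Any local section through \<open>d\<close> gives the same germ, since only its value at
  the base point of \<open>d\<close> counts. The section defined on that single point shows that
  there is one to choose.\<close>

lemma adj_unit_props:
  assumes D: "is_gsheaf (tgt c) D" and d: "d \<in> pts D"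
  shows "adj_unit c D d \<in> pts (push c (pull c D))" "fst (adj_unit c D d) = sproj D d"
    "\<And>x. x \<in> preim c {sproj D d} \<Longrightarrow> gval c (adj_unit c D d) x = (x, d)"
proof -
  let ?y = "sproj D d"
  define P where "P = (\<lambda>(V, t). openin (space_top (tgt c)) V \<and> ?y \<in> V \<and> t \<in> sections (tgt c) D V \<and> t ?y = d)"
  have y: "?y \<in> YY" by (rule gsheafD(3) [OF D d])
  have "subtopology (space_top (tgt c)) {?y} = discrete_topology {?y}"
    by (subst tgt_space) (use y in \<open>simp add: subtopology_discrete_topology\<close>)
  then have "P ({?y}, \<lambda>x\<in>{?y}. d)"
    using y d by (simp add: P_def tgt_open sections_def)
  then have "P (Eps P)" by (rule someI)
  then obtain V t where Vt: "Eps P = (V, t)" "V \<subseteq> YY" "?y \<in> V" "t \<in> sections (tgt c) D V" "t ?y = d"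
    by (cases "Eps P") (simp add: P_def tgt_open)
  let ?s = "\<lambda>x\<in>preim c V. (x, t (smap c x))"
  have eq: "adj_unit c D d = germ c (pull c D) ?y V ?s"
    using d Vt(1) by (simp add: adj_unit_def P_def Let_def)
  have tc: "continuous_map (subtopology (space_top (tgt c)) V) (tot D) t" and tp: "\<forall>y\<in>V. sproj D (t y) = y"
    using Vt(4) by (auto simp: sections_def)
  have "continuous_map (subtopology XT (preim c V)) (subtopology (space_top (tgt c)) V) (smap c)"
    unfolding continuous_map_in_subtopology using smap_cont
    by (auto simp: in_preim intro: continuous_map_from_subtopology)
  from continuous_map_compose [OF this tc]
  have 1: "continuous_map (subtopology XT (preim c V)) (tot D) (\<lambda>x. t (smap c x))" by (simp add: o_def)
  have 2: "continuous_map (subtopology XT (preim c V)) XT (\<lambda>x. x)"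
    by (rule continuous_map_from_subtopology) simp
  have "continuous_map (subtopology XT (preim c V)) (tot (pull c D)) (\<lambda>x. (x, t (smap c x)))"
    unfolding pull_def gsheaf.simps continuous_map_in_subtopology continuous_map_paired
    using 1 2 tp by (auto simp: in_preim)
  then have 3: "continuous_map (subtopology XT (preim c V)) (tot (pull c D)) ?s"
    by (rule continuous_map_eq) (simp add: in_preim)
  have tV: "t y \<in> pts D" if "y \<in> V" for y
    using tc that Vt(2) by (auto simp: continuous_map_def Pi_iff)
  have s: "?s \<in> IS (pull c D) V"
    unfolding IS_iff
  proof (intro conjI ballI)
    fix n x assume n: "n \<in> ker" and x: "x \<in> preim c V"
    then show "?s (ax n x) = sact (pull c D) n (?s x)"
      using preim_ker [OF n x] smap_ker [OF n, of x] gsheafD(7) [OF D tV, of "smap c x"]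
      by (simp add: pull_def) (simp add: in_preim in_ker)
  qed (use 3 in \<open>simp_all add: pull_def\<close>)
  show "adj_unit c D d \<in> pts (push c (pull c D))" "fst (adj_unit c D d) = ?y"
    unfolding eq using germ_in_push [OF s Vt(3,2)] by simp_all
  show "gval c (adj_unit c D d) x = (x, d)" if "x \<in> preim c {?y}" for x
    unfolding eq gval_germ [OF s Vt(3,2)] using that Vt(3,5) by (simp add: in_preim)
qed

lemma adjoint_to_push_props:
  assumes D: "is_gsheaf (tgt c) D" and f: "f \<in> sheaf_hom (src c) (pull c D) E" and d: "d \<in> pts D"
  shows "adjoint_to_push c D E f d \<in> pts (push c E)" "fst (adjoint_to_push c D E f d) = sproj D d"
    "\<And>x. x \<in> preim c {sproj D d} \<Longrightarrow> gval c (adjoint_to_push c D E f d) x = f (x, d)"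
proof -
  note u = adj_unit_props [OF D d]
  note m = push_map_props [OF f u(1), unfolded u(2)]
  have eq: "adjoint_to_push c D E f d = push_map c (pull c D) E f (adj_unit c D d)"
    using d by (simp add: adjoint_to_push_def compose_def)
  show "adjoint_to_push c D E f d \<in> pts (push c E)" "fst (adjoint_to_push c D E f d) = sproj D d"
    unfolding eq by (rule m)+
  show "gval c (adjoint_to_push c D E f d) x = f (x, d)" if "x \<in> preim c {sproj D d}" for x
    unfolding eq m(3) using that u(3) by simp
qed

lemma adjoint_from_pull_val:
  assumes h: "\<And>d. d \<in> pts D \<Longrightarrow> h d \<in> pts (push c E) \<and> fst (h d) = sproj D d"
    and xd: "(x, d) \<in> pts (pull c D)"
  shows "adjoint_from_pull c D E h (x, d) = gval c (h d) x"
proof -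
  have x: "x \<in> topspace XT" "d \<in> pts D" "smap c x = sproj D d" using xd by (simp_all add: pts_pull)
  then have "(x, h d) \<in> pts (pull c (push c E))" using h by (simp add: pts_pull)
  then show ?thesis
    using xd x h [OF x(2)] by (simp add: adjoint_from_pull_def compose_def pull_map_def adj_counit_def gval_simp)
qed

end

context discrete_change
begin

text \<open>On values over a fibre the adjoint sends \<open>d\<close> to the section
  \<open>x \<mapsto> f (x, d)\<close>, so each law follows from the same law for \<open>f\<close> at
  the points \<open>(x, d)\<close>.\<close>

lemma adjoint_to_push_hom:
  assumes D: "is_gsheaf (tgt c) D" and E: "is_gsheaf (src c) E" and f: "f \<in> sheaf_hom (src c) (pull c D) E"
  shows "adjoint_to_push c D E f \<in> sheaf_hom (tgt c) D (push c E)"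
proof (rule discrete_homI [OF discrete_gsheaf_tot [OF discrete D]])
  let ?P = "push c E" and ?a = "adjoint_to_push c D E f"
  note P = adjoint_to_push_props [OF D f]
  show "?a \<in> extensional (pts D)" by (simp add: adjoint_to_push_def)
  show "?a d \<in> pts ?P" "sproj ?P (?a d) = sproj D d" if "d \<in> pts D" for d
    using P [OF that] by simp_all
  have pf: "(x, d) \<in> fib (pull c D) x" if "d \<in> pts D" "x \<in> preim c {sproj D d}" for x d
    using that pts_pull [of x d D] by (simp add: in_preim) (simp add: pull_def)
  show "?a (sact D h d) = sact ?P h (?a d)" if h: "h \<in> carrier B" and d: "d \<in> pts D" for h d
  proof -
    obtain g where g: "g \<in> carrier A" "ghom c g = h" using lift_ex [OF h] by auto
    note hd = gsheafD(11) [OF D h d] and hp = gsheafD(4) [OF D h d]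
    note l = P [OF hd, unfolded hp] and r = push_act [OF E P(1) [OF d] h, unfolded P(2) [OF d]]
    show ?thesis
    proof (rule gval_inj [OF l(1) r(1)])
      fix x assume "x \<in> preim c {fst (?a (sact D h d))}"
      then have x: "x \<in> preim c {ay h (sproj D d)}" unfolding l(2) .
      have xX: "x \<in> topspace XT" using x by (simp add: in_preim)
      have x': "ax (inv\<^bsub>A\<^esub> g) x \<in> preim c {sproj D d}"
        using x g h ax_in [of "inv\<^bsub>A\<^esub> g" x] smap_act [of "inv\<^bsub>A\<^esub> g" x] ay_inv(1) [of "ghom c g" "sproj D d"] gsheafD(3) [OF D d]
        by (simp add: in_preim)
      have "f (sact (pull c D) g (ax (inv\<^bsub>A\<^esub> g) x, d)) = sact E g (f (ax (inv\<^bsub>A\<^esub> g) x, d))"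
        using sheaf_homD(5) [OF f g(1)] pf [OF d x'] by simp
      then show "gval c (?a (sact D h d)) x = gval c (sact ?P h (?a d)) x"
        using r(3) [OF g x] l(3) [OF x] P(3) [OF d x'] ax_inv(2) [OF g(1) xX] g(2) by (simp add: pull_def)
    qed (simp add: l(2) r(2))
  qed
  show "?a (sadd D a b) = sadd ?P (?a a) (?a b)" if y: "y \<in> YY" and ab: "a \<in> fib D y" "b \<in> fib D y" for y a b
  proof -
    have a: "a \<in> pts D" "sproj D a = y" and b: "b \<in> pts D" "sproj D b = y" using ab by simp_all
    have s: "sadd D a b \<in> pts D" "sproj D (sadd D a b) = y" using rat_stalkD(3) [OF gsheafD(5) [OF D y] ab] by simp_all
    note l = P [OF s(1), unfolded s(2)] and A = P [OF a(1), unfolded a(2)] and B = P [OF b(1), unfolded b(2)]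
    note r = push_add [OF E A(1) B(1), unfolded A(2) B(2), OF refl]
    show ?thesis
    proof (rule gval_inj [OF l(1) r(1)])
      fix x assume "x \<in> preim c {fst (?a (sadd D a b))}"
      then have x: "x \<in> preim c {y}" unfolding l(2) .
      have "f (sadd (pull c D) (x, a) (x, b)) = sadd E (f (x, a)) (f (x, b))"
        by (rule sheaf_homD(6) [OF f _ pf [OF a(1), unfolded a(2), OF x] pf [OF b(1), unfolded b(2), OF x]]) (use x in \<open>simp add: in_preim\<close>)
      then show "gval c (?a (sadd D a b)) x = gval c (sadd ?P (?a a) (?a b)) x"
        using l(3) [OF x] r(3) [OF x] A(3) [OF x] B(3) [OF x] by (simp add: pull_def)
    qed (simp add: l(2) r(2))
  qed
  show "?a (sscale D q a) = sscale ?P q (?a a)" if y: "y \<in> YY" and ab: "a \<in> fib D y" for y q a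
  proof -
    have a: "a \<in> pts D" "sproj D a = y" using ab by simp_all
    have s: "sscale D q a \<in> pts D" "sproj D (sscale D q a) = y" using rat_stalkD(4) [OF gsheafD(5) [OF D y] ab, of q] by simp_all
    note l = P [OF s(1), unfolded s(2)] and A = P [OF a(1), unfolded a(2)]
    note r = push_scale [OF E A(1), where r = q, unfolded A(2)]
    show ?thesis
    proof (rule gval_inj [OF l(1) r(1)])
      fix x assume "x \<in> preim c {fst (?a (sscale D q a))}"
      then have x: "x \<in> preim c {y}" unfolding l(2) .
      have "f (sscale (pull c D) q (x, a)) = sscale E q (f (x, a))"
        by (rule sheaf_homD(7) [OF f _ pf [OF a(1), unfolded a(2), OF x]]) (use x in \<open>simp add: in_preim\<close>)
      then show "gval c (?a (sscale D q a)) x = gval c (sscale ?P q (?a a)) x"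
        using l(3) [OF x] r(3) [OF x] A(3) [OF x] by (simp add: pull_def)
    qed (simp add: l(2) r(2))
  qed
qed

text \<open>Since a germ is an invariant section over one fibre, bijectivity of the adjoint means
  that every such section has the form \<open>x \<mapsto> f (x, d)\<close> for exactly one
  \<open>d\<close>. Over a discrete base this suffices for an isomorphism.\<close>

lemma adjoint_isoI:
  assumes D: "is_gsheaf (tgt c) D" and E: "is_gsheaf (src c) E" and f: "f \<in> sheaf_hom (src c) (pull c D) E"
    and inj: "\<And>a b. a \<in> pts D \<Longrightarrow> b \<in> pts D \<Longrightarrow> sproj D a = sproj D b \<Longrightarrow>
       (\<And>x. x \<in> preim c {sproj D b} \<Longrightarrow> f (x, a) = f (x, b)) \<Longrightarrow> a = b"
    and surj: "\<And>y t. y \<in> YY \<Longrightarrow> t \<in> IS E {y} \<Longrightarrow> \<exists>d\<in>fib D y. \<forall>x\<in>preim c {y}. f (x, d) = t x"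
  shows "sheaf_iso (tgt c) D (push c E) (adjoint_to_push c D E f)"
proof (rule discrete_sheaf_iso [OF discrete D push_gsheaf [OF E] adjoint_to_push_hom [OF D E f]])
  let ?a = "adjoint_to_push c D E f"
  note P = adjoint_to_push_props [OF D f]
  have "inj_on ?a (pts D)"
  proof (rule inj_onI)
    fix a b assume a: "a \<in> pts D" and b: "b \<in> pts D" and eq: "?a a = ?a b"
    have pe: "sproj D a = sproj D b" using P(2) [OF a] P(2) [OF b] eq by simp
    show "a = b"
    proof (rule inj [OF a b pe])
      fix x assume "x \<in> preim c {sproj D b}"
      then show "f (x, a) = f (x, b)" using P(3) [OF a, of x] P(3) [OF b, of x] eq pe by simp
    qed
  qed
  moreover have "pts (push c E) \<subseteq> ?a ` pts D"
  proof
    fix z assume z: "z \<in> pts (push c E)"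
    obtain d where d: "d \<in> fib D (fst z)" "\<forall>x\<in>preim c {fst z}. f (x, d) = gval c z x"
      using surj [OF pushD(1,2) [OF z]] ..
    have dp: "d \<in> pts D" "sproj D d = fst z" using d(1) by simp_all
    have "?a d = z"
      by (rule gval_inj [OF P(1) [OF dp(1)] z]) (use P [OF dp(1)] dp d(2) in auto)
    then show "z \<in> ?a ` pts D" using dp(1) by auto
  qed
  ultimately show "bij_betw ?a (pts D) (pts (push c E))"
    using P(1) by (auto simp: bij_betw_def)
qed

text \<open>The converse passage, by which an invertible adjoint structure map is later used: first
  for uniqueness, then for existence of a point with prescribed images.\<close>

lemma adjoint_isoD:
  assumes D: "is_gsheaf (tgt c) D" and f: "f \<in> sheaf_hom (src c) (pull c D) E"
    and iso: "sheaf_iso (tgt c) D (push c E) (adjoint_to_push c D E f)"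
  shows "\<And>a b. a \<in> pts D \<Longrightarrow> b \<in> pts D \<Longrightarrow> sproj D a = sproj D b \<Longrightarrow>
       (\<And>x. x \<in> preim c {sproj D b} \<Longrightarrow> f (x, a) = f (x, b)) \<Longrightarrow> a = b"
    and "\<And>y t. y \<in> YY \<Longrightarrow> t \<in> IS E {y} \<Longrightarrow> \<exists>d\<in>fib D y. \<forall>x\<in>preim c {y}. f (x, d) = t x"
proof -
  let ?a = "adjoint_to_push c D E f"
  note P = adjoint_to_push_props [OF D f] and bij = sheaf_iso_bij(2) [OF iso]
  show "a = b" if a: "a \<in> pts D" and b: "b \<in> pts D" and pe: "sproj D a = sproj D b"
    and eq: "\<And>x. x \<in> preim c {sproj D b} \<Longrightarrow> f (x, a) = f (x, b)" for a b
  proof -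
    have "?a a = ?a b"
      by (rule gval_inj [OF P(1) [OF a] P(1) [OF b]]) (use P [OF a] P [OF b] pe eq in simp_all)
    then show ?thesis by (rule inj_onD [OF bij_betw_imp_inj_on [OF bij] _ a b])
  qed
  show "\<exists>d\<in>fib D y. \<forall>x\<in>preim c {y}. f (x, d) = t x" if y: "y \<in> YY" and t: "t \<in> IS E {y}" for y t
  proof -
    have "germ c E y {y} t \<in> pts (push c E)" using germ_in_push [OF t] y by simp
    then have "germ c E y {y} t \<in> ?a ` pts D" using bij by (simp add: bij_betw_def)
    then obtain d where d: "germ c E y {y} t = ?a d" "d \<in> pts D" by (rule imageE)
    then have dy: "sproj D d = y" using P(2) [OF d(2)] d(1) [symmetric] by simp
    have "f (x, d) = t x" if "x \<in> preim c {y}" for x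
      using P(3) [OF d(2), of x] that dy gval_germ [OF t, of y] y d(1) [symmetric] by simp
    then show ?thesis using d(2) dy by (intro bexI [of _ d]) simp_all
  qed
qed

end

section \<open>The maps between quotients\<close>

context profin
begin

lemma QS_discrete: "N \<in> ON \<Longrightarrow> discrete_gspace (QS N)"
  by (simp add: discrete_gspace_def space_QS quotient_discrete)

lemma ghom_phi:
  assumes "M \<in> ON" "N \<in> ON" "M \<subseteq> N"
  shows "(\<lambda>C. N <#> C) \<in> hom (G Mod M) (G Mod N)"
    "(\<lambda>C. N <#> C) ` carrier (G Mod M) = carrier (G Mod N)"
proof -
  show "(\<lambda>C. N <#> C) \<in> hom (G Mod M) (G Mod N)"
  proof (rule homI)
    show "N <#> C \<in> carrier (G Mod N)" if "C \<in> carrier (G Mod M)" for C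
      using that assms by (auto simp: carrier_FactGroup coset_merge)
    show "N <#> (C \<otimes>\<^bsub>G Mod M\<^esub> D) = (N <#> C) \<otimes>\<^bsub>G Mod N\<^esub> (N <#> D)"
      if "C \<in> carrier (G Mod M)" "D \<in> carrier (G Mod M)" for C D
      using that assms by (auto simp: carrier_FactGroup coset_merge coset_mult)
  qed
  show "(\<lambda>C. N <#> C) ` carrier (G Mod M) = carrier (G Mod N)"
    unfolding carrier_FactGroup image_image by (rule image_cong [OF refl]) (rule coset_merge [OF assms])
qed

text \<open>Continuity of \<open>p N\<close> is the openness of its fibres, on each of which it is
  constant; the remaining conditions are facts about cosets.\<close>

lemma pN_change:
  assumes N: "N \<in> ON" shows "discrete_change (pN G T N)"
proof (rule discrete_change.intro, unfold grp_simps)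
  show "group G" by (rule is_group)
  show "group (G Mod N)" by (rule ON_group_Mod [OF N])
  show "(#>) N \<in> hom G (G Mod N)" by (rule normal.r_coset_hom_Mod [OF ON_normal [OF N]])
  show "(#>) N ` carrier G = carrier (G Mod N)" by (simp add: carrier_FactGroup)
  show "discrete_gspace (QS N)" by (rule QS_discrete [OF N])
  show "continuous_action G T SG act" by (rule continuous_action_SG)
  show "topspace T = carrier G" by simp
  show "qact N h y \<in> topspace (space_top (QS N))" if "h \<in> carrier (G Mod N)" "y \<in> topspace (space_top (QS N))" for h y
    using that N by (simp add: qact_in)
  show "qact N \<one>\<^bsub>G Mod N\<^esub> y = y" if "y \<in> topspace (space_top (QS N))" for y
    using that N by (simp add: qact_one)
  show "qact N (h \<otimes>\<^bsub>G Mod N\<^esub> k) y = qact N h (qact N k y)"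
    if "h \<in> carrier (G Mod N)" "k \<in> carrier (G Mod N)" "y \<in> topspace (space_top (QS N))" for h k y
    using that N by (simp add: qact_mult)
  show "continuous_map SG (space_top (QS N)) (p N)"
  proof (rule continuous_map_locally)
    fix K assume K: "K \<in> topspace SG"
    have "continuous_map (subtopology SG {L \<in> X. p N L = p N K}) (space_top (QS N)) (\<lambda>_. p N K)"
      using K N p_in by simp
    then have "continuous_map (subtopology SG {L \<in> X. p N L = p N K}) (space_top (QS N)) (p N)"
      by (rule continuous_map_eq) simp
    then show "\<exists>U. openin SG U \<and> K \<in> U \<and> continuous_map (subtopology SG U) (space_top (QS N)) (p N)"
      using p_fibre_open [OF N, of "p N K"] K by (intro exI [of _ "{L \<in> X. p N L = p N K}"]) simp
  qed
  show "p N (act g x) = qact N (N #> g) (p N x)" if "g \<in> carrier G" "x \<in> topspace SG" for g x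
    using that p_act [OF N] by simp
qed

lemma phi_change:
  assumes MN: "M \<in> ON" "N \<in> ON" "M \<subseteq> N" shows "discrete_change (phiMN G T M N)"
proof (rule discrete_change.intro, unfold grp_simps)
  note M = MN(1) and N = MN(2)
  show "group (G Mod M)" "group (G Mod N)" by (rule ON_group_Mod [OF M] ON_group_Mod [OF N])+
  show "(<#>) N \<in> hom (G Mod M) (G Mod N)" "(<#>) N ` carrier (G Mod M) = carrier (G Mod N)"
    by (rule ghom_phi [OF MN])+
  show "discrete_gspace (QS N)" by (rule QS_discrete [OF N])
  show "topspace (quotient_group_topology G T M) = carrier (G Mod M)" by (simp add: quotient_discrete M)
  show "continuous_action (G Mod M) (quotient_group_topology G T M) (space_top (QS M)) (qact M)"
    unfolding continuous_action_def space_QS [OF M]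
  proof (intro conjI ballI)
    have e: "prod_topology (quotient_group_topology G T M) (discrete_topology (Y M)) = discrete_topology (carrier (G Mod M) \<times> Y M)"
      by (simp only: quotient_discrete [OF M] prod_topology_discrete_topology)
    show "continuous_map (prod_topology (quotient_group_topology G T M) (discrete_topology (Y M))) (discrete_topology (Y M)) (\<lambda>(g, x). qact M g x)"
      unfolding e using qact_in [OF M] by (simp add: Pi_iff)
    show "qact M \<one>\<^bsub>G Mod M\<^esub> x = x" if "x \<in> topspace (discrete_topology (Y M))" for x
      using that qact_one [OF M] by simp
    show "qact M (g \<otimes>\<^bsub>G Mod M\<^esub> h) x = qact M g (qact M h x)"
      if "g \<in> carrier (G Mod M)" "h \<in> carrier (G Mod M)" "x \<in> topspace (discrete_topology (Y M))" for g h x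
      using that qact_mult [OF M] by simp
  qed
  show "qact N h y \<in> topspace (space_top (QS N))" if "h \<in> carrier (G Mod N)" "y \<in> topspace (space_top (QS N))" for h y
    using that N by (simp add: qact_in)
  show "qact N \<one>\<^bsub>G Mod N\<^esub> y = y" if "y \<in> topspace (space_top (QS N))" for y
    using that N by (simp add: qact_one)
  show "qact N (h \<otimes>\<^bsub>G Mod N\<^esub> k) y = qact N h (qact N k y)"
    if "h \<in> carrier (G Mod N)" "k \<in> carrier (G Mod N)" "y \<in> topspace (space_top (QS N))" for h k y
    using that N by (simp add: qact_mult)
  show "continuous_map (space_top (QS M)) (space_top (QS N)) (ph M N)"
    unfolding space_QS [OF M] using N ph_in [OF MN] by auto
  show "ph M N (qact M g x) = qact N (N <#> g) (ph M N x)"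
    if "g \<in> carrier (G Mod M)" "x \<in> topspace (space_top (QS M))" for g x
    using that ph_qact [OF MN] M by simp
qed

lemma ker_pN: "N \<in> ON \<Longrightarrow> n \<in> kernel G (G Mod N) ((#>) N) \<longleftrightarrow> n \<in> N"
  using ON_sub [of N] coset_eq_one [of N n] by (auto simp: kernel_def)

lemma ker_phi:
  assumes "M \<in> ON" "N \<in> ON" "M \<subseteq> N"
  shows "C \<in> kernel (G Mod M) (G Mod N) ((<#>) N) \<longleftrightarrow> (\<exists>n\<in>N. C = M #> n)"
proof
  assume "C \<in> kernel (G Mod M) (G Mod N) ((<#>) N)"
  then have C: "C \<in> carrier (G Mod M)" "N <#> C = N" by (simp_all add: kernel_def)
  then obtain g where "g \<in> carrier G" "C = M #> g" by (auto simp: carrier_FactGroup)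
  then show "\<exists>n\<in>N. C = M #> n" using C(2) coset_merge [OF assms] coset_eq_one [OF assms(2)] by auto
next
  assume "\<exists>n\<in>N. C = M #> n"
  then obtain n where n: "n \<in> N" "C = M #> n" by auto
  then have "n \<in> carrier G" using ON_sub [OF assms(2)] by auto
  then show "C \<in> kernel (G Mod M) (G Mod N) ((<#>) N)"
    using n coset_merge [OF assms] coset_eq_one [OF assms(2)] coset_in [OF assms(1)] by (simp add: kernel_def)
qed

section \<open>Invariant sections over the fibres\<close>

abbreviation "fibre N S \<equiv> preim (pN G T N) {S}"

lemma in_fibre: "K \<in> fibre N S \<longleftrightarrow> K \<in> X \<and> p N K = S"
  by (simp add: preim_def)

lemma fibre_open: "N \<in> ON \<Longrightarrow> openin SG (fibre N S)"
  using p_fibre_open [of N S] by (simp add: preim_def)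

lemma in_phi_fibre: "M \<in> ON \<Longrightarrow> R \<in> preim (phiMN G T M N) {S} \<longleftrightarrow> R \<in> Y M \<and> ph M N R = S"
  by (simp add: preim_def)

lemma preim_pN: "M \<in> ON \<Longrightarrow> N \<in> ON \<Longrightarrow> M \<subseteq> N \<Longrightarrow> preim (pN G T M) (preim (phiMN G T M N) V) = preim (pN G T N) V"
  by (auto simp: preim_def p_in ph_p)

lemma IS_pN:
  assumes N: "N \<in> ON"
  shows "s \<in> invariant_sections (pN G T N) E V \<longleftrightarrow> s \<in> extensional (preim (pN G T N) V) \<and>
     continuous_map (subtopology SG (preim (pN G T N) V)) (tot E) s \<and>
     (\<forall>K\<in>preim (pN G T N) V. sproj E (s K) = K) \<and>
     (\<forall>n\<in>N. \<forall>K\<in>preim (pN G T N) V. s (act n K) = sact E n (s K))"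
proof -
  interpret discrete_change "pN G T N" by (rule pN_change [OF N])
  have "ker = N" using ker_pN [OF N] by auto
  then show ?thesis unfolding IS_iff by simp
qed

lemma IS_phi:
  assumes MN: "M \<in> ON" "N \<in> ON" "M \<subseteq> N" and D: "is_gsheaf (QS M) D"
  shows "t \<in> invariant_sections (phiMN G T M N) D V \<longleftrightarrow> t \<in> extensional (preim (phiMN G T M N) V) \<and>
     (\<forall>R\<in>preim (phiMN G T M N) V. t R \<in> fib D R) \<and>
     (\<forall>n\<in>N. \<forall>R\<in>preim (phiMN G T M N) V. t (qact M (M #> n) R) = sact D (M #> n) (t R))"
proof -
  interpret discrete_change "phiMN G T M N" by (rule phi_change [OF MN])
  have sub: "subtopology (space_top (QS M)) (preim (phiMN G T M N) V) = discrete_topology (preim (phiMN G T M N) V)"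
    unfolding space_QS [OF MN(1)] subtopology_discrete_topology using MN(1) by (auto simp: preim_def intro!: arg_cong [of _ _ discrete_topology])
  show ?thesis
    unfolding IS_iff grp_simps sub ker_phi [OF MN] Bex_def Ball_def
    by (auto simp: Pi_iff simp del: fun_eq_iff)
qed

lemma pts_pull_pN: "(K, d) \<in> pts (pull (pN G T N) D) \<longleftrightarrow> K \<in> X \<and> d \<in> pts D \<and> p N K = sproj D d"
  by (auto simp: pull_def)

lemma pts_pull_phi: "M \<in> ON \<Longrightarrow> (R, d) \<in> pts (pull (phiMN G T M N) D) \<longleftrightarrow> R \<in> Y M \<and> d \<in> pts D \<and> ph M N R = sproj D d"
  by (auto simp: pull_def)

lemma tot_pull_phi:
  assumes "M \<in> ON" "tot D = discrete_topology (pts D)"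
  shows "tot (pull (phiMN G T M N) D) = discrete_topology (pts (pull (phiMN G T M N) D))"
proof -
  have "tot (pull (phiMN G T M N) D) = subtopology (prod_topology (discrete_topology (Y M)) (discrete_topology (pts D))) {(x, d). ph M N x = sproj D d}"
    using assms by (simp add: pull_def space_QS)
  then show ?thesis
    unfolding prod_topology_discrete_topology [symmetric] subtopology_discrete_topology by simp
qed

lemma pull_simps [simp]:
  "sproj (pull c D) = fst" "sact (pull c D) g (x, d) = (space_act (src c) g x, sact D (ghom c g) d)"
  "szero (pull c D) x = (x, szero D (smap c x))"
  "sadd (pull c D) (x, d) (x', d') = (x, sadd D d d')" "sscale (pull c D) r (x, d) = (x, sscale D r d)"
  by (simp_all add: pull_def)

end

section \<open>Copies of push forwards\<close>

locale profin_universe = profin G T for G :: "'g monoid" (structure) and T :: "'g topology" +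
  fixes code :: "('g set \<Rightarrow> 'u) \<Rightarrow> 'u"
  assumes inj_code: "inj code" and infinite_u: "infinite (UNIV :: 'u set)"
begin

text \<open>A subset is coded by applying \<open>code\<close> to the two-valued function that
  singles it out, and pairs by an injection of the square of an infinite type into the type. The
  coding serves both the points of push forwards and the representatives of points of a
  colimit.\<close>

lemma inj_triple: "\<exists>J :: 'g set \<times> 'g set \<times> 'u \<Rightarrow> 'u. inj J"
proof -
  let ?A = "UNIV :: 'u set"
  obtain P :: "'u \<times> 'u \<Rightarrow> 'u" where P: "inj_on P (?A \<times> ?A)"
    using card_of_ordLeq [THEN iffD2, OF ordIso_imp_ordLeq [OF card_of_Times_same_infinite [OF infinite_u]]] by blast
  have "\<exists>a b :: 'u. a \<noteq> b"
  proof (rule ccontr)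
    assume "\<not> ?thesis"
    then have "?A \<subseteq> {undefined}" by auto
    then have "finite ?A" by (rule finite_subset) simp
    then show False using infinite_u by contradiction
  qed
  then obtain a b :: 'u where ab: "a \<noteq> b" by blast
  define e where "e = (\<lambda>S :: 'g set. code (\<lambda>x. if x = S then a else b))"
  have e: "e S = e S' \<longleftrightarrow> S = S'" for S S'
  proof
    assume "e S = e S'"
    then have "(\<lambda>x. if x = S then a else b) = (\<lambda>x. if x = S' then a else b)"
      unfolding e_def by (rule injD [OF inj_code])
    note eq = fun_cong [OF this, of S]
    show "S = S'"
    proof (rule ccontr)
      assume ne: "S \<noteq> S'"
      from eq have "a = b" by (simp only: ne refl if_True if_False)
      with ab show False by contradiction
    qed
  qed simp
  have P': "P x = P y \<longleftrightarrow> x = y" for x y by (rule inj_on_eq_iff [OF P]) simp_all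
  have "inj (\<lambda>(S, R, u). P (e S, P (e R, u)))"
    by (rule injI) (auto simp: P' e)
  then show ?thesis by blast
qed

text \<open>A germ is a class of sections with varying domains, which \<open>code\<close> does not
  apply to; but it is determined by its base point and its values over one fibre, and these form
  data that can be coded.\<close>

lemma push_pN_copy:
  fixes E :: "('g, 'g set, 'u) gsheaf"
  assumes E: "is_gsheaf SS E" and N: "N \<in> ON"
  shows "is_gsheaf (QS N) (push_pN G T E N)"
    "sheaf_iso (QS N) (push (pN G T N) E) (push_pN G T E N) (to_copy G T E N)"
proof -
  interpret c: discrete_change "pN G T N" by (rule pN_change [OF N])
  let ?P = "push (pN G T N) E"
  have P: "is_gsheaf (QS N) ?P" using c.push_gsheaf [of E] E by simp
  obtain J :: "'g set \<times> 'g set \<times> 'u \<Rightarrow> 'u" where J: "inj J" using inj_triple ..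
  \<comment> \<open>The base point is a set of cosets, recovered from its union, which is a subset
    of \<open>G\<close>. The first slot of \<open>J\<close> is a filler.\<close>
  define r where "r z = J ({}, \<Union>(fst z), code (gval (pN G T N) z))" for z :: "('g set, 'g set set, 'u) germ"
  have "inj_on r (pts ?P)"
  proof (rule inj_onI)
    fix z z' assume z: "z \<in> pts ?P" and z': "z' \<in> pts ?P" and eq: "r z = r z'"
    have *: "\<Union>(fst z) = \<Union>(fst z')" "gval (pN G T N) z = gval (pN G T N) z'"
      using injD [OF J eq [unfolded r_def]] injD [OF inj_code] by auto
    have "fst z \<in> Y N" "fst z' \<in> Y N" using c.pushD(1) [OF z] c.pushD(1) [OF z'] N by simp_all
    then obtain K K' where K: "K \<in> X" "fst z = p N K" "K' \<in> X" "fst z' = p N K'"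
      using p_ex [OF N, of "fst z"] p_ex [OF N, of "fst z'"] by auto
    then have "fst z = fst z'" using p_eq_iff [OF N K(3,1)] *(1) by (simp add: Union_p)
    then show "z = z'"
      using c.gval_inj [OF z z'] *(2) by simp
  qed
  from discrete_copy_exists [OF QS_discrete [OF N] P this]
  have "\<exists>x. case x of (F :: ('g set, 'g set set, 'u) gsheaf, r) \<Rightarrow> is_gsheaf (QS N) F \<and> sheaf_iso (QS N) ?P F r"
    by auto
  then have "case copy (QS N) ?P of (F :: ('g set, 'g set set, 'u) gsheaf, r) \<Rightarrow> is_gsheaf (QS N) F \<and> sheaf_iso (QS N) ?P F r"
    unfolding copy_def by (rule someI_ex)
  then show "is_gsheaf (QS N) (push_pN G T E N)"
    "sheaf_iso (QS N) (push (pN G T N) E) (push_pN G T E N) (to_copy G T E N)"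
    unfolding push_pN_def to_copy_def by (simp_all add: case_prod_beta)
qed

text \<open>A point \<open>u\<close> of \<open>(p\<^sub>N)\<^sub>* E\<close> over \<open>S\<close> is the same as an \<open>N\<close>-invariant section of \<open>E\<close> over the
  fibre of \<open>S\<close>, denoted \<open>sec E N u\<close>.\<close>

definition sec :: "('g, 'g set, 'u) gsheaf \<Rightarrow> 'g set \<Rightarrow> 'u \<Rightarrow> 'g set \<Rightarrow> 'u" where
  "sec E N u = gval (pN G T N) (from_copy G T E N u)"

context
  fixes E :: "('g, 'g set, 'u) gsheaf" and N
  assumes E: "is_gsheaf SS E" and N: "N \<in> ON"
begin

lemma push_pN_gsheaf: "is_gsheaf (QS N) (push_pN G T E N)"
  by (rule push_pN_copy(1) [OF E N])

lemma push_pN_sproj: "u \<in> pts (push_pN G T E N) \<Longrightarrow> sproj (push_pN G T E N) u \<in> Y N"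
  using gsheafD(3) [OF push_pN_gsheaf] N by simp

lemma to_copy_bij: "bij_betw (to_copy G T E N) (pts (push (pN G T N) E)) (pts (push_pN G T E N))"
  and to_copy_hom: "to_copy G T E N \<in> sheaf_hom (QS N) (push (pN G T N) E) (push_pN G T E N)"
  using sheaf_iso_bij [OF push_pN_copy(2) [OF E N]] by simp_all

lemma from_to_copy: "z \<in> pts (push (pN G T N) E) \<Longrightarrow> from_copy G T E N (to_copy G T E N z) = z"
  unfolding from_copy_def by (rule bij_betw_inv_into_left [OF to_copy_bij])

lemma to_copy_in: "z \<in> pts (push (pN G T N) E) \<Longrightarrow> to_copy G T E N z \<in> pts (push_pN G T E N)"
  "z \<in> pts (push (pN G T N) E) \<Longrightarrow> sproj (push_pN G T E N) (to_copy G T E N z) = fst z"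
  using sheaf_homD(3,4) [OF to_copy_hom] discrete_change.sproj_push [OF pN_change [OF N], of E] by simp_all

lemma from_copy_in:
  assumes "u \<in> pts (push_pN G T E N)"
  shows "from_copy G T E N u \<in> pts (push (pN G T N) E)" "to_copy G T E N (from_copy G T E N u) = u"
    "fst (from_copy G T E N u) = sproj (push_pN G T E N) u"
proof -
  show 1: "from_copy G T E N u \<in> pts (push (pN G T N) E)"
    unfolding from_copy_def using to_copy_bij assms by (metis bij_betw_def inv_into_into)
  show 2: "to_copy G T E N (from_copy G T E N u) = u"
    unfolding from_copy_def by (rule bij_betw_inv_into_right [OF to_copy_bij assms])
  show "fst (from_copy G T E N u) = sproj (push_pN G T E N) u"
    using to_copy_in(2) [OF 1] 2 by simp
qed

lemma sec_to_copy: "z \<in> pts (push (pN G T N) E) \<Longrightarrow> sec E N (to_copy G T E N z) = gval (pN G T N) z"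
  by (simp add: sec_def from_to_copy)

lemma sec_IS: "u \<in> pts (push_pN G T E N) \<Longrightarrow> sec E N u \<in> invariant_sections (pN G T N) E {sproj (push_pN G T E N) u}"
  unfolding sec_def using discrete_change.pushD(2) [OF pN_change [OF N] from_copy_in(1)] from_copy_in(3) by metis

lemma sec_fib:
  assumes "u \<in> pts (push_pN G T E N)" "K \<in> fibre N (sproj (push_pN G T E N) u)"
  shows "sec E N u K \<in> pts E" "sproj E (sec E N u K) = K"
  using discrete_change.IS_D(5,3) [OF pN_change [OF N] sec_IS [OF assms(1)] assms(2)] by simp_all

lemma sec_inv:
  assumes "u \<in> pts (push_pN G T E N)" "K \<in> fibre N (sproj (push_pN G T E N) u)" "n \<in> N"
  shows "sec E N u (act n K) = sact E n (sec E N u K)"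
  using sec_IS [OF assms(1)] assms(2,3) unfolding IS_pN [OF N] by blast

lemma sec_inj:
  assumes "u \<in> pts (push_pN G T E N)" "v \<in> pts (push_pN G T E N)"
    "sproj (push_pN G T E N) u = sproj (push_pN G T E N) v"
    "\<And>K. K \<in> fibre N (sproj (push_pN G T E N) v) \<Longrightarrow> sec E N u K = sec E N v K"
  shows "u = v"
proof -
  have "from_copy G T E N u = from_copy G T E N v"
  proof (rule discrete_change.gval_inj [OF pN_change [OF N] from_copy_in(1) [OF assms(1)] from_copy_in(1) [OF assms(2)]])
    show "fst (from_copy G T E N u) = fst (from_copy G T E N v)"
      by (simp only: from_copy_in(3) [OF assms(1)] from_copy_in(3) [OF assms(2)] assms(3))
    show "gval (pN G T N) (from_copy G T E N u) x = gval (pN G T N) (from_copy G T E N v) x"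
      if "x \<in> fibre N (fst (from_copy G T E N u))" for x
      using that assms(4) [unfolded sec_def] by (simp only: from_copy_in(3) [OF assms(1)] assms(3))
  qed
  then have "to_copy G T E N (from_copy G T E N u) = to_copy G T E N (from_copy G T E N v)"
    by (simp only:)
  then show ?thesis unfolding from_copy_in(2) [OF assms(1)] from_copy_in(2) [OF assms(2)] .
qed

lemma sec_surj:
  assumes S: "S \<in> Y N" and s: "s \<in> invariant_sections (pN G T N) E {S}"
  obtains u where "u \<in> pts (push_pN G T E N)" "sproj (push_pN G T E N) u = S" "sec E N u = s"
proof
  interpret c: discrete_change "pN G T N" by (rule pN_change [OF N])
  let ?z = "germ (pN G T N) E S {S} s"
  have z: "?z \<in> pts (push (pN G T N) E)" using c.germ_in_push [OF s] S N by simp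
  show "to_copy G T E N ?z \<in> pts (push_pN G T E N)" "sproj (push_pN G T E N) (to_copy G T E N ?z) = S"
    using to_copy_in [OF z] by simp_all
  have "gval (pN G T N) ?z = s"
    using c.gval_germ [OF s, of S] S N c.IS_D(1) [OF s] by (simp add: extensional_restrict)
  then show "sec E N (to_copy G T E N ?z) = s" using sec_to_copy [OF z] by simp
qed

lemma sec_add:
  assumes a: "a \<in> fib (push_pN G T E N) S" and b: "b \<in> fib (push_pN G T E N) S" and K: "K \<in> fibre N S"
  shows "sec E N (sadd (push_pN G T E N) a b) K = sadd E (sec E N a K) (sec E N b K)"
proof -
  interpret c: discrete_change "pN G T N" by (rule pN_change [OF N])
  let ?a = "from_copy G T E N a" and ?b = "from_copy G T E N b"
  have a': "a \<in> pts (push_pN G T E N)" "fst ?a = S" and b': "b \<in> pts (push_pN G T E N)" "fst ?b = S"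
    using a b from_copy_in(3) [of a] from_copy_in(3) [of b] by simp_all
  have S: "S \<in> topspace (space_top (QS N))" using push_pN_sproj [OF a'(1)] a N by simp
  note A = from_copy_in(1,2) [OF a'(1)] and B = from_copy_in(1,2) [OF b'(1)]
  note s = c.push_add [OF _ A(1) B(1), unfolded a'(2) b'(2), OF _ refl]
  have eq: "to_copy G T E N (sadd (push (pN G T N) E) ?a ?b) = sadd (push_pN G T E N) a b"
    using sheaf_homD(6) [OF to_copy_hom S, of ?a ?b] A B a' b' by simp
  show ?thesis
    unfolding eq [symmetric] using sec_to_copy [OF s(1)] s(3) [OF _ K] E by (simp add: sec_def)
qed

lemma sec_scale:
  assumes a: "a \<in> fib (push_pN G T E N) S" and K: "K \<in> fibre N S"
  shows "sec E N (sscale (push_pN G T E N) r a) K = sscale E r (sec E N a K)"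
proof -
  interpret c: discrete_change "pN G T N" by (rule pN_change [OF N])
  let ?a = "from_copy G T E N a"
  have a': "a \<in> pts (push_pN G T E N)" "fst ?a = S" using a from_copy_in(3) [of a] by simp_all
  have S: "S \<in> topspace (space_top (QS N))" using push_pN_sproj [OF a'(1)] a N by simp
  note A = from_copy_in(1,2) [OF a'(1)]
  note s = c.push_scale [OF _ A(1), where r = r, unfolded a'(2)]
  have eq: "to_copy G T E N (sscale (push (pN G T N) E) r ?a) = sscale (push_pN G T E N) r a"
    using sheaf_homD(7) [OF to_copy_hom S, of ?a r] A a' by simp
  show ?thesis
    unfolding eq [symmetric] using sec_to_copy [OF s(1)] s(3) [OF _ K] E by (simp add: sec_def)
qed

lemma sec_act:
  assumes u: "u \<in> pts (push_pN G T E N)" and g: "g \<in> carrier G"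
    and K: "K \<in> fibre N (qact N (N #> g) (sproj (push_pN G T E N) u))"
  shows "sec E N (sact (push_pN G T E N) (N #> g) u) K = sact E g (sec E N u (act (inv g) K))"
proof -
  interpret c: discrete_change "pN G T N" by (rule pN_change [OF N])
  let ?u = "from_copy G T E N u"
  note U = from_copy_in [OF u]
  have h: "N #> g \<in> carrier (grp (tgt (pN G T N)))" using coset_in [OF N g] by simp
  note s = c.push_act [OF _ U(1) h, unfolded U(3)]
  have eq: "to_copy G T E N (sact (push (pN G T N) E) (N #> g) ?u) = sact (push_pN G T E N) (N #> g) u"
    using sheaf_homD(5) [OF to_copy_hom, of "N #> g" ?u] U coset_in [OF N g] by simp
  show ?thesis
    unfolding eq [symmetric] using sec_to_copy [OF s(1)] s(3) [of g K] E K g by (simp add: sec_def)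
qed

end

end

section \<open>The functor to \<open>G\<^sub>\<bullet>\<close>-sheaves\<close>

context profin_universe
begin

abbreviation PE :: "('g, 'g set, 'u) gsheaf \<Rightarrow> 'g set \<Rightarrow> ('g set, 'g set set, 'u) gsheaf" where
  "PE \<equiv> push_pN G T"

abbreviation st :: "('g, 'g set, 'u) gsheaf \<Rightarrow> 'g set \<Rightarrow> 'g set \<Rightarrow> 'g set set \<times> 'u \<Rightarrow> 'u" where
  "st E \<equiv> struct (fobj (p_bullet G T) E)"

lemma stage_p_bullet [simp]: "stage (fobj (p_bullet G T) E) = PE E"
  by (simp add: p_bullet_def)

lemma fibre_refine:
  assumes "M \<in> ON" "N \<in> ON" "M \<subseteq> N" "K \<in> fibre M R"
  shows "K \<in> fibre N (ph M N R)"
  using assms by (auto simp: in_fibre ph_p)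

lemma fibre_act:
  assumes "N \<in> ON" "g \<in> carrier G" "S \<in> Y N" "K \<in> fibre N (qact N (N #> g) S)"
  shows "act (inv g) K \<in> fibre N S"
proof -
  have K: "K \<in> X" "p N K = qact N (N #> g) S" using assms(4) by (simp_all add: in_fibre)
  have "p N (act (inv g) K) = qact N (N #> inv g) (qact N (N #> g) S)"
    using p_act [OF assms(1) _ K(1), of "inv g"] assms(2) K(2) by simp
  also have "\<dots> = qact N (N #> (inv g \<otimes> g)) S"
    using qact_mult [OF assms(1) _ _ assms(3), of "N #> inv g" "N #> g"] assms(1,2) by (simp add: coset_in coset_mult)
  finally show ?thesis
    using qact_one [OF assms(1,3)] assms(1,2) K(1) act_in [of "inv g" K] by (simp add: in_fibre coset_one)
qed

lemma struct_props:
  assumes E: "is_gsheaf SS E" and MN: "M \<in> ON" "N \<in> ON" "M \<subseteq> N"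
    and R: "R \<in> Y M" and u: "u \<in> pts (PE E N)" and Ru: "ph M N R = sproj (PE E N) u"
  shows "st E M N (R, u) \<in> pts (PE E M)" "sproj (PE E M) (st E M N (R, u)) = R"
    "\<And>K. K \<in> fibre M R \<Longrightarrow> sec E M (st E M N (R, u)) K = sec E N u K"
proof -
  note M = MN(1) and N = MN(2)
  interpret cM: discrete_change "pN G T M" by (rule pN_change [OF M])
  interpret cN: discrete_change "pN G T N" by (rule pN_change [OF N])
  interpret phi: discrete_change "phiMN G T M N" by (rule phi_change [OF MN])
  let ?PM = "push (pN G T M) E" and ?phi = "phiMN G T M N"
  have PM: "is_gsheaf (QS M) ?PM" using cM.push_gsheaf [of E] E by simp
  \<comment> \<open>The equality of the push forward along \<open>p N\<close> with the one along
    \<open>p M\<close> and then \<open>ph M N\<close>, read on the copy at \<open>N\<close>. The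
    structure map is its adjoint, moved to the copy at \<open>M\<close>.\<close>
  define h where "h = compose (pts (PE E N)) (push_comp (pN G T N) ?phi (pN G T M) E) (from_copy G T E N)"
  have key: "h v \<in> pts (push ?phi ?PM) \<and> fst (h v) = sproj (PE E N) v \<and>
      (\<forall>R\<in>Y M. ph M N R = sproj (PE E N) v \<longrightarrow> gval ?phi (h v) R \<in> pts ?PM \<and> fst (gval ?phi (h v) R) = R \<and>
         (\<forall>K\<in>fibre M R. gval (pN G T M) (gval ?phi (h v) R) K = sec E N v K))"
    if v: "v \<in> pts (PE E N)" for v
  proof -
    let ?z = "from_copy G T E N v"
    note Z = from_copy_in [OF E N v]
    note D = cN.pushD [OF Z(1), unfolded Z(3) grp_simps]
    let ?V = "germ_dom ?z" and ?s = "germ_sec ?z"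
    have V: "?V \<subseteq> Y N" using D(4) N by simp
    have pre: "preim (pN G T M) (preim ?phi ?V) = preim (pN G T N) ?V" by (rule preim_pN [OF MN])
    have s: "?s \<in> invariant_sections (pN G T M) E (preim ?phi ?V)"
      using D(6) MN(3) unfolding IS_pN [OF M] IS_pN [OF N] pre by (meson subsetD)
    have W: "preim ?phi ?V \<subseteq> topspace (space_top (tgt (pN G T M)))" using M by (auto simp: preim_def)
    \<comment> \<open>By the definition of \<open>push_comp\<close>, \<open>h v\<close> is the germ
      of this section; its value at \<open>R\<close> is the germ of the original section of
      \<open>E\<close> at \<open>R\<close>.\<close>
    define t where "t = (\<lambda>y\<in>preim ?phi ?V. germ (pN G T M) E y (preim ?phi ?V) ?s)"
    have tin: "t R \<in> pts ?PM" "fst (t R) = R" if "R \<in> preim ?phi ?V" for R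
      using that cM.germ_in_push [OF s that W] by (simp_all add: t_def)
    have tval: "gval (pN G T M) (t R) K = ?s K" if "R \<in> preim ?phi ?V" "K \<in> fibre M R" for R K
      using that cM.gval_germ [OF s that(1) W] by (simp add: t_def)
    have t: "t \<in> invariant_sections ?phi ?PM ?V"
      unfolding IS_phi [OF MN PM]
    proof (intro conjI ballI)
      show "t \<in> extensional (preim ?phi ?V)" by (simp add: t_def)
      show "t R \<in> fib ?PM R" if "R \<in> preim ?phi ?V" for R using tin [OF that] by simp
      fix n R assume n: "n \<in> N" and R: "R \<in> preim ?phi ?V"
      have nG: "n \<in> carrier G" using ON_sub [OF N] n by auto
      have C: "M #> n \<in> carrier (G Mod M)" using coset_in [OF M nG] .
      have RY: "R \<in> Y M" "ph M N R \<in> ?V" using R M by (simp_all add: preim_def)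
      have "ph M N (qact M (M #> n) R) = ph M N R"
        using ph_qact [OF MN C RY(1)] coset_merge [OF MN nG] coset_eq_one [OF N nG] n qact_one [OF N ph_in [OF MN RY(1)]] by simp
      then have nR: "qact M (M #> n) R \<in> preim ?phi ?V" using RY qact_in [OF M C RY(1)] M by (simp add: preim_def)
      have C': "M #> n \<in> carrier (grp (tgt (pN G T M)))" using C by simp
      note a = cM.push_act [OF _ tin(1) [OF R] C', unfolded tin(2) [OF R] grp_simps, OF E]
      show "t (qact M (M #> n) R) = sact ?PM (M #> n) (t R)"
      proof (rule cM.gval_inj [OF tin(1) [OF nR] a(1)])
        show "fst (t (qact M (M #> n) R)) = fst (sact ?PM (M #> n) (t R))" using tin(2) [OF nR] a(2) by simp
        fix K assume "K \<in> fibre M (fst (t (qact M (M #> n) R)))"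
        then have K: "K \<in> fibre M (qact M (M #> n) R)" unfolding tin(2) [OF nR] .
        have K': "act (inv n) K \<in> fibre M R" by (rule fibre_act [OF M nG RY(1) K])
        have KV: "act (inv n) K \<in> preim (pN G T N) ?V" using K' R unfolding pre [symmetric] by (auto simp: preim_def)
        have "?s (act n (act (inv n) K)) = sact E n (?s (act (inv n) K))"
          using D(6) n KV unfolding IS_pN [OF N] by blast
        then have "?s K = sact E n (?s (act (inv n) K))"
          using act_inv(2) [OF nG, of K] K by (simp add: in_fibre)
        then show "gval (pN G T M) (t (qact M (M #> n) R)) K = gval (pN G T M) (sact ?PM (M #> n) (t R)) K"
          using tval [OF nR K] tval [OF R K'] a(3) [OF nG refl K] by simp
      qed
    qed
    have y: "sproj (PE E N) v \<in> ?V" using D(5) .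
    have Vt: "?V \<subseteq> topspace (space_top (tgt ?phi))" using V N by simp
    have h: "h v = germ ?phi ?PM (sproj (PE E N) v) ?V t"
      using v Z by (simp add: h_def compose_def push_comp_def t_def)
    show ?thesis
    proof (intro conjI ballI impI)
      show "h v \<in> pts (push ?phi ?PM)" unfolding h by (rule phi.germ_in_push [OF t y Vt])
      show "fst (h v) = sproj (PE E N) v" unfolding h by simp
      fix R assume R: "R \<in> Y M" "ph M N R = sproj (PE E N) v"
      have RV: "R \<in> preim ?phi ?V" "R \<in> preim ?phi {sproj (PE E N) v}" using R y M by (simp_all add: preim_def)
      have g: "gval ?phi (h v) R = t R" unfolding h phi.gval_germ [OF t y Vt] using RV(2) by simp
      show "gval ?phi (h v) R \<in> pts ?PM" "fst (gval ?phi (h v) R) = R" unfolding g by (rule tin [OF RV(1)])+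
      fix K assume K: "K \<in> fibre M R"
      have "K \<in> fibre N (sproj (PE E N) v)" using fibre_refine [OF MN K] R(2) by simp
      then have "sec E N v K = ?s K" by (simp add: sec_def gval_def Z(3))
      then show "gval (pN G T M) (gval ?phi (h v) R) K = sec E N v K" unfolding g tval [OF RV(1) K] by simp
    qed
  qed
  have mem: "(R, u) \<in> pts (pull ?phi (PE E N))" unfolding pts_pull_phi [OF M] using R u Ru by simp
  have adj: "adjoint_from_pull ?phi (PE E N) ?PM h (R, u) = gval ?phi (h u) R"
    by (rule phi.adjoint_from_pull_val [OF _ mem]) (use key in blast)
  have eq: "st E M N (R, u) = to_copy G T E M (gval ?phi (h u) R)"
    using mem adj by (simp add: p_bullet_def compose_def [of "pts (pull _ _)"] h_def)
  have *: "gval ?phi (h u) R \<in> pts ?PM" "fst (gval ?phi (h u) R) = R"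
      "\<forall>K\<in>fibre M R. gval (pN G T M) (gval ?phi (h u) R) K = sec E N u K"
    using key [OF u] R Ru by simp_all
  show "st E M N (R, u) \<in> pts (PE E M)" "sproj (PE E M) (st E M N (R, u)) = R"
    unfolding eq using to_copy_in [OF E M *(1)] *(2) by simp_all
  show "sec E M (st E M N (R, u)) K = sec E N u K" if "K \<in> fibre M R" for K
    unfolding eq sec_to_copy [OF E M *(1)] using *(3) that by simp
qed

text \<open>Restriction of sections commutes with operations that are computed pointwise;
  \<open>sec_inj\<close> reduces each law to the points of a fibre.\<close>

lemma struct_hom:
  assumes E: "is_gsheaf SS E" and MN: "M \<in> ON" "N \<in> ON" "M \<subseteq> N"
  shows "st E M N \<in> sheaf_hom (QS M) (pull (phiMN G T M N) (PE E N)) (PE E M)"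
proof (rule discrete_homI)
  note M = MN(1) and N = MN(2)
  let ?P = "pull (phiMN G T M N) (PE E N)"
  note PM = push_pN_gsheaf [OF E M] and PN = push_pN_gsheaf [OF E N]
  show "tot ?P = discrete_topology (pts ?P)"
    by (rule tot_pull_phi [OF M discrete_gsheaf_tot [OF QS_discrete [OF N] PN]])
  show "st E M N \<in> extensional (pts ?P)" by (simp add: p_bullet_def)
  have mem: "(R, u) \<in> pts ?P \<longleftrightarrow> R \<in> Y M \<and> u \<in> pts (PE E N) \<and> ph M N R = sproj (PE E N) u" for R u
    by (rule pts_pull_phi [OF M])
  note SP = struct_props [OF E MN]
  show "st E M N e \<in> pts (PE E M)" "sproj (PE E M) (st E M N e) = sproj ?P e" if "e \<in> pts ?P" for e
    using that SP by (cases e; simp add: mem)+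
  show "st E M N (sact ?P C e) = sact (PE E M) C (st E M N e)" if C: "C \<in> carrier (grp (QS M))" and e: "e \<in> pts ?P" for C e
  proof -
    obtain R u where Ru: "e = (R, u)" "R \<in> Y M" "u \<in> pts (PE E N)" "ph M N R = sproj (PE E N) u"
      using e by (cases e) (simp add: mem)
    have C': "C \<in> carrier (G Mod M)" using C by simp
    obtain g where g: "g \<in> carrier G" "C = M #> g" using C' by (rule coset_ex)
    have C2: "N #> g \<in> carrier (grp (QS N))" using coset_in [OF N g(1)] by simp
    have NC: "N <#> C = N #> g" using coset_merge [OF MN g(1)] g(2) by simp
    have eq: "sact ?P C e = (qact M C R, sact (PE E N) (N #> g) u)" using Ru(1) NC by simp
    note R' = qact_in [OF M C' Ru(2)]
    note u' = gsheafD(11) [OF PN C2 Ru(3)] and pu' = gsheafD(4) [OF PN C2 Ru(3)]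
    have ph': "ph M N (qact M C R) = sproj (PE E N) (sact (PE E N) (N #> g) u)"
      unfolding pu' using ph_qact [OF MN C' Ru(2)] NC Ru(4) by simp
    note L = SP [OF R' u' ph'] and S = SP [OF Ru(2-4)]
    note r = gsheafD(11) [OF PM C S(1)] and pr = gsheafD(4) [OF PM C S(1), unfolded S(2)]
    show ?thesis
      unfolding eq unfolding Ru(1)
    proof (rule sec_inj [OF E M L(1) r])
      show "sproj (PE E M) (st E M N (qact M C R, sact (PE E N) (N #> g) u)) = sproj (PE E M) (sact (PE E M) C (st E M N (R, u)))"
        unfolding L(2) pr by simp
      fix K assume "K \<in> fibre M (sproj (PE E M) (sact (PE E M) C (st E M N (R, u))))"
      then have K: "K \<in> fibre M (qact M C R)" unfolding pr by simp
      then have K1: "act (inv g) K \<in> fibre M R" using fibre_act [OF M g(1) Ru(2)] g(2) by simp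
      have "K \<in> fibre N (ph M N (qact M C R))" by (rule fibre_refine [OF MN K])
      then have K2: "K \<in> fibre N (qact N (N #> g) (sproj (PE E N) u))" unfolding ph' pu' by simp
      have "K \<in> fibre M (qact M (M #> g) (sproj (PE E M) (st E M N (R, u))))" using K g(2) S(2) by simp
      from sec_act [OF E M S(1) g(1) this] show "sec E M (st E M N (qact M C R, sact (PE E N) (N #> g) u)) K = sec E M (sact (PE E M) C (st E M N (R, u))) K"
        using L(3) [OF K] sec_act [OF E N Ru(3) g(1) K2] S(3) [OF K1] g(2) by simp
    qed
  qed
  show "st E M N (sadd ?P a b) = sadd (PE E M) (st E M N a) (st E M N b)"
    if R: "R \<in> topspace (space_top (QS M))" and ab: "a \<in> fib ?P R" "b \<in> fib ?P R" for R a b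
  proof -
    obtain u where u: "a = (R, u)" "R \<in> Y M" "u \<in> pts (PE E N)" "ph M N R = sproj (PE E N) u"
      using ab(1) by (cases a) (simp add: mem)
    obtain v where v: "b = (R, v)" "v \<in> pts (PE E N)" "ph M N R = sproj (PE E N) v"
      using ab(2) by (cases b) (simp add: mem)
    have y: "ph M N R \<in> topspace (space_top (QS N))" using ph_in [OF MN u(2)] N by simp
    have uv: "u \<in> fib (PE E N) (ph M N R)" "v \<in> fib (PE E N) (ph M N R)" using u v by simp_all
    have w: "sadd (PE E N) u v \<in> pts (PE E N)" "ph M N R = sproj (PE E N) (sadd (PE E N) u v)"
      using rat_stalkD(3) [OF gsheafD(5) [OF PN y] uv] by simp_all
    note L = SP [OF u(2) w] and U = SP [OF u(2-4)] and V = SP [OF u(2) v(2,3)]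
    have UV: "st E M N (R, u) \<in> fib (PE E M) R" "st E M N (R, v) \<in> fib (PE E M) R" using U V by simp_all
    note r = rat_stalkD(3) [OF gsheafD(5) [OF PM R] UV]
    have "st E M N (R, sadd (PE E N) u v) = sadd (PE E M) (st E M N (R, u)) (st E M N (R, v))"
    proof (rule sec_inj [OF E M L(1)])
      show "sadd (PE E M) (st E M N (R, u)) (st E M N (R, v)) \<in> pts (PE E M)"
        "sproj (PE E M) (st E M N (R, sadd (PE E N) u v)) = sproj (PE E M) (sadd (PE E M) (st E M N (R, u)) (st E M N (R, v)))"
        using r L(2) by simp_all
      fix K assume "K \<in> fibre M (sproj (PE E M) (sadd (PE E M) (st E M N (R, u)) (st E M N (R, v))))"
      then have K: "K \<in> fibre M R" using r by simp
      show "sec E M (st E M N (R, sadd (PE E N) u v)) K = sec E M (sadd (PE E M) (st E M N (R, u)) (st E M N (R, v))) K"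
        unfolding L(3) [OF K] sec_add [OF E M UV K] U(3) [OF K] V(3) [OF K]
        by (rule sec_add [OF E N uv fibre_refine [OF MN K]])
    qed
    then show ?thesis using u(1) v(1) by simp
  qed
  show "st E M N (sscale ?P q a) = sscale (PE E M) q (st E M N a)"
    if R: "R \<in> topspace (space_top (QS M))" and ab: "a \<in> fib ?P R" for R q a
  proof -
    obtain u where u: "a = (R, u)" "R \<in> Y M" "u \<in> pts (PE E N)" "ph M N R = sproj (PE E N) u"
      using ab(1) by (cases a) (simp add: mem)
    have y: "ph M N R \<in> topspace (space_top (QS N))" using ph_in [OF MN u(2)] N by simp
    have uv: "u \<in> fib (PE E N) (ph M N R)" using u by simp
    have w: "sscale (PE E N) q u \<in> pts (PE E N)" "ph M N R = sproj (PE E N) (sscale (PE E N) q u)"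
      using rat_stalkD(4) [OF gsheafD(5) [OF PN y] uv] by simp_all
    note L = SP [OF u(2) w] and U = SP [OF u(2-4)]
    have UV: "st E M N (R, u) \<in> fib (PE E M) R" using U by simp
    note r = rat_stalkD(4) [OF gsheafD(5) [OF PM R] UV, of q]
    have "st E M N (R, sscale (PE E N) q u) = sscale (PE E M) q (st E M N (R, u))"
    proof (rule sec_inj [OF E M L(1)])
      show "sscale (PE E M) q (st E M N (R, u)) \<in> pts (PE E M)"
        "sproj (PE E M) (st E M N (R, sscale (PE E N) q u)) = sproj (PE E M) (sscale (PE E M) q (st E M N (R, u)))"
        using r L(2) by simp_all
      fix K assume "K \<in> fibre M (sproj (PE E M) (sscale (PE E M) q (st E M N (R, u))))"
      then have K: "K \<in> fibre M R" using r by simp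
      show "sec E M (st E M N (R, sscale (PE E N) q u)) K = sec E M (sscale (PE E M) q (st E M N (R, u))) K"
        unfolding L(3) [OF K] sec_scale [OF E M UV K] U(3) [OF K]
        by (rule sec_scale [OF E N uv fibre_refine [OF MN K]])
    qed
    then show ?thesis using u(1) by simp
  qed
qed

text \<open>Compatibility with composition holds because restricting in two steps is restricting at
  once.\<close>

lemma p_bullet_sheaf:
  fixes E :: "('g, 'g set, 'u) gsheaf"
  assumes E: "is_gsheaf SS E"
  shows "is_bullet_sheaf G T (fobj (p_bullet G T) E)"
  unfolding is_bullet_sheaf_def stage_p_bullet
proof (intro conjI ballI impI)
  show "is_gsheaf (QS N) (PE E N)" if "N \<in> ON" for N by (rule push_pN_gsheaf [OF E that])
  show "st E M N \<in> sheaf_hom (QS M) (pull (phiMN G T M N) (PE E N)) (PE E M)"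
    if "M \<in> ON" "N \<in> ON" "M \<subseteq> N" for M N by (rule struct_hom [OF E that])
  show "case z of (K, d) \<Rightarrow> st E N N (K, d) = d" if N: "N \<in> ON" and z: "z \<in> pts (pull (phiMN G T N N) (PE E N))" for N z
  proof -
    obtain R u where z': "z = (R, u)" "R \<in> Y N" "u \<in> pts (PE E N)" "ph N N R = sproj (PE E N) u"
      using z by (cases z) (simp add: pts_pull_phi [OF N])
    note S = struct_props [OF E N N order_refl z'(2-4)]
    have R: "R = sproj (PE E N) u" using z'(4) ph_id [OF N z'(2)] by simp
    have "st E N N (R, u) = u"
      by (rule sec_inj [OF E N S(1) z'(3)]) (use S(2,3) R in simp_all)
    then show ?thesis using z'(1) by simp
  qed
  show "case z of (K, d) \<Rightarrow> st E L N (K, d) = st E L M (K, st E M N (ph L M K, d))"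
    if LMN: "L \<in> ON" "M \<in> ON" "N \<in> ON" "L \<subseteq> M" "M \<subseteq> N" and z: "z \<in> pts (pull (phiMN G T L N) (PE E N))" for L M N z
  proof -
    note L = LMN(1) and M = LMN(2) and N = LMN(3)
    have LN: "L \<subseteq> N" using LMN(4,5) by (rule subset_trans)
    obtain R u where z': "z = (R, u)" "R \<in> Y L" "u \<in> pts (PE E N)" "ph L N R = sproj (PE E N) u"
      using z by (cases z) (simp add: pts_pull_phi [OF L])
    note R' = ph_in [OF L M LMN(4) z'(2)]
    have ph2: "ph M N (ph L M R) = sproj (PE E N) u" using ph_ph [OF LMN z'(2)] z'(4) by simp
    note A = struct_props [OF E L N LN z'(2-4)] and B = struct_props [OF E M N LMN(5) R' z'(3) ph2]
    note C = struct_props [OF E L M LMN(4) z'(2) B(1), unfolded B(2), OF refl]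
    have "st E L N (R, u) = st E L M (R, st E M N (ph L M R, u))"
    proof (rule sec_inj [OF E L A(1) C(1)])
      show "sproj (PE E L) (st E L N (R, u)) = sproj (PE E L) (st E L M (R, st E M N (ph L M R, u)))"
        unfolding A(2) C(2) by simp
      fix K assume "K \<in> fibre L (sproj (PE E L) (st E L M (R, st E M N (ph L M R, u))))"
      then have K: "K \<in> fibre L R" unfolding C(2) .
      show "sec E L (st E L N (R, u)) K = sec E L (st E L M (R, st E M N (ph L M R, u))) K"
        unfolding A(3) [OF K] C(3) [OF K] by (rule B(3) [OF fibre_refine [OF L M LMN(4) K], symmetric])
    qed
    then show ?thesis using z'(1) by simp
  qed
qed

text \<open>A fibre of \<open>p N\<close> is partitioned into open fibres of \<open>p M\<close>. A
  section is therefore determined by its restrictions, and a family of sections on the pieces glues;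
  \<open>N\<close>-invariance of the family is \<open>N\<close>-invariance of the result.\<close>

lemma p_bullet_adjoint_iso:
  assumes E: "is_gsheaf SS E" and MN: "M \<in> ON" "N \<in> ON" "M \<subseteq> N"
  shows "sheaf_iso (QS N) (PE E N) (push (phiMN G T M N) (PE E M)) (adjoint_struct G T (fobj (p_bullet G T) E) M N)"
proof -
  note M = MN(1) and N = MN(2)
  interpret phi: discrete_change "phiMN G T M N" by (rule phi_change [OF MN])
  note PM = push_pN_gsheaf [OF E M] and PN = push_pN_gsheaf [OF E N] and SP = struct_props [OF E MN]
  have "sheaf_iso (tgt (phiMN G T M N)) (PE E N) (push (phiMN G T M N) (PE E M))
     (adjoint_to_push (phiMN G T M N) (PE E N) (PE E M) (st E M N))"
  proof (rule phi.adjoint_isoI, unfold grp_simps in_phi_fibre [OF M] topspace_QS [OF N])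
    show "is_gsheaf (QS N) (PE E N)" "is_gsheaf (QS M) (PE E M)"
      "st E M N \<in> sheaf_hom (QS M) (pull (phiMN G T M N) (PE E N)) (PE E M)"
      by (rule PM PN struct_hom [OF E MN])+
    fix a b assume a: "a \<in> pts (PE E N)" and b: "b \<in> pts (PE E N)" and p: "sproj (PE E N) a = sproj (PE E N) b"
      and eq: "\<And>R. R \<in> Y M \<and> ph M N R = sproj (PE E N) b \<Longrightarrow> st E M N (R, a) = st E M N (R, b)"
    show "a = b"
    proof (rule sec_inj [OF E N a b p])
      fix K assume "K \<in> fibre N (sproj (PE E N) b)"
      then have K: "K \<in> X" "p N K = sproj (PE E N) b" by (simp_all add: in_fibre)
      have R: "p M K \<in> Y M" "ph M N (p M K) = sproj (PE E N) b" using p_in [OF M K(1)] ph_p [OF MN K(1)] K(2) by simp_all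
      have K': "K \<in> fibre M (p M K)" using K(1) by (simp add: in_fibre)
      have Ra: "ph M N (p M K) = sproj (PE E N) a" using R(2) p by simp
      show "sec E N a K = sec E N b K"
        using SP(3) [OF R(1) a Ra K'] SP(3) [OF R(1) b R(2) K'] eq [of "p M K"] R by simp
    qed
  next
    fix S t assume S: "S \<in> Y N" and t: "t \<in> invariant_sections (phiMN G T M N) (PE E M) {S}"
    note t' = t [unfolded IS_phi [OF MN PM]]
    have mem: "R \<in> preim (phiMN G T M N) {S}" if "R \<in> Y M" "ph M N R = S" for R
      using that by (simp add: in_phi_fibre [OF M])
    have t0: "t R \<in> fib (PE E M) R" if "R \<in> Y M" "ph M N R = S" for R
      by (rule bspec [OF t' [THEN conjunct2, THEN conjunct1] mem [OF that]])
    have t1: "t R \<in> pts (PE E M)" "sproj (PE E M) (t R) = R" if "R \<in> Y M" "ph M N R = S" for R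
      using t0 [OF that] by simp_all
    have t2: "t (qact M (M #> n) R) = sact (PE E M) (M #> n) (t R)" if "R \<in> Y M" "ph M N R = S" "n \<in> N" for n R
      by (rule bspec [OF bspec [OF t' [THEN conjunct2, THEN conjunct2] that(3)] mem [OF that(1,2)]])
    \<comment> \<open>At each \<open>K\<close> the glued section uses the member of the family that
      belongs to the piece containing \<open>K\<close>.\<close>
    define s where "s = (\<lambda>K\<in>fibre N S. sec E M (t (p M K)) K)"
    have R: "p M K \<in> Y M" "ph M N (p M K) = S" "K \<in> fibre M (p M K)" if "K \<in> fibre N S" for K
      using that p_in [OF M] ph_p [OF MN] by (simp_all add: in_fibre)
    have KK: "K \<in> fibre M (sproj (PE E M) (t (p M K)))" if "K \<in> fibre N S" for K
      unfolding t1(2) [OF R(1,2) [OF that]] by (rule R(3) [OF that])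
    have "s \<in> invariant_sections (pN G T N) E {S}"
      unfolding IS_pN [OF N]
    proof (intro conjI ballI)
      show "s \<in> extensional (fibre N S)" by (simp add: s_def)
      show "sproj E (s K) = K" if "K \<in> fibre N S" for K
        using that sec_fib(2) [OF E M t1(1) [OF R(1,2) [OF that]] KK [OF that]] by (simp add: s_def)
      \<comment> \<open>On the open piece around \<open>K\<close> the glued section coincides with
        one section of the family.\<close>
      show "continuous_map (subtopology SG (fibre N S)) (tot E) s"
      proof (rule continuous_map_locally)
        fix K assume "K \<in> topspace (subtopology SG (fibre N S))"
        then have K: "K \<in> fibre N S" by simp
        let ?U = "fibre M (p M K)"
        have sub: "?U \<subseteq> fibre N S" using fibre_refine [OF MN, of _ "p M K"] R(2) [OF K] by auto
        have "continuous_map (subtopology SG ?U) (tot E) (sec E M (t (p M K)))"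
          using sec_IS [OF E M t1(1) [OF R(1,2) [OF K]]] unfolding IS_pN [OF M] t1(2) [OF R(1,2) [OF K]] by simp
        then have "continuous_map (subtopology SG ?U) (tot E) s"
          by (rule continuous_map_eq) (use sub in \<open>auto simp: s_def in_fibre\<close>)
        moreover have "subtopology (subtopology SG (fibre N S)) ?U = subtopology SG ?U"
          using sub by (simp add: subtopology_subtopology Int_absorb1)
        moreover have "openin (subtopology SG (fibre N S)) ?U"
          using fibre_open [OF M, of "p M K"] sub fibre_open [OF N, of S] by (simp add: openin_open_subtopology)
        ultimately show "\<exists>U. openin (subtopology SG (fibre N S)) U \<and> K \<in> U \<and> continuous_map (subtopology (subtopology SG (fibre N S)) U) (tot E) s"
          using R(3) [OF K] by (intro exI [of _ ?U]) simp
      qed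
      fix n K assume n: "n \<in> N" and K: "K \<in> fibre N S"
      have nG: "n \<in> carrier G" using ON_sub [OF N] n by auto
      have KX: "K \<in> X" using K by (simp add: in_fibre)
      note RK = R(1,2) [OF K]
      have pn: "p M (act n K) = qact M (M #> n) (p M K)" by (rule p_act [OF M nG KX])
      have nK: "act n K \<in> fibre N S"
        using p_act [OF N nG KX] coset_eq_one [OF N nG] n K qact_one [OF N S] act_in [OF nG KX] by (simp add: in_fibre)
      have "act n K \<in> fibre M (qact M (M #> n) (sproj (PE E M) (t (p M K))))"
        unfolding t1(2) [OF RK] using pn act_in [OF nG KX] by (simp add: in_fibre)
      from sec_act [OF E M t1(1) [OF RK] nG this]
      show "s (act n K) = sact E n (s K)"
        using nK K t2 [OF RK n] act_inv(1) [OF nG KX] by (simp add: s_def pn)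
    qed
    then obtain u where u: "u \<in> pts (PE E N)" "sproj (PE E N) u = S" "sec E N u = s"
      using sec_surj [OF E N S] by metis
    show "\<exists>d\<in>fib (PE E N) S. \<forall>x\<in>preim (phiMN G T M N) {S}. st E M N (x, d) = t x"
    proof (rule bexI [of _ u], rule ballI)
      fix Q assume "Q \<in> preim (phiMN G T M N) {S}"
      then have Q: "Q \<in> Y M" "ph M N Q = S" by (simp_all add: in_phi_fibre [OF M])
      have Qu: "ph M N Q = sproj (PE E N) u" using Q(2) u(2) by simp
      note P = SP [OF Q(1) u(1) Qu]
      show "st E M N (Q, u) = t Q"
      proof (rule sec_inj [OF E M P(1) t1(1) [OF Q]])
        show "sproj (PE E M) (st E M N (Q, u)) = sproj (PE E M) (t Q)" unfolding P(2) t1(2) [OF Q] by simp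
        fix K assume "K \<in> fibre M (sproj (PE E M) (t Q))"
        then have K: "K \<in> fibre M Q" unfolding t1(2) [OF Q] .
        have "K \<in> fibre N S" using fibre_refine [OF MN K] Q(2) by simp
        then show "sec E M (st E M N (Q, u)) K = sec E M (t Q) K"
          unfolding P(3) [OF K] u(3) using K by (simp add: s_def in_fibre)
      qed
    qed (use u in simp)
  qed
  then show ?thesis by (simp add: adjoint_struct_def)
qed

text \<open>If \<open>p N K = S\<close>, each coset in \<open>S\<close> has a representative in
  \<open>K\<close> itself. It normalizes \<open>K\<close> and acts trivially on the stalk there, so
  it fixes the value at \<open>K\<close> of any section over the fibre of \<open>S\<close>.\<close>

lemma p_bullet_weyl:
  assumes E: "is_weyl_sheaf G T E" and N: "N \<in> ON"
  shows "is_weyl_sheaf (G Mod N) (quotient_group_topology G T N) (PE E N)"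
proof -
  have E': "is_gsheaf SS E" and W: "\<And>K k e. K \<in> X \<Longrightarrow> k \<in> K \<Longrightarrow> e \<in> fib E K \<Longrightarrow> sact E k e = e"
    using E by (simp_all add: is_weyl_sheaf_def carrier_stalk)
  note PN = push_pN_gsheaf [OF E' N]
  have "sact (PE E N) C u = u" if S: "S \<in> Y N" and C: "C \<in> S" and u: "u \<in> fib (PE E N) S" for S C u
  proof -
    have u': "u \<in> pts (PE E N)" "sproj (PE E N) u = S" using u by simp_all
    have sub: "subgroup S (G Mod N)" using S N by (simp add: Y_iff)
    have C': "C \<in> carrier (grp (QS N))" using subgroup.mem_carrier [OF sub C] by simp
    obtain K0 where K0: "K0 \<in> X" "S = p N K0" using p_ex [OF N S] by auto
    then obtain k0 where k0: "k0 \<in> K0" "C = N #> k0" using C by (auto simp: p_def')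
    have k0G: "k0 \<in> carrier G" using X_sub [OF K0(1)] k0 by auto
    have CS: "qact N C S = S"
      using p_act [OF N k0G K0(1)] act_self [OF K0(1) k0(1)] k0(2) K0(2) by simp
    note r = gsheafD(11) [OF PN C' u'(1)] and pr = gsheafD(4) [OF PN C' u'(1), unfolded u'(2) CS]
    show ?thesis
    proof (rule sec_inj [OF E' N r u'(1)])
      show "sproj (PE E N) (sact (PE E N) C u) = sproj (PE E N) u" unfolding pr CS u'(2) by simp
      fix K assume "K \<in> fibre N (sproj (PE E N) u)"
      then have K: "K \<in> X" "p N K = S" using u'(2) by (simp_all add: in_fibre)
      \<comment> \<open>The representative is chosen anew for each \<open>K\<close> of the fibre;
        the formula for the action holds for every representative.\<close>
      obtain k where k: "k \<in> K" "C = N #> k" using C K(2) by (auto simp: p_def')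
      have kG: "k \<in> carrier G" using X_sub [OF K(1)] k by auto
      have iK: "act (inv k) K = K"
        using act_self [OF K(1)] subgroup.m_inv_closed [OF X_subgroup [OF K(1)] k(1)] by simp
      have "K \<in> fibre N (qact N (N #> k) (sproj (PE E N) u))" using K CS k(2) u'(2) by (simp add: in_fibre)
      from sec_act [OF E' N u'(1) kG this]
      have "sec E N (sact (PE E N) C u) K = sact E k (sec E N u K)" using k(2) iK by simp
      also have "\<dots> = sec E N u K"
        using W [OF K(1) k(1)] sec_fib [OF E' N u'(1), of K] K u'(2) by (simp add: in_fibre)
      finally show "sec E N (sact (PE E N) C u) K = sec E N u K" .
    qed
  qed
  then show ?thesis
    unfolding is_weyl_sheaf_def carrier_stalk using PN by (simp add: quotient_subgroup_space_def)
qed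

section \<open>The action of a sheaf map on invariant sections\<close>

lemma farr_props:
  assumes E: "is_gsheaf SS E" and E': "is_gsheaf SS E'" and f: "f \<in> sheaf_hom SS E E'" and N: "N \<in> ON"
    and u: "u \<in> pts (PE E N)"
  shows "farr (p_bullet G T) E E' f N u \<in> pts (PE E' N)"
    "sproj (PE E' N) (farr (p_bullet G T) E E' f N u) = sproj (PE E N) u"
    "\<And>K. K \<in> fibre N (sproj (PE E N) u) \<Longrightarrow> sec E' N (farr (p_bullet G T) E E' f N u) K = f (sec E N u K)"
proof -
  interpret c: discrete_change "pN G T N" by (rule pN_change [OF N])
  note U = from_copy_in [OF E N u]
  have f': "f \<in> sheaf_hom (src (pN G T N)) E E'" using f by simp
  note P = c.push_map_props [OF f' U(1), unfolded U(3)]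
  have eq: "farr (p_bullet G T) E E' f N u = to_copy G T E' N (push_map (pN G T N) E E' f (from_copy G T E N u))"
    using u N by (simp add: p_bullet_def)
  show "farr (p_bullet G T) E E' f N u \<in> pts (PE E' N)"
    "sproj (PE E' N) (farr (p_bullet G T) E E' f N u) = sproj (PE E N) u"
    unfolding eq using to_copy_in [OF E' N P(1)] P(2) by simp_all
  show "sec E' N (farr (p_bullet G T) E E' f N u) K = f (sec E N u K)" if "K \<in> fibre N (sproj (PE E N) u)" for K
    unfolding eq sec_to_copy [OF E' N P(1)] P(3) using that by (simp add: sec_def)
qed

lemma farr_hom:
  assumes E: "is_gsheaf SS E" and E': "is_gsheaf SS E'" and f: "f \<in> sheaf_hom SS E E'" and N: "N \<in> ON"
  shows "farr (p_bullet G T) E E' f N \<in> sheaf_hom (QS N) (PE E N) (PE E' N)"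
proof (rule discrete_homI)
  note PN = push_pN_gsheaf [OF E N] and PN' = push_pN_gsheaf [OF E' N] and F = farr_props [OF E E' f N]
  note Fh = sheaf_homD [OF f, unfolded grp_simps topspace_SG]
  let ?f = "farr (p_bullet G T) E E' f N"
  show "tot (PE E N) = discrete_topology (pts (PE E N))" by (rule discrete_gsheaf_tot [OF QS_discrete [OF N] PN])
  show "?f \<in> extensional (pts (PE E N))" using N by (simp add: p_bullet_def)
  show "?f u \<in> pts (PE E' N)" "sproj (PE E' N) (?f u) = sproj (PE E N) u" if "u \<in> pts (PE E N)" for u
    using F [OF that] by simp_all
  show "?f (sact (PE E N) C u) = sact (PE E' N) C (?f u)" if C: "C \<in> carrier (grp (QS N))" and u: "u \<in> pts (PE E N)" for C u
  proof -
    have C': "C \<in> carrier (G Mod N)" using C by simp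
    obtain g where g: "g \<in> carrier G" "C = N #> g" using C' by (rule coset_ex)
    note cu = gsheafD(11) [OF PN C u] gsheafD(4) [OF PN C u]
    note L = F [OF cu(1), unfolded cu(2)] and U = F [OF u]
    note r = gsheafD(11) [OF PN' C U(1)] gsheafD(4) [OF PN' C U(1), unfolded U(2)]
    have Su: "sproj (PE E N) u \<in> Y N" by (rule push_pN_sproj [OF E N u])
    show ?thesis
    proof (rule sec_inj [OF E' N L(1) r(1)])
      show "sproj (PE E' N) (?f (sact (PE E N) C u)) = sproj (PE E' N) (sact (PE E' N) C (?f u))" unfolding L(2) r(2) ..
      fix K assume "K \<in> fibre N (sproj (PE E' N) (sact (PE E' N) C (?f u)))"
      then have K: "K \<in> fibre N (qact N C (sproj (PE E N) u))" unfolding r(2) .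
      have K1: "K \<in> fibre N (qact N (N #> g) (sproj (PE E N) u))" using K g(2) by simp
      have K2: "K \<in> fibre N (qact N (N #> g) (sproj (PE E' N) (?f u)))" using K1 U(2) by simp
      have K3: "act (inv g) K \<in> fibre N (sproj (PE E N) u)" by (rule fibre_act [OF N g(1) Su K1])
      show "sec E' N (?f (sact (PE E N) C u)) K = sec E' N (sact (PE E' N) C (?f u)) K"
        using L(3) [OF K] sec_act [OF E N u g(1) K1] sec_act [OF E' N U(1) g(1) K2] U(3) [OF K3] g
          Fh(5) [OF g(1) sec_fib(1) [OF E N u K3]] by simp
    qed
  qed
  show "?f (sadd (PE E N) a b) = sadd (PE E' N) (?f a) (?f b)"
    if S: "S \<in> topspace (space_top (QS N))" and ab: "a \<in> fib (PE E N) S" "b \<in> fib (PE E N) S" for S a b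
  proof -
    have a: "a \<in> pts (PE E N)" "sproj (PE E N) a = S" and b: "b \<in> pts (PE E N)" "sproj (PE E N) b = S" using ab by simp_all
    have s: "sadd (PE E N) a b \<in> pts (PE E N)" "sproj (PE E N) (sadd (PE E N) a b) = S"
      using rat_stalkD(3) [OF gsheafD(5) [OF PN S] ab] by simp_all
    note L = F [OF s(1), unfolded s(2)] and A = F [OF a(1), unfolded a(2)] and B = F [OF b(1), unfolded b(2)]
    have AB: "?f a \<in> fib (PE E' N) S" "?f b \<in> fib (PE E' N) S" using A B by simp_all
    note r = rat_stalkD(3) [OF gsheafD(5) [OF PN' S] AB]
    show ?thesis
    proof (rule sec_inj [OF E' N L(1)])
      show "sadd (PE E' N) (?f a) (?f b) \<in> pts (PE E' N)"
        "sproj (PE E' N) (?f (sadd (PE E N) a b)) = sproj (PE E' N) (sadd (PE E' N) (?f a) (?f b))" using r L(2) by simp_all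
      fix K assume "K \<in> fibre N (sproj (PE E' N) (sadd (PE E' N) (?f a) (?f b)))"
      then have K: "K \<in> fibre N S" using r by simp
      have KX: "K \<in> X" using K by (simp add: in_fibre)
      have "sec E N a K \<in> fib E K" "sec E N b K \<in> fib E K"
        using sec_fib [OF E N a(1), of K] sec_fib [OF E N b(1), of K] K a(2) b(2) by simp_all
      from Fh(6) [OF KX this]
      show "sec E' N (?f (sadd (PE E N) a b)) K = sec E' N (sadd (PE E' N) (?f a) (?f b)) K"
        unfolding L(3) [OF K] sec_add [OF E' N AB K] sec_add [OF E N ab K] A(3) [OF K] B(3) [OF K] .
    qed
  qed
  show "?f (sscale (PE E N) q a) = sscale (PE E' N) q (?f a)"
    if S: "S \<in> topspace (space_top (QS N))" and ab: "a \<in> fib (PE E N) S" for S q a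
  proof -
    have a: "a \<in> pts (PE E N)" "sproj (PE E N) a = S" using ab by simp_all
    have s: "sscale (PE E N) q a \<in> pts (PE E N)" "sproj (PE E N) (sscale (PE E N) q a) = S"
      using rat_stalkD(4) [OF gsheafD(5) [OF PN S] ab] by simp_all
    note L = F [OF s(1), unfolded s(2)] and A = F [OF a(1), unfolded a(2)]
    have AB: "?f a \<in> fib (PE E' N) S" using A by simp
    note r = rat_stalkD(4) [OF gsheafD(5) [OF PN' S] AB, of q]
    show ?thesis
    proof (rule sec_inj [OF E' N L(1)])
      show "sscale (PE E' N) q (?f a) \<in> pts (PE E' N)"
        "sproj (PE E' N) (?f (sscale (PE E N) q a)) = sproj (PE E' N) (sscale (PE E' N) q (?f a))" using r L(2) by simp_all
      fix K assume "K \<in> fibre N (sproj (PE E' N) (sscale (PE E' N) q (?f a)))"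
      then have K: "K \<in> fibre N S" using r by simp
      have KX: "K \<in> X" using K by (simp add: in_fibre)
      have "sec E N a K \<in> fib E K"
        using sec_fib [OF E N a(1), of K] K a(2) by simp
      from Fh(7) [OF KX this]
      show "sec E' N (?f (sscale (PE E N) q a)) K = sec E' N (sscale (PE E' N) q (?f a)) K"
        unfolding L(3) [OF K] sec_scale [OF E' N AB K] sec_scale [OF E N ab K] A(3) [OF K] .
    qed
  qed
qed

lemma farr_bullet_hom:
  fixes E E' :: "('g, 'g set, 'u) gsheaf"
  assumes E: "is_gsheaf SS E" and E': "is_gsheaf SS E'" and f: "f \<in> sheaf_hom SS E E'"
  shows "farr (p_bullet G T) E E' f \<in> bullet_hom G T (fobj (p_bullet G T) E) (fobj (p_bullet G T) E')"
  unfolding bullet_hom_def stage_p_bullet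
proof (intro CollectI conjI ballI impI)
  let ?f = "farr (p_bullet G T) E E' f"
  show "?f \<in> extensional ON" by (simp add: p_bullet_def)
  show "?f N \<in> sheaf_hom (QS N) (PE E N) (PE E' N)" if "N \<in> ON" for N by (rule farr_hom [OF E E' f that])
  fix M N z assume MN: "M \<in> ON" "N \<in> ON" "M \<subseteq> N" and z: "z \<in> pts (pull (phiMN G T M N) (PE E N))"
  note M = MN(1) and N = MN(2)
  obtain R u where z': "z = (R, u)" "R \<in> Y M" "u \<in> pts (PE E N)" "ph M N R = sproj (PE E N) u"
    using z by (cases z) (simp add: pts_pull_phi [OF M])
  note S = struct_props [OF E MN z'(2-4)] and FN = farr_props [OF E E' f N z'(3)]
  note FM = farr_props [OF E E' f M S(1), unfolded S(2)]
  have ph': "ph M N R = sproj (PE E' N) (?f N u)" using z'(4) FN(2) by simp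
  note S' = struct_props [OF E' MN z'(2) FN(1) ph']
  have "?f M (st E M N (R, u)) = st E' M N (R, ?f N u)"
  proof (rule sec_inj [OF E' M FM(1) S'(1)])
    show "sproj (PE E' M) (?f M (st E M N (R, u))) = sproj (PE E' M) (st E' M N (R, ?f N u))" unfolding FM(2) S'(2) ..
    fix K assume "K \<in> fibre M (sproj (PE E' M) (st E' M N (R, ?f N u)))"
    then have K: "K \<in> fibre M R" unfolding S'(2) .
    have K': "K \<in> fibre N (sproj (PE E N) u)" using fibre_refine [OF MN K] z'(4) by simp
    show "sec E' M (?f M (st E M N (R, u))) K = sec E' M (st E' M N (R, ?f N u)) K"
      unfolding FM(3) [OF K] S'(3) [OF K] FN(3) [OF K'] S(3) [OF K] ..
  qed
  then show "?f M (st E M N z) = st E' M N (pull_map (phiMN G T M N) (PE E N) (?f N) z)"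
    using z z'(1) by (simp add: pull_map_def)
qed

end

section \<open>Colimits\<close>

context profin
begin

definition tr :: "('g, 'u) bullet_sheaf \<Rightarrow> 'g set \<Rightarrow> 'g set \<Rightarrow> 'g set \<Rightarrow> 'u \<Rightarrow> 'u" where
  "tr D M N K d = struct D M N (p M K, d)"

text \<open>The pair \<open>(K, d)\<close> is a point over \<open>K\<close> of the pull back of
  \<open>D\<close> at stage \<open>N\<close>. The transition maps and the identifications in the
  colimit stay over one \<open>K\<close>, which is why it is carried as a separate argument.\<close>

definition at_stage :: "('g, 'u) bullet_sheaf \<Rightarrow> 'g set \<Rightarrow> 'g set \<Rightarrow> 'u \<Rightarrow> bool" where
  "at_stage D N K d \<longleftrightarrow> N \<in> ON \<and> K \<in> X \<and> d \<in> pts (stage D N) \<and> sproj (stage D N) d = p N K"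

lemma at_stageD:
  assumes "at_stage D N K d"
  shows "N \<in> ON" "K \<in> X" "d \<in> pts (stage D N)" "sproj (stage D N) d = p N K" "d \<in> fib (stage D N) (p N K)"
  using assms by (simp_all add: at_stage_def)

lemma at_stageI: "N \<in> ON \<Longrightarrow> K \<in> X \<Longrightarrow> d \<in> fib (stage D N) (p N K) \<Longrightarrow> at_stage D N K d"
  by (simp add: at_stage_def)

lemma at_stage_fibre: "N \<in> ON \<Longrightarrow> d \<in> pts (stage D N) \<Longrightarrow> K \<in> fibre N (sproj (stage D N) d) \<Longrightarrow> at_stage D N K d"
  by (simp add: at_stage_def in_fibre)

end

locale profin_bullet = profin G T for G :: "'g monoid" (structure) and T :: "'g topology" +
  fixes D :: "('g, 'u) bullet_sheaf"
  assumes BD: "is_bullet_sheaf G T D"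
begin

lemma in_pull: "N \<in> ON \<Longrightarrow> (K, d) \<in> pts (pull (pN G T N) (stage D N)) \<longleftrightarrow> at_stage D N K d"
  by (auto simp: pts_pull_pN at_stage_def)

lemma self_fibre: "at_stage D N K d \<Longrightarrow> K \<in> fibre N (sproj (stage D N) d)"
  by (simp add: at_stage_def in_fibre)

lemma stage_gsheaf: "N \<in> ON \<Longrightarrow> is_gsheaf (QS N) (stage D N)"
  using BD by (simp add: is_bullet_sheaf_def)

lemma stage_stalk: "N \<in> ON \<Longrightarrow> K \<in> X \<Longrightarrow> rat_stalk (stage D N) (p N K)"
  using gsheafD(5) [OF stage_gsheaf, of N "p N K"] by (simp add: p_in)

lemma struct_sheaf_hom: "M \<in> ON \<Longrightarrow> N \<in> ON \<Longrightarrow> M \<subseteq> N \<Longrightarrow>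
    struct D M N \<in> sheaf_hom (QS M) (pull (phiMN G T M N) (stage D N)) (stage D M)"
  using BD by (simp add: is_bullet_sheaf_def)

lemma mem_pull:
  assumes "M \<in> ON" "M \<subseteq> N" "at_stage D N K d"
  shows "(p M K, d) \<in> pts (pull (phiMN G T M N) (stage D N))"
  using assms(1,2) at_stageD [OF assms(3)] by (simp add: pts_pull_phi p_in ph_p)

lemma tr_in:
  assumes "M \<in> ON" "M \<subseteq> N" "at_stage D N K d"
  shows "at_stage D M K (tr D M N K d)"
  using sheaf_homD(3,4) [OF struct_sheaf_hom [OF assms(1) at_stageD(1) [OF assms(3)] assms(2)] mem_pull [OF assms]]
    assms(1) at_stageD(2) [OF assms(3)]
  by (simp add: tr_def at_stage_def)

lemma tr_id:
  assumes "at_stage D N K d" shows "tr D N N K d = d"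
proof -
  note N = at_stageD(1) [OF assms]
  have "\<forall>z\<in>pts (pull (phiMN G T N N) (stage D N)). case z of (K, d) \<Rightarrow> struct D N N (K, d) = d"
    using BD N by (simp add: is_bullet_sheaf_def)
  from bspec [OF this mem_pull [OF N order_refl assms]] show ?thesis by (simp add: tr_def)
qed

lemma tr_comp:
  assumes L: "L \<in> ON" "L \<subseteq> M" and M: "M \<in> ON" "M \<subseteq> N" and d: "at_stage D N K d"
  shows "tr D L N K d = tr D L M K (tr D M N K d)"
proof -
  note N = at_stageD(1) [OF d]
  have "\<forall>z\<in>pts (pull (phiMN G T L N) (stage D N)). case z of (K, d) \<Rightarrow>
      struct D L N (K, d) = struct D L M (K, struct D M N (ph L M K, d))"
    using BD L M N unfolding is_bullet_sheaf_def by blast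
  from bspec [OF this mem_pull [OF L(1) subset_trans [OF L(2) M(2)] d]]
  show ?thesis using ph_p [OF L(1) M(1) L(2) at_stageD(2) [OF d]] by (simp add: tr_def)
qed

lemma stage_ops:
  assumes a: "at_stage D N K a" and b: "at_stage D N K b"
  shows "at_stage D N K (sadd (stage D N) a b)" "at_stage D N K (sscale (stage D N) r a)"
    "at_stage D N K (szero (stage D N) (p N K))"
  using rat_stalkD(3) [OF stage_stalk [OF at_stageD(1,2) [OF a]] at_stageD(5) [OF a] at_stageD(5) [OF b]]
    rat_stalkD(4) [OF stage_stalk [OF at_stageD(1,2) [OF a]] at_stageD(5) [OF a], of r]
    rat_stalkD(1,2) [OF stage_stalk [OF at_stageD(1,2) [OF a]]] at_stageD(1,2) [OF a]
  by (simp_all add: at_stage_def)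

lemma stage_zero: "N \<in> ON \<Longrightarrow> K \<in> X \<Longrightarrow> at_stage D N K (szero (stage D N) (p N K))"
  using rat_stalkD(1,2) [OF stage_stalk, of N K] by (simp add: at_stage_def)

lemma stage_act:
  assumes d: "at_stage D N K d" and g: "g \<in> carrier G"
  shows "at_stage D N (act g K) (sact (stage D N) (N #> g) d)"
proof -
  note N = at_stageD(1) [OF d] and KX = at_stageD(2) [OF d]
  have C: "N #> g \<in> carrier (grp (QS N))" using coset_in [OF N g] by simp
  show ?thesis
    using gsheafD(11) [OF stage_gsheaf [OF N] C at_stageD(3) [OF d]] gsheafD(4) [OF stage_gsheaf [OF N] C at_stageD(3) [OF d]]
      p_act [OF N g KX] act_in [OF g KX] N at_stageD(4) [OF d]
    by (simp add: at_stage_def)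
qed

lemma tr_ops:
  assumes M: "M \<in> ON" "M \<subseteq> N" and a: "at_stage D N K a" and b: "at_stage D N K b"
  shows "tr D M N K (sadd (stage D N) a b) = sadd (stage D M) (tr D M N K a) (tr D M N K b)"
    "tr D M N K (sscale (stage D N) r a) = sscale (stage D M) r (tr D M N K a)"
proof -
  note h = struct_sheaf_hom [OF M(1) at_stageD(1) [OF a] M(2)]
  have R: "p M K \<in> topspace (space_top (QS M))" using p_in [OF M(1) at_stageD(2) [OF a]] M(1) by simp
  have ab: "(p M K, a) \<in> fib (pull (phiMN G T M N) (stage D N)) (p M K)"
      "(p M K, b) \<in> fib (pull (phiMN G T M N) (stage D N)) (p M K)"
    using mem_pull [OF M a] mem_pull [OF M b] by simp_all
  show "tr D M N K (sadd (stage D N) a b) = sadd (stage D M) (tr D M N K a) (tr D M N K b)"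
    using sheaf_homD(6) [OF h R ab] by (simp add: tr_def)
  show "tr D M N K (sscale (stage D N) r a) = sscale (stage D M) r (tr D M N K a)"
    using sheaf_homD(7) [OF h R ab(1), of r] by (simp add: tr_def)
qed

lemma tr_act:
  assumes M: "M \<in> ON" "M \<subseteq> N" and a: "at_stage D N K a" and g: "g \<in> carrier G"
  shows "tr D M N (act g K) (sact (stage D N) (N #> g) a) = sact (stage D M) (M #> g) (tr D M N K a)"
proof -
  note h = struct_sheaf_hom [OF M(1) at_stageD(1) [OF a] M(2)]
  have C: "M #> g \<in> carrier (grp (QS M))" using coset_in [OF M(1) g] by simp
  show ?thesis
    using sheaf_homD(5) [OF h C mem_pull [OF M a]] p_act [OF M(1) g at_stageD(2) [OF a]]
      coset_merge [OF M(1) at_stageD(1) [OF a] M(2) g] by (simp add: tr_def)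
qed

text \<open>The source of all local constancy: an equation between transitions to \<open>M\<close>
  that holds at \<open>K\<close> holds on the whole fibre of \<open>p M\<close> through
  \<open>K\<close>.\<close>

lemma tr_local: "p M K = p M K' \<Longrightarrow> tr D M N K d = tr D M N K' d"
  by (simp add: tr_def)

subsection \<open>Cocones\<close>

text \<open>As \<open>D\<close> at stage \<open>N\<close> is discrete, its pull back is a disjoint
  union of open pieces, one for each point \<open>d\<close>, and each piece projects onto a fibre of
  \<open>p N\<close>. Continuity is tested on these.\<close>

lemma pull_pN_homI:
  assumes N: "N \<in> ON" and ext: "k \<in> extensional (pts (pull (pN G T N) (stage D N)))"
    and k: "\<And>K d. at_stage D N K d \<Longrightarrow> k (K, d) \<in> pts E \<and> sproj E (k (K, d)) = K"
    and cont: "\<And>d. d \<in> pts (stage D N) \<Longrightarrow>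
       continuous_map (subtopology SG (fibre N (sproj (stage D N) d))) (tot E) (\<lambda>K. k (K, d))"
    and act: "\<And>g K d. g \<in> carrier G \<Longrightarrow> at_stage D N K d \<Longrightarrow> k (act g K, sact (stage D N) (N #> g) d) = sact E g (k (K, d))"
    and add: "\<And>K a b. at_stage D N K a \<Longrightarrow> at_stage D N K b \<Longrightarrow> k (K, sadd (stage D N) a b) = sadd E (k (K, a)) (k (K, b))"
    and scale: "\<And>K a r. at_stage D N K a \<Longrightarrow> k (K, sscale (stage D N) r a) = sscale E r (k (K, a))"
  shows "k \<in> sheaf_hom SS (pull (pN G T N) (stage D N)) E"
proof (rule sheaf_homI)
  let ?P = "pull (pN G T N) (stage D N)"
  show "k \<in> extensional (pts ?P)" by (rule ext)
  show "k e \<in> pts E" "sproj E (k e) = sproj ?P e" if "e \<in> pts ?P" for e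
    using that k in_pull [OF N] by (cases e; simp)+
  show "k (sact ?P g e) = sact E g (k e)" if "g \<in> carrier (grp SS)" "e \<in> pts ?P" for g e
    using that act in_pull [OF N] by (cases e) simp
  show "k (sadd ?P a b) = sadd E (k a) (k b)" if "a \<in> fib ?P x" "b \<in> fib ?P x" for x a b
    using that add in_pull [OF N] by (cases a; cases b) simp
  show "k (sscale ?P r a) = sscale E r (k a)" if "a \<in> fib ?P x" for x r a
    using that scale in_pull [OF N] by (cases a) simp
  have tot: "tot (stage D N) = discrete_topology (pts (stage D N))"
    by (rule discrete_gsheaf_tot [OF QS_discrete [OF N] stage_gsheaf [OF N]])
  have Ptot: "tot ?P = subtopology (prod_topology SG (tot (stage D N))) {(x, d). p N x = sproj (stage D N) d}"
    by (simp add: pull_def)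
  have cf: "continuous_map (tot ?P) SG fst" and cs: "continuous_map (tot ?P) (tot (stage D N)) snd"
    unfolding Ptot by (auto intro: continuous_map_from_subtopology continuous_map_fst continuous_map_snd)
  show "continuous_map (tot ?P) (tot E) k"
  proof (rule continuous_map_locally)
    fix z assume z: "z \<in> pts ?P"
    obtain K d where Kd: "z = (K, d)" "at_stage D N K d" using z in_pull [OF N] by (cases z) simp
    note d = at_stageD(3) [OF Kd(2)]
    let ?U = "{w \<in> pts ?P. snd w \<in> {d}}"
    have "openin (tot (stage D N)) {d}" by (subst tot) (use d in simp)
    then have U: "openin (tot ?P) ?U" by (rule openin_continuous_map_preimage [OF cs])
    have fU: "fst w \<in> fibre N (sproj (stage D N) d)" if "w \<in> ?U" for w
      using that in_pull [OF N] self_fibre by (cases w) auto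
    have "continuous_map (subtopology (tot ?P) ?U) (subtopology SG (fibre N (sproj (stage D N) d))) fst"
      unfolding continuous_map_in_subtopology using cf fU by (auto intro: continuous_map_from_subtopology)
    from continuous_map_compose [OF this cont [OF d]]
    have "continuous_map (subtopology (tot ?P) ?U) (tot E) k"
      by (rule continuous_map_eq) auto
    then show "\<exists>U. openin (tot ?P) U \<and> z \<in> U \<and> continuous_map (subtopology (tot ?P) U) (tot E) k"
      using U z Kd(1) by (intro exI [of _ ?U]) simp
  qed
qed

context
  fixes E :: "('g, 'g set, 'u) gsheaf" and \<kappa>
  assumes CC: "is_cocone G T D E \<kappa>"
begin

lemma cocone_gsheaf: "is_gsheaf SS E"
  using CC by (simp add: is_cocone_def)

lemma cocone_hom: "N \<in> ON \<Longrightarrow> \<kappa> N \<in> sheaf_hom SS (pull (pN G T N) (stage D N)) E"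
  using CC by (simp add: is_cocone_def)

lemma cocone_in:
  assumes "at_stage D N K d"
  shows "\<kappa> N (K, d) \<in> pts E" "sproj E (\<kappa> N (K, d)) = K" "\<kappa> N (K, d) \<in> fib E K"
proof -
  note N = at_stageD(1) [OF assms]
  show "\<kappa> N (K, d) \<in> pts E" "sproj E (\<kappa> N (K, d)) = K"
    using sheaf_homD(3,4) [OF cocone_hom [OF N], of "(K, d)"] assms in_pull [OF N] by simp_all
  then show "\<kappa> N (K, d) \<in> fib E K" by simp
qed

lemma cocone_tr:
  assumes "M \<in> ON" "M \<subseteq> N" "at_stage D N K d"
  shows "\<kappa> M (K, tr D M N K d) = \<kappa> N (K, d)"
proof -
  note N = at_stageD(1) [OF assms(3)]
  have "\<forall>z\<in>pts (pull (pN G T N) (stage D N)). case z of (K, d) \<Rightarrow> \<kappa> M (K, struct D M N (p M K, d)) = \<kappa> N (K, d)"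
    using CC assms(1,2) N unfolding is_cocone_def by blast
  moreover have "(K, d) \<in> pts (pull (pN G T N) (stage D N))" using assms(3) in_pull [OF N] by simp
  ultimately have "case (K, d) of (K, d) \<Rightarrow> \<kappa> M (K, struct D M N (p M K, d)) = \<kappa> N (K, d)" by (rule bspec)
  then show ?thesis by (simp add: tr_def)
qed

lemma cocone_act:
  assumes "at_stage D N K d" "g \<in> carrier G"
  shows "\<kappa> N (act g K, sact (stage D N) (N #> g) d) = sact E g (\<kappa> N (K, d))"
  using sheaf_homD(5) [OF cocone_hom [OF at_stageD(1) [OF assms(1)]], of g "(K, d)"] assms in_pull at_stageD(1) [OF assms(1)]
  by simp

lemma cocone_add:
  assumes "at_stage D N K a" "at_stage D N K b"
  shows "\<kappa> N (K, sadd (stage D N) a b) = sadd E (\<kappa> N (K, a)) (\<kappa> N (K, b))"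
  using sheaf_homD(6) [OF cocone_hom [OF at_stageD(1) [OF assms(1)]], of K "(K, a)" "(K, b)"] assms in_pull at_stageD(1,2) [OF assms(1)]
  by simp

lemma cocone_scale:
  assumes "at_stage D N K a"
  shows "\<kappa> N (K, sscale (stage D N) r a) = sscale E r (\<kappa> N (K, a))"
  using sheaf_homD(7) [OF cocone_hom [OF at_stageD(1) [OF assms(1)]], of K "(K, a)" r] assms in_pull at_stageD(1,2) [OF assms(1)]
  by simp

lemma cocone_cont:
  assumes N: "N \<in> ON" and d: "d \<in> pts (stage D N)"
  shows "continuous_map (subtopology SG (fibre N (sproj (stage D N) d))) (tot E) (\<lambda>K. \<kappa> N (K, d))"
proof -
  let ?F = "subtopology SG (fibre N (sproj (stage D N) d))"
  have "continuous_map ?F (prod_topology SG (tot (stage D N))) (\<lambda>K. (K, d))"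
    using d by (simp add: continuous_map_paired continuous_map_from_subtopology)
  then have "continuous_map ?F (tot (pull (pN G T N) (stage D N))) (\<lambda>K. (K, d))"
    unfolding pull_def gsheaf.simps continuous_map_in_subtopology by (auto simp: in_fibre)
  from continuous_map_compose [OF this sheaf_homD(2) [OF cocone_hom [OF N]]] show ?thesis by (simp add: o_def)
qed

end

text \<open>A cocone is a colimit if it is so on stalks.\<close>

definition good_cocone :: "('g, 'g set, 'u) gsheaf \<Rightarrow> ('g set \<Rightarrow> 'g set \<times> 'u \<Rightarrow> 'u) \<Rightarrow> bool" where
  "good_cocone E \<kappa> \<longleftrightarrow> is_cocone G T D E \<kappa> \<and>
     (\<forall>e\<in>pts E. \<exists>N d. at_stage D N (sproj E e) d \<and> \<kappa> N (sproj E e, d) = e) \<and>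
     (\<forall>N N' K d d'. at_stage D N K d \<longrightarrow> at_stage D N' K d' \<longrightarrow> \<kappa> N (K, d) = \<kappa> N' (K, d') \<longrightarrow>
        (\<exists>M\<in>ON. M \<subseteq> N \<and> M \<subseteq> N' \<and> tr D M N K d = tr D M N' K d'))"

lemma good_surj:
  assumes "good_cocone E \<kappa>" "e \<in> pts E"
  obtains N d where "at_stage D N (sproj E e) d" "\<kappa> N (sproj E e, d) = e"
  using assms unfolding good_cocone_def by metis

lemma good_eq:
  assumes "good_cocone E \<kappa>" "at_stage D N K d" "at_stage D N' K d'" "\<kappa> N (K, d) = \<kappa> N' (K, d')"
  obtains M where "M \<in> ON" "M \<subseteq> N" "M \<subseteq> N'" "tr D M N K d = tr D M N' K d'"
  using assms unfolding good_cocone_def by metis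

text \<open>Representatives at two stages are carried to the intersection of the stages, so that
  sums can be compared at one stage.\<close>

lemma good_common:
  assumes g: "good_cocone E \<kappa>" and a: "a \<in> fib E K" and b: "b \<in> fib E K"
  obtains M d d' where "at_stage D M K d" "at_stage D M K d'" "\<kappa> M (K, d) = a" "\<kappa> M (K, d') = b"
proof -
  have CC: "is_cocone G T D E \<kappa>" using g by (simp add: good_cocone_def)
  obtain N1 d1 where 1: "at_stage D N1 (sproj E a) d1" "\<kappa> N1 (sproj E a, d1) = a" using good_surj [OF g] a by auto
  obtain N2 d2 where 2: "at_stage D N2 (sproj E b) d2" "\<kappa> N2 (sproj E b, d2) = b" using good_surj [OF g] b by auto
  have ab: "sproj E a = K" "sproj E b = K" using a b by simp_all
  note 1 = 1 [unfolded ab] and 2 = 2 [unfolded ab]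
  have M: "N1 \<inter> N2 \<in> ON" by (rule ON_Int [OF at_stageD(1) [OF 1(1)] at_stageD(1) [OF 2(1)]])
  show ?thesis
    by (rule that [OF tr_in [OF M Int_lower1 1(1)] tr_in [OF M Int_lower2 2(1)]])
       (simp_all add: cocone_tr [OF CC M Int_lower1 1(1)] cocone_tr [OF CC M Int_lower2 2(1)] 1 2)
qed

text \<open>The factoring map sends a point to the image of any of its representatives under the
  other cocone. Two representatives meet at a finer stage, where that cocone takes equal values, so
  the choice does not matter.\<close>

lemma good_colimit:
  assumes g: "good_cocone E \<kappa>"
  shows "is_colimit G T D E \<kappa>"
  unfolding is_colimit_def
proof (intro conjI allI impI)
  show CC: "is_cocone G T D E \<kappa>" using g by (simp add: good_cocone_def)
  fix E' \<kappa>' assume CC': "is_cocone G T D E' \<kappa>'"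
  note Es = cocone_gsheaf [OF CC] and Es' = cocone_gsheaf [OF CC']
  define r where "r e = (SOME (N, d). at_stage D N (sproj E e) d \<and> \<kappa> N (sproj E e, d) = e)" for e
  define h where "h = (\<lambda>e\<in>pts E. \<kappa>' (fst (r e)) (sproj E e, snd (r e)))"
  have r: "at_stage D (fst (r e)) (sproj E e) (snd (r e))" "\<kappa> (fst (r e)) (sproj E e, snd (r e)) = e" if e: "e \<in> pts E" for e
  proof -
    obtain N d where "at_stage D N (sproj E e) d" "\<kappa> N (sproj E e, d) = e"
      by (rule good_surj [OF g e])
    then have "\<exists>x. case x of (N, d) \<Rightarrow> at_stage D N (sproj E e) d \<and> \<kappa> N (sproj E e, d) = e"
      by (intro exI [of _ "(N, d)"]) simp
    then have "case r e of (N, d) \<Rightarrow> at_stage D N (sproj E e) d \<and> \<kappa> N (sproj E e, d) = e"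
      unfolding r_def by (rule someI_ex)
    then show "at_stage D (fst (r e)) (sproj E e) (snd (r e))" "\<kappa> (fst (r e)) (sproj E e, snd (r e)) = e"
      by (simp_all add: case_prod_beta)
  qed
  have h: "h (\<kappa> N (K, d)) = \<kappa>' N (K, d)" if d: "at_stage D N K d" for N K d
  proof -
    let ?e = "\<kappa> N (K, d)"
    note e = cocone_in [OF CC d]
    note r' = r [OF e(1), unfolded e(2)]
    obtain M where M: "M \<in> ON" "M \<subseteq> fst (r ?e)" "M \<subseteq> N" "tr D M (fst (r ?e)) K (snd (r ?e)) = tr D M N K d"
      using good_eq [OF g r'(1) d r'(2)] by metis
    have "\<kappa>' (fst (r ?e)) (K, snd (r ?e)) = \<kappa>' N (K, d)"
      using cocone_tr [OF CC' M(1,2) r'(1)] cocone_tr [OF CC' M(1,3) d] M(4) by simp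
    then show ?thesis using e by (simp add: h_def)
  qed
  have hh: "h \<in> sheaf_hom SS E E'"
  proof (rule sheaf_homI)
    show "h \<in> extensional (pts E)" by (simp add: h_def)
    show hp: "h e \<in> pts E'" "sproj E' (h e) = sproj E e" if "e \<in> pts E" for e
      using cocone_in [OF CC' r(1) [OF that]] that by (simp_all add: h_def)
    show "continuous_map (tot E) (tot E') h"
    \<comment> \<open>Through every point runs the section
      \<open>K \<mapsto> \<kappa> N (K, d)\<close>, along which \<open>h\<close> is the
      corresponding section of the other cocone.\<close>
    proof (rule continuous_map_over [OF gsheafD(1) [OF Es, unfolded grp_simps]])
      fix e assume e: "e \<in> pts E"
      obtain N d where d: "at_stage D N (sproj E e) d" "\<kappa> N (sproj E e, d) = e" using good_surj [OF g e] by metis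
      note N = at_stageD(1) [OF d(1)] and dp = at_stageD(3) [OF d(1)]
      let ?U = "fibre N (sproj (stage D N) d)"
      have U: "at_stage D N K d" if "K \<in> ?U" for K using at_stage_fibre [OF N dp that] .
      have "continuous_map (subtopology SG ?U) (tot E') (\<lambda>K. h (\<kappa> N (K, d)))"
        by (rule continuous_map_eq [OF cocone_cont [OF CC' N dp]]) (use h [OF U] in simp)
      then show "\<exists>U s. openin SG U \<and> sproj E e \<in> U \<and> continuous_map (subtopology SG U) (tot E) s \<and>
          (\<forall>x\<in>U. sproj E (s x) = x) \<and> s (sproj E e) = e \<and> continuous_map (subtopology SG U) (tot E') (\<lambda>x. h (s x))"
        using fibre_open [OF N] self_fibre [OF d(1)] cocone_cont [OF CC N dp] cocone_in(2) [OF CC U] d(2)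
        by (intro exI [of _ ?U] exI [of _ "\<lambda>K. \<kappa> N (K, d)"]) simp
    qed
    show "h (sact E a e) = sact E' a (h e)" if a: "a \<in> carrier (grp SS)" and e: "e \<in> pts E" for a e
    proof -
      have aG: "a \<in> carrier G" using a by simp
      obtain N d where d: "at_stage D N (sproj E e) d" "\<kappa> N (sproj E e, d) = e" using good_surj [OF g e] by metis
      show ?thesis
        using cocone_act [OF CC d(1) aG] cocone_act [OF CC' d(1) aG] h [OF d(1)] h [OF stage_act [OF d(1) aG]] d(2) by simp
    qed
    show "h (sadd E a b) = sadd E' (h a) (h b)" if ab: "a \<in> fib E x" "b \<in> fib E x" for x a b
    proof -
      obtain M d d' where d: "at_stage D M x d" "at_stage D M x d'" "\<kappa> M (x, d) = a" "\<kappa> M (x, d') = b"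
        using good_common [OF g ab] by metis
      show ?thesis
        using cocone_add [OF CC d(1,2)] cocone_add [OF CC' d(1,2)] h [OF d(1)] h [OF d(2)] h [OF stage_ops(1) [OF d(1,2)]] d(3,4) by simp
    qed
    show "h (sscale E q a) = sscale E' q (h a)" if ab: "a \<in> fib E x" for x q a
    proof -
      obtain M d d' where d: "at_stage D M x d" "at_stage D M x d'" "\<kappa> M (x, d) = a" "\<kappa> M (x, d') = a"
        using good_common [OF g ab ab] by metis
      show ?thesis
        using cocone_scale [OF CC d(1), of q] cocone_scale [OF CC' d(1), of q] h [OF d(1)] h [OF stage_ops(2) [OF d(1,2)], of q] d(3) by simp
    qed
  qed
  show "\<exists>!h. h \<in> sheaf_hom SS E E' \<and> (\<forall>N\<in>ON. \<forall>z\<in>pts (pull (pN G T N) (stage D N)). h (\<kappa> N z) = \<kappa>' N z)"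
  proof (rule ex1I [of _ h])
    show "h \<in> sheaf_hom SS E E' \<and> (\<forall>N\<in>ON. \<forall>z\<in>pts (pull (pN G T N) (stage D N)). h (\<kappa> N z) = \<kappa>' N z)"
    proof (intro conjI ballI hh)
      fix N z assume "N \<in> ON" "z \<in> pts (pull (pN G T N) (stage D N))"
      then show "h (\<kappa> N z) = \<kappa>' N z" using h in_pull by (cases z) simp
    qed
    fix k assume k: "k \<in> sheaf_hom SS E E' \<and> (\<forall>N\<in>ON. \<forall>z\<in>pts (pull (pN G T N) (stage D N)). k (\<kappa> N z) = \<kappa>' N z)"
    show "k = h"
    proof (rule extensionalityI [of _ "pts E"])
      show "k \<in> extensional (pts E)" "h \<in> extensional (pts E)" using k sheaf_homD(1) hh by blast+
      fix e assume e: "e \<in> pts E"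
      obtain N d where d: "at_stage D N (sproj E e) d" "\<kappa> N (sproj E e, d) = e" using good_surj [OF g e] by metis
      note N = at_stageD(1) [OF d(1)]
      have "(sproj E e, d) \<in> pts (pull (pN G T N) (stage D N))" using in_pull [OF N] d(1) by simp
      then have "k (\<kappa> N (sproj E e, d)) = \<kappa>' N (sproj E e, d)" using k N by simp
      then show "k e = h e" using h [OF d(1)] d(2) by simp
    qed
  qed
qed

text \<open>The legs of a colimit are jointly epimorphic: \<open>f\<close> and \<open>k\<close> both
  factor the cocone obtained by composing the legs with \<open>f\<close>. This is how the functor
  laws for the colimit and the naturality of the unit are checked.\<close>

lemma colimit_eqI:
  fixes E' :: "('g, 'g set, 'u) gsheaf"
  assumes c: "is_colimit G T D E \<kappa>" and E': "is_gsheaf SS E'"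
    and f: "f \<in> sheaf_hom SS E E'" and k: "k \<in> sheaf_hom SS E E'"
    and eq: "\<And>N K d. at_stage D N K d \<Longrightarrow> f (\<kappa> N (K, d)) = k (\<kappa> N (K, d))"
  shows "f = k"
proof -
  have CC: "is_cocone G T D E \<kappa>" using c by (simp add: is_colimit_def)
  define \<kappa>' where "\<kappa>' N = compose (pts (pull (pN G T N) (stage D N))) f (\<kappa> N)" for N
  note F = sheaf_homD [OF f, unfolded grp_simps topspace_SG]
  have k': "\<kappa>' N (K, d) = f (\<kappa> N (K, d))" if "at_stage D N K d" for N K d
    using that in_pull [OF at_stageD(1) [OF that]] by (simp add: \<kappa>'_def compose_def)
  have "is_cocone G T D E' \<kappa>'"
    unfolding is_cocone_def
  proof (intro conjI ballI impI E')
    fix N assume N: "N \<in> ON"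
    show "\<kappa>' N \<in> sheaf_hom SS (pull (pN G T N) (stage D N)) E'"
    proof (rule pull_pN_homI [OF N])
      show "\<kappa>' N \<in> extensional (pts (pull (pN G T N) (stage D N)))" by (simp add: \<kappa>'_def)
      show "\<kappa>' N (K, d) \<in> pts E' \<and> sproj E' (\<kappa>' N (K, d)) = K" if "at_stage D N K d" for K d
        using k' [OF that] F(3,4) cocone_in [OF CC that] by simp
      show "continuous_map (subtopology SG (fibre N (sproj (stage D N) d))) (tot E') (\<lambda>K. \<kappa>' N (K, d))"
        if d: "d \<in> pts (stage D N)" for d
        by (rule continuous_map_eq [OF continuous_map_compose [OF cocone_cont [OF CC N d] F(2)]])
          (use k' [OF at_stage_fibre [OF N d]] in simp)
      show "\<kappa>' N (act g K, sact (stage D N) (N #> g) d) = sact E' g (\<kappa>' N (K, d))" if "g \<in> carrier G" "at_stage D N K d" for g K d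
        using k' [OF that(2)] k' [OF stage_act [OF that(2,1)]] cocone_act [OF CC that(2,1)] F(5) [OF that(1)] cocone_in [OF CC that(2)] by simp
      show "\<kappa>' N (K, sadd (stage D N) a b) = sadd E' (\<kappa>' N (K, a)) (\<kappa>' N (K, b))" if "at_stage D N K a" "at_stage D N K b" for K a b
        using k' [OF that(1)] k' [OF that(2)] k' [OF stage_ops(1) [OF that]] cocone_add [OF CC that]
          F(6) [OF at_stageD(2) [OF that(1)] cocone_in(3) [OF CC that(1)] cocone_in(3) [OF CC that(2)]] by simp
      show "\<kappa>' N (K, sscale (stage D N) r a) = sscale E' r (\<kappa>' N (K, a))" if "at_stage D N K a" for K a r
        using k' [OF that(1)] k' [OF stage_ops(2) [OF that that], of r] cocone_scale [OF CC that, of r]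
          F(7) [OF at_stageD(2) [OF that(1)] cocone_in(3) [OF CC that(1)]] by simp
    qed
  next
    fix M N z assume MN: "M \<in> ON" "N \<in> ON" "M \<subseteq> N" and z: "z \<in> pts (pull (pN G T N) (stage D N))"
    obtain K d where Kd: "z = (K, d)" "at_stage D N K d" using z in_pull [OF MN(2)] by (cases z) simp
    show "case z of (K, d) \<Rightarrow> \<kappa>' M (K, struct D M N (p M K, d)) = \<kappa>' N (K, d)"
      using k' [OF Kd(2)] k' [OF tr_in [OF MN(1,3) Kd(2)]] cocone_tr [OF CC MN(1,3) Kd(2)] Kd(1) by (simp add: tr_def)
  qed
  then have ex1: "\<exists>!h. h \<in> sheaf_hom SS E E' \<and> (\<forall>N\<in>ON. \<forall>z\<in>pts (pull (pN G T N) (stage D N)). h (\<kappa> N z) = \<kappa>' N z)"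
    using c unfolding is_colimit_def by blast
  have 1: "f \<in> sheaf_hom SS E E' \<and> (\<forall>N\<in>ON. \<forall>z\<in>pts (pull (pN G T N) (stage D N)). f (\<kappa> N z) = \<kappa>' N z)"
  proof (intro conjI ballI f)
    fix N z assume "N \<in> ON" "z \<in> pts (pull (pN G T N) (stage D N))"
    then show "f (\<kappa> N z) = \<kappa>' N z" using k' in_pull by (cases z) simp
  qed
  have 2: "k \<in> sheaf_hom SS E E' \<and> (\<forall>N\<in>ON. \<forall>z\<in>pts (pull (pN G T N) (stage D N)). k (\<kappa> N z) = \<kappa>' N z)"
  proof (intro conjI ballI k)
    fix N z assume "N \<in> ON" "z \<in> pts (pull (pN G T N) (stage D N))"
    then show "k (\<kappa> N z) = \<kappa>' N z" using k' eq in_pull by (cases z) simp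
  qed
  show ?thesis using ex1 1 2 by blast
qed

lemma colimit_factor:
  assumes c: "is_colimit G T D E \<kappa>" and CC': "is_cocone G T D E' \<kappa>'"
  obtains h where "h \<in> sheaf_hom SS E E'" "\<forall>N K d. at_stage D N K d \<longrightarrow> h (\<kappa> N (K, d)) = \<kappa>' N (K, d)"
proof -
  obtain h where h: "h \<in> sheaf_hom SS E E' \<and> (\<forall>N\<in>ON. \<forall>z\<in>pts (pull (pN G T N) (stage D N)). h (\<kappa> N z) = \<kappa>' N z)"
    using c CC' unfolding is_colimit_def by blast
  show ?thesis
  proof (rule that [OF conjunct1 [OF h]], intro allI impI)
    fix N K d assume d: "at_stage D N K d"
    show "h (\<kappa> N (K, d)) = \<kappa>' N (K, d)"
      using h in_pull [OF at_stageD(1) [OF d]] d at_stageD(1) [OF d] by simp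
  qed
qed

lemma colimit_unique:
  assumes c: "is_colimit G T D E \<kappa>" and c': "is_colimit G T D E' \<kappa>'"
  obtains h k where "h \<in> sheaf_hom SS E E'" "k \<in> sheaf_hom SS E' E"
    "\<forall>N K d. at_stage D N K d \<longrightarrow> h (\<kappa> N (K, d)) = \<kappa>' N (K, d)"
    "compose (pts E) k h = (\<lambda>e\<in>pts E. e)" "compose (pts E') h k = (\<lambda>e\<in>pts E'. e)"
proof -
  have CC: "is_cocone G T D E \<kappa>" and CC': "is_cocone G T D E' \<kappa>'"
    using c c' by (simp_all add: is_colimit_def)
  note Es = cocone_gsheaf [OF CC] and Es' = cocone_gsheaf [OF CC']
  obtain h where h: "h \<in> sheaf_hom SS E E'" "\<forall>N K d. at_stage D N K d \<longrightarrow> h (\<kappa> N (K, d)) = \<kappa>' N (K, d)"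
    using colimit_factor [OF c CC'] by metis
  obtain k where k: "k \<in> sheaf_hom SS E' E" "\<forall>N K d. at_stage D N K d \<longrightarrow> k (\<kappa>' N (K, d)) = \<kappa> N (K, d)"
    using colimit_factor [OF c' CC] by metis
  have "compose (pts E) k h = (\<lambda>e\<in>pts E. e)"
    by (rule colimit_eqI [OF c Es sheaf_hom_compose [OF Es h(1) k(1)] sheaf_hom_id [OF Es]])
       (use h(2) k(2) cocone_in(1) [OF CC] in \<open>simp add: compose_def\<close>)
  moreover have "compose (pts E') h k = (\<lambda>e\<in>pts E'. e)"
    by (rule colimit_eqI [OF c' Es' sheaf_hom_compose [OF Es' k(1) h(1)] sheaf_hom_id [OF Es']])
       (use h(2) k(2) cocone_in(1) [OF CC'] in \<open>simp add: compose_def\<close>)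
  ultimately show ?thesis using that h k(1) by blast
qed

text \<open>The isomorphism between two colimits respects the legs, so the stalkwise description
  passes from one known colimit to any other, in particular to the one picked by choice.\<close>

lemma colimit_good:
  assumes g: "good_cocone E0 \<kappa>0" and c: "is_colimit G T D E \<kappa>"
  shows "good_cocone E \<kappa>"
proof -
  have CC: "is_cocone G T D E \<kappa>" and CC0: "is_cocone G T D E0 \<kappa>0"
    using c g by (simp_all add: is_colimit_def good_cocone_def)
  obtain h k where h: "h \<in> sheaf_hom SS E0 E" and k: "k \<in> sheaf_hom SS E E0"
    and hk: "\<forall>N K d. at_stage D N K d \<longrightarrow> h (\<kappa>0 N (K, d)) = \<kappa> N (K, d)"
    and kh: "compose (pts E0) k h = (\<lambda>e\<in>pts E0. e)" and hk1: "compose (pts E) h k = (\<lambda>e\<in>pts E. e)"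
    using colimit_unique [OF good_colimit [OF g] c] by metis
  have kh': "k (h e) = e" if "e \<in> pts E0" for e using fun_cong [OF kh, of e] that by (simp add: compose_def)
  have hk': "h (k e) = e" if "e \<in> pts E" for e using fun_cong [OF hk1, of e] that by (simp add: compose_def)
  show ?thesis
    unfolding good_cocone_def
  proof (intro conjI ballI allI impI CC)
    fix e assume e: "e \<in> pts E"
    note ke = sheaf_homD(3,4) [OF k e]
    obtain N d where d: "at_stage D N (sproj E0 (k e)) d" "\<kappa>0 N (sproj E0 (k e), d) = k e" using good_surj [OF g ke(1)] by metis
    have "\<kappa> N (sproj E e, d) = e" using hk d hk' [OF e] ke(2) by metis
    then show "\<exists>N d. at_stage D N (sproj E e) d \<and> \<kappa> N (sproj E e, d) = e" using d(1) ke(2) by metis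
  next
    fix N N' K d d' assume d: "at_stage D N K d" and d': "at_stage D N' K d'" and eq: "\<kappa> N (K, d) = \<kappa> N' (K, d')"
    have "\<kappa>0 N (K, d) = k (h (\<kappa>0 N (K, d)))" using kh' [OF cocone_in(1) [OF CC0 d]] by simp
    also have "\<dots> = k (h (\<kappa>0 N' (K, d')))" using hk d d' eq by simp
    also have "\<dots> = \<kappa>0 N' (K, d')" using kh' [OF cocone_in(1) [OF CC0 d']] by simp
    finally show "\<exists>M\<in>ON. M \<subseteq> N \<and> M \<subseteq> N' \<and> tr D M N K d = tr D M N' K d'"
      using good_eq [OF g d d'] by metis
  qed
qed

end

subsection \<open>Existence\<close>

locale bullet_universe = profin_bullet G T D + profin_universe G T code
  for G :: "'g monoid" (structure) and T :: "'g topology" and D :: "('g, 'u) bullet_sheaf"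
    and code :: "('g set \<Rightarrow> 'u) \<Rightarrow> 'u"
begin

section \<open>The directed colimit of the stalks as a set of coded classes\<close>

definition equ :: "'g set \<times> 'g set \<times> 'u \<Rightarrow> 'g set \<times> 'g set \<times> 'u \<Rightarrow> bool" where
  "equ = (\<lambda>(N, K, d) (N', K', d'). at_stage D N K d \<and> at_stage D N' K' d' \<and> K = K' \<and>
     (\<exists>M\<in>ON. M \<subseteq> N \<and> M \<subseteq> N' \<and> tr D M N K d = tr D M N' K d'))"

lemma equ_iff: "equ (N, K, d) (N', K', d') \<longleftrightarrow> at_stage D N K d \<and> at_stage D N' K' d' \<and> K = K' \<and>
     (\<exists>M\<in>ON. M \<subseteq> N \<and> M \<subseteq> N' \<and> tr D M N K d = tr D M N' K d')"
  by (simp add: equ_def)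

lemma equ_refl: "at_stage D N K d \<Longrightarrow> equ (N, K, d) (N, K, d)"
  using at_stageD(1) [of D N K d] by (auto simp: equ_def)

lemma equ_sym:
  assumes "equ s t" shows "equ t s"
proof -
  obtain N K d where s: "s = (N, K, d)" by (cases s)
  obtain N' K' d' where t: "t = (N', K', d')" by (cases t)
  note A = assms [unfolded s t equ_iff]
  obtain M where M: "M \<in> ON" "M \<subseteq> N \<and> M \<subseteq> N' \<and> tr D M N K d = tr D M N' K d'"
    using A [THEN conjunct2, THEN conjunct2, THEN conjunct2] ..
  have K: "K = K'" using A by blast
  show ?thesis
    unfolding s t equ_iff using A M(1) M(2) [THEN conjunct1] M(2) [THEN conjunct2, THEN conjunct1]
      M(2) [THEN conjunct2, THEN conjunct2, symmetric] unfolding K by blast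
qed

lemma equ_trans:
  assumes "equ s t" "equ t u" shows "equ s u"
proof -
  obtain N K d where s: "s = (N, K, d)" by (cases s)
  obtain N' K' d' where t: "t = (N', K', d')" by (cases t)
  obtain N'' K'' d'' where u: "u = (N'', K'', d'')" by (cases u)
  note A = assms(1) [unfolded s t equ_iff] and B = assms(2) [unfolded t u equ_iff]
  have K: "K' = K" "K'' = K" using A B by simp_all
  note A = A [unfolded K] and B = B [unfolded K]
  have d: "at_stage D N K d" "at_stage D N' K d'" "at_stage D N'' K d''" using A B by simp_all
  obtain M where M0: "M \<in> ON" "M \<subseteq> N \<and> M \<subseteq> N' \<and> tr D M N K d = tr D M N' K d'"
    using A [THEN conjunct2, THEN conjunct2, THEN conjunct2] ..
  obtain M' where M0': "M' \<in> ON" "M' \<subseteq> N' \<and> M' \<subseteq> N'' \<and> tr D M' N' K d' = tr D M' N'' K d''"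
    using B [THEN conjunct2, THEN conjunct2, THEN conjunct2] ..
  note M = M0(1) M0(2) [THEN conjunct1] M0(2) [THEN conjunct2, THEN conjunct1] M0(2) [THEN conjunct2, THEN conjunct2]
  note M' = M0'(1) M0'(2) [THEN conjunct1] M0'(2) [THEN conjunct2, THEN conjunct1] M0'(2) [THEN conjunct2, THEN conjunct2]
  let ?L = "M \<inter> M'"
  note L = ON_Int [OF M(1) M'(1)]
  have "tr D ?L N K d = tr D ?L M K (tr D M N K d)" by (rule tr_comp [OF L Int_lower1 M(1,2) d(1)])
  also have "\<dots> = tr D ?L N' K d'" unfolding M(4) by (rule tr_comp [OF L Int_lower1 M(1,3) d(2), symmetric])
  also have "\<dots> = tr D ?L M' K (tr D M' N' K d')" by (rule tr_comp [OF L Int_lower2 M'(1,2) d(2)])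
  also have "\<dots> = tr D ?L N'' K d''" unfolding M'(4) by (rule tr_comp [OF L Int_lower2 M'(1,3) d(3), symmetric])
  \<comment> \<open>The intersection of the two stages lies below both coincidences, and transitions
    compose.\<close>
  finally have *: "tr D ?L N K d = tr D ?L N'' K d''" .
  have "?L \<subseteq> N" "?L \<subseteq> N''" using M(2) M'(3) by auto
  then show ?thesis
    unfolding s u equ_iff K using d L * by (intro conjI refl bexI [of _ ?L])
qed

definition J :: "'g set \<times> 'g set \<times> 'u \<Rightarrow> 'u" where
  "J = (SOME J. inj J)"

lemma inj_J: "inj J"
  unfolding J_def by (rule someI_ex [OF inj_triple])

text \<open>A point of the colimit is a class of triples \<open>(N, K, d)\<close>, coded in \<open>'u\<close> by a chosen representative.\<close>

definition q :: "'g set \<Rightarrow> 'g set \<Rightarrow> 'u \<Rightarrow> 'u" where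
  "q N K d = J (SOME t. equ t (N, K, d))"

lemma q_eq:
  assumes "at_stage D N K d" "at_stage D N' K' d'"
  shows "q N K d = q N' K' d' \<longleftrightarrow> equ (N, K, d) (N', K', d')"
proof
  assume "equ (N, K, d) (N', K', d')"
  then have "(\<lambda>t. equ t (N, K, d)) = (\<lambda>t. equ t (N', K', d'))"
    using equ_trans equ_sym by (intro ext iffI) blast+
  then show "q N K d = q N' K' d'" by (simp add: q_def)
next
  assume "q N K d = q N' K' d'"
  then have eq: "(SOME t. equ t (N, K, d)) = (SOME t. equ t (N', K', d'))"
    unfolding q_def by (rule injD [OF inj_J])
  have "equ (SOME t. equ t (N, K, d)) (N, K, d)" by (rule someI [of "\<lambda>t. equ t (N, K, d)", OF equ_refl [OF assms(1)]])
  moreover have "equ (SOME t. equ t (N', K', d')) (N', K', d')" by (rule someI [of "\<lambda>t. equ t (N', K', d')", OF equ_refl [OF assms(2)]])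
  ultimately show "equ (N, K, d) (N', K', d')"
    unfolding eq using equ_sym equ_trans by blast
qed

lemma q_eqD:
  assumes "at_stage D N K d" "at_stage D N' K' d'" "q N K d = q N' K' d'"
  shows "K' = K" "\<exists>M\<in>ON. M \<subseteq> N \<and> M \<subseteq> N' \<and> tr D M N K d = tr D M N' K d'"
  using assms(3) unfolding q_eq [OF assms(1,2)] by (auto simp: equ_def)

lemma q_tr:
  assumes "M \<in> ON" "M \<subseteq> N" "at_stage D N K d"
  shows "q M K (tr D M N K d) = q N K d"
  unfolding q_eq [OF tr_in [OF assms] assms(3)] equ_def
  using assms tr_in [OF assms] tr_id [OF tr_in [OF assms]] by auto

lemma q_common:
  assumes "at_stage D N K d" "at_stage D N' K d'"
  obtains M e e' where "M \<subseteq> N" "M \<subseteq> N'" "at_stage D M K e" "at_stage D M K e'" "q M K e = q N K d" "q M K e' = q N' K d'"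
proof -
  note M = ON_Int [OF at_stageD(1) [OF assms(1)] at_stageD(1) [OF assms(2)]]
  show ?thesis
    by (rule that [OF _ _ tr_in [OF M Int_lower1 assms(1)] tr_in [OF M Int_lower2 assms(2)]
      q_tr [OF M Int_lower1 assms(1)] q_tr [OF M Int_lower2 assms(2)]]) auto
qed

section \<open>Total space and topology of the colimit\<close>

definition P :: "'u set" where "P = {q N K d | N K d. at_stage D N K d}"

definition pr :: "'u \<Rightarrow> 'g set" where "pr u = (SOME K. \<exists>N d. at_stage D N K d \<and> u = q N K d)"

lemma q_in: "at_stage D N K d \<Longrightarrow> q N K d \<in> P"
  by (auto simp: P_def)

lemma pr_q:
  assumes "at_stage D N K d" shows "pr (q N K d) = K"
proof -
  have "\<exists>N' d'. at_stage D N' (pr (q N K d)) d' \<and> q N K d = q N' (pr (q N K d)) d'"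
    unfolding pr_def by (rule someI [of _ K]) (use assms in blast)
  then obtain N' d' where "at_stage D N' (pr (q N K d)) d'" "q N K d = q N' (pr (q N K d)) d'" by blast
  then show ?thesis using q_eqD(1) [OF assms] by simp
qed

lemma P_rep:
  assumes "u \<in> P" obtains N d where "at_stage D N (pr u) d" "u = q N (pr u) d"
proof -
  obtain N K d where d: "u = q N K d" "at_stage D N K d" using assms by (auto simp: P_def)
  show ?thesis by (rule that [of N d]) (use d pr_q [OF d(2)] in simp_all)
qed

lemma P_rep2:
  assumes "u \<in> P" "v \<in> P" "pr v = pr u"
  obtains M d e where "at_stage D M (pr u) d" "at_stage D M (pr u) e" "u = q M (pr u) d" "v = q M (pr u) e"
proof -
  obtain N d where d: "at_stage D N (pr u) d" "u = q N (pr u) d" by (rule P_rep [OF assms(1)])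
  obtain N' e where e: "at_stage D N' (pr v) e" "v = q N' (pr v) e" by (rule P_rep [OF assms(2)])
  note e = e [unfolded assms(3)]
  obtain M x y where "at_stage D M (pr u) x" "at_stage D M (pr u) y" "q M (pr u) x = q N (pr u) d" "q M (pr u) y = q N' (pr u) e"
    by (rule q_common [OF d(1) e(1)])
  then show ?thesis using that [of M x y] d(2) e(2) by simp
qed

lemma P_rep3:
  assumes "u \<in> P" "v \<in> P" "w \<in> P" "pr v = pr u" "pr w = pr u"
  obtains M d e f where "at_stage D M (pr u) d" "at_stage D M (pr u) e" "at_stage D M (pr u) f"
    "u = q M (pr u) d" "v = q M (pr u) e" "w = q M (pr u) f"
proof -
  obtain N d e where d: "at_stage D N (pr u) d" "at_stage D N (pr u) e" "u = q N (pr u) d" "v = q N (pr u) e"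
    by (rule P_rep2 [OF assms(1,2,4)])
  obtain N' f where f: "at_stage D N' (pr w) f" "w = q N' (pr w) f" by (rule P_rep [OF assms(3)])
  note f = f [unfolded assms(5)]
  note M = ON_Int [OF at_stageD(1) [OF d(1)] at_stageD(1) [OF f(1)]]
  show ?thesis
    by (rule that [OF tr_in [OF M Int_lower1 d(1)] tr_in [OF M Int_lower1 d(2)] tr_in [OF M Int_lower2 f(1)]])
       (simp_all only: q_tr [OF M Int_lower1 d(1)] q_tr [OF M Int_lower1 d(2)] q_tr [OF M Int_lower2 f(1)] d(3,4) [symmetric] f(2) [symmetric])
qed

text \<open>The final topology for the maps \<open>K \<mapsto> q N K d\<close> defined on open
  fibres. The condition is phrased through these maps since each stage is discrete in
  \<open>d\<close>.\<close>

definition C_top :: "'u topology" where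
  "C_top = topology (\<lambda>U. U \<subseteq> P \<and> (\<forall>N\<in>ON. \<forall>d\<in>pts (stage D N).
     openin SG {K \<in> fibre N (sproj (stage D N) d). q N K d \<in> U}))"

lemma openin_C: "openin C_top U \<longleftrightarrow> U \<subseteq> P \<and> (\<forall>N\<in>ON. \<forall>d\<in>pts (stage D N).
     openin SG {K \<in> fibre N (sproj (stage D N) d). q N K d \<in> U})"
proof -
  have "istopology (\<lambda>U. U \<subseteq> P \<and> (\<forall>N\<in>ON. \<forall>d\<in>pts (stage D N).
     openin SG {K \<in> fibre N (sproj (stage D N) d). q N K d \<in> U}))"
    unfolding istopology_def
  proof (intro conjI allI impI)
    fix U V
    assume U: "U \<subseteq> P \<and> (\<forall>N\<in>ON. \<forall>d\<in>pts (stage D N). openin SG {K \<in> fibre N (sproj (stage D N) d). q N K d \<in> U})"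
      and V: "V \<subseteq> P \<and> (\<forall>N\<in>ON. \<forall>d\<in>pts (stage D N). openin SG {K \<in> fibre N (sproj (stage D N) d). q N K d \<in> V})"
    show "U \<inter> V \<subseteq> P" using U by auto
    show "\<forall>N\<in>ON. \<forall>d\<in>pts (stage D N). openin SG {K \<in> fibre N (sproj (stage D N) d). q N K d \<in> U \<inter> V}"
    proof (intro ballI)
      fix N d assume "N \<in> ON" "d \<in> pts (stage D N)"
      then have "openin SG ({K \<in> fibre N (sproj (stage D N) d). q N K d \<in> U} \<inter> {K \<in> fibre N (sproj (stage D N) d). q N K d \<in> V})"
        using U V by (intro openin_Int) auto
      then show "openin SG {K \<in> fibre N (sproj (stage D N) d). q N K d \<in> U \<inter> V}"
        by (rule back_subst [of "openin SG"]) blast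
    qed
  next
    fix \<U>
    assume U: "\<forall>U\<in>\<U>. U \<subseteq> P \<and> (\<forall>N\<in>ON. \<forall>d\<in>pts (stage D N). openin SG {K \<in> fibre N (sproj (stage D N) d). q N K d \<in> U})"
    show "\<Union>\<U> \<subseteq> P" using U by auto
    show "\<forall>N\<in>ON. \<forall>d\<in>pts (stage D N). openin SG {K \<in> fibre N (sproj (stage D N) d). q N K d \<in> \<Union>\<U>}"
    proof (intro ballI)
      fix N d assume "N \<in> ON" "d \<in> pts (stage D N)"
      then have "openin SG (\<Union>U\<in>\<U>. {K \<in> fibre N (sproj (stage D N) d). q N K d \<in> U})"
        using U by (intro openin_Union) auto
      then show "openin SG {K \<in> fibre N (sproj (stage D N) d). q N K d \<in> \<Union>\<U>}"
        by (rule back_subst [of "openin SG"]) blast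
    qed
  qed
  then show ?thesis unfolding C_top_def by (simp only: topology_inverse')
qed

lemma topspace_C: "topspace C_top = P"
proof -
  have "openin C_top P"
    unfolding openin_C
  proof (intro conjI ballI order_refl)
    fix N d assume N: "N \<in> ON" and d: "d \<in> pts (stage D N)"
    have "{K \<in> fibre N (sproj (stage D N) d). q N K d \<in> P} = fibre N (sproj (stage D N) d)"
      using q_in [OF at_stage_fibre [OF N d]] by auto
    then show "openin SG {K \<in> fibre N (sproj (stage D N) d). q N K d \<in> P}"
      using fibre_open [OF N] by simp
  qed
  then show ?thesis using openin_subset openin_C by (metis openin_topspace subset_antisym)
qed

lemma q_cont:
  assumes N: "N \<in> ON" and d: "d \<in> pts (stage D N)"
  shows "continuous_map (subtopology SG (fibre N (sproj (stage D N) d))) C_top (\<lambda>K. q N K d)"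
  unfolding continuous_map_def
proof (intro conjI allI impI)
  let ?F = "fibre N (sproj (stage D N) d)"
  have FX: "topspace (subtopology SG ?F) = ?F" by (auto simp: in_fibre)
  show "(\<lambda>K. q N K d) \<in> topspace (subtopology SG ?F) \<rightarrow> topspace C_top"
    unfolding FX topspace_C using q_in [OF at_stage_fibre [OF N d]] by auto
  fix U assume "openin C_top U"
  then have "openin SG {K \<in> ?F. q N K d \<in> U}" using N d by (simp add: openin_C)
  then show "openin (subtopology SG ?F) {K \<in> topspace (subtopology SG ?F). q N K d \<in> U}"
    unfolding FX using fibre_open [OF N] by (simp add: openin_open_subtopology)
qed

text \<open>If the sheets through \<open>d\<close> and \<open>d'\<close> meet over \<open>K\<close>,
  the two points become equal at some stage \<open>M\<close>; by \<open>tr_local\<close> they do so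
  on the whole fibre of \<open>p M\<close> through \<open>K\<close>, so the sheets agree near
  \<open>K\<close>. Hence sheets are open in the final topology.\<close>

lemma q_open:
  assumes N: "N \<in> ON" and d: "d \<in> pts (stage D N)" and W: "openin SG W" "W \<subseteq> fibre N (sproj (stage D N) d)"
  shows "openin C_top ((\<lambda>K. q N K d) ` W)"
  unfolding openin_C
proof (intro conjI ballI)
  have dW: "at_stage D N K d" if "K \<in> W" for K using at_stage_fibre [OF N d] W(2) that by auto
  show "(\<lambda>K. q N K d) ` W \<subseteq> P" using q_in [OF dW] by auto
  fix N' d' assume N': "N' \<in> ON" and d': "d' \<in> pts (stage D N')"
  let ?F = "fibre N' (sproj (stage D N') d')"
  show "openin SG {K \<in> ?F. q N' K d' \<in> (\<lambda>K. q N K d) ` W}"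
  proof (subst openin_subopen, intro ballI)
    fix K assume "K \<in> {K \<in> ?F. q N' K d' \<in> (\<lambda>K. q N K d) ` W}"
    then obtain L where L: "K \<in> ?F" "L \<in> W" "q N' K d' = q N L d" by auto
    note dK = at_stage_fibre [OF N' d' L(1)]
    have LK: "L = K" by (rule q_eqD(1) [OF dK dW [OF L(2)] L(3)])
    note L = L [unfolded LK]
    obtain M where M: "M \<in> ON" "M \<subseteq> N'" "M \<subseteq> N" "tr D M N' K d' = tr D M N K d"
      using q_eqD(2) [OF dK dW [OF L(2)] L(3)] by auto
    \<comment> \<open>\<open>W\<close> is kept in the intersection so that \<open>d\<close> remains
      defined over every point of the neighbourhood.\<close>
    let ?T = "W \<inter> fibre M (p M K)"
    have "openin SG ?T" using W(1) fibre_open [OF M(1)] by (rule openin_Int)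
    moreover have "K \<in> ?T" using L(2) at_stageD(2) [OF dK] by (simp add: in_fibre)
    moreover have "?T \<subseteq> {K \<in> ?F. q N' K d' \<in> (\<lambda>K. q N K d) ` W}"
    proof
      fix Q assume "Q \<in> ?T"
      then have Q: "Q \<in> W" "Q \<in> X" "p M Q = p M K" by (simp_all add: in_fibre)
      have "p N' Q = p N' K" by (rule p_refine [OF M(1) N' M(2) at_stageD(2) [OF dK] Q(2,3)])
      then have QF: "Q \<in> ?F" using L(1) Q(2) by (simp add: in_fibre)
      note dQ = at_stage_fibre [OF N' d' QF]
      have "tr D M N' Q d' = tr D M N Q d"
        using M(4) tr_local [OF Q(3), of N' d'] tr_local [OF Q(3), of N d] by simp
      then have "q N' Q d' = q N Q d"
        using q_tr [OF M(1,2) dQ] q_tr [OF M(1,3) dW [OF Q(1)]] by simp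
      then show "Q \<in> {K \<in> ?F. q N' K d' \<in> (\<lambda>K. q N K d) ` W}" using QF Q(1) by auto
    qed
    ultimately show "\<exists>T. openin SG T \<and> K \<in> T \<and> T \<subseteq> {K \<in> ?F. q N' K d' \<in> (\<lambda>K. q N K d) ` W}" by blast
  qed
qed

section \<open>Operations on classes\<close>

definition C_add :: "'u \<Rightarrow> 'u \<Rightarrow> 'u" where
  "C_add u v = (SOME w. \<exists>M K d e. at_stage D M K d \<and> at_stage D M K e \<and> u = q M K d \<and> v = q M K e \<and>
     w = q M K (sadd (stage D M) d e))"

definition C_scale :: "rat \<Rightarrow> 'u \<Rightarrow> 'u" where
  "C_scale r u = (SOME w. \<exists>M K d. at_stage D M K d \<and> u = q M K d \<and> w = q M K (sscale (stage D M) r d))"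

definition C_act :: "'g \<Rightarrow> 'u \<Rightarrow> 'u" where
  "C_act g u = (SOME w. \<exists>M K d. at_stage D M K d \<and> u = q M K d \<and> w = q M (act g K) (sact (stage D M) (M #> g) d))"

text \<open>Independence of representatives. The coincidences of the two summands may occur at
  different stages, so the comparison is made at the intersection, where transition is
  additive.\<close>

lemma C_add_q:
  assumes d: "at_stage D M K d" and e: "at_stage D M K e"
  shows "C_add (q M K d) (q M K e) = q M K (sadd (stage D M) d e)"
proof -
  let ?R = "\<lambda>w. \<exists>M' K' d' e'. at_stage D M' K' d' \<and> at_stage D M' K' e' \<and> q M K d = q M' K' d' \<and> q M K e = q M' K' e' \<and>
     w = q M' K' (sadd (stage D M') d' e')"
  have "?R (q M K (sadd (stage D M) d e))" using d e by blast
  then have "?R (C_add (q M K d) (q M K e))" unfolding C_add_def by (rule someI)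
  then obtain M' K' d' e' where *: "at_stage D M' K' d'" "at_stage D M' K' e'" "q M K d = q M' K' d'" "q M K e = q M' K' e'"
     "C_add (q M K d) (q M K e) = q M' K' (sadd (stage D M') d' e')" by blast
  have K: "K' = K" by (rule q_eqD(1) [OF d *(1,3)])
  note * = * [unfolded K]
  obtain L where L: "L \<in> ON" "L \<subseteq> M" "L \<subseteq> M'" "tr D L M K d = tr D L M' K d'" using q_eqD(2) [OF d *(1,3)] by auto
  obtain L' where L': "L' \<in> ON" "L' \<subseteq> M" "L' \<subseteq> M'" "tr D L' M K e = tr D L' M' K e'" using q_eqD(2) [OF e *(2,4)] by auto
  let ?N = "L \<inter> L'"
  note N = ON_Int [OF L(1) L'(1)]
  have NM: "?N \<subseteq> M" "?N \<subseteq> M'" using L(2,3) by auto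
  have 1: "tr D ?N M K d = tr D ?N M' K d'"
    using tr_comp [OF N Int_lower1 L(1,2) d] tr_comp [OF N Int_lower1 L(1,3) *(1)] L(4) by simp
  have 2: "tr D ?N M K e = tr D ?N M' K e'"
    using tr_comp [OF N Int_lower2 L'(1,2) e] tr_comp [OF N Int_lower2 L'(1,3) *(2)] L'(4) by simp
  have "q M K (sadd (stage D M) d e) = q ?N K (sadd (stage D ?N) (tr D ?N M K d) (tr D ?N M K e))"
    using q_tr [OF N NM(1) stage_ops(1) [OF d e]] tr_ops(1) [OF N NM(1) d e] by simp
  also have "\<dots> = q M' K (sadd (stage D M') d' e')"
    unfolding 1 2 using q_tr [OF N NM(2) stage_ops(1) [OF *(1,2)]] tr_ops(1) [OF N NM(2) *(1,2)] by simp
  finally show ?thesis using *(5) by simp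
qed

lemma C_scale_q:
  assumes d: "at_stage D M K d"
  shows "C_scale r (q M K d) = q M K (sscale (stage D M) r d)"
proof -
  let ?R = "\<lambda>w. \<exists>M' K' d'. at_stage D M' K' d' \<and> q M K d = q M' K' d' \<and> w = q M' K' (sscale (stage D M') r d')"
  have "?R (q M K (sscale (stage D M) r d))" using d by blast
  then have "?R (C_scale r (q M K d))" unfolding C_scale_def by (rule someI)
  then obtain M' K' d' where *: "at_stage D M' K' d'" "q M K d = q M' K' d'"
     "C_scale r (q M K d) = q M' K' (sscale (stage D M') r d')" by blast
  have K: "K' = K" by (rule q_eqD(1) [OF d *(1,2)])
  note * = * [unfolded K]
  obtain L where L: "L \<in> ON" "L \<subseteq> M" "L \<subseteq> M'" "tr D L M K d = tr D L M' K d'" using q_eqD(2) [OF d *(1,2)] by auto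
  have "q M K (sscale (stage D M) r d) = q L K (sscale (stage D L) r (tr D L M K d))"
    using q_tr [OF L(1,2) stage_ops(2) [OF d d]] tr_ops(2) [OF L(1,2) d d] by simp
  also have "\<dots> = q M' K (sscale (stage D M') r d')"
    unfolding L(4) using q_tr [OF L(1,3) stage_ops(2) [OF *(1) *(1)]] tr_ops(2) [OF L(1,3) *(1) *(1)] by simp
  finally show ?thesis using *(3) by simp
qed

lemma C_act_q:
  assumes d: "at_stage D M K d" and g: "g \<in> carrier G"
  shows "C_act g (q M K d) = q M (act g K) (sact (stage D M) (M #> g) d)"
proof -
  let ?R = "\<lambda>w. \<exists>M' K' d'. at_stage D M' K' d' \<and> q M K d = q M' K' d' \<and> w = q M' (act g K') (sact (stage D M') (M' #> g) d')"
  have "?R (q M (act g K) (sact (stage D M) (M #> g) d))" using d by blast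
  then have "?R (C_act g (q M K d))" unfolding C_act_def by (rule someI)
  then obtain M' K' d' where *: "at_stage D M' K' d'" "q M K d = q M' K' d'"
     "C_act g (q M K d) = q M' (act g K') (sact (stage D M') (M' #> g) d')" by blast
  have K: "K' = K" by (rule q_eqD(1) [OF d *(1,2)])
  note * = * [unfolded K]
  obtain L where L: "L \<in> ON" "L \<subseteq> M" "L \<subseteq> M'" "tr D L M K d = tr D L M' K d'" using q_eqD(2) [OF d *(1,2)] by auto
  have "q M (act g K) (sact (stage D M) (M #> g) d) = q L (act g K) (sact (stage D L) (L #> g) (tr D L M K d))"
    using q_tr [OF L(1,2) stage_act [OF d g]] tr_act [OF L(1,2) d g] by simp
  also have "\<dots> = q M' (act g K) (sact (stage D M') (M' #> g) d')"
    unfolding L(4) using q_tr [OF L(1,3) stage_act [OF *(1) g]] tr_act [OF L(1,3) *(1) g] by simp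
  finally show ?thesis using *(3) by simp
qed

text \<open>Transition maps preserve zero because it is 0 times a point. The whole group serves as
  reference stage since it lies above every \<open>N\<close>.\<close>

lemma q_zero:
  assumes N: "N \<in> ON" and K: "K \<in> X"
  shows "q N K (szero (stage D N) (p N K)) = q (carrier G) K (szero (stage D (carrier G)) (p (carrier G) K))"
proof -
  let ?z = "szero (stage D N) (p N K)" and ?z1 = "szero (stage D (carrier G)) (p (carrier G) K)"
  note z = stage_zero [OF N K] and z1 = stage_zero [OF ON_carrier K]
  have sub: "N \<subseteq> carrier G" by (rule ON_sub [OF N])
  have "tr D N (carrier G) K ?z1 = tr D N (carrier G) K (sscale (stage D (carrier G)) 0 ?z1)"
    using rat_stalkD(9) [OF stage_stalk [OF ON_carrier K] at_stageD(5) [OF z1]] by simp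
  also have "\<dots> = sscale (stage D N) 0 (tr D N (carrier G) K ?z1)" by (rule tr_ops(2) [OF N sub z1 z1])
  also have "\<dots> = ?z" by (rule rat_stalkD(9) [OF stage_stalk [OF N K] at_stageD(5) [OF tr_in [OF N sub z1]]])
  finally show ?thesis using q_tr [OF N sub z1] by simp
qed

section \<open>The sheaf axioms for the constructed colimit\<close>

definition CE :: "('g, 'g set, 'u) gsheaf" where
  "CE = \<lparr>tot = C_top, sproj = pr, sact = C_act,
     szero = (\<lambda>K. q (carrier G) K (szero (stage D (carrier G)) (p (carrier G) K))), sadd = C_add, sscale = C_scale\<rparr>"

lemma CE_simps: "tot CE = C_top" "topspace C_top = P" "sproj CE = pr" "sact CE = C_act" "sadd CE = C_add" "sscale CE = C_scale"
  by (simp_all add: CE_def topspace_C)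

lemma CE_zero: "N \<in> ON \<Longrightarrow> K \<in> X \<Longrightarrow> szero CE K = q N K (szero (stage D N) (p N K))"
  using q_zero by (simp add: CE_def)

lemma pr_cont: "continuous_map C_top SG pr"
  unfolding continuous_map_def topspace_C topspace_SG
proof (intro conjI allI impI)
  show "pr \<in> P \<rightarrow> X" using at_stageD(2) pr_q by (auto simp: P_def)
  fix U assume U: "openin SG U"
  show "openin C_top {u \<in> P. pr u \<in> U}"
    unfolding openin_C
  proof (intro conjI ballI)
    fix N d assume N: "N \<in> ON" and d: "d \<in> pts (stage D N)"
    have "{K \<in> fibre N (sproj (stage D N) d). q N K d \<in> {u \<in> P. pr u \<in> U}} = fibre N (sproj (stage D N) d) \<inter> U"
      using q_in [OF at_stage_fibre [OF N d]] pr_q [OF at_stage_fibre [OF N d]] by auto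
    then show "openin SG {K \<in> fibre N (sproj (stage D N) d). q N K d \<in> {u \<in> P. pr u \<in> U}}"
      using U fibre_open [OF N] by (simp add: openin_Int)
  qed auto
qed

lemma sheet:
  assumes d: "at_stage D N K d"
  shows "openin C_top ((\<lambda>K. q N K d) ` fibre N (sproj (stage D N) d))"
    "q N K d \<in> (\<lambda>K. q N K d) ` fibre N (sproj (stage D N) d)"
    "\<And>u. u \<in> (\<lambda>K. q N K d) ` fibre N (sproj (stage D N) d) \<Longrightarrow> u \<in> P \<and> at_stage D N (pr u) d \<and> u = q N (pr u) d"
proof -
  note N = at_stageD(1) [OF d] and dp = at_stageD(3) [OF d]
  show "openin C_top ((\<lambda>K. q N K d) ` fibre N (sproj (stage D N) d))"
    by (rule q_open [OF N dp fibre_open [OF N] order_refl])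
  show "q N K d \<in> (\<lambda>K. q N K d) ` fibre N (sproj (stage D N) d)"
    using self_fibre [OF d] by (rule imageI)
  show "u \<in> P \<and> at_stage D N (pr u) d \<and> u = q N (pr u) d" if "u \<in> (\<lambda>K. q N K d) ` fibre N (sproj (stage D N) d)" for u
    using that q_in [OF at_stage_fibre [OF N dp]] pr_q [OF at_stage_fibre [OF N dp]] at_stage_fibre [OF N dp] by auto
qed

text \<open>On a sheet the projection is inverse to \<open>K \<mapsto> q N K d\<close>; both are
  continuous and the sheet is open.\<close>

lemma CE_lh: "local_homeomorphism C_top SG pr"
  unfolding local_homeomorphism_def topspace_C
proof (intro conjI ballI pr_cont)
  fix u assume "u \<in> P"
  then obtain N d where d: "at_stage D N (pr u) d" "u = q N (pr u) d" by (rule P_rep)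
  note N = at_stageD(1) [OF d(1)] and dp = at_stageD(3) [OF d(1)]
  let ?F = "fibre N (sproj (stage D N) d)" let ?U = "(\<lambda>K. q N K d) ` ?F"
  note S = sheet [OF d(1)]
  have im: "pr ` ?U = ?F"
  proof -
    have "pr ` ?U = (\<lambda>K. K) ` ?F"
      unfolding image_image by (rule image_cong [OF refl]) (rule pr_q [OF at_stage_fibre [OF N dp]])
    then show ?thesis by simp
  qed
  have "homeomorphic_maps (subtopology C_top ?U) (subtopology SG ?F) pr (\<lambda>K. q N K d)"
    unfolding homeomorphic_maps_def
  proof (intro conjI ballI)
    show "continuous_map (subtopology C_top ?U) (subtopology SG ?F) pr"
      unfolding continuous_map_in_subtopology using pr_cont im by (auto intro: continuous_map_from_subtopology)
    show "continuous_map (subtopology SG ?F) (subtopology C_top ?U) (\<lambda>K. q N K d)"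
      unfolding continuous_map_in_subtopology using q_cont [OF N dp] by auto
    show "q N (pr v) d = v" if "v \<in> topspace (subtopology C_top ?U)" for v
      using S(3) [of v] that by simp
    show "pr (q N K d) = K" if "K \<in> topspace (subtopology SG ?F)" for K
      using pr_q [OF at_stage_fibre [OF N dp]] that by simp
  qed
  then have "homeomorphic_map (subtopology C_top ?U) (subtopology SG (pr ` ?U)) pr"
    unfolding im homeomorphic_map_maps by blast
  moreover have "openin SG (pr ` ?U)" unfolding im by (rule fibre_open [OF N])
  moreover have "u \<in> ?U" using S(2) d(2) by simp
  ultimately show "\<exists>U. openin C_top U \<and> u \<in> U \<and> openin SG (pr ` U) \<and> homeomorphic_map (subtopology C_top U) (subtopology SG (pr ` U)) pr"
    using S(1) by blast
qed

lemma CE_act_cont: "continuous_map (prod_topology T C_top) C_top (\<lambda>(g, e). C_act g e)"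
proof (rule continuous_map_locally)
  fix z assume "z \<in> topspace (prod_topology T C_top)"
  then obtain g u where gu: "z = (g, u)" "g \<in> carrier G" "u \<in> P" by (auto simp: topspace_C)
  obtain N d where d: "at_stage D N (pr u) d" "u = q N (pr u) d" by (rule P_rep [OF gu(3)])
  note N = at_stageD(1) [OF d(1)] and dp = at_stageD(3) [OF d(1)]
  let ?U = "(\<lambda>K. q N K d) ` fibre N (sproj (stage D N) d)" let ?V = "(N #> g) \<times> ?U"
  let ?d = "sact (stage D N) (N #> g) d" let ?Z = "subtopology (prod_topology T C_top) ?V"
  note S = sheet [OF d(1)]
  have h: "h \<in> carrier G" "N #> h = N #> g" if "h \<in> N #> g" for h
    using coset_eqI [OF N gu(2) that] that r_coset_subset_G [OF ON_sub [OF N] gu(2)] by auto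
  \<comment> \<open>On the coset of \<open>g\<close> the translated point \<open>?d\<close> stays
    fixed, so near \<open>(g, u)\<close> the action is conjugation of the base point followed by one
    section.\<close>
  have val: "C_act h v = q N (act h (pr v)) ?d \<and> at_stage D N (act h (pr v)) ?d" if "h \<in> N #> g" "v \<in> ?U" for h v
    using C_act_q [of N "pr v" d h] stage_act [of N "pr v" d h] S(3) [OF that(2)] h [OF that(1)] by simp
  have dp': "?d \<in> pts (stage D N)" by (rule at_stageD(3) [OF stage_act [OF d(1) gu(2)]])
  have c1: "continuous_map ?Z T fst" by (rule continuous_map_from_subtopology) (rule continuous_map_fst)
  have "continuous_map ?Z C_top snd" by (rule continuous_map_from_subtopology) (rule continuous_map_snd)
  from continuous_map_compose [OF this pr_cont] have c2: "continuous_map ?Z SG (\<lambda>z. pr (snd z))" by (simp add: o_def)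
  have "continuous_map ?Z (prod_topology T SG) (\<lambda>z. (fst z, pr (snd z)))"
    using c1 c2 by (simp add: continuous_map_paired)
  moreover have "continuous_map (prod_topology T SG) SG (\<lambda>(g, x). act g x)"
    using continuous_action_SG by (simp add: continuous_action_def)
  ultimately have "continuous_map ?Z SG ((\<lambda>(g, x). act g x) \<circ> (\<lambda>z. (fst z, pr (snd z))))"
    by (rule continuous_map_compose)
  then have "continuous_map ?Z (subtopology SG (fibre N (sproj (stage D N) ?d))) (\<lambda>z. act (fst z) (pr (snd z)))"
    unfolding continuous_map_in_subtopology using self_fibre val by (auto simp: o_def)
  from continuous_map_compose [OF this q_cont [OF N dp']]
  have "continuous_map ?Z C_top (\<lambda>(g, e). C_act g e)"
    by (rule continuous_map_eq) (use val in auto)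
  moreover have "openin (prod_topology T C_top) ?V"
    using S(1) coset_open [OF N gu(2)] by (simp add: openin_prod_Times_iff)
  moreover have "z \<in> ?V" using gu(1) coset_self [OF N gu(2)] S(2) d(2) by simp
  ultimately show "\<exists>U. openin (prod_topology T C_top) U \<and> z \<in> U \<and> continuous_map (subtopology (prod_topology T C_top) U) C_top (\<lambda>(g, e). C_act g e)"
    by blast
qed

lemma CE_minus_cont:
  "continuous_map (subtopology (prod_topology C_top C_top) {(d, e). pr d = pr e}) C_top (\<lambda>(d, e). C_add d (C_scale (- 1) e))"
  (is "continuous_map ?S _ _")
proof (rule continuous_map_locally)
  fix z assume "z \<in> topspace ?S"
  then obtain u v where uv: "z = (u, v)" "u \<in> P" "v \<in> P" "pr v = pr u" by (auto simp: topspace_C)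
  obtain N d e where d: "at_stage D N (pr u) d" "u = q N (pr u) d" and e: "at_stage D N (pr u) e" "v = q N (pr u) e"
    by (rule P_rep2 [OF uv(2-4)])
  note N = at_stageD(1) [OF d(1)]
  let ?U = "(\<lambda>K. q N K d) ` fibre N (sproj (stage D N) d)" and ?V = "(\<lambda>K. q N K e) ` fibre N (sproj (stage D N) e)"
  \<comment> \<open>Both points are represented at one stage, so near \<open>z\<close> the
    difference runs along the single sheet through \<open>?f\<close>.\<close>
  let ?f = "sadd (stage D N) d (sscale (stage D N) (- 1) e)" let ?W = "(?U \<times> ?V) \<inter> {(d, e). pr d = pr e}" let ?Z = "subtopology ?S ?W"
  note Sd = sheet [OF d(1)] and Se = sheet [OF e(1)]
  have f: "at_stage D N (pr u) ?f" by (rule stage_ops(1) [OF d(1) stage_ops(2) [OF e(1) e(1)]])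
  have val: "C_add x (C_scale (- 1) y) = q N (pr x) ?f \<and> at_stage D N (pr x) ?f" if "x \<in> ?U" "y \<in> ?V" "pr x = pr y" for x y
  proof -
    have x: "at_stage D N (pr x) d" "x = q N (pr x) d" and y: "at_stage D N (pr x) e" "y = q N (pr x) e"
      using Sd(3) [OF that(1)] Se(3) [OF that(2)] that(3) by simp_all
    have "C_scale (- 1) y = q N (pr x) (sscale (stage D N) (- 1) e)"
      by (subst y(2)) (rule C_scale_q [OF y(1)])
    moreover have "C_add x (q N (pr x) (sscale (stage D N) (- 1) e)) = q N (pr x) ?f"
      by (subst (1) x(2)) (rule C_add_q [OF x(1) stage_ops(2) [OF y(1) y(1)]])
    ultimately show ?thesis using stage_ops(1) [OF x(1) stage_ops(2) [OF y(1) y(1)]] by simp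
  qed
  have "continuous_map ?Z C_top fst"
    by (intro continuous_map_from_subtopology continuous_map_fst)
  from continuous_map_compose [OF this pr_cont] have "continuous_map ?Z SG (\<lambda>z. pr (fst z))" by (simp add: o_def)
  note cont = this
  have ZW: "z \<in> ?W" if "z \<in> topspace ?Z" for z using that unfolding topspace_subtopology by (rule IntD2)
  have W: "fst z \<in> ?U" "snd z \<in> ?V" "pr (fst z) = pr (snd z)" if "z \<in> ?W" for z
    using that by (cases z, simp)+
  have Wf: "pr (fst z) \<in> fibre N (sproj (stage D N) ?f)" if "z \<in> ?W" for z
    by (rule self_fibre [OF conjunct2 [OF val [OF W [OF that]]]])
  have "continuous_map ?Z (subtopology SG (fibre N (sproj (stage D N) ?f))) (\<lambda>z. pr (fst z))"
    unfolding continuous_map_in_subtopology by (intro conjI cont Pi_I image_subsetI Wf ZW)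
  from continuous_map_compose [OF this q_cont [OF N at_stageD(3) [OF f]]]
  have "continuous_map ?Z C_top (\<lambda>(d, e). C_add d (C_scale (- 1) e))"
  proof (rule continuous_map_eq)
    fix z assume "z \<in> topspace ?Z"
    from conjunct1 [OF val [OF W [OF ZW [OF this]]]]
    show "((\<lambda>K. q N K ?f) \<circ> (\<lambda>z. pr (fst z))) z = (case z of (d, e) \<Rightarrow> C_add d (C_scale (- 1) e))"
      by (simp add: case_prod_beta)
  qed
  moreover have "openin ?S ?W"
    by (rule openin_subtopology_Int) (simp add: openin_prod_Times_iff Sd(1) Se(1))
  moreover have "z \<in> ?W" using uv Sd(2) Se(2) d(2) e(2) by simp
  ultimately show "\<exists>U. openin ?S U \<and> z \<in> U \<and> continuous_map (subtopology ?S U) C_top (\<lambda>(d, e). C_add d (C_scale (- 1) e))"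
    by (intro exI [of _ ?W] conjI)
qed

lemma CE_scale_cont: "continuous_map C_top C_top (C_scale r)"
proof (rule continuous_map_over [OF CE_lh])
  fix u assume "u \<in> topspace C_top"
  then have "u \<in> P" by (simp add: topspace_C)
  then obtain N d where d: "at_stage D N (pr u) d" "u = q N (pr u) d" by (rule P_rep)
  note N = at_stageD(1) [OF d(1)] and dp = at_stageD(3) [OF d(1)]
  let ?F = "fibre N (sproj (stage D N) d)" and ?d = "sscale (stage D N) r d"
  have st: "at_stage D N K d" if "K \<in> ?F" for K by (rule at_stage_fibre [OF N dp that])
  note rd = stage_ops(2) [OF d(1) d(1), of r]
  have F: "fibre N (sproj (stage D N) ?d) = ?F" using at_stageD(4) [OF rd] at_stageD(4) [OF d(1)] by simp
  have "continuous_map (subtopology SG ?F) C_top (\<lambda>K. C_scale r (q N K d))"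
    by (rule continuous_map_eq [OF q_cont [OF N at_stageD(3) [OF rd], unfolded F]]) (use C_scale_q [OF st] in simp)
  then show "\<exists>U s. openin SG U \<and> pr u \<in> U \<and> continuous_map (subtopology SG U) C_top s \<and> (\<forall>x\<in>U. pr (s x) = x) \<and>
      s (pr u) = u \<and> continuous_map (subtopology SG U) C_top (\<lambda>x. C_scale r (s x))"
    using fibre_open [OF N] self_fibre [OF d(1)] q_cont [OF N dp] pr_q [OF st] d(2)
    by (intro exI [of _ ?F] exI [of _ "\<lambda>K. q N K d"]) simp
qed

text \<open>Any three points over \<open>K\<close> are represented at one stage, where the module
  axioms hold.\<close>

lemma CE_stalk:
  assumes K: "K \<in> X" shows "rat_stalk CE K"
  unfolding rat_stalk_def in_fib_iff CE_simps
proof (intro conjI ballI allI)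
  note z = stage_zero [OF ON_carrier K]
  show "szero CE K \<in> P" "pr (szero CE K) = K"
    unfolding CE_zero [OF ON_carrier K] using q_in [OF z] pr_q [OF z] by simp_all
  fix a b c assume "a \<in> fib CE K" "b \<in> fib CE K" "c \<in> fib CE K"
  then have a: "a \<in> P" "pr a = K" and b: "b \<in> P" "pr b = K" and c: "c \<in> P" "pr c = K" by (simp_all add: CE_simps)
  obtain N x y w where st: "at_stage D N K x" "at_stage D N K y" "at_stage D N K w"
    and eq: "a = q N K x" "b = q N K y" "c = q N K w"
    by (rule P_rep3 [OF a(1) b(1) c(1)]) (use a b c in simp_all)
  note N = at_stageD(1) [OF st(1)]
  note R = stage_stalk [OF N K] and f = at_stageD(5) [OF st(1)] at_stageD(5) [OF st(2)] at_stageD(5) [OF st(3)]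
  note xy = stage_ops(1) [OF st(1,2)] and yw = stage_ops(1) [OF st(2,3)]
  fix r s :: rat
  note rx = stage_ops(2) [OF st(1) st(1), of r] and sx = stage_ops(2) [OF st(1) st(1), of s] and ry = stage_ops(2) [OF st(2) st(2), of r]
  show "C_add a b \<in> P" "pr (C_add a b) = K" unfolding eq C_add_q [OF st(1,2)] using q_in [OF xy] pr_q [OF xy] by simp_all
  show "C_scale r a \<in> P" "pr (C_scale r a) = K" unfolding eq C_scale_q [OF st(1)] using q_in [OF rx] pr_q [OF rx] by simp_all
  show "C_add (C_add a b) c = C_add a (C_add b c)"
    unfolding eq C_add_q [OF st(1,2)] C_add_q [OF st(2,3)] C_add_q [OF xy st(3)] C_add_q [OF st(1) yw] rat_stalkD(5) [OF R f] ..
  show "C_add a b = C_add b a"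
    unfolding eq C_add_q [OF st(1,2)] C_add_q [OF st(2,1)] rat_stalkD(6) [OF R f(1,2)] ..
  show "C_add (szero CE K) a = a"
    unfolding eq CE_zero [OF N K] C_add_q [OF stage_zero [OF N K] st(1)] rat_stalkD(7) [OF R f(1)] ..
  show "C_scale 1 a = a" unfolding eq C_scale_q [OF st(1)] rat_stalkD(8) [OF R f(1)] ..
  show "C_scale 0 a = szero CE K" unfolding eq C_scale_q [OF st(1)] CE_zero [OF N K] rat_stalkD(9) [OF R f(1)] ..
  show "C_scale (r + s) a = C_add (C_scale r a) (C_scale s a)"
    unfolding eq C_scale_q [OF st(1)] C_add_q [OF rx sx] rat_stalkD(10) [OF R f(1)] ..
  show "C_scale (r * s) a = C_scale r (C_scale s a)"
    unfolding eq C_scale_q [OF st(1)] C_scale_q [OF sx] rat_stalkD(11) [OF R f(1)] ..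
  show "C_scale r (C_add a b) = C_add (C_scale r a) (C_scale r b)"
    unfolding eq C_add_q [OF st(1,2)] C_scale_q [OF st(1)] C_scale_q [OF st(2)] C_scale_q [OF xy] C_add_q [OF rx ry] rat_stalkD(12) [OF R f(1,2)] ..
qed

lemma CE_gsheaf: "is_gsheaf SS CE"
  unfolding is_gsheaf_iff continuous_action_def grp_simps CE_simps topspace_SG
proof (intro conjI allI ballI)
  show "continuous_map (prod_topology T C_top) C_top (\<lambda>(g, e). C_act g e)" by (rule CE_act_cont)
  show "local_homeomorphism C_top SG pr" by (rule CE_lh)
  show "continuous_map (subtopology (prod_topology C_top C_top) {(d, e). pr d = pr e}) C_top (\<lambda>(d, e). C_add d (C_scale (- 1) e))"
    by (rule CE_minus_cont)
  show "continuous_map C_top C_top (C_scale r)" for r by (rule CE_scale_cont)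
  show "rat_stalk CE K" if "K \<in> X" for K by (rule CE_stalk [OF that])
  show act: "pr (C_act g u) = act g (pr u)" if g: "g \<in> carrier G" and u: "u \<in> P" for g u
  proof -
    obtain N d where d: "at_stage D N (pr u) d" "u = q N (pr u) d" by (rule P_rep [OF u])
    have "C_act g u = q N (act g (pr u)) (sact (stage D N) (N #> g) d)"
      by (subst (1) d(2)) (rule C_act_q [OF d(1) g])
    then show ?thesis using pr_q [OF stage_act [OF d(1) g]] by simp
  qed
  show "C_act \<one> u = u" if u: "u \<in> P" for u
  proof -
    obtain N d where d: "at_stage D N (pr u) d" "u = q N (pr u) d" by (rule P_rep [OF u])
    note N = at_stageD(1) [OF d(1)]
    have "C_act \<one> u = q N (act \<one> (pr u)) (sact (stage D N) (N #> \<one>) d)"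
      by (subst (1) d(2)) (rule C_act_q [OF d(1) one_closed])
    then show ?thesis
      using gsheafD(7) [OF stage_gsheaf [OF N] at_stageD(3) [OF d(1)]] d(2) act_one [OF at_stageD(2) [OF d(1)]] coset_one [OF N] by simp
  qed
  show "C_act (g \<otimes> h) u = C_act g (C_act h u)" if g: "g \<in> carrier G" and h: "h \<in> carrier G" and u: "u \<in> P" for g h u
  proof -
    obtain N d where d: "at_stage D N (pr u) d" "u = q N (pr u) d" by (rule P_rep [OF u])
    note N = at_stageD(1) [OF d(1)]
    have "C_act (g \<otimes> h) u = q N (act (g \<otimes> h) (pr u)) (sact (stage D N) (N #> (g \<otimes> h)) d)"
      by (subst (1) d(2)) (rule C_act_q [OF d(1) m_closed [OF g h]])
    moreover have "C_act h u = q N (act h (pr u)) (sact (stage D N) (N #> h) d)"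
      by (subst (1) d(2)) (rule C_act_q [OF d(1) h])
    moreover have "sact (stage D N) (N #> (g \<otimes> h)) d = sact (stage D N) (N #> g) (sact (stage D N) (N #> h) d)"
      using gsheafD(8) [OF stage_gsheaf [OF N] _ _ at_stageD(3) [OF d(1)], of "N #> g" "N #> h"] coset_in [OF N] g h coset_mult [OF N g h] by simp
    ultimately show ?thesis
      using C_act_q [OF stage_act [OF d(1) h] g] act_mult [OF g h at_stageD(2) [OF d(1)]] by simp
  qed
  show "module_linear (stalk CE K) (stalk CE (act g K)) (C_act g)" if g: "g \<in> carrier G" and K: "K \<in> X" for g K
    unfolding module_linear_iff in_fib_iff CE_simps
  proof (intro conjI ballI allI)
    fix a b assume "a \<in> fib CE K" "b \<in> fib CE K"
    then have a: "a \<in> P" "pr a = K" and b: "b \<in> P" "pr b = K" by (simp_all add: CE_simps)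
    obtain N x y where st: "at_stage D N K x" "at_stage D N K y" and eq: "a = q N K x" "b = q N K y"
      by (rule P_rep2 [OF a(1) b(1)]) (use a b in simp_all)
    note N = at_stageD(1) [OF st(1)]
    note gx = stage_act [OF st(1) g] and gy = stage_act [OF st(2) g]
    have S: "p N K \<in> topspace (space_top (QS N))" "N #> g \<in> carrier (grp (QS N))" using p_in [OF N K] coset_in [OF N g] N by simp_all
    show "C_act g a \<in> P" "pr (C_act g a) = act g K" unfolding eq C_act_q [OF st(1) g] using q_in [OF gx] pr_q [OF gx] by simp_all
    show "C_act g (C_add a b) = C_add (C_act g a) (C_act g b)"
      unfolding eq C_add_q [OF st] C_act_q [OF st(1) g] C_act_q [OF st(2) g] C_add_q [OF gx gy] C_act_q [OF stage_ops(1) [OF st] g]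
        gsheafD(12) [OF stage_gsheaf [OF N] S(2,1) at_stageD(5) [OF st(1)] at_stageD(5) [OF st(2)]] ..
    fix r
    show "C_act g (C_scale r a) = C_scale r (C_act g a)"
      unfolding eq C_scale_q [OF st(1)] C_act_q [OF st(1) g] C_scale_q [OF gx] C_act_q [OF stage_ops(2) [OF st(1) st(1)] g]
        gsheafD(13) [OF stage_gsheaf [OF N] S(2,1) at_stageD(5) [OF st(1)]] ..
  qed
qed

theorem good_exists: "good_cocone CE (\<lambda>N. \<lambda>z\<in>pts (pull (pN G T N) (stage D N)). q N (fst z) (snd z))"
  unfolding good_cocone_def is_cocone_def
proof (intro conjI ballI allI impI)
  let ?k = "\<lambda>N. \<lambda>z\<in>pts (pull (pN G T N) (stage D N)). q N (fst z) (snd z)"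
  have k: "?k N (K, d) = q N K d" if "at_stage D N K d" for N K d
    using that in_pull [OF at_stageD(1) [OF that]] by simp
  show "is_gsheaf SS CE" by (rule CE_gsheaf)
  show "?k N \<in> sheaf_hom SS (pull (pN G T N) (stage D N)) CE" if N: "N \<in> ON" for N
  proof (rule pull_pN_homI [OF N], unfold CE_simps)
    show "?k N \<in> extensional (pts (pull (pN G T N) (stage D N)))" by simp
    show "?k N (K, d) \<in> P \<and> pr (?k N (K, d)) = K" if "at_stage D N K d" for K d
      unfolding k [OF that] using q_in [OF that] pr_q [OF that] by simp
    show "continuous_map (subtopology SG (fibre N (sproj (stage D N) d))) C_top (\<lambda>K. ?k N (K, d))" if d: "d \<in> pts (stage D N)" for d
      by (rule continuous_map_eq [OF q_cont [OF N d]]) (use k [OF at_stage_fibre [OF N d]] in simp)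
    show "?k N (act g K, sact (stage D N) (N #> g) d) = C_act g (?k N (K, d))" if "g \<in> carrier G" "at_stage D N K d" for g K d
      unfolding k [OF that(2)] k [OF stage_act [OF that(2,1)]] C_act_q [OF that(2,1)] ..
    show "?k N (K, sadd (stage D N) a b) = C_add (?k N (K, a)) (?k N (K, b))" if "at_stage D N K a" "at_stage D N K b" for K a b
      unfolding k [OF that(1)] k [OF that(2)] k [OF stage_ops(1) [OF that]] C_add_q [OF that] ..
    show "?k N (K, sscale (stage D N) r a) = C_scale r (?k N (K, a))" if "at_stage D N K a" for K a r
      unfolding k [OF that] k [OF stage_ops(2) [OF that that]] C_scale_q [OF that] ..
  qed
  show "case z of (K, d) \<Rightarrow> ?k M (K, struct D M N (p M K, d)) = ?k N (K, d)"
    if MN: "M \<in> ON" "N \<in> ON" "M \<subseteq> N" and z: "z \<in> pts (pull (pN G T N) (stage D N))" for M N z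
  proof -
    obtain K d where Kd: "z = (K, d)" "at_stage D N K d" using z in_pull [OF MN(2)] by (cases z) simp
    show ?thesis
      using k [OF Kd(2)] k [OF tr_in [OF MN(1,3) Kd(2)]] q_tr [OF MN(1,3) Kd(2)] Kd(1) by (simp add: tr_def)
  qed
  show "\<exists>N d. at_stage D N (sproj CE e) d \<and> ?k N (sproj CE e, d) = e" if "e \<in> pts CE" for e
  proof -
    have "e \<in> P" using that by (simp add: CE_simps)
    then obtain N d where d: "at_stage D N (pr e) d" "e = q N (pr e) d" by (rule P_rep)
    show ?thesis unfolding CE_simps using d(1) k [OF d(1)] d(2) by (intro exI [of _ N] exI [of _ d]) simp
  qed
  show "\<exists>M\<in>ON. M \<subseteq> N \<and> M \<subseteq> N' \<and> tr D M N K d = tr D M N' K d'"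
    if "at_stage D N K d" "at_stage D N' K d'" "?k N (K, d) = ?k N' (K, d')" for N N' K d d'
    using q_eqD(2) [OF that(1,2)] that(3) k [OF that(1)] k [OF that(2)] by simp
qed

end

section \<open>Unit and counit\<close>

text \<open>Where \<open>f\<close> and \<open>h\<close> both take values in a sheet on which
  \<open>p\<close> is injective, the common projection forces them to be equal.\<close>

lemma equalizer_open:
  assumes lh: "local_homeomorphism E X p" and f: "continuous_map Z E f" and h: "continuous_map Z E h"
    and eq: "\<And>z. z \<in> topspace Z \<Longrightarrow> p (f z) = p (h z)"
  shows "openin Z {z \<in> topspace Z. f z = h z}"
proof (subst openin_subopen, intro ballI)
  fix z assume "z \<in> {z \<in> topspace Z. f z = h z}"
  then have z: "z \<in> topspace Z" "f z = h z" by auto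
  then have fz: "f z \<in> topspace E" using f by (auto simp: continuous_map_def Pi_iff)
  obtain W where W: "openin E W" "f z \<in> W" "homeomorphic_map (subtopology E W) (subtopology X (p ` W)) p"
    using lh fz unfolding local_homeomorphism_def by blast
  have "W \<subseteq> topspace E" using W(1) by (rule openin_subset)
  then have inj: "inj_on p W"
    using W(3) by (simp add: homeomorphic_eq_everything_map Int_absorb1)
  let ?T = "{z \<in> topspace Z. f z \<in> W} \<inter> {z \<in> topspace Z. h z \<in> W}"
  have "openin Z ?T"
    by (intro openin_Int openin_continuous_map_preimage [OF f W(1)] openin_continuous_map_preimage [OF h W(1)])
  moreover have "z \<in> ?T" using z W(2) by auto
  moreover have "?T \<subseteq> {z \<in> topspace Z. f z = h z}"
    using inj_onD [OF inj] eq by auto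
  ultimately show "\<exists>T. openin Z T \<and> z \<in> T \<and> T \<subseteq> {z \<in> topspace Z. f z = h z}" by blast
qed

context profin
begin

text \<open>Being invariant is an open condition on group elements and points, and it holds at \<open>(\<one>, K)\<close>.\<close>

lemma local_invariant_section:
  assumes E: "is_gsheaf SS E" and e: "e \<in> pts E"
  obtains N s where "N \<in> ON" "s \<in> invariant_sections (pN G T N) E {p N (sproj E e)}" "s (sproj E e) = e"
proof -
  let ?K = "sproj E e"
  have K: "?K \<in> X" using gsheafD(3) [OF E e] by simp
  obtain U s where U: "openin SG U" "?K \<in> U" "continuous_map (subtopology SG U) (tot E) s" "\<forall>L\<in>U. sproj E (s L) = L" "s ?K = e"
    using local_section_exists [OF gsheafD(1) [OF E, unfolded grp_simps] e] by metis
  have UX: "U \<subseteq> X" using openin_subset [OF U(1)] by simp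
  let ?P = "prod_topology T SG" let ?a = "\<lambda>z. act (fst z) (snd z)"
  have ac: "continuous_map ?P SG ?a"
    using conjunct1 [OF continuous_action_SG [unfolded continuous_action_def]] by (simp add: case_prod_beta')
  \<comment> \<open>The pairs for which \<open>s\<close> is defined at the point and at its
    translate, so that the two sides of the invariance equation can be compared.\<close>
  define W where "W = {z \<in> topspace ?P. ?a z \<in> U} \<inter> {z \<in> topspace ?P. snd z \<in> U}"
  have W: "openin ?P W"
    unfolding W_def by (intro openin_Int openin_continuous_map_preimage [OF ac U(1)] openin_continuous_map_preimage [OF continuous_map_snd U(1)])
  let ?Z = "subtopology ?P W"
  have ZW: "z \<in> W" if "z \<in> topspace ?Z" for z using that unfolding topspace_subtopology by (rule IntD2)
  have WD: "fst z \<in> carrier G" "snd z \<in> U" "?a z \<in> U" if "z \<in> W" for z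
    using that by (cases z; simp add: W_def)+
  have "continuous_map ?Z (subtopology SG U) ?a"
    unfolding continuous_map_in_subtopology
    by (intro conjI continuous_map_from_subtopology ac Pi_I image_subsetI WD(3) ZW)
  from continuous_map_compose [OF this U(3)] have f1: "continuous_map ?Z (tot E) (\<lambda>z. s (?a z))" by (simp add: o_def)
  have "continuous_map ?Z (subtopology SG U) snd"
    unfolding continuous_map_in_subtopology
    by (intro conjI continuous_map_from_subtopology continuous_map_snd Pi_I image_subsetI WD(2) ZW)
  from continuous_map_compose [OF this U(3)] have "continuous_map ?Z (tot E) (\<lambda>z. s (snd z))" by (simp add: o_def)
  moreover have "continuous_map ?Z T fst" by (intro continuous_map_from_subtopology continuous_map_fst)
  ultimately have "continuous_map ?Z (prod_topology T (tot E)) (\<lambda>z. (fst z, s (snd z)))"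
    by (simp add: continuous_map_paired)
  from continuous_map_compose [OF this gsheafD(10) [OF E, unfolded grp_simps]]
  have f2: "continuous_map ?Z (tot E) (\<lambda>z. sact E (fst z) (s (snd z)))" by (simp add: o_def)
  have sU: "s L \<in> pts E" if "L \<in> U" for L
    using U(3) that UX by (auto simp: continuous_map_def Pi_iff)
  let ?Q = "{z \<in> topspace ?Z. s (?a z) = sact E (fst z) (s (snd z))}"
  have pe: "sproj E (s (?a z)) = sproj E (sact E (fst z) (s (snd z)))" if "z \<in> topspace ?Z" for z
  proof -
    note w = WD [OF ZW [OF that]]
    have 1: "sproj E (s (?a z)) = ?a z" using U(4) w(3) by (rule bspec)
    have 2: "sproj E (s (snd z)) = snd z" using U(4) w(2) by (rule bspec)
    have "sproj E (sact E (fst z) (s (snd z))) = act (fst z) (sproj E (s (snd z)))"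
      using gsheafD(4) [OF E _ sU [OF w(2)], of "fst z"] w(1) by simp
    then show ?thesis unfolding 1 2 by simp
  qed
  have "openin ?Z ?Q" by (rule equalizer_open [OF gsheafD(1) [OF E, unfolded grp_simps] f1 f2 pe])
  then have Q: "openin ?P ?Q" using W by (simp add: openin_open_subtopology)
  have "(\<one>, ?K) \<in> ?Q"
    using K U(2,5) act_one [OF K] gsheafD(7) [OF E e] by (simp add: W_def)
  from Q [unfolded openin_prod_topology_alt, rule_format, OF this]
  obtain A where "\<exists>V. openin T A \<and> openin SG V \<and> \<one> \<in> A \<and> ?K \<in> V \<and> A \<times> V \<subseteq> ?Q" ..
  then obtain V where "openin T A \<and> openin SG V \<and> \<one> \<in> A \<and> ?K \<in> V \<and> A \<times> V \<subseteq> ?Q" ..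
  then have AV: "openin T A" "openin SG V" "\<one> \<in> A" "?K \<in> V" "A \<times> V \<subseteq> ?Q" by (simp_all only: simp_thms)
  obtain N1 where N1: "N1 \<in> ON" "N1 \<subseteq> A" using open_normal_base [OF AV(1,3)] by metis
  obtain N2 where N2: "N2 \<in> ON" "\<forall>L\<in>X. p N2 L = p N2 ?K \<longrightarrow> L \<in> V" using SG_base [OF AV(2,4)] ..
  \<comment> \<open>\<open>N1\<close> controls the group elements and \<open>N2\<close> the points.
    The intersection does both, and its fibres are stable under it, so the restriction of
    \<open>s\<close> is an invariant section in the required sense.\<close>
  let ?N = "N1 \<inter> N2"
  note N = ON_Int [OF N1(1) N2(1)]
  let ?F = "fibre ?N (p ?N ?K)"
  have FV: "L \<in> V" if "L \<in> ?F" for L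
  proof -
    have L: "L \<in> X" "p ?N L = p ?N ?K" using that by (simp_all add: in_fibre)
    have "p N2 L = p N2 ?K" by (rule p_refine [OF N N2(1) Int_lower2 K L])
    then show ?thesis using N2(2) L(1) by simp
  qed
  have QW: "(n, L) \<in> W" "s (act n L) = sact E n (s L)" if "n \<in> ?N" "L \<in> ?F" for n L
  proof -
    have "(n, L) \<in> A \<times> V" using that FV [OF that(2)] N1(2) by auto
    then have q: "(n, L) \<in> ?Q" using AV(5) by (rule rev_subsetD)
    then have "(n, L) \<in> topspace ?Z" by simp
    then show "(n, L) \<in> W" by (rule ZW)
    show "s (act n L) = sact E n (s L)" using q by simp
  qed
  have FU: "L \<in> U" if "L \<in> ?F" for L using WD(2) [OF QW(1) [OF ON_one [OF N] that]] by simp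
  have Fact: "act n L \<in> ?F" if n: "n \<in> ?N" and L: "L \<in> ?F" for n L
  proof -
    have nG: "n \<in> carrier G" using ON_sub [OF N] n by auto
    have LX: "L \<in> X" "p ?N L = p ?N ?K" using L by (simp_all add: in_fibre)
    have "p ?N (act n L) = qact ?N ?N (p ?N L)" using p_act [OF N nG LX(1)] coset_eq_one [OF N nG] n by simp
    then show ?thesis using qact_one [OF N p_in [OF N LX(1)]] LX act_in [OF nG LX(1)] by (simp add: in_fibre)
  qed
  have "restrict s ?F \<in> invariant_sections (pN G T ?N) E {p ?N ?K}"
    unfolding IS_pN [OF N]
  proof (intro conjI ballI)
    have "continuous_map (subtopology SG ?F) (tot E) s"
      by (rule continuous_map_from_subtopology_mono [OF U(3)]) (use FU in auto)
    then show "continuous_map (subtopology SG ?F) (tot E) (restrict s ?F)"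
      by (rule continuous_map_eq) simp
    show "sproj E (restrict s ?F L) = L" if "L \<in> ?F" for L using U(4) FU [OF that] that by simp
    show "restrict s ?F (act n L) = sact E n (restrict s ?F L)" if "n \<in> ?N" "L \<in> ?F" for n L
      using QW(2) [OF that] Fact [OF that] that(2) by simp
  qed simp
  moreover have "restrict s ?F ?K = e" using U(5) K by (simp add: in_fibre)
  ultimately show ?thesis using that N by blast
qed

end

context profin_universe
begin

text \<open>Evaluation of the section \<open>u\<close> at \<open>K\<close>: the counit of the
  adjunction for \<open>p N\<close>, read on the copy.\<close>

definition unit_cocone :: "('g, 'g set, 'u) gsheaf \<Rightarrow> 'g set \<Rightarrow> 'g set \<times> 'u \<Rightarrow> 'u" where
  "unit_cocone E N = (\<lambda>z\<in>pts (pull (pN G T N) (PE E N)). sec E N (snd z) (fst z))"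

lemma p_bullet_interpret:
  fixes E :: "('g, 'g set, 'u) gsheaf"
  shows "is_gsheaf SS E \<Longrightarrow> profin_bullet G T (fobj (p_bullet G T) E)"
  by (intro profin_bullet.intro profin_bullet_axioms.intro profin_axioms p_bullet_sheaf)

text \<open>Points of \<open>E\<close> are values of invariant sections by
  \<open>local_invariant_section\<close>. Two sections with the same value at \<open>K\<close> agree
  on a small fibre around it, that is, they restrict to the same point at a finer stage.\<close>

lemma unit_good:
  fixes E :: "('g, 'g set, 'u) gsheaf"
  assumes E: "is_gsheaf SS E"
  shows "profin_bullet.good_cocone G T (fobj (p_bullet G T) E) E (unit_cocone E)"
proof -
  let ?D = "fobj (p_bullet G T) E"
  interpret bd: profin_bullet G T ?D by (rule p_bullet_interpret [OF E])
  have k: "unit_cocone E N (K, u) = sec E N u K" if "at_stage ?D N K u" for N K u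
    using that bd.in_pull [OF at_stageD(1) [OF that]] by (simp add: unit_cocone_def)
  have st: "N \<in> ON" "K \<in> X" "u \<in> pts (PE E N)" "sproj (PE E N) u = p N K" "K \<in> fibre N (sproj (PE E N) u)"
    if "at_stage ?D N K u" for N K u
    using that by (simp_all add: at_stage_def in_fibre)
  have sf: "sec E N u K \<in> pts E" "sproj E (sec E N u K) = K" if "at_stage ?D N K u" for N K u
    by (rule sec_fib [OF E st(1,3,5) [OF that]])+
  have tr: "sec E M (tr ?D M N K u) L = sec E N u L" if M: "M \<in> ON" "M \<subseteq> N" and u: "at_stage ?D N K u" and L: "L \<in> fibre M (p M K)" for M N K u L
    unfolding tr_def
    by (rule struct_props(3) [OF E M(1) st(1) [OF u] M(2) p_in [OF M(1) st(2) [OF u]] st(3) [OF u] _ L])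
       (simp add: ph_p [OF M(1) st(1) [OF u] M(2) st(2) [OF u]] st(4) [OF u])
  show ?thesis
    unfolding bd.good_cocone_def is_cocone_def
  proof (intro conjI ballI allI impI E)
    show "unit_cocone E N \<in> sheaf_hom SS (pull (pN G T N) (stage ?D N)) E" if N: "N \<in> ON" for N
    proof (rule bd.pull_pN_homI [OF N])
      show "unit_cocone E N \<in> extensional (pts (pull (pN G T N) (stage ?D N)))" by (simp add: unit_cocone_def)
      show "unit_cocone E N (K, d) \<in> pts E \<and> sproj E (unit_cocone E N (K, d)) = K" if "at_stage ?D N K d" for K d
        unfolding k [OF that] using sf [OF that] by simp
      show "continuous_map (subtopology SG (fibre N (sproj (stage ?D N) d))) (tot E) (\<lambda>K. unit_cocone E N (K, d))"
        if d: "d \<in> pts (stage ?D N)" for d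
      proof -
        have d': "d \<in> pts (PE E N)" using d by simp
        have "continuous_map (subtopology SG (fibre N (sproj (PE E N) d))) (tot E) (sec E N d)"
          using sec_IS [OF E N d'] unfolding IS_pN [OF N] by simp
        then have "continuous_map (subtopology SG (fibre N (sproj (PE E N) d))) (tot E) (\<lambda>K. unit_cocone E N (K, d))"
        proof (rule continuous_map_eq)
          fix K assume "K \<in> topspace (subtopology SG (fibre N (sproj (PE E N) d)))"
          then have "K \<in> fibre N (sproj (stage ?D N) d)" by simp
          from k [OF at_stage_fibre [OF N d this]] show "sec E N d K = unit_cocone E N (K, d)" by simp
        qed
        then show ?thesis by simp
      qed
      show "unit_cocone E N (act g K, sact (stage ?D N) (N #> g) d) = sact E g (unit_cocone E N (K, d))"
        if g: "g \<in> carrier G" and d: "at_stage ?D N K d" for g K d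
      proof -
        have F: "act g K \<in> fibre N (qact N (N #> g) (sproj (PE E N) d))"
          using p_act [OF N g st(2) [OF d]] st(4) [OF d] act_in [OF g st(2) [OF d]] by (simp add: in_fibre)
        show ?thesis
          unfolding k [OF d] k [OF bd.stage_act [OF d g]]
          using sec_act [OF E N st(3) [OF d] g F] act_inv(1) [OF g st(2) [OF d]] by simp
      qed
      show "unit_cocone E N (K, sadd (stage ?D N) a b) = sadd E (unit_cocone E N (K, a)) (unit_cocone E N (K, b))"
        if a: "at_stage ?D N K a" and b: "at_stage ?D N K b" for K a b
        unfolding k [OF a] k [OF b] k [OF bd.stage_ops(1) [OF a b]] unfolding stage_p_bullet
        by (rule sec_add [OF E N, of _ "p N K"]) (use st [OF a] st [OF b] in \<open>simp_all add: in_fibre\<close>)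
      show "unit_cocone E N (K, sscale (stage ?D N) r a) = sscale E r (unit_cocone E N (K, a))"
        if a: "at_stage ?D N K a" for K a r
        unfolding k [OF a] k [OF bd.stage_ops(2) [OF a a]] unfolding stage_p_bullet
        by (rule sec_scale [OF E N, of _ "p N K"]) (use st [OF a] in \<open>simp_all add: in_fibre\<close>)
    qed
    show "case z of (K, d) \<Rightarrow> unit_cocone E M (K, struct ?D M N (p M K, d)) = unit_cocone E N (K, d)"
      if MN: "M \<in> ON" "N \<in> ON" "M \<subseteq> N" and z: "z \<in> pts (pull (pN G T N) (stage ?D N))" for M N z
    proof -
      obtain K d where Kd: "z = (K, d)" "at_stage ?D N K d" using z bd.in_pull [OF MN(2)] by (cases z) simp
      have "K \<in> fibre M (p M K)" using st(2) [OF Kd(2)] by (simp add: in_fibre)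
      from tr [OF MN(1,3) Kd(2) this] show ?thesis
        using k [OF Kd(2)] k [OF bd.tr_in [OF MN(1,3) Kd(2)]] Kd(1) by (simp add: tr_def)
    qed
    show "\<exists>N d. at_stage ?D N (sproj E e) d \<and> unit_cocone E N (sproj E e, d) = e" if e: "e \<in> pts E" for e
    proof -
      have K: "sproj E e \<in> X" using gsheafD(3) [OF E e] by simp
      obtain N s where N: "N \<in> ON" and s: "s \<in> invariant_sections (pN G T N) E {p N (sproj E e)}" "s (sproj E e) = e"
        by (rule local_invariant_section [OF E e])
      obtain u where u: "u \<in> pts (PE E N)" "sproj (PE E N) u = p N (sproj E e)" "sec E N u = s"
        by (rule sec_surj [OF E N p_in [OF N K] s(1)])
      have "at_stage ?D N (sproj E e) u" using N K u by (simp add: at_stage_def)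
      then show ?thesis using k u(3) s(2) by (intro exI [of _ N] exI [of _ u]) simp
    qed
    fix N N' K d d' assume d: "at_stage ?D N K d" and d': "at_stage ?D N' K d'" and eq: "unit_cocone E N (K, d) = unit_cocone E N' (K, d')"
    let ?F = "fibre N (sproj (PE E N) d)" and ?F' = "fibre N' (sproj (PE E N') d')"
    have c: "continuous_map (subtopology SG ?F) (tot E) (sec E N d)" "\<forall>L\<in>?F. sproj E (sec E N d L) = L"
      using sec_IS [OF E st(1,3) [OF d]] unfolding IS_pN [OF st(1) [OF d]] by simp_all
    have c': "continuous_map (subtopology SG ?F') (tot E) (sec E N' d')" "\<forall>L\<in>?F'. sproj E (sec E N' d' L) = L"
      using sec_IS [OF E st(1,3) [OF d']] unfolding IS_pN [OF st(1) [OF d']] by simp_all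
    have o: "openin SG {L \<in> ?F \<inter> ?F'. sec E N d L = sec E N' d' L}"
      by (rule sections_agree_open [OF gsheafD(1) [OF E, unfolded grp_simps] fibre_open [OF st(1) [OF d]] c fibre_open [OF st(1) [OF d']] c'])
    have "K \<in> {L \<in> ?F \<inter> ?F'. sec E N d L = sec E N' d' L}"
      using eq st(5) [OF d] st(5) [OF d'] unfolding k [OF d] k [OF d'] by simp
    from SG_base [OF o this]
    obtain M0 where M0: "M0 \<in> ON" "\<forall>L\<in>X. p M0 L = p M0 K \<longrightarrow> L \<in> {L \<in> ?F \<inter> ?F'. sec E N d L = sec E N' d' L}" ..
    \<comment> \<open>Agreement holds on the fibre at \<open>M0\<close>; intersecting with
      \<open>N\<close> and \<open>N'\<close> makes both restrictions defined.\<close>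
    let ?M = "M0 \<inter> (N \<inter> N')"
    note M = ON_Int [OF M0(1) ON_Int [OF st(1) [OF d] st(1) [OF d']]]
    have sub: "?M \<subseteq> N" "?M \<subseteq> N'" by auto
    note t = bd.tr_in [OF M sub(1) d] and t' = bd.tr_in [OF M sub(2) d']
    have "tr ?D ?M N K d = tr ?D ?M N' K d'"
    proof (rule sec_inj [OF E M st(3) [OF t] st(3) [OF t']])
      show "sproj (PE E ?M) (tr ?D ?M N K d) = sproj (PE E ?M) (tr ?D ?M N' K d')"
        unfolding st(4) [OF t] st(4) [OF t'] ..
      fix L assume "L \<in> fibre ?M (sproj (PE E ?M) (tr ?D ?M N' K d'))"
      then have L: "L \<in> fibre ?M (p ?M K)" unfolding st(4) [OF t'] .
      then have L': "L \<in> X" "p ?M L = p ?M K" by (simp_all add: in_fibre)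
      have "p M0 L = p M0 K" by (rule p_refine [OF M M0(1) Int_lower1 st(2) [OF d] L'])
      then have "sec E N d L = sec E N' d' L" using M0(2) L'(1) by simp
      then show "sec E ?M (tr ?D ?M N K d) L = sec E ?M (tr ?D ?M N' K d') L"
        unfolding tr [OF M sub(1) d L] tr [OF M sub(2) d' L] .
    qed
    then show "\<exists>M\<in>ON. M \<subseteq> N \<and> M \<subseteq> N' \<and> tr ?D M N K d = tr ?D M N' K d'"
      using M sub by blast
  qed
qed

end

subsection \<open>The counit\<close>

text \<open>\<open>theta N\<close> is the canonical map \<open>D\<^sub>N \<rightarrow> (p\<^sub>N)\<^sub>* E\<close> for a colimit \<open>E\<close> of \<open>D\<close>.\<close>

context bullet_universe
begin

context
  fixes E :: "('g, 'g set, 'u) gsheaf" and \<kappa>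
  assumes good: "good_cocone E \<kappa>"
begin

lemma CC: "is_cocone G T D E \<kappa>"
  using good by (simp add: good_cocone_def)

lemma E: "is_gsheaf SS E"
  by (rule cocone_gsheaf [OF CC])

definition theta :: "'g set \<Rightarrow> 'u \<Rightarrow> 'u" where
  "theta N = (\<lambda>d\<in>pts (stage D N). SOME u. u \<in> pts (PE E N) \<and> sproj (PE E N) u = sproj (stage D N) d \<and>
     sec E N u = (\<lambda>K\<in>fibre N (sproj (stage D N) d). \<kappa> N (K, d)))"

lemma theta_props:
  assumes N: "N \<in> ON" and d: "d \<in> pts (stage D N)"
  shows "theta N d \<in> pts (PE E N)" "sproj (PE E N) (theta N d) = sproj (stage D N) d"
    "\<And>K. K \<in> fibre N (sproj (stage D N) d) \<Longrightarrow> sec E N (theta N d) K = \<kappa> N (K, d)"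
proof -
  let ?S = "sproj (stage D N) d" let ?F = "fibre N ?S"
  have S: "?S \<in> Y N" using gsheafD(3) [OF stage_gsheaf [OF N] d] N by simp
  have st: "at_stage D N K d" if "K \<in> ?F" for K by (rule at_stage_fibre [OF N d that])
  have "(\<lambda>K\<in>?F. \<kappa> N (K, d)) \<in> invariant_sections (pN G T N) E {?S}"
    unfolding IS_pN [OF N]
  proof (intro conjI ballI)
    show "continuous_map (subtopology SG ?F) (tot E) (\<lambda>K\<in>?F. \<kappa> N (K, d))"
      by (rule continuous_map_eq [OF cocone_cont [OF CC N d]]) simp
    show "sproj E ((\<lambda>K\<in>?F. \<kappa> N (K, d)) K) = K" if "K \<in> ?F" for K
      using cocone_in(2) [OF CC st [OF that]] that by simp
    fix n K assume n: "n \<in> N" and K: "K \<in> ?F"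
    have nG: "n \<in> carrier G" using ON_sub [OF N] n by auto
    have Nn: "N #> n = N" using coset_eq_one [OF N nG] n by simp
    \<comment> \<open>Elements of \<open>N\<close> act on the stage through the identity of
      \<open>G Mod N\<close>. This makes the section defined by a fixed \<open>d\<close> invariant
      under \<open>N\<close>.\<close>
    have dn: "sact (stage D N) (N #> n) d = d" using gsheafD(7) [OF stage_gsheaf [OF N] d] Nn by simp
    have "act n K \<in> ?F"
      using stage_act [OF st [OF K] nG] self_fibre unfolding dn by blast
    then show "(\<lambda>K\<in>?F. \<kappa> N (K, d)) (act n K) = sact E n ((\<lambda>K\<in>?F. \<kappa> N (K, d)) K)"
      using cocone_act [OF CC st [OF K] nG] K unfolding dn by simp
  qed simp
  then obtain u where u: "u \<in> pts (PE E N)" "sproj (PE E N) u = ?S" "sec E N u = (\<lambda>K\<in>?F. \<kappa> N (K, d))"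
    by (rule sec_surj [OF E N S])
  have eq: "theta N d = (SOME u. u \<in> pts (PE E N) \<and> sproj (PE E N) u = ?S \<and> sec E N u = (\<lambda>K\<in>?F. \<kappa> N (K, d)))"
    using d by (simp add: theta_def)
  have *: "theta N d \<in> pts (PE E N) \<and> sproj (PE E N) (theta N d) = ?S \<and> sec E N (theta N d) = (\<lambda>K\<in>?F. \<kappa> N (K, d))"
    unfolding eq by (rule someI [of _ u]) (use u in simp)
  then show "theta N d \<in> pts (PE E N)" "sproj (PE E N) (theta N d) = ?S" by simp_all
  show "sec E N (theta N d) K = \<kappa> N (K, d)" if "K \<in> ?F" for K using * that by simp
qed

lemma theta_hom:
  assumes N: "N \<in> ON"
  shows "theta N \<in> sheaf_hom (QS N) (stage D N) (PE E N)"
proof (rule discrete_homI)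
  note DN = stage_gsheaf [OF N] and PN = push_pN_gsheaf [OF E N] and TP = theta_props [OF N]
  show "tot (stage D N) = discrete_topology (pts (stage D N))" by (rule discrete_gsheaf_tot [OF QS_discrete [OF N] DN])
  show "theta N \<in> extensional (pts (stage D N))" by (simp add: theta_def)
  show "theta N d \<in> pts (PE E N)" "sproj (PE E N) (theta N d) = sproj (stage D N) d" if "d \<in> pts (stage D N)" for d
    using TP [OF that] by simp_all
  show "theta N (sact (stage D N) C d) = sact (PE E N) C (theta N d)" if C: "C \<in> carrier (grp (QS N))" and d: "d \<in> pts (stage D N)" for C d
  proof -
    have C': "C \<in> carrier (G Mod N)" using C by simp
    obtain g where g: "g \<in> carrier G" "C = N #> g" using C' by (rule coset_ex)
    note cd = gsheafD(11) [OF DN C d] gsheafD(4) [OF DN C d]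
    note L = TP [OF cd(1), unfolded cd(2)] and U = TP [OF d]
    note r = gsheafD(11) [OF PN C U(1)] gsheafD(4) [OF PN C U(1), unfolded U(2)]
    have Sd: "sproj (stage D N) d \<in> Y N" using gsheafD(3) [OF DN d] N by simp
    show ?thesis
    proof (rule sec_inj [OF E N L(1) r(1)])
      show "sproj (PE E N) (theta N (sact (stage D N) C d)) = sproj (PE E N) (sact (PE E N) C (theta N d))" unfolding L(2) r(2) ..
      fix K assume "K \<in> fibre N (sproj (PE E N) (sact (PE E N) C (theta N d)))"
      then have K: "K \<in> fibre N (qact N C (sproj (stage D N) d))" unfolding r(2) .
      have K1: "K \<in> fibre N (qact N (N #> g) (sproj (stage D N) d))" using K g(2) by simp
      have K2: "K \<in> fibre N (qact N (N #> g) (sproj (PE E N) (theta N d)))" using K1 U(2) by simp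
      have K3: "act (inv g) K \<in> fibre N (sproj (stage D N) d)" by (rule fibre_act [OF N g(1) Sd K1])
      have KX: "K \<in> X" using K by (simp add: in_fibre)
      show "sec E N (theta N (sact (stage D N) C d)) K = sec E N (sact (PE E N) C (theta N d)) K"
        using L(3) [OF K] sec_act [OF E N U(1) g(1) K2] U(3) [OF K3] g(2)
          cocone_act [OF CC at_stage_fibre [OF N d K3] g(1)] act_inv(2) [OF g(1) KX] by simp
    qed
  qed
  show "theta N (sadd (stage D N) a b) = sadd (PE E N) (theta N a) (theta N b)"
    if S: "S \<in> topspace (space_top (QS N))" and ab: "a \<in> fib (stage D N) S" "b \<in> fib (stage D N) S" for S a b
  proof -
    have a: "a \<in> pts (stage D N)" "sproj (stage D N) a = S" and b: "b \<in> pts (stage D N)" "sproj (stage D N) b = S" using ab by simp_all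
    have s: "sadd (stage D N) a b \<in> pts (stage D N)" "sproj (stage D N) (sadd (stage D N) a b) = S"
      using rat_stalkD(3) [OF gsheafD(5) [OF DN S] ab] by simp_all
    note L = TP [OF s(1), unfolded s(2)] and A = TP [OF a(1), unfolded a(2)] and B = TP [OF b(1), unfolded b(2)]
    have AB: "theta N a \<in> fib (PE E N) S" "theta N b \<in> fib (PE E N) S" using A B by simp_all
    note r = rat_stalkD(3) [OF gsheafD(5) [OF PN S] AB]
    show ?thesis
    proof (rule sec_inj [OF E N L(1)])
      show "sadd (PE E N) (theta N a) (theta N b) \<in> pts (PE E N)"
        "sproj (PE E N) (theta N (sadd (stage D N) a b)) = sproj (PE E N) (sadd (PE E N) (theta N a) (theta N b))" using r L(2) by simp_all
      fix K assume "K \<in> fibre N (sproj (PE E N) (sadd (PE E N) (theta N a) (theta N b)))"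
      then have K: "K \<in> fibre N S" using r by simp
      have "at_stage D N K a" "at_stage D N K b" using at_stage_fibre [OF N a(1)] at_stage_fibre [OF N b(1)] a(2) b(2) K by simp_all
      from cocone_add [OF CC this]
      show "sec E N (theta N (sadd (stage D N) a b)) K = sec E N (sadd (PE E N) (theta N a) (theta N b)) K"
        unfolding L(3) [OF K] sec_add [OF E N AB K] A(3) [OF K] B(3) [OF K] .
    qed
  qed
  show "theta N (sscale (stage D N) r a) = sscale (PE E N) r (theta N a)"
    if S: "S \<in> topspace (space_top (QS N))" and ab: "a \<in> fib (stage D N) S" for S r a
  proof -
    have a: "a \<in> pts (stage D N)" "sproj (stage D N) a = S" using ab by simp_all
    have s: "sscale (stage D N) r a \<in> pts (stage D N)" "sproj (stage D N) (sscale (stage D N) r a) = S"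
      using rat_stalkD(4) [OF gsheafD(5) [OF DN S] ab] by simp_all
    note L = TP [OF s(1), unfolded s(2)] and A = TP [OF a(1), unfolded a(2)]
    have AB: "theta N a \<in> fib (PE E N) S" using A by simp
    note q = rat_stalkD(4) [OF gsheafD(5) [OF PN S] AB, of r]
    show ?thesis
    proof (rule sec_inj [OF E N L(1)])
      show "sscale (PE E N) r (theta N a) \<in> pts (PE E N)"
        "sproj (PE E N) (theta N (sscale (stage D N) r a)) = sproj (PE E N) (sscale (PE E N) r (theta N a))" using q L(2) by simp_all
      fix K assume "K \<in> fibre N (sproj (PE E N) (sscale (PE E N) r (theta N a)))"
      then have K: "K \<in> fibre N S" using q by simp
      have "at_stage D N K a" using at_stage_fibre [OF N a(1)] a(2) K by simp
      from cocone_scale [OF CC this]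
      show "sec E N (theta N (sscale (stage D N) r a)) K = sec E N (sscale (PE E N) r (theta N a)) K"
        unfolding L(3) [OF K] sec_scale [OF E N AB K] A(3) [OF K] .
    qed
  qed
qed

text \<open>The structure map on the right restricts sections, and the legs of a cocone take the
  same value before and after transition; so both sides have the same values.\<close>

lemma theta_struct:
  assumes MN: "M \<in> ON" "N \<in> ON" "M \<subseteq> N" and R: "R \<in> Y M" and d: "d \<in> pts (stage D N)" "ph M N R = sproj (stage D N) d"
  shows "theta M (struct D M N (R, d)) = st E M N (R, theta N d)"
proof -
  note M = MN(1) and N = MN(2)
  obtain K0 where K0: "K0 \<in> X" "R = p M K0" using p_ex [OF M R] ..
  have "at_stage D N K0 d" using N K0 d ph_p [OF MN K0(1)] by (simp add: at_stage_def)
  from tr_in [OF M MN(3) this] have s: "struct D M N (R, d) \<in> pts (stage D M)" "sproj (stage D M) (struct D M N (R, d)) = R"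
    using K0(2) by (simp_all add: at_stage_def tr_def)
  note TN = theta_props [OF N d(1)] and TM = theta_props [OF M s(1), unfolded s(2)]
  have ph': "ph M N R = sproj (PE E N) (theta N d)" using TN(2) d(2) by simp
  note S = struct_props [OF E MN R TN(1) ph']
  show ?thesis
  proof (rule sec_inj [OF E M TM(1) S(1)])
    show "sproj (PE E M) (theta M (struct D M N (R, d))) = sproj (PE E M) (st E M N (R, theta N d))" unfolding TM(2) S(2) ..
    fix K assume "K \<in> fibre M (sproj (PE E M) (st E M N (R, theta N d)))"
    then have K: "K \<in> fibre M R" unfolding S(2) .
    have K': "K \<in> fibre N (sproj (stage D N) d)" using fibre_refine [OF MN K] d(2) by simp
    have "p M K = R" using K by (simp add: in_fibre)
    then show "sec E M (theta M (struct D M N (R, d))) K = sec E M (st E M N (R, theta N d)) K"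
      unfolding TM(3) [OF K] S(3) [OF K] TN(3) [OF K']
      using cocone_tr [OF CC M MN(3) at_stage_fibre [OF N d(1) K']] by (simp add: tr_def)
  qed
qed

text \<open>Finitely many conditions, each reached at some stage and inherited by finer ones, are
  all reached at the intersection of these stages.\<close>

lemma finite_refine:
  assumes F: "finite F" and M: "M \<in> ON" and "\<And>C. C \<in> F \<Longrightarrow> \<exists>L\<in>ON. L \<subseteq> M \<and> R C L"
    and down: "\<And>C L L'. C \<in> F \<Longrightarrow> L' \<in> ON \<Longrightarrow> L \<in> ON \<Longrightarrow> L' \<subseteq> L \<Longrightarrow> L \<subseteq> M \<Longrightarrow> R C L \<Longrightarrow> R C L'"
  shows "\<exists>L\<in>ON. L \<subseteq> M \<and> (\<forall>C\<in>F. R C L)"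
  using F assms(3) down
proof (induction F rule: finite_induct)
  case empty
  then show ?case using M by auto
next
  case (insert C F)
  have "\<exists>L\<in>ON. L \<subseteq> M \<and> (\<forall>C\<in>F. R C L)"
    by (rule insert.IH) (use insert.prems(1) in simp, rule insert.prems(2) [OF insertI2])
  then obtain L1 where L1: "L1 \<in> ON" "L1 \<subseteq> M" "\<forall>C\<in>F. R C L1" by (elim bexE conjE)
  obtain L2 where L2: "L2 \<in> ON" "L2 \<subseteq> M" "R C L2" using insert.prems(1) [OF insertI1] by (elim bexE conjE)
  note L = ON_Int [OF L1(1) L2(1)]
  have "R C (L1 \<inter> L2)" by (rule insert.prems(2) [OF insertI1 L L2(1) Int_lower2 L2(2,3)])
  moreover have "R C' (L1 \<inter> L2)" if "C' \<in> F" for C'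
    by (rule insert.prems(2) [OF insertI2 [OF that] L L1(1) Int_lower1 L1(2) bspec [OF L1(3) that]])
  ultimately have "\<forall>C'\<in>insert C F. R C' (L1 \<inter> L2)" by simp
  moreover have "L1 \<inter> L2 \<subseteq> M" using L1(2) by auto
  ultimately show ?case using L by (intro bexI [of _ "L1 \<inter> L2"] conjI)
qed

section \<open>Bijectivity of \<open>theta\<close> when the adjoint structure maps are
  invertible\<close>

context
  assumes iso: "\<And>M N. M \<in> ON \<Longrightarrow> N \<in> ON \<Longrightarrow> M \<subseteq> N \<Longrightarrow>
    sheaf_iso (QS N) (stage D N) (push (phiMN G T M N) (stage D M)) (adjoint_struct G T D M N)"
begin

text \<open>Each point of a fibre of \<open>ph M N\<close> has the form \<open>p M K\<close>, so
  agreement of the images may be tested with the transition maps along closed subgroups of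
  \<open>G\<close>.\<close>

lemma adjoint_inj:
  assumes MN: "M \<in> ON" "N \<in> ON" "M \<subseteq> N" and a: "a \<in> pts (stage D N)" and b: "b \<in> pts (stage D N)"
    and p: "sproj (stage D N) a = sproj (stage D N) b"
    and eq: "\<And>K. K \<in> fibre N (sproj (stage D N) b) \<Longrightarrow> tr D M N K a = tr D M N K b"
  shows "a = b"
proof (rule discrete_change.adjoint_isoD(1) [OF phi_change [OF MN], of "stage D N" "struct D M N" "stage D M"], unfold grp_simps)
  show "is_gsheaf (QS N) (stage D N)" by (rule stage_gsheaf [OF MN(2)])
  show "struct D M N \<in> sheaf_hom (QS M) (pull (phiMN G T M N) (stage D N)) (stage D M)" by (rule struct_sheaf_hom [OF MN])
  show "sheaf_iso (QS N) (stage D N) (push (phiMN G T M N) (stage D M))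
     (adjoint_to_push (phiMN G T M N) (stage D N) (stage D M) (struct D M N))"
    using iso [OF MN] by (simp add: adjoint_struct_def)
  fix R assume "R \<in> preim (phiMN G T M N) {sproj (stage D N) b}"
  then have R: "R \<in> Y M" "ph M N R = sproj (stage D N) b" by (simp_all add: in_phi_fibre [OF MN(1)])
  obtain K where K: "K \<in> X" "R = p M K" using p_ex [OF MN(1) R(1)] ..
  have "K \<in> fibre N (sproj (stage D N) b)" using K R(2) ph_p [OF MN K(1)] by (simp add: in_fibre)
  from eq [OF this] show "struct D M N (R, a) = struct D M N (R, b)" using K(2) by (simp add: tr_def)
qed (rule a b p)+

lemma adjoint_surj:
  assumes MN: "M \<in> ON" "N \<in> ON" "M \<subseteq> N" and S: "S \<in> Y N"
    and t: "t \<in> invariant_sections (phiMN G T M N) (stage D M) {S}"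
  shows "\<exists>d\<in>fib (stage D N) S. \<forall>K\<in>fibre N S. tr D M N K d = t (p M K)"
proof -
  have "\<exists>d\<in>fib (stage D N) S. \<forall>R\<in>preim (phiMN G T M N) {S}. struct D M N (R, d) = t R"
  proof (rule discrete_change.adjoint_isoD(2) [OF phi_change [OF MN]], unfold grp_simps)
    show "is_gsheaf (QS N) (stage D N)" by (rule stage_gsheaf [OF MN(2)])
    show "struct D M N \<in> sheaf_hom (QS M) (pull (phiMN G T M N) (stage D N)) (stage D M)" by (rule struct_sheaf_hom [OF MN])
    show "sheaf_iso (QS N) (stage D N) (push (phiMN G T M N) (stage D M))
       (adjoint_to_push (phiMN G T M N) (stage D N) (stage D M) (struct D M N))"
      using iso [OF MN] by (simp add: adjoint_struct_def)
    show "S \<in> topspace (space_top (QS N))" using S MN(2) by simp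
  qed (rule t)
  then obtain d where d: "d \<in> fib (stage D N) S" "\<forall>R\<in>preim (phiMN G T M N) {S}. struct D M N (R, d) = t R" ..
  have "tr D M N K d = t (p M K)" if "K \<in> fibre N S" for K
  proof -
    have K: "K \<in> X" "p N K = S" using that by (simp_all add: in_fibre)
    have "p M K \<in> preim (phiMN G T M N) {S}"
      using K p_in [OF MN(1) K(1)] ph_p [OF MN K(1)] by (simp add: in_phi_fibre [OF MN(1)])
    from bspec [OF d(2) this] show ?thesis by (simp add: tr_def)
  qed
  then show ?thesis using d(1) by blast
qed

text \<open>Equal sections mean that \<open>a\<close> and \<open>b\<close> become equal over each
  \<open>K\<close> at a stage depending on \<open>K\<close>. Compactness gives one stage for the
  whole fibre, and injectivity of the adjoint structure map at that stage applies.\<close>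

lemma theta_inj:
  assumes N: "N \<in> ON" and a: "a \<in> pts (stage D N)" and b: "b \<in> pts (stage D N)" and eq: "theta N a = theta N b"
  shows "a = b"
proof -
  note A = theta_props [OF N a] and B = theta_props [OF N b]
  have pab: "sproj (stage D N) a = sproj (stage D N) b" using A(2) B(2) eq by simp
  let ?S = "sproj (stage D N) b"
  \<comment> \<open>Away from the fibre of the common base point the condition is void. Including
    \<open>M \<subseteq> N\<close> forces the stage delivered by compactness to lie below
    \<open>N\<close>.\<close>
  define R where "R M Q \<longleftrightarrow> M \<subseteq> N \<and> (\<forall>K\<in>fibre M Q. K \<in> fibre N ?S \<longrightarrow> tr D M N K a = tr D M N K b)" for M Q
  have "\<exists>M\<in>ON. \<forall>Q\<in>Y M. R M Q"
  proof (rule compact_stage)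
    fix K assume K: "K \<in> X"
    show "\<exists>M\<in>ON. R M (p M K)"
    proof (cases "K \<in> fibre N ?S")
      case False
      have "\<not> (L \<in> fibre N ?S)" if "L \<in> fibre N (p N K)" for L
        using that False K by (simp add: in_fibre)
      then have "R N (p N K)" by (auto simp: R_def)
      then show ?thesis using N by blast
    next
      case True
      have Ka: "K \<in> fibre N (sproj (stage D N) a)" using True pab by simp
      note sa = at_stage_fibre [OF N a Ka] and sb = at_stage_fibre [OF N b True]
      have "\<kappa> N (K, a) = \<kappa> N (K, b)" using A(3) [OF Ka] B(3) [OF True] eq by simp
      then obtain M where M: "M \<in> ON" "M \<subseteq> N" "tr D M N K a = tr D M N K b" using good_eq [OF good sa sb] by metis
      have "tr D M N L a = tr D M N L b" if "L \<in> fibre M (p M K)" for L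
      proof -
        have pL: "p M L = p M K" using that by (simp add: in_fibre)
        show ?thesis unfolding tr_local [OF pL] by (rule M(3))
      qed
      then have "R M (p M K)" using M(2) by (simp add: R_def)
      then show ?thesis using M(1) by blast
    qed
  next
    fix M' M Q assume M': "M' \<in> ON" and M: "M \<in> ON" and sub: "M' \<subseteq> M" and Q: "Q \<in> Y M'" and RM: "R M (ph M' M Q)"
    have MN: "M \<subseteq> N" using RM by (simp add: R_def)
    show "R M' Q"
      unfolding R_def
    proof (intro conjI ballI impI)
      show "M' \<subseteq> N" using sub MN by (rule subset_trans)
      fix K assume K: "K \<in> fibre M' Q" and KN: "K \<in> fibre N ?S"
      have Ka: "K \<in> fibre N (sproj (stage D N) a)" using KN pab by simp
      note sa = at_stage_fibre [OF N a Ka] and sb = at_stage_fibre [OF N b KN]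
      have "tr D M N K a = tr D M N K b" using RM fibre_refine [OF M' M sub K] KN by (simp add: R_def)
      then show "tr D M' N K a = tr D M' N K b"
        unfolding tr_comp [OF M' sub M MN sa] tr_comp [OF M' sub M MN sb] by simp
    qed
  qed
  then obtain M where M: "M \<in> ON" "\<forall>Q\<in>Y M. R M Q" ..
  have RM: "R M (p M K)" if "K \<in> X" for K using M(2) p_in [OF M(1) that] by (rule bspec)
  \<comment> \<open>\<open>M \<subseteq> N\<close> can be read off only at an actual point, and the
    base point of \<open>b\<close> provides one.\<close>
  obtain K0 where "K0 \<in> X" using p_ex [OF N, of ?S] gsheafD(3) [OF stage_gsheaf [OF N] b] N by auto
  then have MN: "M \<subseteq> N" using RM by (auto simp: R_def)
  show ?thesis
  proof (rule adjoint_inj [OF M(1) N MN a b pab])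
    fix K assume K: "K \<in> fibre N ?S"
    then have "K \<in> X" by (simp add: in_fibre)
    then show "tr D M N K a = tr D M N K b" using RM [of K] K by (simp add: R_def in_fibre)
  qed
qed

text \<open>The section has to be lifted to an \<open>N\<close>-invariant family at one stage.
  Uniformity in the point costs one use of compactness, invariance under a single group element a
  second one, and invariance under all of \<open>N\<close> finiteness of the quotient.\<close>

lemma theta_surj:
  assumes N: "N \<in> ON" and u: "u \<in> pts (PE E N)"
  shows "\<exists>d\<in>pts (stage D N). theta N d = u"
proof -
  let ?y = "sproj (PE E N) u" let ?F = "fibre N ?y" let ?s = "sec E N u"
  have y: "?y \<in> Y N" by (rule push_pN_sproj [OF E N u])
  have sc: "continuous_map (subtopology SG ?F) (tot E) ?s" "\<forall>L\<in>?F. sproj E (?s L) = L"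
    using sec_IS [OF E N u] unfolding IS_pN [OF N] by simp_all
  have FX: "K \<in> X" if "K \<in> ?F" for K using that by (simp add: in_fibre)
  have Fact: "act n K \<in> ?F" if n: "n \<in> N" and K: "K \<in> ?F" for n K
  proof -
    have nG: "n \<in> carrier G" using ON_sub [OF N] n by auto
    have Nn: "N #> n = N" using coset_eq_one [OF N nG] n by simp
    have "p N (act n K) = ?y"
      using p_act [OF N nG FX [OF K]] K qact_one [OF N y] unfolding Nn by (simp add: in_fibre)
    then show ?thesis using act_in [OF nG FX [OF K]] by (simp add: in_fibre)
  qed
  \<comment> \<open>A single \<open>d\<close> has to represent the section on the whole fibre of
    \<open>S\<close>, not just near one subgroup.\<close>
  define R where "R M S \<longleftrightarrow> M \<subseteq> N \<and> (ph M N S = ?y \<longrightarrow> (\<exists>d\<in>fib (stage D M) S. \<forall>L\<in>fibre M S. ?s L = \<kappa> M (L, d)))" for M S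
  have "\<exists>M\<in>ON. \<forall>S\<in>Y M. R M S"
  proof (rule compact_stage)
    fix K assume K: "K \<in> X"
    show "\<exists>M\<in>ON. R M (p M K)"
    proof (cases "K \<in> ?F")
      case False
      then have "ph N N (p N K) \<noteq> ?y" using K ph_id [OF N p_in [OF N K]] by (simp add: in_fibre)
      then have "R N (p N K)" by (simp add: R_def)
      then show ?thesis using N by (rule rev_bexI [rotated])
    next
      case True
      have e: "?s K \<in> pts E" "sproj E (?s K) = K" by (rule sec_fib [OF E N u True])+
      obtain N1 d1 where "at_stage D N1 (sproj E (?s K)) d1" "\<kappa> N1 (sproj E (?s K), d1) = ?s K" by (rule good_surj [OF good e(1)])
      then have d1: "at_stage D N1 K d1" "\<kappa> N1 (K, d1) = ?s K" by (simp_all only: e(2))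
      note N1 = at_stageD(1) [OF d1(1)]
      let ?F1 = "fibre N1 (sproj (stage D N1) d1)"
      have s1: "at_stage D N1 L d1" if "L \<in> ?F1" for L by (rule at_stage_fibre [OF N1 at_stageD(3) [OF d1(1)] that])
      have c1: "\<forall>L\<in>?F1. sproj E (\<kappa> N1 (L, d1)) = L" using cocone_in(2) [OF CC s1] by (rule ballI)
      \<comment> \<open>Both are continuous sections of \<open>E\<close> with the same value at
        \<open>K\<close>, so they agree on a neighbourhood, which contains a fibre.\<close>
      have o: "openin SG {L \<in> ?F \<inter> ?F1. ?s L = \<kappa> N1 (L, d1)}"
        by (rule sections_agree_open [OF gsheafD(1) [OF E, unfolded grp_simps] fibre_open [OF N] sc fibre_open [OF N1]
          cocone_cont [OF CC N1 at_stageD(3) [OF d1(1)]] c1])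
      have "K \<in> {L \<in> ?F \<inter> ?F1. ?s L = \<kappa> N1 (L, d1)}" using True self_fibre [OF d1(1)] d1(2) by simp
      from SG_base [OF o this] obtain M0 where M0: "M0 \<in> ON" "\<forall>L\<in>X. p M0 L = p M0 K \<longrightarrow> L \<in> {L \<in> ?F \<inter> ?F1. ?s L = \<kappa> N1 (L, d1)}" ..
      let ?M = "M0 \<inter> (N \<inter> N1)"
      note M = ON_Int [OF M0(1) ON_Int [OF N N1]]
      have sub: "?M \<subseteq> N" "?M \<subseteq> N1" by auto
      note t = tr_in [OF M sub(2) d1(1)]
      \<comment> \<open>\<open>tr_local\<close> makes the transition of \<open>d1\<close> over
        \<open>L\<close> the one over \<open>K\<close>, so the same point serves throughout the
        fibre.\<close>
      have "?s L = \<kappa> ?M (L, tr D ?M N1 K d1)" if "L \<in> fibre ?M (p ?M K)" for L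
      proof -
        have L: "L \<in> X" "p ?M L = p ?M K" using that by (simp_all add: in_fibre)
        have "p M0 L = p M0 K" by (rule p_refine [OF M M0(1) Int_lower1 K L])
        then have LA: "L \<in> ?F1" "?s L = \<kappa> N1 (L, d1)" using M0(2) L(1) by simp_all
        show ?thesis unfolding LA(2) tr_local [OF L(2), symmetric] by (rule cocone_tr [OF CC M sub(2) s1 [OF LA(1)], symmetric])
      qed
      then have "\<exists>d\<in>fib (stage D ?M) (p ?M K). \<forall>L\<in>fibre ?M (p ?M K). ?s L = \<kappa> ?M (L, d)"
        by (intro bexI [of _ "tr D ?M N1 K d1"] ballI at_stageD(5) [OF t])
      then have "R ?M (p ?M K)" unfolding R_def using sub(1) by (intro conjI impI)
      then show ?thesis using M by (rule rev_bexI [rotated])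
    qed
  next
    fix M' M Q assume M': "M' \<in> ON" and M: "M \<in> ON" and sub: "M' \<subseteq> M" and Q: "Q \<in> Y M'" and RM: "R M (ph M' M Q)"
    have MN: "M \<subseteq> N" using RM unfolding R_def by (rule conjunct1)
    show "R M' Q"
      unfolding R_def
    proof (intro conjI impI)
      show "M' \<subseteq> N" using sub MN by (rule subset_trans)
      assume "ph M' N Q = ?y"
      then have "ph M N (ph M' M Q) = ?y" using ph_ph [OF M' M N sub MN Q] by (rule trans [rotated])
      then have "\<exists>d\<in>fib (stage D M) (ph M' M Q). \<forall>L\<in>fibre M (ph M' M Q). ?s L = \<kappa> M (L, d)"
        using RM unfolding R_def by simp
      then obtain d where d: "d \<in> fib (stage D M) (ph M' M Q)" "\<forall>L\<in>fibre M (ph M' M Q). ?s L = \<kappa> M (L, d)" ..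
      obtain K0 where K0: "K0 \<in> X" "Q = p M' K0" using p_ex [OF M' Q] ..
      have ds: "at_stage D M L d" if "L \<in> fibre M' Q" for L
      proof (rule at_stageI [OF M])
        show LX: "L \<in> X" using that by (simp add: in_fibre)
        have "ph M' M Q = p M L" using that ph_p [OF M' M sub LX] by (simp add: in_fibre)
        then show "d \<in> fib (stage D M) (p M L)" using d(1) by simp
      qed
      have K0F: "K0 \<in> fibre M' Q" using K0 by (simp add: in_fibre)
      show "\<exists>d\<in>fib (stage D M') Q. \<forall>L\<in>fibre M' Q. ?s L = \<kappa> M' (L, d)"
      proof (intro bexI ballI)
        show "tr D M' M K0 d \<in> fib (stage D M') Q" using at_stageD(5) [OF tr_in [OF M' sub ds [OF K0F]]] K0(2) by simp
        fix L assume L: "L \<in> fibre M' Q"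
        have LK: "p M' L = p M' K0" using L K0(2) by (simp add: in_fibre)
        have "?s L = \<kappa> M (L, d)" using d(2) fibre_refine [OF M' M sub L] by (rule bspec)
        then show "?s L = \<kappa> M' (L, tr D M' M K0 d)"
          unfolding tr_local [OF LK, symmetric] cocone_tr [OF CC M' sub ds [OF L]] .
      qed
    qed
  qed
  then obtain M where M: "M \<in> ON" "\<forall>S\<in>Y M. R M S" ..
  obtain K0 where K0: "K0 \<in> X" using p_ex [OF N y] by (elim bexE)
  have MN: "M \<subseteq> N" using bspec [OF M(2) p_in [OF M(1) K0]] unfolding R_def by (rule conjunct1)
  have "\<forall>S\<in>{S \<in> Y M. ph M N S = ?y}. \<exists>d. d \<in> fib (stage D M) S \<and> (\<forall>L\<in>fibre M S. ?s L = \<kappa> M (L, d))"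
    using M(2) unfolding R_def by blast
  then obtain dd where dd: "\<forall>S\<in>{S \<in> Y M. ph M N S = ?y}. dd S \<in> fib (stage D M) S \<and> (\<forall>L\<in>fibre M S. ?s L = \<kappa> M (L, dd S))"
    unfolding bchoice_iff ..
  \<comment> \<open>Chosen once for each point of stage \<open>M\<close>, hence constant on the
    fibres of \<open>p M\<close>; this local constancy is what the next use of compactness
    needs.\<close>
  define e where "e K = dd (p M K)" for K
  have eD: "at_stage D M K (e K)" "\<kappa> M (K, e K) = ?s K" if K: "K \<in> ?F" for K
  proof -
    have "p M K \<in> {S \<in> Y M. ph M N S = ?y}" using K p_in [OF M(1) FX [OF K]] ph_p [OF M(1) N MN FX [OF K]] by (simp add: in_fibre)
    note * = bspec [OF dd this, folded e_def]
    show "at_stage D M K (e K)" by (rule at_stageI [OF M(1) FX [OF K] conjunct1 [OF *]])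
    have "K \<in> fibre M (p M K)" using FX [OF K] by (simp add: in_fibre)
    from bspec [OF conjunct2 [OF *] this] show "\<kappa> M (K, e K) = ?s K" by (rule sym)
  qed
  have e_local: "e K = e K'" if "p M K = p M K'" for K K' unfolding e_def that ..
  have NG: "g \<in> carrier G" if "g \<in> N" for g using ON_sub [OF N] that by auto
  note DM = stage_gsheaf [OF M(1)]
  have ea: "at_stage D M (act g K) (sact (stage D M) (M #> g) (e K))" if "g \<in> N" "K \<in> ?F" for g K
    by (rule stage_act [OF eD(1) [OF that(2)] NG [OF that(1)]])
  \<comment> \<open>The section is invariant, but its representatives \<open>e K\<close> are so only
    in the colimit. This is invariance under \<open>g\<close> over \<open>K\<close> after transition
    to stage \<open>L\<close>.\<close>
  define inv_at where "inv_at L g K \<longleftrightarrow> tr D L M (act g K) (sact (stage D M) (M #> g) (e K)) = tr D L M (act g K) (e (act g K))" for L g K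
  have down: "inv_at L' g K" if ia: "inv_at L g K" and L: "L' \<in> ON" "L \<in> ON" "L' \<subseteq> L" "L \<subseteq> M" and g: "g \<in> N" and K: "K \<in> ?F" for L L' g K
    using ia unfolding inv_at_def tr_comp [OF L(1,3,2,4) ea [OF g K]] tr_comp [OF L(1,3,2,4) eD(1) [OF Fact [OF g K]]] by simp
  \<comment> \<open>For one fixed \<open>g\<close>, compactness makes the stage independent of
    \<open>K\<close>.\<close>
  have one: "\<exists>L\<in>ON. L \<subseteq> M \<and> (\<forall>K\<in>?F. inv_at L g K)" if g: "g \<in> N" for g
  proof -
    define R2 where "R2 L S \<longleftrightarrow> L \<subseteq> M \<and> (\<forall>K\<in>fibre L S. K \<in> ?F \<longrightarrow> inv_at L g K)" for L S
    have "\<exists>L\<in>ON. \<forall>S\<in>Y L. R2 L S"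
    proof (rule compact_stage)
      fix K assume K: "K \<in> X"
      show "\<exists>L\<in>ON. R2 L (p L K)"
      proof (cases "K \<in> ?F")
        case False
        have "K' \<notin> ?F" if "K' \<in> fibre M (p M K)" for K'
        proof -
          have K': "K' \<in> X" "p M K' = p M K" using that by (simp_all add: in_fibre)
          have "p N K' = p N K" by (rule p_refine [OF M(1) N MN K K'])
          then show ?thesis using False K by (simp add: in_fibre)
        qed
        then have "R2 M (p M K)" by (simp add: R2_def)
        then show ?thesis using M(1) by (rule rev_bexI [rotated])
      next
        case True
        have "\<kappa> M (act g K, sact (stage D M) (M #> g) (e K)) = sact E g (?s K)"
          unfolding cocone_act [OF CC eD(1) [OF True] NG [OF g]] eD(2) [OF True] ..
        also have "\<dots> = \<kappa> M (act g K, e (act g K))"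
          unfolding eD(2) [OF Fact [OF g True]] by (rule sec_inv [OF E N u True g, symmetric])
        finally obtain L where L: "L \<in> ON" "L \<subseteq> M" "L \<subseteq> M" "tr D L M (act g K) (sact (stage D M) (M #> g) (e K)) = tr D L M (act g K) (e (act g K))"
          by (rule good_eq [OF good ea [OF g True] eD(1) [OF Fact [OF g True]]])
        \<comment> \<open>All ingredients of the equation at \<open>K'\<close> depend only on
          \<open>p L K'\<close>, so the equation at \<open>K\<close> carries over.\<close>
        have "inv_at L g K'" if "K' \<in> fibre L (p L K)" for K'
        proof -
          have K': "K' \<in> X" "p L K' = p L K" using that by (simp_all add: in_fibre)
          have 1: "p L (act g K') = p L (act g K)"
            unfolding p_act [OF L(1) NG [OF g] K'(1)] p_act [OF L(1) NG [OF g] K] K'(2) ..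
          have 2: "e K' = e K" by (rule e_local, rule p_refine [OF L(1) M(1) L(2) K K'])
          have 3: "e (act g K') = e (act g K)"
            by (rule e_local, rule p_refine [OF L(1) M(1) L(2) act_in [OF NG [OF g] K] act_in [OF NG [OF g] K'(1)] 1])
          show ?thesis unfolding inv_at_def tr_local [OF 1] 2 3 by (rule L(4))
        qed
        then have "R2 L (p L K)" using L(2) by (simp add: R2_def)
        then show ?thesis using L(1) by (rule rev_bexI [rotated])
      qed
    next
      fix L' L S assume L': "L' \<in> ON" and L: "L \<in> ON" and sub: "L' \<subseteq> L" and S: "S \<in> Y L'" and RL: "R2 L (ph L' L S)"
      have LM: "L \<subseteq> M" using RL unfolding R2_def by (rule conjunct1)
      show "R2 L' S"
        unfolding R2_def
      proof (intro conjI ballI impI)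
        show "L' \<subseteq> M" using sub LM by (rule subset_trans)
        fix K assume K: "K \<in> fibre L' S" and KF: "K \<in> ?F"
        have "inv_at L g K" using RL fibre_refine [OF L' L sub K] KF unfolding R2_def by simp
        then show "inv_at L' g K" by (rule down [OF _ L' L sub LM g KF])
      qed
    qed
    then obtain L where L: "L \<in> ON" "\<forall>S\<in>Y L. R2 L S" ..
    have RL: "R2 L (p L K)" if "K \<in> X" for K using L(2) p_in [OF L(1) that] by (rule bspec)
    have "L \<subseteq> M" using RL [OF K0] unfolding R2_def by (rule conjunct1)
    moreover have "inv_at L g K" if K: "K \<in> ?F" for K
      using RL [OF FX [OF K]] K FX [OF K] unfolding R2_def by (simp add: in_fibre)
    ultimately show ?thesis using L(1) by (intro bexI [of _ L] conjI ballI)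
  qed
  \<comment> \<open>\<open>M\<close> acts trivially on stage \<open>M\<close> and fixes the points
    of \<open>Y M\<close>, so the equation for \<open>m \<otimes> g\<close> is the one for
    \<open>g\<close> translated by \<open>m\<close>. Thus only finitely many cosets have to be
    treated.\<close>
  have coset: "inv_at L (m \<otimes> g) K" if L: "L \<in> ON" "L \<subseteq> M" and ia: "inv_at L g K" and m: "m \<in> M" and g: "g \<in> N" and K: "K \<in> ?F" for L m g K
  proof -
    have mG: "m \<in> carrier G" using ON_sub [OF M(1)] m by auto
    note gG = NG [OF g]
    have Mm: "M #> m = M" using coset_eq_one [OF M(1) mG] m by simp
    have Mmg: "M #> (m \<otimes> g) = M #> g" using coset_mult [OF M(1) mG gG] unfolding Mm
      using monoid.l_one [OF group.is_monoid [OF ON_group_Mod [OF M(1)]] coset_in [OF M(1) gG]] by simp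
    have act2: "act (m \<otimes> g) K = act m (act g K)" by (rule act_mult [OF mG gG FX [OF K]])
    have m1: "sact (stage D M) (M #> m) a = a" if "a \<in> pts (stage D M)" for a
      unfolding Mm using gsheafD(7) [OF DM that] by simp
    note a = ea [OF g K] and b = eD(1) [OF Fact [OF g K]]
    have "p M (act m (act g K)) = p M (act g K)"
      unfolding p_act [OF M(1) mG act_in [OF gG FX [OF K]]] Mm by (rule qact_one [OF M(1) p_in [OF M(1) act_in [OF gG FX [OF K]]]])
    then have em: "e (act m (act g K)) = e (act g K)" by (rule e_local)
    show ?thesis
      unfolding inv_at_def Mmg act2 em
      using tr_act [OF L a mG] tr_act [OF L b mG] ia
      unfolding inv_at_def m1 [OF at_stageD(3) [OF a]] m1 [OF at_stageD(3) [OF b]] by simp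
  qed
  \<comment> \<open>The cosets of \<open>M\<close> in \<open>N\<close> are finite in number, so one
    stage achieves invariance under all of \<open>N\<close>.\<close>
  have "\<exists>L\<in>ON. L \<subseteq> M \<and> (\<forall>C\<in>(\<lambda>g. M #> g) ` N. \<forall>g\<in>N. M #> g = C \<longrightarrow> (\<forall>K\<in>?F. inv_at L g K))"
  proof (rule finite_refine [OF _ M(1)])
    show "finite ((\<lambda>g. M #> g) ` N)"
      by (rule finite_subset [OF _ finite_quotient [OF M(1)]]) (use coset_in [OF M(1) NG] in auto)
    fix C assume "C \<in> (\<lambda>g. M #> g) ` N"
    then obtain g where g: "g \<in> N" "C = M #> g" by (elim imageE)
    obtain L where L: "L \<in> ON" "L \<subseteq> M" "\<forall>K\<in>?F. inv_at L g K" using one [OF g(1)] by (elim bexE conjE)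
    have "inv_at L h K" if h: "h \<in> N" "M #> h = C" and K: "K \<in> ?F" for h K
    proof -
      have "h \<in> M #> g" using coset_self [OF M(1) NG [OF h(1)]] h(2) g(2) by simp
      then obtain m where m: "m \<in> M" "h = m \<otimes> g" unfolding r_coset_def by (elim UN_E singletonE)
      show ?thesis unfolding m(2) by (rule coset [OF L(1,2) bspec [OF L(3) K] m(1) g(1) K])
    qed
    then show "\<exists>L\<in>ON. L \<subseteq> M \<and> (\<forall>g\<in>N. M #> g = C \<longrightarrow> (\<forall>K\<in>?F. inv_at L g K))"
      using L(1,2) by (intro bexI [of _ L] conjI ballI impI)
  next
    fix C L L' assume L: "L' \<in> ON" "L \<in> ON" "L' \<subseteq> L" "L \<subseteq> M" and "\<forall>g\<in>N. M #> g = C \<longrightarrow> (\<forall>K\<in>?F. inv_at L g K)"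
    then show "\<forall>g\<in>N. M #> g = C \<longrightarrow> (\<forall>K\<in>?F. inv_at L' g K)"
      using down [OF _ L] by simp
  qed
  then obtain L where L: "L \<in> ON" "L \<subseteq> M" and
    iv: "\<forall>C\<in>(\<lambda>g. M #> g) ` N. \<forall>g\<in>N. M #> g = C \<longrightarrow> (\<forall>K\<in>?F. inv_at L g K)" by (elim bexE conjE)
  have LN: "L \<subseteq> N" using L(2) MN by (rule subset_trans)
  let ?P = "preim (phiMN G T L N) {?y}"
  \<comment> \<open>The representatives moved to stage \<open>L\<close>. There they form a genuinely
    \<open>N\<close>-invariant section, which surjectivity of the adjoint structure map lifts to
    stage \<open>N\<close>.\<close>
  let ?t = "\<lambda>S\<in>?P. struct D L M (S, dd (ph L M S))"
  have PD: "\<exists>K\<in>?F. S = p L K" if "S \<in> ?P" for S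
  proof -
    have S: "S \<in> Y L" "ph L N S = ?y" using that by (simp_all add: in_phi_fibre [OF L(1)])
    obtain K where K: "K \<in> X" "S = p L K" using p_ex [OF L(1) S(1)] ..
    then have "K \<in> ?F" using S(2) ph_p [OF L(1) N LN K(1)] by (simp add: in_fibre)
    then show ?thesis using K(2) by (rule rev_bexI)
  qed
  have FP: "p L K \<in> ?P" if K: "K \<in> ?F" for K
    using K p_in [OF L(1) FX [OF K]] ph_p [OF L(1) N LN FX [OF K]] by (simp add: in_phi_fibre [OF L(1)] in_fibre)
  have tp: "?t (p L K) = tr D L M K (e K)" if K: "K \<in> ?F" for K
    using FP [OF K] ph_p [OF L(1) M(1) L(2) FX [OF K]] by (simp add: tr_def e_def)
  have "?t \<in> invariant_sections (phiMN G T L N) (stage D L) {?y}"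
    unfolding IS_phi [OF L(1) N LN stage_gsheaf [OF L(1)]]
  proof (intro conjI ballI)
    fix S assume S: "S \<in> ?P"
    obtain K where K: "K \<in> ?F" "S = p L K" using PD [OF S] ..
    show "?t S \<in> fib (stage D L) S"
      unfolding K(2) tp [OF K(1)] by (rule at_stageD(5) [OF tr_in [OF L eD(1) [OF K(1)]]])
    fix n assume n: "n \<in> N"
    have "?t (qact L (L #> n) (p L K)) = ?t (p L (act n K))" unfolding p_act [OF L(1) NG [OF n] FX [OF K(1)]] ..
    also have "\<dots> = tr D L M (act n K) (e (act n K))" by (rule tp [OF Fact [OF n K(1)]])
    also have "\<dots> = tr D L M (act n K) (sact (stage D M) (M #> n) (e K))"
      using iv n K(1) unfolding inv_at_def by simp
    also have "\<dots> = sact (stage D L) (L #> n) (tr D L M K (e K))" by (rule tr_act [OF L eD(1) [OF K(1)] NG [OF n]])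
    finally show "?t (qact L (L #> n) S) = sact (stage D L) (L #> n) (?t S)" unfolding K(2) tp [OF K(1)] .
  qed simp
  from adjoint_surj [OF L(1) N LN y this]
  obtain d where d: "d \<in> fib (stage D N) ?y" "\<forall>K\<in>?F. tr D L N K d = ?t (p L K)" ..
  have d': "d \<in> pts (stage D N)" "sproj (stage D N) d = ?y" using d(1) by simp_all
  note TP = theta_props [OF N d'(1), unfolded d'(2)]
  have "theta N d = u"
  proof (rule sec_inj [OF E N TP(1) u TP(2)])
    fix K assume K: "K \<in> ?F"
    have dK: "at_stage D N K d" using K d' FX [OF K] N by (simp add: at_stage_def in_fibre)
    have "sec E N (theta N d) K = \<kappa> N (K, d)" by (rule TP(3) [OF K])
    also have "\<dots> = \<kappa> L (K, tr D L N K d)" by (rule cocone_tr [OF CC L(1) LN dK, symmetric])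
    also have "\<dots> = \<kappa> L (K, tr D L M K (e K))" using d(2) K tp [OF K] by simp
    also have "\<dots> = \<kappa> M (K, e K)" by (rule cocone_tr [OF CC L eD(1) [OF K]])
    also have "\<dots> = ?s K" by (rule eD(2) [OF K])
    finally show "sec E N (theta N d) K = ?s K" .
  qed
  then show ?thesis using d'(1) by (rule bexI)
qed

end

end

end

section \<open>The equivalence\<close>

lemma full_subcategory_simps [simp]:
  "X \<in> Obj (full_subcategory C P) \<longleftrightarrow> X \<in> Obj C \<and> P X" "Hom (full_subcategory C P) = Hom C"
  "Idn (full_subcategory C P) = Idn C" "Cmp (full_subcategory C P) = Cmp C"
  by (simp_all add: full_subcategory_def)

lemma full_subcategory_is_category: "is_category C \<Longrightarrow> is_category (full_subcategory C P)"
  by (simp add: is_category_def)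

lemma sheaf_category_simps [simp]:
  "Obj (sheaf_category B) = {E. is_gsheaf B E}" "Hom (sheaf_category B) = sheaf_hom B"
  "Idn (sheaf_category B) = (\<lambda>E. \<lambda>e\<in>pts E. e)" "Cmp (sheaf_category B) = (\<lambda>X Y Z g f. compose (pts X) g f)"
  by (simp_all add: sheaf_category_def)

lemma sheaf_hom_funcset: "f \<in> sheaf_hom B E F \<Longrightarrow> f \<in> pts E \<rightarrow> pts F"
  by (rule Pi_I, rule sheaf_homD(3))

lemma sheaf_hom_unit:
  assumes "f \<in> sheaf_hom B E F"
  shows "compose (pts E) f (\<lambda>e\<in>pts E. e) = f" "compose (pts E) (\<lambda>e\<in>pts F. e) f = f"
  using compose_Id [OF sheaf_hom_funcset [OF assms] sheaf_homD(1) [OF assms]]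
    Id_compose [OF sheaf_hom_funcset [OF assms] sheaf_homD(1) [OF assms]] by simp_all

lemma sheaf_hom_assoc:
  assumes "f \<in> sheaf_hom B E F"
  shows "compose (pts E) (compose (pts F) h g) f = compose (pts E) h (compose (pts E) g f)"
  by (rule compose_assoc [OF sheaf_hom_funcset [OF assms], symmetric])

lemma sheaf_category_is_category: "is_category (sheaf_category B)"
  unfolding is_category_def sheaf_category_simps
  by (auto intro: sheaf_hom_compose sheaf_hom_id simp: sheaf_hom_unit sheaf_hom_assoc)

lemma bullet_category_simps [simp]:
  "Obj (bullet_category G T) = {D. is_bullet_sheaf G T D}" "Hom (bullet_category G T) = bullet_hom G T"
  "Idn (bullet_category G T) = (\<lambda>D. \<lambda>N\<in>open_normal G T. \<lambda>e\<in>pts (stage D N). e)"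
  "Cmp (bullet_category G T) = (\<lambda>X Y Z g f. \<lambda>N\<in>open_normal G T. compose (pts (stage X N)) (g N) (f N))"
  by (simp_all add: bullet_category_def)

section \<open>Morphisms of compatible systems of sheaves\<close>

context profin
begin

lemma bullet_homD:
  assumes "f \<in> bullet_hom G T D D'"
  shows "f \<in> extensional ON" "\<And>N. N \<in> ON \<Longrightarrow> f N \<in> sheaf_hom (QS N) (stage D N) (stage D' N)"
    "\<And>M N R d. M \<in> ON \<Longrightarrow> N \<in> ON \<Longrightarrow> M \<subseteq> N \<Longrightarrow> R \<in> Y M \<Longrightarrow> d \<in> pts (stage D N) \<Longrightarrow> ph M N R = sproj (stage D N) d
       \<Longrightarrow> f M (struct D M N (R, d)) = struct D' M N (R, f N d)"
proof -
  note * = assms [unfolded bullet_hom_def mem_Collect_eq]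
  show "f \<in> extensional ON" "\<And>N. N \<in> ON \<Longrightarrow> f N \<in> sheaf_hom (QS N) (stage D N) (stage D' N)" using * by simp_all
  fix M N R d assume MN: "M \<in> ON" "N \<in> ON" "M \<subseteq> N" and d: "R \<in> Y M" "d \<in> pts (stage D N)" "ph M N R = sproj (stage D N) d"
  have z: "(R, d) \<in> pts (pull (phiMN G T M N) (stage D N))" using d by (simp add: pts_pull_phi [OF MN(1)])
  have "f M (struct D M N (R, d)) = struct D' M N (pull_map (phiMN G T M N) (stage D N) (f N) (R, d))"
    using * MN z by blast
  then show "f M (struct D M N (R, d)) = struct D' M N (R, f N d)" using z by (simp add: pull_map_def)
qed

lemma bullet_homI:
  assumes "f \<in> extensional ON" "\<And>N. N \<in> ON \<Longrightarrow> f N \<in> sheaf_hom (QS N) (stage D N) (stage D' N)"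
    and st: "\<And>M N R d. M \<in> ON \<Longrightarrow> N \<in> ON \<Longrightarrow> M \<subseteq> N \<Longrightarrow> R \<in> Y M \<Longrightarrow> d \<in> pts (stage D N) \<Longrightarrow> ph M N R = sproj (stage D N) d
       \<Longrightarrow> f M (struct D M N (R, d)) = struct D' M N (R, f N d)"
  shows "f \<in> bullet_hom G T D D'"
  unfolding bullet_hom_def
proof (intro CollectI conjI ballI impI assms(1,2))
  fix M N z assume MN: "M \<in> ON" "N \<in> ON" "M \<subseteq> N" and z: "z \<in> pts (pull (phiMN G T M N) (stage D N))"
  obtain R d where z': "z = (R, d)" "R \<in> Y M" "d \<in> pts (stage D N)" "ph M N R = sproj (stage D N) d"
    using z by (cases z) (simp add: pts_pull_phi [OF MN(1)])
  show "f M (struct D M N z) = struct D' M N (pull_map (phiMN G T M N) (stage D N) (f N) z)"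
    using st [OF MN z'(2-4)] z z'(1) by (simp add: pull_map_def)
qed

lemma bullet_hom_at_stage:
  assumes f: "f \<in> bullet_hom G T D D'" and d: "at_stage D N K d"
  shows "at_stage D' N K (f N d)"
  using sheaf_homD(3,4) [OF bullet_homD(2) [OF f at_stageD(1) [OF d]] at_stageD(3) [OF d]] at_stageD(1,2,4) [OF d]
  by (simp add: at_stage_def)

lemma bullet_hom_tr:
  assumes f: "f \<in> bullet_hom G T D D'" and M: "M \<in> ON" "M \<subseteq> N" and d: "at_stage D N K d"
  shows "f M (tr D M N K d) = tr D' M N K (f N d)"
  unfolding tr_def
  by (rule bullet_homD(3) [OF f M(1) at_stageD(1) [OF d] M(2) p_in [OF M(1) at_stageD(2) [OF d]] at_stageD(3) [OF d]])
     (simp add: ph_p [OF M(1) at_stageD(1) [OF d] M(2) at_stageD(2) [OF d]] at_stageD(4) [OF d])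

lemma bullet_stage: "is_bullet_sheaf G T D \<Longrightarrow> N \<in> ON \<Longrightarrow> is_gsheaf (QS N) (stage D N)"
  by (simp add: is_bullet_sheaf_def)

lemma bullet_struct_in:
  assumes D: "is_bullet_sheaf G T D" and MN: "M \<in> ON" "N \<in> ON" "M \<subseteq> N"
    and d: "R \<in> Y M" "d \<in> pts (stage D N)" "ph M N R = sproj (stage D N) d"
  shows "struct D M N (R, d) \<in> pts (stage D M)" "sproj (stage D M) (struct D M N (R, d)) = R"
proof -
  have s: "struct D M N \<in> sheaf_hom (QS M) (pull (phiMN G T M N) (stage D N)) (stage D M)"
    using D MN by (simp add: is_bullet_sheaf_def)
  have z: "(R, d) \<in> pts (pull (phiMN G T M N) (stage D N))" using d by (simp add: pts_pull_phi [OF MN(1)])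
  show "struct D M N (R, d) \<in> pts (stage D M)" "sproj (stage D M) (struct D M N (R, d)) = R"
    using sheaf_homD(3,4) [OF s z] by simp_all
qed

lemma bullet_hom_id:
  assumes D: "is_bullet_sheaf G T D"
  shows "(\<lambda>N\<in>ON. \<lambda>e\<in>pts (stage D N). e) \<in> bullet_hom G T D D"
proof (rule bullet_homI)
  show "(\<lambda>N\<in>ON. \<lambda>e\<in>pts (stage D N). e) N \<in> sheaf_hom (QS N) (stage D N) (stage D N)" if "N \<in> ON" for N
    using sheaf_hom_id [OF bullet_stage [OF D that]] that by simp
  fix M N R d assume a: "M \<in> ON" "N \<in> ON" "M \<subseteq> N" "R \<in> Y M" "d \<in> pts (stage D N)" "ph M N R = sproj (stage D N) d"
  show "(\<lambda>N\<in>ON. \<lambda>e\<in>pts (stage D N). e) M (struct D M N (R, d)) = struct D M N (R, (\<lambda>N\<in>ON. \<lambda>e\<in>pts (stage D N). e) N d)"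
    using bullet_struct_in(1) [OF D a] a(1,2,5) by simp
qed simp

lemma bullet_hom_compose:
  assumes D: "is_bullet_sheaf G T D" and f: "f \<in> bullet_hom G T D D'" and g: "g \<in> bullet_hom G T D' D''"
  shows "(\<lambda>N\<in>ON. compose (pts (stage D N)) (g N) (f N)) \<in> bullet_hom G T D D''"
proof (rule bullet_homI)
  let ?h = "\<lambda>N\<in>ON. compose (pts (stage D N)) (g N) (f N)"
  show "?h N \<in> sheaf_hom (QS N) (stage D N) (stage D'' N)" if N: "N \<in> ON" for N
    using sheaf_hom_compose [OF bullet_stage [OF D N] bullet_homD(2) [OF f N] bullet_homD(2) [OF g N]] N by simp
  fix M N R d assume a: "M \<in> ON" "N \<in> ON" "M \<subseteq> N" "R \<in> Y M" "d \<in> pts (stage D N)" "ph M N R = sproj (stage D N) d"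
  note b = sheaf_homD(3,4) [OF bullet_homD(2) [OF f a(2)] a(5)]
  have "ph M N R = sproj (stage D' N) (f N d)" using a(6) b(2) by simp
  from bullet_homD(3) [OF g a(1-4) b(1) this] bullet_homD(3) [OF f a]
  show "?h M (struct D M N (R, d)) = struct D'' M N (R, ?h N d)"
    using bullet_struct_in(1) [OF D a] a(1,2,5) by (simp add: compose_eq)
qed simp

lemma bullet_category_is_category:
  "is_category (bullet_category G T :: (('g, 'u) bullet_sheaf, 'g set \<Rightarrow> 'u \<Rightarrow> 'u) category)"
  unfolding is_category_def bullet_category_simps mem_Collect_eq
proof (intro conjI ballI)
  fix D D' :: "('g, 'u) bullet_sheaf" and f assume f: "f \<in> bullet_hom G T D D'"
  show "(\<lambda>N\<in>ON. compose (pts (stage D N)) (f N) ((\<lambda>N\<in>ON. \<lambda>e\<in>pts (stage D N). e) N)) = f"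
    "(\<lambda>N\<in>ON. compose (pts (stage D N)) ((\<lambda>N\<in>ON. \<lambda>e\<in>pts (stage D' N). e) N) (f N)) = f"
    by (rule extensionalityI [OF restrict_extensional bullet_homD(1) [OF f]],
        simp add: sheaf_hom_unit [OF bullet_homD(2) [OF f]])+
next
  fix D D' :: "('g, 'u) bullet_sheaf" and f g h :: "'g set \<Rightarrow> 'u \<Rightarrow> 'u" assume f: "f \<in> bullet_hom G T D D'"
  show "(\<lambda>N\<in>ON. compose (pts (stage D N)) ((\<lambda>N\<in>ON. compose (pts (stage D' N)) (h N) (g N)) N) (f N)) =
    (\<lambda>N\<in>ON. compose (pts (stage D N)) (h N) ((\<lambda>N\<in>ON. compose (pts (stage D N)) (g N) (f N)) N))"
    by (rule restrict_ext) (simp add: sheaf_hom_assoc [OF bullet_homD(2) [OF f]])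
qed (auto intro: bullet_hom_id bullet_hom_compose)

lemma weyl_category_Obj: "E \<in> Obj (weyl_category G T) \<longleftrightarrow> is_weyl_sheaf G T E"
  by (auto simp: weyl_category_def is_weyl_sheaf_def)

lemma weyl_gsheaf: "is_weyl_sheaf G T E \<Longrightarrow> is_gsheaf SS E"
  by (simp add: is_weyl_sheaf_def)

lemma weyl_category_simps: "Hom (weyl_category G T) = sheaf_hom SS"
  "Idn (weyl_category G T) = (\<lambda>E. \<lambda>e\<in>pts E. e)" "Cmp (weyl_category G T) = (\<lambda>X Y Z g f. compose (pts X) g f)"
  by (simp_all add: weyl_category_def)

lemma weyl_bullet_category_Obj: "D \<in> Obj (weyl_bullet_category G T) \<longleftrightarrow> is_bullet_sheaf G T D \<and>
     (\<forall>N\<in>ON. is_weyl_sheaf (G Mod N) (quotient_group_topology G T N) (stage D N)) \<and>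
     (\<forall>M\<in>ON. \<forall>N\<in>ON. M \<subseteq> N \<longrightarrow>
        sheaf_iso (QS N) (stage D N) (push (phiMN G T M N) (stage D M)) (adjoint_struct G T D M N))"
  by (simp add: weyl_bullet_category_def)

lemma weyl_bullet_category_simps: "Hom (weyl_bullet_category G T) = bullet_hom G T"
  "Idn (weyl_bullet_category G T) = (\<lambda>D. \<lambda>N\<in>ON. \<lambda>e\<in>pts (stage D N). e)"
  "Cmp (weyl_bullet_category G T) = (\<lambda>X Y Z g f. \<lambda>N\<in>ON. compose (pts (stage X N)) (g N) (f N))"
  by (simp_all add: weyl_bullet_category_def)

text \<open>A stagewise bijective morphism is invertible: over finite discrete bases each inverse is
  a sheaf map, and injectivity of \<open>f M\<close> transfers compatibility with the structure maps
  from \<open>f\<close> to the inverses.\<close>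

lemma bullet_inverse:
  assumes D: "is_bullet_sheaf G T D" and D': "is_bullet_sheaf G T D'" and f: "f \<in> bullet_hom G T D D'"
    and bij: "\<And>N. N \<in> ON \<Longrightarrow> bij_betw (f N) (pts (stage D N)) (pts (stage D' N))"
  defines "g \<equiv> \<lambda>N\<in>ON. \<lambda>u\<in>pts (stage D' N). inv_into (pts (stage D N)) (f N) u"
  shows "g \<in> bullet_hom G T D' D"
    "\<And>N d. N \<in> ON \<Longrightarrow> d \<in> pts (stage D N) \<Longrightarrow> g N (f N d) = d"
    "\<And>N u. N \<in> ON \<Longrightarrow> u \<in> pts (stage D' N) \<Longrightarrow> g N u \<in> pts (stage D N) \<and> f N (g N u) = u"
proof -
  have gf: "g N (f N d) = d" if "N \<in> ON" "d \<in> pts (stage D N)" for N d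
    using bij_betw_inv_into_left [OF bij that(2)] sheaf_homD(3) [OF bullet_homD(2) [OF f that(1)] that(2)] that
    by (simp add: g_def)
  have fg: "g N u \<in> pts (stage D N)" "f N (g N u) = u" if "N \<in> ON" "u \<in> pts (stage D' N)" for N u
    using bij_betw_inv_into_right [OF bij that(2)] bij_betwE [OF bij_betw_inv_into [OF bij]] that
    by (simp_all add: g_def)
  show "g N (f N d) = d" if "N \<in> ON" "d \<in> pts (stage D N)" for N d by (rule gf [OF that])
  show "g N u \<in> pts (stage D N) \<and> f N (g N u) = u" if "N \<in> ON" "u \<in> pts (stage D' N)" for N u
    using fg [OF that] by simp
  show "g \<in> bullet_hom G T D' D"
  proof (rule bullet_homI)
    show "g \<in> extensional ON" by (simp add: g_def)
    show hom: "g N \<in> sheaf_hom (QS N) (stage D' N) (stage D N)" if N: "N \<in> ON" for N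
    proof -
      have "sheaf_iso (QS N) (stage D N) (stage D' N) (f N)"
        by (rule discrete_sheaf_iso [OF QS_discrete [OF N] bullet_stage [OF D N] bullet_stage [OF D' N] bullet_homD(2) [OF f N] bij [OF N]])
      then obtain k where k: "k \<in> sheaf_hom (QS N) (stage D' N) (stage D N)" "\<forall>e\<in>pts (stage D N). k (f N e) = e"
        unfolding sheaf_iso_def by blast
      have "k u = g N u" if u: "u \<in> pts (stage D' N)" for u
        using bspec [OF k(2) fg(1) [OF N u]] fg(2) [OF N u] by simp
      then have "k = g N" using sheaf_homD(1) [OF k(1)] N by (intro extensionalityI [of k "pts (stage D' N)"]) (simp_all add: g_def)
      then show ?thesis using k(1) by simp
    qed
    fix M N R u assume a: "M \<in> ON" "N \<in> ON" "M \<subseteq> N" "R \<in> Y M" "u \<in> pts (stage D' N)" "ph M N R = sproj (stage D' N) u"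
    note b = fg [OF a(2,5)]
    have ph': "ph M N R = sproj (stage D N) (g N u)" using a(6) sheaf_homD(4) [OF hom [OF a(2)] a(5)] by simp
    have "f M (struct D M N (R, g N u)) = struct D' M N (R, u)"
      using bullet_homD(3) [OF f a(1-4) b(1) ph'] b(2) by simp
    then show "g M (struct D' M N (R, u)) = struct D M N (R, g N u)"
      using gf [OF a(1) bullet_struct_in(1) [OF D a(1-4) b(1) ph']] by simp
  qed
qed

end

section \<open>The chosen colimit\<close>

context bullet_universe
begin

abbreviation "co \<equiv> fst (colim G T D)"
abbreviation "cok \<equiv> snd (colim G T D)"

text \<open>The colimit constructed in the same point type shows that the choice in
  \<open>colim\<close> is made from a nonempty collection.\<close>

lemma colim_is_colimit: "is_colimit G T D co cok"
proof -
  have "\<exists>E \<kappa>. is_colimit G T D E \<kappa>"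
    by (intro exI) (rule good_colimit [OF good_exists])
  then have "\<exists>z. case z of (E, \<kappa>) \<Rightarrow> is_colimit G T D E \<kappa>" by simp
  then have "case colim G T D of (E, \<kappa>) \<Rightarrow> is_colimit G T D E \<kappa>" unfolding colim_def by (rule someI_ex)
  then show ?thesis by (simp add: case_prod_beta)
qed

lemma colim_good: "good_cocone co cok"
  by (rule colimit_good [OF good_exists colim_is_colimit])

lemmas colim_cocone = CC [OF colim_good] and colim_gsheaf = E [OF colim_good]

text \<open>A point over \<open>K\<close> comes from some \<open>(K, d)\<close> at a stage
  \<open>N\<close>. An element \<open>k\<close> of \<open>K\<close> fixes \<open>K\<close> and acts
  on \<open>d\<close> through its coset, which lies in \<open>p N K\<close> and therefore fixes
  \<open>d\<close>.\<close>

lemma colim_weyl: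
  assumes W: "\<And>N. N \<in> ON \<Longrightarrow> is_weyl_sheaf (G Mod N) (quotient_group_topology G T N) (stage D N)"
  shows "is_weyl_sheaf G T co"
  unfolding is_weyl_sheaf_def
proof (intro conjI ballI colim_gsheaf)
  fix K k e assume K: "K \<in> X" and k: "k \<in> K" and "e \<in> carrier (stalk co K)"
  then have e: "e \<in> pts co" "sproj co e = K" by (simp_all add: stalk_def)
  obtain N d where "at_stage D N (sproj co e) d" "cok N (sproj co e, d) = e" by (rule good_surj [OF colim_good e(1)])
  then have d: "at_stage D N K d" "cok N (K, d) = e" by (simp_all only: e(2))
  have kG: "k \<in> carrier G" using X_sub [OF K] k by auto
  have "N #> k \<in> p N K" unfolding p_def' using k by (rule imageI)
  moreover have "d \<in> carrier (stalk (stage D N) (p N K))" using at_stageD(3,4) [OF d(1)] by (simp add: stalk_def)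
  ultimately have "sact (stage D N) (N #> k) d = d"
    using W [OF at_stageD(1) [OF d(1)]] p_in [OF at_stageD(1) [OF d(1)] K] unfolding is_weyl_sheaf_def by blast
  then show "sact co k e = e"
    using cocone_act [OF colim_cocone d(1) kG] d(2) unfolding act_self [OF K k] by simp
qed

end

context profin_universe
begin

lemma bullet_interpret:
  fixes D :: "('g, 'u) bullet_sheaf"
  shows "is_bullet_sheaf G T D \<Longrightarrow> bullet_universe G T D code"
  by (intro bullet_universe.intro profin_bullet.intro profin_bullet_axioms.intro profin_axioms profin_universe_axioms)

lemma farr_eqI:
  fixes E E' :: "('g, 'g set, 'u) gsheaf"
  assumes E: "is_gsheaf SS E" and E': "is_gsheaf SS E'" and f: "f \<in> sheaf_hom SS E E'" and N: "N \<in> ON"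
    and u: "u \<in> pts (PE E N)" and v: "v \<in> pts (PE E' N)" "sproj (PE E' N) v = sproj (PE E N) u"
    and eq: "\<And>K. K \<in> fibre N (sproj (PE E N) u) \<Longrightarrow> sec E' N v K = f (sec E N u K)"
  shows "farr (p_bullet G T) E E' f N u = v"
proof -
  note F = farr_props [OF E E' f N u]
  show ?thesis
  proof (rule sec_inj [OF E' N F(1) v(1)])
    show "sproj (PE E' N) (farr (p_bullet G T) E E' f N u) = sproj (PE E' N) v" unfolding F(2) v(2) ..
    fix K assume "K \<in> fibre N (sproj (PE E' N) v)"
    then have K: "K \<in> fibre N (sproj (PE E N) u)" unfolding v(2) .
    show "sec E' N (farr (p_bullet G T) E E' f N u) K = sec E' N v K" unfolding F(3) [OF K] eq [OF K] ..
  qed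
qed

lemma p_bullet_Obj:
  fixes E :: "('g, 'g set, 'u) gsheaf"
  assumes E: "is_weyl_sheaf G T E"
  shows "fobj (p_bullet G T) E \<in> Obj (weyl_bullet_category G T)"
  unfolding weyl_bullet_category_Obj stage_p_bullet
  by (intro conjI ballI impI p_bullet_sheaf [OF weyl_gsheaf [OF E]] p_bullet_weyl [OF E] p_bullet_adjoint_iso [OF weyl_gsheaf [OF E]])

section \<open>Functoriality of both constructions\<close>

lemma p_bullet_functor:
  "is_functor (weyl_category G T :: (('g, 'g set, 'u) gsheaf, 'u \<Rightarrow> 'u) category) (weyl_bullet_category G T) (p_bullet G T)"
  unfolding is_functor_def weyl_category_simps weyl_bullet_category_simps
proof (intro conjI ballI)
  let ?A = "farr (p_bullet G T)"
  fix E :: "('g, 'g set, 'u) gsheaf"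
  assume "E \<in> Obj (weyl_category G T)"
  then have WE: "is_weyl_sheaf G T E" by (simp add: weyl_category_Obj)
  note E = weyl_gsheaf [OF WE]
  show "fobj (p_bullet G T) E \<in> Obj (weyl_bullet_category G T)" by (rule p_bullet_Obj [OF WE])
  note i = sheaf_hom_id [OF E]
  have aext: "?A E E' f N \<in> extensional (pts (PE E N))" "?A E E' f \<in> extensional ON" if "N \<in> ON" for E E' :: "('g, 'g set, 'u) gsheaf" and f N
    using that by (simp_all add: p_bullet_def)
  have "?A E E (\<lambda>e\<in>pts E. e) N = (\<lambda>e\<in>pts (PE E N). e)" if N: "N \<in> ON" for N
  proof (rule extensionalityI [OF aext(1) [OF N] restrict_extensional])
    fix u assume u: "u \<in> pts (PE E N)"
    have "?A E E (\<lambda>e\<in>pts E. e) N u = u"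
      by (rule farr_eqI [OF E E i N u u refl]) (simp add: sec_fib(1) [OF E N u])
    then show "?A E E (\<lambda>e\<in>pts E. e) N u = (\<lambda>e\<in>pts (PE E N). e) u" using u by simp
  qed
  then show "?A E E (\<lambda>e\<in>pts E. e) = (\<lambda>N\<in>ON. \<lambda>e\<in>pts (stage (fobj (p_bullet G T) E) N). e)"
    by (intro extensionalityI [OF aext(2) [OF ON_carrier] restrict_extensional]) simp
  fix E' :: "('g, 'g set, 'u) gsheaf" and f
  assume "E' \<in> Obj (weyl_category G T)" and f: "f \<in> sheaf_hom SS E E'"
  then have E': "is_gsheaf SS E'" by (simp add: weyl_category_Obj weyl_gsheaf)
  show "?A E E' f \<in> bullet_hom G T (fobj (p_bullet G T) E) (fobj (p_bullet G T) E')" by (rule farr_bullet_hom [OF E E' f])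
  fix E'' :: "('g, 'g set, 'u) gsheaf" and g
  assume "E'' \<in> Obj (weyl_category G T)" and g: "g \<in> sheaf_hom SS E' E''"
  then have E'': "is_gsheaf SS E''" by (simp add: weyl_category_Obj weyl_gsheaf)
  note gf = sheaf_hom_compose [OF E f g]
  have "?A E E'' (compose (pts E) g f) N = compose (pts (PE E N)) (?A E' E'' g N) (?A E E' f N)" if N: "N \<in> ON" for N
  proof (rule extensionalityI [OF aext(1) [OF N] compose_extensional])
    fix u assume u: "u \<in> pts (PE E N)"
    note F = farr_props [OF E E' f N u]
    note H = farr_props [OF E' E'' g N F(1), unfolded F(2)]
    have "?A E E'' (compose (pts E) g f) N u = ?A E' E'' g N (?A E E' f N u)"
    proof (rule farr_eqI [OF E E'' gf N u H(1,2)])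
      fix K assume K: "K \<in> fibre N (sproj (PE E N) u)"
      show "sec E'' N (?A E' E'' g N (?A E E' f N u)) K = compose (pts E) g f (sec E N u K)"
        unfolding H(3) [OF K] F(3) [OF K] using sec_fib(1) [OF E N u K] by (simp add: compose_eq)
    qed
    then show "?A E E'' (compose (pts E) g f) N u = compose (pts (PE E N)) (?A E' E'' g N) (?A E E' f N) u"
      using u by (simp add: compose_eq)
  qed
  then show "?A E E'' (compose (pts E) g f) =
     (\<lambda>N\<in>ON. compose (pts (stage (fobj (p_bullet G T) E) N)) (?A E' E'' g N) (?A E E' f N))"
    by (intro extensionalityI [OF aext(2) [OF ON_carrier] restrict_extensional]) simp
qed

abbreviation CO :: "('g, 'u) bullet_sheaf \<Rightarrow> ('g, 'g set, 'u) gsheaf" where "CO D \<equiv> fst (colim G T D)"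
abbreviation COK :: "('g, 'u) bullet_sheaf \<Rightarrow> 'g set \<Rightarrow> 'g set \<times> 'u \<Rightarrow> 'u" where "COK D \<equiv> snd (colim G T D)"

lemma colim_functor_simps:
  "fobj (colim_functor G T) D = CO D"
  "farr (colim_functor G T) D D' f = (THE h. h \<in> sheaf_hom SS (CO D) (CO D') \<and>
     (\<forall>N\<in>ON. \<forall>z\<in>pts (pull (pN G T N) (stage D N)). h (COK D N z) = COK D' N (pull_map (pN G T N) (stage D N) (f N) z)))"
  by (simp_all add: colim_functor_def)

lemma CO_facts:
  fixes D :: "('g, 'u) bullet_sheaf"
  assumes D: "is_bullet_sheaf G T D"
  shows "is_colimit G T D (CO D) (COK D)" "is_gsheaf SS (CO D)" "is_cocone G T D (CO D) (COK D)"
    "profin_bullet.good_cocone G T D (CO D) (COK D)"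
  using bullet_universe.colim_is_colimit [OF bullet_interpret [OF D]] bullet_universe.colim_gsheaf [OF bullet_interpret [OF D]]
    bullet_universe.colim_cocone [OF bullet_interpret [OF D]] bullet_universe.colim_good [OF bullet_interpret [OF D]] by simp_all

lemma bullet_locale:
  fixes D :: "('g, 'u) bullet_sheaf"
  shows "is_bullet_sheaf G T D \<Longrightarrow> profin_bullet G T D"
  by (intro profin_bullet.intro profin_bullet_axioms.intro profin_axioms)

lemma CO_eqI:
  fixes D :: "('g, 'u) bullet_sheaf" and E' :: "('g, 'g set, 'u) gsheaf"
  assumes D: "is_bullet_sheaf G T D" and E': "is_gsheaf SS E'"
    and f: "f \<in> sheaf_hom SS (CO D) E'" and k: "k \<in> sheaf_hom SS (CO D) E'"
    and eq: "\<And>N K d. at_stage D N K d \<Longrightarrow> f (COK D N (K, d)) = k (COK D N (K, d))"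
  shows "f = k"
  by (rule profin_bullet.colimit_eqI [OF bullet_locale [OF D] CO_facts(1) [OF D] E' f k eq])

text \<open>The legs of the target composed with \<open>f\<close> form a cocone on the source. The
  universal property then makes the definite description in \<open>colim_functor\<close> meaningful
  and yields its defining equation.\<close>

lemma colim_map:
  fixes D D' :: "('g, 'u) bullet_sheaf"
  assumes D: "is_bullet_sheaf G T D" and D': "is_bullet_sheaf G T D'" and f: "f \<in> bullet_hom G T D D'"
  shows "farr (colim_functor G T) D D' f \<in> sheaf_hom SS (CO D) (CO D')"
    "\<And>N K d. at_stage D N K d \<Longrightarrow> farr (colim_functor G T) D D' f (COK D N (K, d)) = COK D' N (K, f N d)"
proof -
  interpret b: profin_bullet G T D by (rule bullet_locale [OF D])
  interpret b': profin_bullet G T D' by (rule bullet_locale [OF D'])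
  note CC' = CO_facts(3) [OF D']
  define k where "k N = (\<lambda>z\<in>pts (pull (pN G T N) (stage D N)). COK D' N (pull_map (pN G T N) (stage D N) (f N) z))" for N
  have k: "k N (K, d) = COK D' N (K, f N d)" if "at_stage D N K d" for N K d
    using that b.in_pull [OF at_stageD(1) [OF that]] by (simp add: k_def pull_map_def)
  note fs = bullet_hom_at_stage [OF f] and fh = bullet_homD(2) [OF f]
  have "is_cocone G T D (CO D') k"
    unfolding is_cocone_def
  proof (intro conjI ballI impI CO_facts(2) [OF D'])
    show "k N \<in> sheaf_hom SS (pull (pN G T N) (stage D N)) (CO D')" if N: "N \<in> ON" for N
    proof (rule b.pull_pN_homI [OF N])
      show "k N \<in> extensional (pts (pull (pN G T N) (stage D N)))" by (simp add: k_def)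
      show "k N (K, d) \<in> pts (CO D') \<and> sproj (CO D') (k N (K, d)) = K" if "at_stage D N K d" for K d
        unfolding k [OF that] using b'.cocone_in(1,2) [OF CC' fs [OF that]] by (rule conjI)
      show "continuous_map (subtopology SG (fibre N (sproj (stage D N) d))) (tot (CO D')) (\<lambda>K. k N (K, d))"
        if d: "d \<in> pts (stage D N)" for d
      proof -
        note fd = sheaf_homD(3,4) [OF fh [OF N] d]
        from b'.cocone_cont [OF CC' N fd(1)]
        have "continuous_map (subtopology SG (fibre N (sproj (stage D N) d))) (tot (CO D')) (\<lambda>K. COK D' N (K, f N d))"
          unfolding fd(2) .
        then show ?thesis by (rule continuous_map_eq) (use k [OF at_stage_fibre [OF N d]] in simp)
      qed
      show "k N (act g K, sact (stage D N) (N #> g) d) = sact (CO D') g (k N (K, d))"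
        if g: "g \<in> carrier G" and d: "at_stage D N K d" for g K d
      proof -
        have "f N (sact (stage D N) (N #> g) d) = sact (stage D' N) (N #> g) (f N d)"
          using sheaf_homD(5) [OF fh [OF N], of "N #> g" d] coset_in [OF N g] at_stageD(3) [OF d] by simp
        then show ?thesis unfolding k [OF d] k [OF b.stage_act [OF d g]] using b'.cocone_act [OF CC' fs [OF d] g] by simp
      qed
      show "k N (K, sadd (stage D N) a b) = sadd (CO D') (k N (K, a)) (k N (K, b))"
        if a: "at_stage D N K a" and b: "at_stage D N K b" for K a b
      proof -
        have "f N (sadd (stage D N) a b) = sadd (stage D' N) (f N a) (f N b)"
          using sheaf_homD(6) [OF fh [OF N], of "p N K" a b] p_in [OF N at_stageD(2) [OF a]] at_stageD(5) [OF a] at_stageD(5) [OF b] N by simp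
        then show ?thesis
          unfolding k [OF a] k [OF b] k [OF b.stage_ops(1) [OF a b]] using b'.cocone_add [OF CC' fs [OF a] fs [OF b]] by simp
      qed
      show "k N (K, sscale (stage D N) r a) = sscale (CO D') r (k N (K, a))" if a: "at_stage D N K a" for K a r
      proof -
        have "f N (sscale (stage D N) r a) = sscale (stage D' N) r (f N a)"
          using sheaf_homD(7) [OF fh [OF N], of "p N K" a r] p_in [OF N at_stageD(2) [OF a]] at_stageD(5) [OF a] N by simp
        then show ?thesis
          unfolding k [OF a] k [OF b.stage_ops(2) [OF a a]] using b'.cocone_scale [OF CC' fs [OF a]] by simp
      qed
    qed
    show "case z of (K, d) \<Rightarrow> k M (K, struct D M N (p M K, d)) = k N (K, d)"
      if MN: "M \<in> ON" "N \<in> ON" "M \<subseteq> N" and z: "z \<in> pts (pull (pN G T N) (stage D N))" for M N z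
    proof -
      obtain K d where Kd: "z = (K, d)" "at_stage D N K d" using z b.in_pull [OF MN(2)] by (cases z) simp
      have "k M (K, tr D M N K d) = k N (K, d)"
        unfolding k [OF Kd(2)] k [OF b.tr_in [OF MN(1,3) Kd(2)]] bullet_hom_tr [OF f MN(1,3) Kd(2)]
        by (rule b'.cocone_tr [OF CC' MN(1,3) fs [OF Kd(2)]])
      then show ?thesis unfolding Kd(1) tr_def by simp
    qed
  qed
  then have "\<exists>!h. h \<in> sheaf_hom SS (CO D) (CO D') \<and>
     (\<forall>N\<in>ON. \<forall>z\<in>pts (pull (pN G T N) (stage D N)). h (COK D N z) = k N z)"
    using CO_facts(1) [OF D] unfolding is_colimit_def by blast
  then have "\<exists>!h. h \<in> sheaf_hom SS (CO D) (CO D') \<and>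
     (\<forall>N\<in>ON. \<forall>z\<in>pts (pull (pN G T N) (stage D N)). h (COK D N z) = COK D' N (pull_map (pN G T N) (stage D N) (f N) z))"
    unfolding k_def by simp
  from theI' [OF this, folded colim_functor_simps(2)]
  have *: "farr (colim_functor G T) D D' f \<in> sheaf_hom SS (CO D) (CO D')"
    "\<forall>N\<in>ON. \<forall>z\<in>pts (pull (pN G T N) (stage D N)). farr (colim_functor G T) D D' f (COK D N z) = COK D' N (pull_map (pN G T N) (stage D N) (f N) z)"
    by simp_all
  show "farr (colim_functor G T) D D' f \<in> sheaf_hom SS (CO D) (CO D')" by (rule *(1))
  show "farr (colim_functor G T) D D' f (COK D N (K, d)) = COK D' N (K, f N d)" if d: "at_stage D N K d" for N K d
  proof -
    have z: "(K, d) \<in> pts (pull (pN G T N) (stage D N))" using d b.in_pull [OF at_stageD(1) [OF d]] by simp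
    from bspec [OF bspec [OF *(2) at_stageD(1) [OF d]] this] show ?thesis using z by (simp add: pull_map_def)
  qed
qed

lemma colim_functor_functor:
  "is_functor (weyl_bullet_category G T) (weyl_category G T :: (('g, 'g set, 'u) gsheaf, 'u \<Rightarrow> 'u) category) (colim_functor G T)"
  unfolding is_functor_def weyl_category_simps weyl_bullet_category_simps colim_functor_simps(1)
proof (intro conjI ballI)
  let ?A = "farr (colim_functor G T)"
  fix D :: "('g, 'u) bullet_sheaf"
  assume "D \<in> Obj (weyl_bullet_category G T)"
  note O = this [unfolded weyl_bullet_category_Obj]
  then have D: "is_bullet_sheaf G T D" by (rule conjunct1)
  note C = CO_facts(2) [OF D]
  show "CO D \<in> Obj (weyl_category G T)"
    unfolding weyl_category_Obj by (rule bullet_universe.colim_weyl [OF bullet_interpret [OF D]]) (use O in simp)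
  note i = bullet_hom_id [OF D]
  show "?A D D (\<lambda>N\<in>ON. \<lambda>e\<in>pts (stage D N). e) = (\<lambda>e\<in>pts (CO D). e)"
  proof (rule CO_eqI [OF D C colim_map(1) [OF D D i] sheaf_hom_id [OF C]])
    fix N K d assume d: "at_stage D N K d"
    have "COK D N (K, d) \<in> pts (CO D)" by (rule profin_bullet.cocone_in(1) [OF bullet_locale [OF D] CO_facts(3) [OF D] d])
    then show "?A D D (\<lambda>N\<in>ON. \<lambda>e\<in>pts (stage D N). e) (COK D N (K, d)) = (\<lambda>e\<in>pts (CO D). e) (COK D N (K, d))"
      unfolding colim_map(2) [OF D D i d] using at_stageD(1,3) [OF d] by simp
  qed
  fix D' :: "('g, 'u) bullet_sheaf" and f
  assume "D' \<in> Obj (weyl_bullet_category G T)" and f: "f \<in> bullet_hom G T D D'"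
  then have D': "is_bullet_sheaf G T D'" by (simp add: weyl_bullet_category_Obj)
  show "?A D D' f \<in> sheaf_hom SS (CO D) (CO D')" by (rule colim_map(1) [OF D D' f])
  fix D'' :: "('g, 'u) bullet_sheaf" and g
  assume "D'' \<in> Obj (weyl_bullet_category G T)" and g: "g \<in> bullet_hom G T D' D''"
  then have D'': "is_bullet_sheaf G T D''" by (simp add: weyl_bullet_category_Obj)
  note gf = bullet_hom_compose [OF D f g]
  show "?A D D'' (\<lambda>N\<in>ON. compose (pts (stage D N)) (g N) (f N)) = compose (pts (CO D)) (?A D' D'' g) (?A D D' f)"
  proof (rule CO_eqI [OF D CO_facts(2) [OF D''] colim_map(1) [OF D D'' gf]
        sheaf_hom_compose [OF C colim_map(1) [OF D D' f] colim_map(1) [OF D' D'' g]]])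
    fix N K d assume d: "at_stage D N K d"
    have "COK D N (K, d) \<in> pts (CO D)" by (rule profin_bullet.cocone_in(1) [OF bullet_locale [OF D] CO_facts(3) [OF D] d])
    then show "?A D D'' (\<lambda>N\<in>ON. compose (pts (stage D N)) (g N) (f N)) (COK D N (K, d)) =
        compose (pts (CO D)) (?A D' D'' g) (?A D D' f) (COK D N (K, d))"
      unfolding colim_map(2) [OF D D'' gf d]
      using colim_map(2) [OF D D' f d] colim_map(2) [OF D' D'' g bullet_hom_at_stage [OF f d]] at_stageD(1,3) [OF d]
      by (simp add: compose_eq)
  qed
qed

section \<open>The unit\<close>

lemma unit_cocone_at:
  fixes E :: "('g, 'g set, 'u) gsheaf"
  assumes E: "is_gsheaf SS E" and u: "at_stage (fobj (p_bullet G T) E) N K u"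
  shows "unit_cocone E N (K, u) = sec E N u K"
  using u profin_bullet.in_pull [OF p_bullet_interpret [OF E] at_stageD(1) [OF u]] by (simp add: unit_cocone_def)

text \<open>\<open>E\<close> with the evaluation maps is itself a colimit of its push forwards by
  \<open>unit_good\<close>, so the comparison with the chosen colimit is an isomorphism.\<close>

lemma unit_iso:
  fixes E :: "('g, 'g set, 'u) gsheaf"
  assumes E: "is_gsheaf SS E"
  shows "\<exists>h. is_isomorphism (weyl_category G T) E (CO (fobj (p_bullet G T) E)) h \<and>
    (\<forall>N K u. at_stage (fobj (p_bullet G T) E) N K u \<longrightarrow> h (sec E N u K) = COK (fobj (p_bullet G T) E) N (K, u))"
proof -
  let ?D = "fobj (p_bullet G T) E"
  note b = p_bullet_interpret [OF E]
  obtain h k where h: "h \<in> sheaf_hom SS E (CO ?D)" "k \<in> sheaf_hom SS (CO ?D) E"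
    "\<forall>N K d. at_stage ?D N K d \<longrightarrow> h (unit_cocone E N (K, d)) = COK ?D N (K, d)"
    "compose (pts E) k h = (\<lambda>e\<in>pts E. e)" "compose (pts (CO ?D)) h k = (\<lambda>e\<in>pts (CO ?D). e)"
    by (rule profin_bullet.colimit_unique [OF b profin_bullet.good_colimit [OF b unit_good [OF E]] CO_facts(1) [OF p_bullet_sheaf [OF E]]])
  have "is_isomorphism (weyl_category G T) E (CO ?D) h"
    unfolding is_isomorphism_def weyl_category_simps using h(1,2,4,5) by (intro conjI bexI [of _ k])
  moreover have "h (sec E N u K) = COK ?D N (K, u)" if "at_stage ?D N K u" for N K u
    by (rule h(3) [rule_format, OF that, unfolded unit_cocone_at [OF E that]])
  ultimately show ?thesis by (intro exI [of _ h] conjI allI impI)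
qed

text \<open>Every point of \<open>E\<close> is a value of some invariant section, so the second
  clause leaves only one candidate. It is kept in the choice because naturality is computed from
  it.\<close>

definition eta :: "('g, 'g set, 'u) gsheaf \<Rightarrow> 'u \<Rightarrow> 'u" where
  "eta E = (SOME h. is_isomorphism (weyl_category G T) E (CO (fobj (p_bullet G T) E)) h \<and>
    (\<forall>N K u. at_stage (fobj (p_bullet G T) E) N K u \<longrightarrow> h (sec E N u K) = COK (fobj (p_bullet G T) E) N (K, u)))"

lemma eta_props:
  fixes E :: "('g, 'g set, 'u) gsheaf"
  assumes E: "is_gsheaf SS E"
  shows "is_isomorphism (weyl_category G T) E (CO (fobj (p_bullet G T) E)) (eta E)"
    "eta E \<in> sheaf_hom SS E (CO (fobj (p_bullet G T) E))"
    "\<And>N K u. at_stage (fobj (p_bullet G T) E) N K u \<Longrightarrow> eta E (sec E N u K) = COK (fobj (p_bullet G T) E) N (K, u)"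
proof -
  note * = someI_ex [OF unit_iso [OF E], folded eta_def]
  show 1: "is_isomorphism (weyl_category G T) E (CO (fobj (p_bullet G T) E)) (eta E)" using * by (rule conjunct1)
  show "eta E \<in> sheaf_hom SS E (CO (fobj (p_bullet G T) E))"
    using 1 unfolding is_isomorphism_def weyl_category_simps by (rule conjunct1)
  show "\<And>N K u. at_stage (fobj (p_bullet G T) E) N K u \<Longrightarrow> eta E (sec E N u K) = COK (fobj (p_bullet G T) E) N (K, u)"
    using * by simp
qed

text \<open>Both composites are maps out of a colimit, namely \<open>E\<close> with its evaluation
  maps, so it is enough to compare them on the values of sections.\<close>

lemma eta_natural:
  fixes E E' :: "('g, 'g set, 'u) gsheaf"
  assumes E: "is_gsheaf SS E" and E': "is_gsheaf SS E'" and f: "f \<in> sheaf_hom SS E E'"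
  shows "compose (pts E) (eta E') f = compose (pts E)
    (farr (colim_functor G T) (fobj (p_bullet G T) E) (fobj (p_bullet G T) E') (farr (p_bullet G T) E E' f)) (eta E)"
proof -
  let ?D = "fobj (p_bullet G T) E" and ?D' = "fobj (p_bullet G T) E'" and ?f = "farr (p_bullet G T) E E' f"
  note b = p_bullet_interpret [OF E] and pf = farr_bullet_hom [OF E E' f]
  note D = p_bullet_sheaf [OF E] and D' = p_bullet_sheaf [OF E']
  note H = eta_props [OF E] and H' = eta_props [OF E'] and cm = colim_map [OF D D' pf]
  show ?thesis
  proof (rule profin_bullet.colimit_eqI [OF b profin_bullet.good_colimit [OF b unit_good [OF E]] CO_facts(2) [OF D']
        sheaf_hom_compose [OF E f H'(2)] sheaf_hom_compose [OF E H(2) cm(1)]])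
    fix N K u assume u: "at_stage ?D N K u"
    have u': "N \<in> ON" "u \<in> pts (PE E N)" "K \<in> fibre N (sproj (PE E N) u)" using u by (simp_all add: at_stage_def in_fibre)
    note s = sec_fib(1) [OF E u']
    show "compose (pts E) (eta E') f (unit_cocone E N (K, u)) =
        compose (pts E) (farr (colim_functor G T) ?D ?D' ?f) (eta E) (unit_cocone E N (K, u))"
      unfolding unit_cocone_at [OF E u] compose_eq [OF s] H(3) [OF u] cm(2) [OF u]
        farr_props(3) [OF E E' f u', symmetric] by (rule H'(3) [OF bullet_hom_at_stage [OF pf u]])
  qed
qed

lemma unit_natural_isomorphism:
  "natural_isomorphism (weyl_category G T) (weyl_category G T :: (('g, 'g set, 'u) gsheaf, 'u \<Rightarrow> 'u) category)
     id_functor (comp_functor (colim_functor G T) (p_bullet G T)) eta"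
  unfolding natural_isomorphism_def weyl_category_simps id_functor_def comp_functor_def cfunctor.simps colim_functor_simps(1) Ball_def weyl_category_Obj
  by (intro conjI allI impI eta_props(1) eta_natural weyl_gsheaf)

section \<open>The counit\<close>

definition theta_map :: "('g, 'u) bullet_sheaf \<Rightarrow> 'g set \<Rightarrow> 'u \<Rightarrow> 'u" where
  "theta_map D = (\<lambda>N\<in>ON. bullet_universe.theta G T D (CO D) (COK D) N)"

text \<open>The canonical maps lead from \<open>D\<close> to the push forwards of its colimit,
  against the direction of the counit; the counit is therefore their stagewise inverse.\<close>

definition eps :: "('g, 'u) bullet_sheaf \<Rightarrow> 'g set \<Rightarrow> 'u \<Rightarrow> 'u" where
  "eps D = (\<lambda>N\<in>ON. \<lambda>u\<in>pts (PE (CO D) N). inv_into (pts (stage D N)) (theta_map D N) u)"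

lemma theta_map:
  fixes D :: "('g, 'u) bullet_sheaf"
  assumes D: "is_bullet_sheaf G T D"
  shows "theta_map D \<in> bullet_hom G T D (fobj (p_bullet G T) (CO D))"
    "\<And>N d. N \<in> ON \<Longrightarrow> d \<in> pts (stage D N) \<Longrightarrow> theta_map D N d \<in> pts (PE (CO D) N)"
    "\<And>N d. N \<in> ON \<Longrightarrow> d \<in> pts (stage D N) \<Longrightarrow> sproj (PE (CO D) N) (theta_map D N d) = sproj (stage D N) d"
    "\<And>N d K. N \<in> ON \<Longrightarrow> d \<in> pts (stage D N) \<Longrightarrow> K \<in> fibre N (sproj (stage D N) d) \<Longrightarrow>
       sec (CO D) N (theta_map D N d) K = COK D N (K, d)"
proof -
  interpret b: bullet_universe G T D code by (rule bullet_interpret [OF D])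
  have t: "theta_map D N = b.theta (CO D) (COK D) N" if "N \<in> ON" for N using that by (simp add: theta_map_def)
  note g = b.colim_good
  show P: "theta_map D N d \<in> pts (PE (CO D) N)" "sproj (PE (CO D) N) (theta_map D N d) = sproj (stage D N) d"
    if "N \<in> ON" "d \<in> pts (stage D N)" for N d unfolding t [OF that(1)] by (rule b.theta_props(1,2) [OF g that])+
  show "sec (CO D) N (theta_map D N d) K = COK D N (K, d)"
    if "N \<in> ON" "d \<in> pts (stage D N)" "K \<in> fibre N (sproj (stage D N) d)" for N d K
    unfolding t [OF that(1)] by (rule b.theta_props(3) [OF g that])
  show "theta_map D \<in> bullet_hom G T D (fobj (p_bullet G T) (CO D))"
  proof (rule bullet_homI)
    show "theta_map D \<in> extensional ON" by (simp add: theta_map_def)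
    show "theta_map D N \<in> sheaf_hom (QS N) (stage D N) (stage (fobj (p_bullet G T) (CO D)) N)" if "N \<in> ON" for N
      unfolding t [OF that] stage_p_bullet by (rule b.theta_hom [OF g that])
    show "theta_map D M (struct D M N (R, d)) = st (CO D) M N (R, theta_map D N d)"
      if "M \<in> ON" "N \<in> ON" "M \<subseteq> N" "R \<in> Y M" "d \<in> pts (stage D N)" "ph M N R = sproj (stage D N) d" for M N R d
      unfolding t [OF that(1)] t [OF that(2)] by (rule b.theta_struct [OF g that])
  qed
qed

text \<open>The invertible adjoint structure maps of an object of this category supply the
  hypothesis of \<open>theta_inj\<close> and \<open>theta_surj\<close>.\<close>

lemma theta_map_bij:
  fixes D :: "('g, 'u) bullet_sheaf"
  assumes "D \<in> Obj (weyl_bullet_category G T)" and N: "N \<in> ON"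
  shows "bij_betw (theta_map D N) (pts (stage D N)) (pts (PE (CO D) N))"
proof -
  note O = assms(1) [unfolded weyl_bullet_category_Obj]
  note D = conjunct1 [OF O]
  interpret b: bullet_universe G T D code by (rule bullet_interpret [OF D])
  have t: "theta_map D N = b.theta (CO D) (COK D) N" using N by (simp add: theta_map_def)
  have iso: "sheaf_iso (QS N) (stage D N) (push (phiMN G T M N) (stage D M)) (adjoint_struct G T D M N)"
    if "M \<in> ON" "N \<in> ON" "M \<subseteq> N" for M N using O that by simp
  note g = b.colim_good
  show ?thesis
    unfolding t
  proof (rule bij_betw_imageI)
    show "inj_on (b.theta (CO D) (COK D) N) (pts (stage D N))"
      by (rule inj_onI) (rule b.theta_inj [OF g iso N])
    show "b.theta (CO D) (COK D) N ` pts (stage D N) = pts (PE (CO D) N)"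
    proof (intro equalityI subsetI)
      fix u assume "u \<in> b.theta (CO D) (COK D) N ` pts (stage D N)"
      then show "u \<in> pts (PE (CO D) N)" using b.theta_props(1) [OF g N] by (elim imageE) simp
    next
      fix u assume u: "u \<in> pts (PE (CO D) N)"
      have "\<exists>d\<in>pts (stage D N). b.theta (CO D) (COK D) N d = u"
        by (rule b.theta_surj [OF g _ N u]) (rule iso)
      then show "u \<in> b.theta (CO D) (COK D) N ` pts (stage D N)" by (elim bexE) (rule image_eqI [OF sym])
    qed
  qed
qed

lemma eps_props:
  fixes D :: "('g, 'u) bullet_sheaf"
  assumes O: "D \<in> Obj (weyl_bullet_category G T)"
  shows "eps D \<in> bullet_hom G T (fobj (p_bullet G T) (CO D)) D"
    "\<And>N d. N \<in> ON \<Longrightarrow> d \<in> pts (stage D N) \<Longrightarrow> eps D N (theta_map D N d) = d"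
    "\<And>N u. N \<in> ON \<Longrightarrow> u \<in> pts (PE (CO D) N) \<Longrightarrow> eps D N u \<in> pts (stage D N) \<and> theta_map D N (eps D N u) = u"
proof -
  have D: "is_bullet_sheaf G T D" using O by (simp add: weyl_bullet_category_Obj)
  have bij: "bij_betw (theta_map D N) (pts (stage D N)) (pts (stage (fobj (p_bullet G T) (CO D)) N))" if "N \<in> ON" for N
    using theta_map_bij [OF O that] by simp
  note * = bullet_inverse [OF D p_bullet_sheaf [OF CO_facts(2) [OF D]] theta_map(1) [OF D] bij, unfolded stage_p_bullet, folded eps_def]
  show "eps D \<in> bullet_hom G T (fobj (p_bullet G T) (CO D)) D" by (rule *(1))
  show "\<And>N d. N \<in> ON \<Longrightarrow> d \<in> pts (stage D N) \<Longrightarrow> eps D N (theta_map D N d) = d" by (rule *(2))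
  show "\<And>N u. N \<in> ON \<Longrightarrow> u \<in> pts (PE (CO D) N) \<Longrightarrow> eps D N u \<in> pts (stage D N) \<and> theta_map D N (eps D N u) = u" by (rule *(3))
qed

text \<open>Naturality is proved for the direction with an explicit formula: on values both sides
  are the legs of the target colimit at \<open>f N d\<close>. It is inverted afterwards to obtain
  naturality of \<open>eps\<close>.\<close>

lemma theta_map_natural:
  fixes D D' :: "('g, 'u) bullet_sheaf"
  assumes D: "is_bullet_sheaf G T D" and D': "is_bullet_sheaf G T D'" and f: "f \<in> bullet_hom G T D D'"
    and N: "N \<in> ON" and d: "d \<in> pts (stage D N)"
  shows "farr (p_bullet G T) (CO D) (CO D') (farr (colim_functor G T) D D' f) N (theta_map D N d) = theta_map D' N (f N d)"
proof -
  note t = theta_map(2-4) [OF D N d] and fd = sheaf_homD(3,4) [OF bullet_homD(2) [OF f N] d]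
  note t' = theta_map(2-4) [OF D' N fd(1), unfolded fd(2)]
  show ?thesis
  proof (rule farr_eqI [OF CO_facts(2) [OF D] CO_facts(2) [OF D'] colim_map(1) [OF D D' f] N t(1) t'(1)])
    show "sproj (PE (CO D') N) (theta_map D' N (f N d)) = sproj (PE (CO D) N) (theta_map D N d)" unfolding t(2) t'(2) ..
    fix K assume "K \<in> fibre N (sproj (PE (CO D) N) (theta_map D N d))"
    then have K: "K \<in> fibre N (sproj (stage D N) d)" unfolding t(2) .
    show "sec (CO D') N (theta_map D' N (f N d)) K = farr (colim_functor G T) D D' f (sec (CO D) N (theta_map D N d) K)"
      unfolding t(3) [OF K] t'(3) [OF K] by (rule colim_map(2) [OF D D' f at_stage_fibre [OF N d K], symmetric])
  qed
qed

lemma counit_natural_isomorphism: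
  "natural_isomorphism (weyl_bullet_category G T) (weyl_bullet_category G T :: (('g, 'u) bullet_sheaf, 'g set \<Rightarrow> 'u \<Rightarrow> 'u) category)
     (comp_functor (p_bullet G T) (colim_functor G T)) id_functor eps"
  unfolding natural_isomorphism_def weyl_bullet_category_simps id_functor_def comp_functor_def cfunctor.simps colim_functor_simps(1)
proof (intro conjI ballI)
  fix D :: "('g, 'u) bullet_sheaf" assume O: "D \<in> Obj (weyl_bullet_category G T)"
  then have D: "is_bullet_sheaf G T D" by (simp add: weyl_bullet_category_Obj)
  let ?B = "fobj (p_bullet G T) (CO D)"
  note e = eps_props [OF O] and t = theta_map [OF D]
  show "is_isomorphism (weyl_bullet_category G T) ?B D (eps D)"
    unfolding is_isomorphism_def weyl_bullet_category_simps stage_p_bullet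
  proof (intro conjI e(1) bexI [OF _ t(1)] restrict_ext)
    fix N assume N: "N \<in> ON"
    show "compose (pts (PE (CO D) N)) (theta_map D N) (eps D N) = (\<lambda>e\<in>pts (PE (CO D) N). e)"
      by (rule extensionalityI [OF compose_extensional restrict_extensional]) (use e(3) [OF N] in \<open>simp add: compose_eq\<close>)
    show "compose (pts (stage D N)) (eps D N) (theta_map D N) = (\<lambda>e\<in>pts (stage D N). e)"
      by (rule extensionalityI [OF compose_extensional restrict_extensional]) (use e(2) [OF N] in \<open>simp add: compose_eq\<close>)
  qed
  fix D' :: "('g, 'u) bullet_sheaf" and f assume O': "D' \<in> Obj (weyl_bullet_category G T)" and f: "f \<in> bullet_hom G T D D'"
  then have D': "is_bullet_sheaf G T D'" by (simp add: weyl_bullet_category_Obj)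
  let ?g = "farr (p_bullet G T) (CO D) (CO D') (farr (colim_functor G T) D D' f)"
  show "(\<lambda>N\<in>ON. compose (pts (stage ?B N)) (eps D' N) (?g N)) = (\<lambda>N\<in>ON. compose (pts (stage ?B N)) (f N) (eps D N))"
    unfolding stage_p_bullet
  proof (rule restrict_ext, rule extensionalityI [OF compose_extensional compose_extensional])
    fix N u assume N: "N \<in> ON" and u: "u \<in> pts (PE (CO D) N)"
    note d = conjunct1 [OF e(3) [OF N u]] and td = conjunct2 [OF e(3) [OF N u]]
    \<comment> \<open>Write \<open>u\<close> as the image under \<open>theta_map\<close> of
      \<open>eps D N u\<close>, apply naturality there, and cancel with
      \<open>eps D'\<close>.\<close>
    have "?g N u = theta_map D' N (f N (eps D N u))" using theta_map_natural [OF D D' f N d] unfolding td .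
    then have "eps D' N (?g N u) = f N (eps D N u)"
      using eps_props(2) [OF O' N sheaf_homD(3) [OF bullet_homD(2) [OF f N] d]] by simp
    then show "compose (pts (PE (CO D) N)) (eps D' N) (?g N) u = compose (pts (PE (CO D) N)) (f N) (eps D N) u"
      unfolding compose_eq [OF u] .
  qed
qed

end

theorem corollary11p8:
  fixes G :: "'g monoid" and T :: "'g topology"
  assumes "profinite_group G T"
    and "universe TYPE('g) TYPE('u)"
  shows "equivalence_of_categories
    (weyl_category G T :: (('g, 'g set, 'u) gsheaf, 'u \<Rightarrow> 'u) category)
    (weyl_bullet_category G T :: (('g, 'u) bullet_sheaf, 'g set \<Rightarrow> 'u \<Rightarrow> 'u) category)
    (p_bullet G T)
    (colim_functor G T)"
proof -
  obtain code :: "('g set \<Rightarrow> 'u) \<Rightarrow> 'u" where "inj code" and "infinite (UNIV :: 'u set)"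
    using assms(2) unfolding universe_def by blast
  then interpret profin_universe G T code
    using assms(1) by unfold_locales
  show ?thesis
    unfolding equivalence_of_categories_def
  proof (intro conjI p_bullet_functor colim_functor_functor)
    show "\<exists>\<eta>. natural_isomorphism (weyl_category G T) (weyl_category G T :: (('g, 'g set, 'u) gsheaf, 'u \<Rightarrow> 'u) category)
       id_functor (comp_functor (colim_functor G T) (p_bullet G T)) \<eta>"
      by (rule exI) (rule unit_natural_isomorphism)
    show "\<exists>\<epsilon>. natural_isomorphism (weyl_bullet_category G T) (weyl_bullet_category G T :: (('g, 'u) bullet_sheaf, 'g set \<Rightarrow> 'u \<Rightarrow> 'u) category)
       (comp_functor (p_bullet G T) (colim_functor G T)) id_functor \<epsilon>"
      by (rule exI) (rule counit_natural_isomorphism)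
    show "is_category (weyl_category G T :: (('g, 'g set, 'u) gsheaf, 'u \<Rightarrow> 'u) category)"
      unfolding weyl_category_def by (rule full_subcategory_is_category [OF sheaf_category_is_category])
    show "is_category (weyl_bullet_category G T :: (('g, 'u) bullet_sheaf, 'g set \<Rightarrow> 'u \<Rightarrow> 'u) category)"
      unfolding weyl_bullet_category_def by (rule full_subcategory_is_category [OF bullet_category_is_category])
  qed
qed

end
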